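(* Let $k(x,y)=\psi(\|x-y\|)$ be a positive definite radial kernel on $\mathbb R^d$ with $\psi$ analytic at $0$ and finite regularity index $r\ge1$. Let $\{x_1,\dots,x_n\}\subset\mathbb R^d$ be a set of $n$ points such that $\mathrm{rank}\,V_{\le r-1}<n$, where $V_{\le r-1}=(V_0\ \cdots\ V_{r-1})$ is the multivariate Vandermonde matrix, and let $K(\varepsilon)=[\psi(\varepsilon\|x_i-x_j\|)]_{i,j=1}^n$. Let $Q_0,\dots,Q_{r-1}$ and $R_{0,0},\dots,R_{r-1,r-1}$ come from the block QR factorisation of $V_{\le r-1}$. Let $A\in\mathbb R^{n\times c}$, $c=n-\mathrm{rank}\,V_{\le r-1}$, be an arbitrary full column rank matrix such that the columns of $[V_{\le r-1}\ A]$ span $\mathbb R^n$, and let $D^{(2r-1)}=[\|x_i-x_j\|^{2r-1}]_{i,j=1}^n$. Then the asymptotic spectral equivalent of $K$ is $$\underline K(\varepsilon)=\sum_{i=0}^{r-1}\varepsilon^{2i}\,Q_iS_iQ_i^T+\varepsilon^{2r-1}\,\psi_{2r-1}\,AA^{\dagger}D^{(2r-1)}AA^{\dagger},$$ where $S_0,\dots,S_{r-1}$ are the Schur complements of $$H=\mathrm{diag}(R_{0,0},\dots,R_{r-1,r-1})\,W_{\le r-1,\le r-1}\,\mathrm{diag}(R_{0,0}^T,\dots,R_{r-1,r-1}^T).$$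
   Context: Vandermonde matrices: for $\alpha\in\mathbb N^d$, $x^\alpha=\prod x_i^{\alpha_i}$, $|\alpha|=\sum\alpha_i$, $\alpha!=\prod\alpha_i!$. $V_s=[x_i^{\alpha}]_{1\le i\le n,\,|\alpha|=s}$, $V_{\le s}=(V_0\cdots V_s)$, with a fixed ordering of monomials of each degree; $\mathcal H_{s,d}=\binom{s+d-1}{d-1}$ is the number of monomials of degree $s$. Kernels: a positive definite kernel is a symmetric function on $\mathbb R^d\times\mathbb R^d$ whose kernel matrices at finitely many distinct points are positive definite. With $\psi(s)=\sum_m\psi_ms^m$ near $0$, the regularity index is the integer $r$ with $\psi_{2r-1}\ne0$ and $\psi_{2c-1}=0$ for $1\le c<r$. $K(\varepsilon)$ is regarded as analytic in $\varepsilon$ via the power series of $\psi$. Wronskian: for $i+j\le2r-2$, $W_{i,j}=\left[\frac{1}{\alpha!\beta!}\partial_x^\alpha\partial_y^\beta k(x,y)|_{x=y=0}\right]_{|\alpha|=i,|\beta|=j}$ (ordering as in $V_i,V_j$); $W_{\le r-1,\le r-1}=(W_{i,j})_{i,j=0}^{r-1}$. Block QR: with $b_i=\mathrm{rank}\,V_{\le i}-\mathrm{rank}\,V_{\le i-1}$ ($\mathrm{rank}\,V_{\le-1}=0$), $V_{\le r-1}=QR$ where $Q=(Q_0\cdots Q_{r-1})$ has orthonormal columns, $Q_i\in\mathbb R^{n\times b_i}$, and $R$ is block upper triangular with blocks $R_{i,j}\in\mathbb R^{b_i\times\mathcal H_{j,d}}$. Schur complements of $H=(H_{i,j})$, $H_{i,j}\in\mathbb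 R^{b_i\times b_j}$: $S_0=H_{0,0}$, $S_i=H_{i,i}-H_{i,<i}(H_{<i,<i})^{-1}H_{<i,i}$, where $H_{<i,<i}=(H_{k,l})_{k,l<i}$, $H_{i,<i}=(H_{i,0}\cdots H_{i,i-1})$, $H_{<i,i}=H_{i,<i}^T$. $A^\dagger$ is the Moore–Penrose pseudoinverse. Asymptotic spectral equivalent (ASE): for a real symmetric $K(\varepsilon)$ analytic near $0$, take analytic eigenvalues $\lambda_k(\varepsilon)$ and analytic orthonormal eigenvectors $u_k(\varepsilon)$ (Rellich). If $\lambda_k\not\equiv0$, write $\lambda_k=\varepsilon^{a}(\tilde\lambda_k+O(\varepsilon))$, $\tilde\lambda_k\ne0$, and $\mathrm{lt}(\lambda_k)=\tilde\lambda_k\varepsilon^a$; otherwise $\mathrm{lt}(\lambda_k)=0$. The ASE is $\underline K(\varepsilon)=\sum_k\mathrm{lt}(\lambda_k)(\varepsilon)\,u_k(0)u_k(0)^T$ (independent of choices).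
   Formalization: The matrix A is additionally required to satisfy AᵀV_{≤r-1}=0 (its columns span the orthogonal complement of the columns of V_{≤r-1}); for other A the formula fails, e.g. d=1, r=1, ψ(s)=e^{-s}, n=2, A=(1,0)ᵀ. *)

theory Defs
  imports
    "HOL-Analysis.Analysis"
    "Jordan_Normal_Form.DL_Rank"
    "Jordan_Normal_Form.Gauss_Jordan_Elimination"
begin

text \<open>
  Points of \<open>\<real>\<^sup>d\<close> have type \<open>real ^ 'd\<close>.  All matrices whose sizes are values (numbers of points,
  numbers of monomials, ranks) are those of \<open>Jordan_Normal_Form\<close>; their indices start at 0.
\<close>

unbundle no vec_syntax
unbundle no inner_syntax
hide_const (open) Finite_Cartesian_Product.vec Finite_Cartesian_Product.mat
  Finite_Cartesian_Product.row Finite_Cartesian_Product.rows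
  Cartesian_Space.rank
hide_type (open) Finite_Cartesian_Product.vec

type_synonym 'd multi_index = "'d \<Rightarrow> nat"

section \<open>Kernels\<close>

definition positive_definite_mat :: "nat \<Rightarrow> real mat \<Rightarrow> bool" where
  "positive_definite_mat n M \<longleftrightarrow> M \<in> carrier_mat n n \<and> transpose_mat M = M \<and>
     (\<forall>v \<in> carrier_vec n. v \<noteq> 0\<^sub>v n \<longrightarrow> v \<bullet> (M *\<^sub>v v) > 0)"

definition positive_definite_kernel :: "(real ^ 'd \<Rightarrow> real ^ 'd \<Rightarrow> real) \<Rightarrow> bool" where
  "positive_definite_kernel k \<longleftrightarrow> (\<forall>x y. k x y = k y x) \<and>
     (\<forall>n (x :: nat \<Rightarrow> real ^ 'd). inj_on x {..<n} \<longrightarrow>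
        positive_definite_mat n (mat n n (\<lambda>(i, j). k (x i) (x j))))"

definition regularity_index :: "real fps \<Rightarrow> nat \<Rightarrow> bool" where
  "regularity_index \<Psi> r \<longleftrightarrow> r \<ge> 1 \<and> fps_nth \<Psi> (2 * r - 1) \<noteq> 0 \<and>
     (\<forall>c. 1 \<le> c \<and> c < r \<longrightarrow> fps_nth \<Psi> (2 * c - 1) = 0)"

section \<open>Monomials, Vandermonde matrices and the Wronskian\<close>

definition monomial :: "real ^ 'd \<Rightarrow> 'd multi_index \<Rightarrow> real" where
  "monomial x \<alpha> = (\<Prod>l\<in>UNIV. vec_nth x l ^ \<alpha> l)"

text \<open>\<open>mons s\<close> lists the multi-indices of degree \<open>s\<close>, each exactly once, in an arbitrary fixed order.\<close>

definition monomial_ordering :: "(nat \<Rightarrow> ('d :: finite) multi_index list) \<Rightarrow> bool" where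
  "monomial_ordering mons \<longleftrightarrow>
     (\<forall>s. distinct (mons s) \<and> set (mons s) = {\<alpha>. (\<Sum>l\<in>UNIV. \<alpha> l) = s})"

definition upto_degree :: "(nat \<Rightarrow> 'd multi_index list) \<Rightarrow> nat \<Rightarrow> 'd multi_index list" where
  "upto_degree mons s = concat (map mons [0..<Suc s])"

definition vandermonde :: "nat \<Rightarrow> (nat \<Rightarrow> real ^ 'd) \<Rightarrow> 'd multi_index list \<Rightarrow> real mat" where
  "vandermonde n x as = mat n (length as) (\<lambda>(i, j). monomial (x i) (as ! j))"

definition vandermonde_le ::
  "(nat \<Rightarrow> 'd multi_index list) \<Rightarrow> nat \<Rightarrow> (nat \<Rightarrow> real ^ 'd) \<Rightarrow> nat \<Rightarrow> real mat" where
  "vandermonde_le mons n x s = vandermonde n x (upto_degree mons s)"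

definition partial_deriv :: "'d \<Rightarrow> (real ^ 'd \<Rightarrow> real) \<Rightarrow> real ^ 'd \<Rightarrow> real" where
  "partial_deriv l f = (\<lambda>x. deriv (\<lambda>t. f (x + t *\<^sub>R axis l 1)) 0)"

text \<open>
  The index type carries no order, so the coordinates are differentiated in the order of some
  fixed enumeration; for the kernels under consideration partial derivatives of the orders
  involved commute.
\<close>

definition coordinates :: "('d :: finite) list" where
  "coordinates = (SOME ls. distinct ls \<and> set ls = UNIV)"

definition multi_deriv ::
  "('d :: finite) multi_index \<Rightarrow> (real ^ 'd \<Rightarrow> real) \<Rightarrow> real ^ 'd \<Rightarrow> real" where
  "multi_deriv \<alpha> f = foldr (\<lambda>l. partial_deriv l ^^ \<alpha> l) coordinates f"

definition multi_fact :: "('d :: finite) multi_index \<Rightarrow> real" where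
  "multi_fact \<alpha> = (\<Prod>l\<in>UNIV. fact (\<alpha> l))"

definition wronskian ::
  "(real ^ 'd \<Rightarrow> real ^ 'd \<Rightarrow> real) \<Rightarrow> ('d :: finite) multi_index list \<Rightarrow> 'd multi_index list \<Rightarrow> real mat"
where
  "wronskian k as bs = mat (length as) (length bs) (\<lambda>(p, q).
     multi_deriv (as ! p) (\<lambda>x. multi_deriv (bs ! q) (\<lambda>y. k x y) 0) 0
       / (multi_fact (as ! p) * multi_fact (bs ! q)))"

definition wronskian_le ::
  "(nat \<Rightarrow> ('d :: finite) multi_index list) \<Rightarrow> (real ^ 'd \<Rightarrow> real ^ 'd \<Rightarrow> real) \<Rightarrow> nat \<Rightarrow> real mat" where
  "wronskian_le mons k s = wronskian k (upto_degree mons s) (upto_degree mons s)"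

section \<open>Block QR factorisation and Schur complements\<close>

text \<open>Rows \<open>r0, \<dots>, r1 - 1\<close> and columns \<open>c0, \<dots>, c1 - 1\<close> of \<open>A\<close>.\<close>

definition sub_mat :: "'a mat \<Rightarrow> nat \<Rightarrow> nat \<Rightarrow> nat \<Rightarrow> nat \<Rightarrow> 'a mat" where
  "sub_mat A r0 r1 c0 c1 = mat (r1 - r0) (c1 - c0) (\<lambda>(i, j). A $$ (r0 + i, c0 + j))"

text \<open>
  For block sizes \<open>b 0, b 1, \<dots>\<close>, block \<open>i\<close> occupies the indices from \<open>offset b i\<close>
  up to, but excluding, \<open>offset b (Suc i)\<close>.
\<close>

definition offset :: "(nat \<Rightarrow> nat) \<Rightarrow> nat \<Rightarrow> nat" where
  "offset b i = (\<Sum>k<i. b k)"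

definition blk :: "(nat \<Rightarrow> nat) \<Rightarrow> (nat \<Rightarrow> nat) \<Rightarrow> 'a mat \<Rightarrow> nat \<Rightarrow> nat \<Rightarrow> 'a mat" where
  "blk p q A i j = sub_mat A (offset p i) (offset p (Suc i)) (offset q j) (offset q (Suc j))"

definition col_blk :: "(nat \<Rightarrow> nat) \<Rightarrow> 'a mat \<Rightarrow> nat \<Rightarrow> 'a mat" where
  "col_blk q A j = sub_mat A 0 (dim_row A) (offset q j) (offset q (Suc j))"

definition rank_increment ::
  "(nat \<Rightarrow> 'd multi_index list) \<Rightarrow> nat \<Rightarrow> (nat \<Rightarrow> real ^ 'd) \<Rightarrow> nat \<Rightarrow> nat" where
  "rank_increment mons n x i = vec_space.rank n (vandermonde_le mons n x i)
     - (if i = 0 then 0 else vec_space.rank n (vandermonde_le mons n x (i - 1)))"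

definition monomial_count :: "(nat \<Rightarrow> 'd multi_index list) \<Rightarrow> nat \<Rightarrow> nat" where
  "monomial_count mons s = length (mons s)"

definition is_block_QR ::
  "(nat \<Rightarrow> 'd multi_index list) \<Rightarrow> nat \<Rightarrow> (nat \<Rightarrow> real ^ 'd) \<Rightarrow> nat \<Rightarrow> real mat \<Rightarrow> real mat \<Rightarrow> bool"
where
  "is_block_QR mons n x r Q R \<longleftrightarrow>
     (let b = rank_increment mons n x; h = monomial_count mons in
      Q \<in> carrier_mat n (offset b r) \<and> R \<in> carrier_mat (offset b r) (offset h r) \<and>
      transpose_mat Q * Q = 1\<^sub>m (offset b r) \<and>
      vandermonde_le mons n x (r - 1) = Q * R \<and>
      (\<forall>i<r. \<forall>j<i. blk b h R i j = 0\<^sub>m (b i) (h j)))"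

definition schur_complement :: "(nat \<Rightarrow> nat) \<Rightarrow> real mat \<Rightarrow> nat \<Rightarrow> real mat" where
  "schur_complement b H i =
     (if i = 0 then blk b b H 0 0
      else blk b b H i i
        - sub_mat H (offset b i) (offset b (Suc i)) 0 (offset b i)
          * the (mat_inverse (sub_mat H 0 (offset b i) 0 (offset b i)))
          * transpose_mat (sub_mat H (offset b i) (offset b (Suc i)) 0 (offset b i)))"

section \<open>Moore--Penrose pseudoinverse\<close>

definition is_pseudoinverse :: "real mat \<Rightarrow> real mat \<Rightarrow> bool" where
  "is_pseudoinverse A X \<longleftrightarrow> X \<in> carrier_mat (dim_col A) (dim_row A) \<and>
     A * X * A = A \<and> X * A * X = X \<and>
     transpose_mat (A * X) = A * X \<and> transpose_mat (X * A) = X * A"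

definition pseudoinverse :: "real mat \<Rightarrow> real mat" where
  "pseudoinverse A = (THE X. is_pseudoinverse A X)"

section \<open>Asymptotic spectral equivalent\<close>

text \<open>For \<open>F = 0\<close> this is 0; otherwise the subdegree is the exponent \<open>a\<close> in
  \<open>\<lambda>(\<epsilon>) = \<epsilon>\<^sup>a (c + O(\<epsilon>))\<close>, \<open>c \<noteq> 0\<close>.\<close>

definition leading_term :: "real fps \<Rightarrow> real \<Rightarrow> real" where
  "leading_term F \<epsilon> = fps_nth F (subdegree F) * \<epsilon> ^ subdegree F"

definition analytic_spectral_decomposition ::
  "nat \<Rightarrow> (real \<Rightarrow> real mat) \<Rightarrow> (nat \<Rightarrow> real \<Rightarrow> real) \<Rightarrow> (nat \<Rightarrow> real fps) \<Rightarrow>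
   (nat \<Rightarrow> real \<Rightarrow> real vec) \<Rightarrow> bool" where
  "analytic_spectral_decomposition n K ev \<Lambda> u \<longleftrightarrow>
     (\<forall>k<n. ev k has_fps_expansion \<Lambda> k) \<and>
     (\<forall>k<n. \<forall>i<n. \<exists>F. (\<lambda>\<epsilon>. u k \<epsilon> $ i) has_fps_expansion F) \<and>
     (\<forall>\<^sub>F \<epsilon> in nhds 0. K \<epsilon> \<in> carrier_mat n n \<and>
        (\<forall>k<n. u k \<epsilon> \<in> carrier_vec n \<and> K \<epsilon> *\<^sub>v u k \<epsilon> = ev k \<epsilon> \<cdot>\<^sub>v u k \<epsilon> \<and>
           (\<forall>l<n. u k \<epsilon> \<bullet> u l \<epsilon> = (if k = l then 1 else 0))))"

text \<open>
  Both the existence of an analytic spectral decomposition and the independence of the result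
  from its choice are part of the definition.
\<close>

definition is_asymptotic_spectral_equivalent ::
  "nat \<Rightarrow> (real \<Rightarrow> real mat) \<Rightarrow> (real \<Rightarrow> real mat) \<Rightarrow> bool" where
  "is_asymptotic_spectral_equivalent n K E \<longleftrightarrow>
     (\<exists>ev \<Lambda> u. analytic_spectral_decomposition n K ev \<Lambda> u) \<and>
     (\<forall>ev \<Lambda> u. analytic_spectral_decomposition n K ev \<Lambda> u \<longrightarrow>
        (\<forall>\<epsilon>. E \<epsilon> = mat n n (\<lambda>(i, j).
           \<Sum>k<n. leading_term (\<Lambda> k) \<epsilon> * (u k 0 $ i) * (u k 0 $ j))))"

definition mat_sum :: "nat \<Rightarrow> (nat \<Rightarrow> real mat) \<Rightarrow> nat \<Rightarrow> real mat" where
  "mat_sum n M r = mat n n (\<lambda>(i, j). \<Sum>k<r. M k $$ (i, j))"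

end

theory Submission
  imports Defs "HOL-Complex_Analysis.Laurent_Convergence" "Jordan_Normal_Form.Spectral_Radius"
begin

text \<open>
  The columns of \<open>Q\<close> and of the projection \<open>P = A A\<^sup>\<dagger> = 1 - Q Q\<^sup>T\<close> form a Parseval frame. In frame
  coordinates the entry \<open>(p, q)\<close> of \<open>K(\<epsilon>)\<close> is divisible by \<open>\<epsilon>\<close> to the power \<open>e p + e q\<close>, where
  \<open>e = i\<close> on block \<open>i\<close> and \<open>e = r - 1/2\<close> on the columns of \<open>P\<close>; the leading coefficients are the
  entries of \<open>H\<close> and of \<open>\<psi>\<^bsub>2r-1\<^esub> P D P\<close>. Once the leading blocks are known to be nonsingular, comparing
  the lowest order terms of \<open>K u = \<lambda> u\<close> shows that \<open>u(0)\<close> lives in a single block and is there an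
  eigenvector of the Schur complement (or of \<open>\<psi>\<^bsub>2r-1\<^esub> P D P\<close>) for the leading coefficient of \<open>\<lambda>\<close>.
  Hence both sides of the claim agree on the orthonormal basis \<open>u\<^sub>k(0)\<close>.

  Positive definiteness of the kernel gives semidefiniteness of the leading blocks. If the distance
  form vanished at a functional, the functional would be orthogonal to all functionals with enough
  vanishing moments, which fails for functionals concentrated near one of its nodes. If the Wronskian
  had an isotropic vector of degree \<open>s\<close>, then a differential operator of order \<open>s\<close> would annihilate
  \<open>\<parallel>y\<parallel>\<^bsup>2r-1\<^esup>\<close>; applying Laplacians reduces the order until its symbol is seen to vanish.

  Analytic eigenvectors come from splitting \<open>K(\<epsilon>)\<close> into blocks, one for each eigenvalue of \<open>K(0)\<close>,
  by a Picard iteration, and induction on the size.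
\<close>

unbundle no vec_syntax
unbundle no inner_syntax
hide_const (open) Finite_Cartesian_Product.vec Finite_Cartesian_Product.mat
  Finite_Cartesian_Product.row Finite_Cartesian_Product.rows
  Cartesian_Space.rank
hide_type (open) Finite_Cartesian_Product.vec
unbundle no Formal_Power_Series.fps_syntax

section \<open>Convergent power series\<close>

text \<open>The spectral equivalent is defined through arbitrary analytic decompositions, and
  positive definiteness survives the limit of small \<open>\<epsilon>\<close> only as
  semidefiniteness. The first obstacle is met by not constructing a limit: any eigenpair of power
  series is taken as given and its lowest coefficients are compared, so that independence of the
  choices comes for free and only existence needs Rellich's theorem. There a formal diagonalisation
  would not do, since the series have to converge; hence the norm estimates along the iteration. The
  second obstacle is met by one device, used twice: a nonnegative quadratic polynomial in t without
  constant term has no linear term, where t weighs a test functional chosen to make the linear term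
  visible. The projection \<open>P\<close> stands for an orthonormal basis of the complement of V;
  this avoids a choice and yields A A^+ directly. Its columns are dependent, but all coordinates
  that occur lie in its range. The exponent r - 1/2 splits the degree 2 r - 1 of the distance term
  evenly between row and column, and the mixed leading coefficients vanish by parity.\<close>

definition cvg :: "real fps \<Rightarrow> bool" where "cvg F \<longleftrightarrow> fps_conv_radius F > 0"

text \<open>All partial sums are bounded, instead of the value of a series: such a bound is stable
  under sums and products without any discussion of convergence, and for each \<open>M\<close> it
  involves finitely many coefficients, so it passes to coefficientwise limits.\<close>

definition l1_bounded :: "real \<Rightarrow> real \<Rightarrow> real fps \<Rightarrow> bool" where
  "l1_bounded \<rho> C F \<longleftrightarrow> (\<forall>M. (\<Sum>m\<le>M. \<bar>fps_nth F m\<bar> * \<rho> ^ m) \<le> C)"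

lemma l1_bounded_nonneg: "l1_bounded \<rho> C F \<Longrightarrow> 0 \<le> C"
  unfolding l1_bounded_def by (drule spec[of _ 0]) auto

lemma l1_bounded_mono: "l1_bounded \<rho> C F \<Longrightarrow> C \<le> D \<Longrightarrow> l1_bounded \<rho> D F"
  unfolding l1_bounded_def by (meson order_trans)

lemma l1_bounded_zero [simp]: "0 \<le> C \<Longrightarrow> l1_bounded \<rho> C 0"
  unfolding l1_bounded_def by simp

lemma l1_bounded_add:
  assumes "0 \<le> \<rho>" "l1_bounded \<rho> C F" "l1_bounded \<rho> D G"
  shows "l1_bounded \<rho> (C + D) (F + G)"
  unfolding l1_bounded_def
proof
  fix M
  have "(\<Sum>m\<le>M. \<bar>fps_nth (F + G) m\<bar> * \<rho> ^ m)
      \<le> (\<Sum>m\<le>M. \<bar>fps_nth F m\<bar> * \<rho> ^ m + \<bar>fps_nth G m\<bar> * \<rho> ^ m)"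
    using assms(1) by (intro sum_mono) (simp add: distrib_right[symmetric] mult_right_mono)
  also have "\<dots> \<le> C + D"
    using assms(2,3) unfolding l1_bounded_def sum.distrib by (meson add_mono)
  finally show "(\<Sum>m\<le>M. \<bar>fps_nth (F + G) m\<bar> * \<rho> ^ m) \<le> C + D" .
qed

lemma l1_bounded_sum:
  assumes "0 \<le> \<rho>" "\<And>i. i \<in> I \<Longrightarrow> l1_bounded \<rho> C (F i)" "0 \<le> C"
  shows "l1_bounded \<rho> (real (card I) * C) (sum F I)"
proof (cases "finite I")
  case True
  then show ?thesis using assms(2)
  proof (induction I)
    case (insert i I)
    have "l1_bounded \<rho> (C + real (card I) * C) (F i + sum F I)"
      using insert by (intro l1_bounded_add[OF assms(1)]) auto
    then show ?case using insert.hyps by (simp add: distrib_right)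
  qed simp
qed simp

text \<open>The triangle \<open>i + j \<le> M\<close> of the Cauchy product lies in the square of
  the two truncations, so the weighted norm is submultiplicative.\<close>

lemma l1_bounded_mult:
  assumes "0 \<le> \<rho>" "l1_bounded \<rho> C F" "l1_bounded \<rho> D G"
  shows "l1_bounded \<rho> (C * D) (F * G)"
  unfolding l1_bounded_def
proof
  fix M
  define a where "a i = \<bar>fps_nth F i\<bar> * \<rho> ^ i" for i
  define b where "b i = \<bar>fps_nth G i\<bar> * \<rho> ^ i" for i
  have nn: "0 \<le> a i" "0 \<le> b i" for i
    using assms(1) by (auto simp: a_def b_def)
  have "(\<Sum>m\<le>M. \<bar>fps_nth (F * G) m\<bar> * \<rho> ^ m) \<le> (\<Sum>m\<le>M. \<Sum>i\<le>m. a i * b (m - i))"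
  proof (rule sum_mono)
    fix m
    have "\<bar>fps_nth (F * G) m\<bar> * \<rho> ^ m \<le> (\<Sum>i\<le>m. \<bar>fps_nth F i * fps_nth G (m - i)\<bar>) * \<rho> ^ m"
      using assms(1) by (auto simp: fps_mult_nth atLeast0AtMost intro!: mult_right_mono)
    also have "\<dots> = (\<Sum>i\<le>m. a i * b (m - i))"
      unfolding sum_distrib_right a_def b_def
      by (intro sum.cong refl)
         (auto simp: abs_mult mult.assoc mult.left_commute simp flip: power_add)
    finally show "\<bar>fps_nth (F * G) m\<bar> * \<rho> ^ m \<le> (\<Sum>i\<le>m. a i * b (m - i))" .
  qed
  also have "\<dots> = (\<Sum>(i,j)\<in>{(i,j). i + j \<le> M}. a i * b j)"
    by (simp add: sum.triangle_reindex_eq)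
  also have "\<dots> \<le> (\<Sum>(i,j)\<in>{..M} \<times> {..M}. a i * b j)"
    by (rule sum_mono2) (auto simp: nn)
  also have "\<dots> = (\<Sum>i\<le>M. a i) * (\<Sum>j\<le>M. b j)"
    by (simp add: sum_product sum.cartesian_product)
  also have "\<dots> \<le> C * D"
    using assms(2,3) l1_bounded_nonneg[OF assms(2)]
    by (intro mult_mono sum_nonneg) (auto simp: a_def b_def l1_bounded_def assms(1))
  finally show "(\<Sum>m\<le>M. \<bar>fps_nth (F * G) m\<bar> * \<rho> ^ m) \<le> C * D" .
qed

lemma l1_bounded_shrink:
  assumes "0 \<le> \<sigma>" "\<sigma> \<le> \<rho>" "l1_bounded \<rho> C F"
  shows "l1_bounded \<sigma> C F"
  unfolding l1_bounded_def
proof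
  fix M
  have "(\<Sum>m\<le>M. \<bar>fps_nth F m\<bar> * \<sigma> ^ m) \<le> (\<Sum>m\<le>M. \<bar>fps_nth F m\<bar> * \<rho> ^ m)"
    by (intro sum_mono mult_left_mono power_mono assms) auto
  then show "(\<Sum>m\<le>M. \<bar>fps_nth F m\<bar> * \<sigma> ^ m) \<le> C"
    using assms(3) unfolding l1_bounded_def by (meson order_trans)
qed

text \<open>Each coefficient of positive order carries at least one factor \<open>t\<close>, so
  without a constant coefficient a smaller weight makes the norm itself small. This provides the
  small data of the Picard iteration.\<close>

lemma l1_bounded_small:
  assumes "0 \<le> t" "t \<le> 1" "0 \<le> \<rho>" "l1_bounded \<rho> C F" "fps_nth F 0 = 0"
  shows "l1_bounded (t * \<rho>) (t * C) F"
  unfolding l1_bounded_def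
proof
  fix M
  have "\<bar>fps_nth F m\<bar> * (t * \<rho>) ^ m \<le> t * (\<bar>fps_nth F m\<bar> * \<rho> ^ m)" for m
  proof (cases m)
    case (Suc k)
    have "t ^ m \<le> t" using power_decreasing[of 1 m t] assms(1,2) Suc by simp
    then have "t ^ m * (\<bar>fps_nth F m\<bar> * \<rho> ^ m) \<le> t * (\<bar>fps_nth F m\<bar> * \<rho> ^ m)"
      using assms(3) by (intro mult_right_mono) auto
    then show ?thesis by (simp add: power_mult_distrib mult_ac)
  qed (simp add: assms)
  then have "(\<Sum>m\<le>M. \<bar>fps_nth F m\<bar> * (t * \<rho>) ^ m) \<le> t * (\<Sum>m\<le>M. \<bar>fps_nth F m\<bar> * \<rho> ^ m)"
    unfolding sum_distrib_left by (intro sum_mono)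
  also have "\<dots> \<le> t * C"
    using assms(1,4) unfolding l1_bounded_def by (intro mult_left_mono) auto
  finally show "(\<Sum>m\<le>M. \<bar>fps_nth F m\<bar> * (t * \<rho>) ^ m) \<le> t * C" .
qed

lemma l1_bounded_imp_cvg:
  assumes "0 < \<rho>" "l1_bounded \<rho> C F"
  shows "cvg F"
proof -
  have "summable (\<lambda>m. norm (fps_nth F m * of_real \<rho> ^ m))"
  proof (rule bounded_imp_summable)
    show "(\<Sum>k\<le>n. norm (fps_nth F k * of_real \<rho> ^ k)) \<le> C" for n
      using assms unfolding l1_bounded_def by (auto simp: abs_mult power_abs)
  qed auto
  then have "summable (\<lambda>m. fps_nth F m * of_real \<rho> ^ m)" by (rule summable_norm_cancel)
  then have "conv_radius (fps_nth F) \<ge> ereal (norm (of_real \<rho> :: real))" by (rule conv_radius_geI)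
  then show ?thesis using assms(1) unfolding cvg_def fps_conv_radius_def
    by (metis abs_of_pos ereal_less(2) less_le_trans norm_of_real)
qed

lemma cvg_imp_l1_bounded:
  assumes "cvg F"
  obtains \<rho> C where "0 < \<rho>" "l1_bounded \<rho> C F"
proof -
  obtain \<rho> where \<rho>: "0 < ereal \<rho>" "ereal \<rho> < fps_conv_radius F"
    using assms unfolding cvg_def by (metis ereal_dense2 zero_ereal_def)
  then have s: "summable (\<lambda>m. norm (fps_nth F m * \<rho> ^ m))"
    by (intro abs_summable_in_conv_radius) (auto simp: fps_conv_radius_def)
  have "l1_bounded \<rho> (\<Sum>m. norm (fps_nth F m * \<rho> ^ m)) F"
    unfolding l1_bounded_def
  proof
    fix M
    have "(\<Sum>m\<le>M. norm (fps_nth F m * \<rho> ^ m)) \<le> (\<Sum>m. norm (fps_nth F m * \<rho> ^ m))"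
      by (intro sum_le_suminf s) auto
    then show "(\<Sum>m\<le>M. \<bar>fps_nth F m\<bar> * \<rho> ^ m) \<le> (\<Sum>m. norm (fps_nth F m * \<rho> ^ m))"
      using \<rho> by (simp add: abs_mult power_abs)
  qed
  then show ?thesis using that \<rho>(1) by auto
qed

lemma cvg_finite_l1_bounded:
  assumes "finite S" "\<And>F. F \<in> S \<Longrightarrow> cvg F"
  obtains \<rho> C where "0 < \<rho>" "0 < C" "\<And>F. F \<in> S \<Longrightarrow> l1_bounded \<rho> C F"
proof -
  have "\<exists>\<rho>>0. \<exists>C>0. \<forall>F\<in>S. l1_bounded \<rho> C F"
    using assms
  proof (induction S)
    case empty
    then show ?case by (auto intro: exI[of _ 1])
  next
    case (insert F S)
    then obtain \<rho> C where 1: "0 < \<rho>" "0 < C" "\<forall>F\<in>S. l1_bounded \<rho> C F" by auto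
    obtain \<sigma> D where 2: "0 < \<sigma>" "l1_bounded \<sigma> D F" using insert.prems cvg_imp_l1_bounded by blast
    have "l1_bounded (min \<rho> \<sigma>) (max C D) G" if "G \<in> insert F S" for G
      using that 1 2 l1_bounded_shrink[of "min \<rho> \<sigma>" \<sigma> D F] l1_bounded_shrink[of "min \<rho> \<sigma>" \<rho> C G]
      by (auto intro: l1_bounded_mono)
    then show ?case using 1 2 by (intro exI[of _ "min \<rho> \<sigma>"] conjI exI[of _ "max C D"]) auto
  qed
  then show ?thesis using that by blast
qed

lemma cvg_const [simp]: "cvg (fps_const c)" "cvg 0" "cvg 1"
  by (simp_all add: cvg_def)

lemma cvg_add [intro]: "cvg F \<Longrightarrow> cvg G \<Longrightarrow> cvg (F + G)"
  unfolding cvg_def using fps_conv_radius_add[of F G] by (auto simp: min_def split: if_splits)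

lemma cvg_diff [intro]: "cvg F \<Longrightarrow> cvg G \<Longrightarrow> cvg (F - G)"
  unfolding cvg_def using fps_conv_radius_diff[of F G] by (auto simp: min_def split: if_splits)

lemma cvg_uminus [intro]: "cvg F \<Longrightarrow> cvg (- F)"
  by (simp add: cvg_def)

lemma cvg_mult [intro]: "cvg F \<Longrightarrow> cvg G \<Longrightarrow> cvg (F * G)"
  unfolding cvg_def using fps_conv_radius_mult[of F G] by (auto simp: min_def split: if_splits)

lemma cvg_sum [intro]: "(\<And>i. i \<in> I \<Longrightarrow> cvg (F i)) \<Longrightarrow> cvg (sum F I)"
  by (induction I rule: infinite_finite_induct) auto

lemma cvg_shift [intro]: "cvg F \<Longrightarrow> cvg (fps_shift m F)"
  by (simp add: cvg_def)

lemma fps_X_power_dvd_iff: "fps_X ^ n dvd (F :: real fps) \<longleftrightarrow> (\<forall>m<n. fps_nth F m = 0)"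
proof
  assume "\<forall>m<n. fps_nth F m = 0"
  then have "F = fps_X ^ n * fps_shift n F"
    by (intro fps_ext) (auto simp: fps_X_power_mult_nth)
  then show "fps_X ^ n dvd F" by (metis dvd_triv_left)
qed (auto simp: dvd_def fps_X_power_mult_nth)

lemma fps_X_dvd_iff: "fps_X dvd (F :: real fps) \<longleftrightarrow> fps_nth F 0 = 0"
  using fps_X_power_dvd_iff[of 1 F] by simp

lemma fps_all_X_power_dvd: "(\<And>n. fps_X ^ n dvd (F :: real fps)) \<Longrightarrow> F = 0"
  using fps_X_power_dvd_iff by (intro fps_ext) (metis fps_zero_nth lessI)

text \<open>Picard iteration started at 0; in the weighted \<open>\<ell>\<^sup>1\<close> norm with small weight it stays in a
  small ball, and it converges coefficientwise.\<close>

lemma quadratic_fixed_point: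
  fixes f :: "'i \<Rightarrow> real fps"
  assumes fin: "finite I"
    and cf: "\<And>i. i \<in> I \<Longrightarrow> cvg (f i)"
    and cg: "\<And>i j. i \<in> I \<Longrightarrow> j \<in> I \<Longrightarrow> cvg (g i j)"
    and ch: "\<And>i j k. i \<in> I \<Longrightarrow> j \<in> I \<Longrightarrow> k \<in> I \<Longrightarrow> cvg (h i j k)"
    and f0: "\<And>i. i \<in> I \<Longrightarrow> fps_nth (f i) 0 = 0"
    and g0: "\<And>i j. i \<in> I \<Longrightarrow> j \<in> I \<Longrightarrow> fps_nth (g i j) 0 = 0"
  obtains x where "\<And>i. i \<in> I \<Longrightarrow> cvg (x i)" "\<And>i. i \<in> I \<Longrightarrow> fps_nth (x i) 0 = 0"
    "\<And>i. i \<in> I \<Longrightarrow> x i = f i + (\<Sum>j\<in>I. g i j * x j) + (\<Sum>j\<in>I. \<Sum>k\<in>I. h i j k * x j * x k)"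
proof -
  define \<Phi> where "\<Phi> x i = f i + (\<Sum>j\<in>I. g i j * x j) + (\<Sum>j\<in>I. \<Sum>k\<in>I. h i j k * x j * x k)" for x i
  define it where "it k = (\<Phi> ^^ k) (\<lambda>_. 0)" for k
  have it_0: "it 0 = (\<lambda>_. 0)" and it_Suc: "it (Suc k) = \<Phi> (it k)" for k
    by (simp_all add: it_def)
  define S where "S = f ` I \<union> (\<lambda>(i,j). g i j) ` (I \<times> I) \<union> (\<lambda>(i,j,k). h i j k) ` (I \<times> I \<times> I)"
  have "finite S" unfolding S_def using fin by auto
  moreover have "\<And>F. F \<in> S \<Longrightarrow> cvg F" unfolding S_def using cf cg ch by auto
  ultimately obtain \<rho> C where \<rho>: "0 < \<rho>" "0 < C" "\<And>F. F \<in> S \<Longrightarrow> l1_bounded \<rho> C F"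
    using cvg_finite_l1_bounded by metis
  define N where "N = real (card I)"
  have N: "0 \<le> N" by (simp add: N_def)
  \<comment> \<open>\<tau> is the radius of the invariant ball: the quadratic part is at most
    \<open>N * N * C * \<tau> * \<tau>\<close>, hence at most half of it. Shrinking the weight by
    the factor \<open>t\<close> below leaves the other half to \<open>f\<close> and
    \<open>g\<close>, whose constant coefficients vanish.\<close>
  define \<tau> where "\<tau> = 1 / (2 * (N * N * C + 1))"
  have \<tau>: "0 < \<tau>" "\<tau> \<le> 1" "N * N * C * \<tau> \<le> 1 / 2"
  proof -
    have "0 \<le> N * N * C" using N \<rho>(2) by auto
    then show "0 < \<tau>" "\<tau> \<le> 1" "N * N * C * \<tau> \<le> 1 / 2"
      unfolding \<tau>_def by (auto simp: divide_simps)
  qed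
  define t where "t = min 1 (\<tau> / (2 * (1 + N) * C))"
  have t: "0 < t" "t \<le> 1" using \<tau> N \<rho>(2) by (auto simp: t_def)
  have tC: "t * C * (1 + N) \<le> \<tau> / 2"
  proof -
    have "t \<le> \<tau> / (2 * (1 + N) * C)" by (simp add: t_def)
    then have "t * (C * (1 + N)) \<le> \<tau> / (2 * (1 + N) * C) * (C * (1 + N))"
      using N \<rho>(2) by (intro mult_right_mono) auto
    also have "\<dots> = (\<tau> * (C * (1 + N))) / (2 * (C * (1 + N)))" by (simp add: mult_ac)
    also have "\<dots> = \<tau> / 2" using N \<rho>(2) by (subst mult_divide_mult_cancel_right) auto
    finally show ?thesis by (simp add: mult_ac)
  qed
  define \<sigma> where "\<sigma> = t * \<rho>"
  have \<sigma>: "0 < \<sigma>" "\<sigma> \<le> \<rho>" using t \<rho> by (auto simp: \<sigma>_def)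
  have bf: "l1_bounded \<sigma> (t * C) (f i)" if "i \<in> I" for i
    unfolding \<sigma>_def using t \<rho> f0 that by (intro l1_bounded_small) (auto simp: S_def)
  have bg: "l1_bounded \<sigma> (t * C) (g i j)" if "i \<in> I" "j \<in> I" for i j
    unfolding \<sigma>_def using t \<rho> g0 that by (intro l1_bounded_small) (auto simp: S_def)
  have bh: "l1_bounded \<sigma> C (h i j k)" if "i \<in> I" "j \<in> I" "k \<in> I" for i j k
    using \<sigma> that by (intro l1_bounded_shrink[OF _ \<sigma>(2)] \<rho>(3)) (force simp: S_def)+
  have b\<Phi>: "l1_bounded \<sigma> \<tau> (\<Phi> x i)" if x: "\<And>j. j \<in> I \<Longrightarrow> l1_bounded \<sigma> \<tau> (x j)" and i: "i \<in> I" for x i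
  proof -
    have "l1_bounded \<sigma> (t * C + N * (t * C * \<tau>) + N * (N * (C * \<tau> * \<tau>))) (\<Phi> x i)"
      unfolding \<Phi>_def N_def
      using \<sigma> t \<rho> \<tau> i
      by (intro l1_bounded_add l1_bounded_sum l1_bounded_mult bf bg bh x) auto
    moreover have "t * C + N * (t * C * \<tau>) + N * (N * (C * \<tau> * \<tau>)) \<le> \<tau>"
    proof -
      have "t * C * N * \<tau> \<le> t * C * N" using \<tau> t \<rho>(2) N by (intro mult_left_le) auto
      then have "t * C + N * (t * C * \<tau>) \<le> \<tau> / 2" using tC by (simp add: algebra_simps)
      moreover have "N * N * C * \<tau> * \<tau> \<le> 1 / 2 * \<tau>" using \<tau> by (intro mult_right_mono) auto
      ultimately show ?thesis by (simp add: mult_ac)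
    qed
    ultimately show ?thesis by (rule l1_bounded_mono)
  qed
  have bit: "l1_bounded \<sigma> \<tau> (it k i)" if "i \<in> I" for k i
    using that
  proof (induction k arbitrary: i)
    case 0
    then show ?case using \<tau> by (simp add: it_0)
  next
    case (Suc k)
    then show ?case unfolding it_Suc by (intro b\<Phi>) auto
  qed
  have X\<Phi>: "fps_X dvd \<Phi> x i" if "\<And>j. j \<in> I \<Longrightarrow> fps_X dvd x j" "i \<in> I" for x i
    unfolding \<Phi>_def using that by (intro dvd_add dvd_sum dvd_mult) (auto simp: fps_X_dvd_iff f0)
  have Xit: "fps_X dvd it k i" if "i \<in> I" for k i
    using that
  proof (induction k arbitrary: i)
    case (Suc k)
    then show ?case unfolding it_Suc by (intro X\<Phi>) auto
  qed (simp add: it_0)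
  \<comment> \<open>Contraction in the adic sense: arguments that agree modulo
    \<open>fps_X ^ n\<close> have images that agree modulo one more power, because \<open>g\<close>,
    \<open>x\<close> and \<open>y\<close> have no constant coefficient.\<close>
  have contr: "fps_X ^ Suc n dvd \<Phi> x i - \<Phi> y i"
    if xy: "\<And>j. j \<in> I \<Longrightarrow> fps_X ^ n dvd x j - y j"
      and x: "\<And>j. j \<in> I \<Longrightarrow> fps_X dvd x j" and y: "\<And>j. j \<in> I \<Longrightarrow> fps_X dvd y j"
      and i: "i \<in> I" for x y i n
  proof -
    have "\<Phi> x i - \<Phi> y i = (\<Sum>j\<in>I. g i j * (x j - y j))
        + (\<Sum>j\<in>I. \<Sum>k\<in>I. h i j k * (x j * (x k - y k) + y k * (x j - y j)))"
    proof -
      have "(\<Sum>j\<in>I. g i j * x j) - (\<Sum>j\<in>I. g i j * y j) = (\<Sum>j\<in>I. g i j * (x j - y j))"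
        by (simp only: sum_subtractf[symmetric] right_diff_distrib)
      moreover have "(\<Sum>j\<in>I. \<Sum>k\<in>I. h i j k * x j * x k) - (\<Sum>j\<in>I. \<Sum>k\<in>I. h i j k * y j * y k)
          = (\<Sum>j\<in>I. \<Sum>k\<in>I. h i j k * (x j * (x k - y k) + y k * (x j - y j)))"
        unfolding sum_subtractf[symmetric] by (intro sum.cong refl) (simp add: algebra_simps)
      ultimately show ?thesis unfolding \<Phi>_def by (simp add: algebra_simps)
    qed
    moreover have "fps_X ^ Suc n dvd \<dots>"
      using i xy x y g0 unfolding power_Suc
      by (intro dvd_add dvd_sum dvd_mult mult_dvd_mono) (auto simp: fps_X_dvd_iff)
    ultimately show ?thesis by simp
  qed
  have step: "fps_X ^ k dvd it (Suc k) i - it k i" if "i \<in> I" for k i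
    using that
  proof (induction k arbitrary: i)
    case (Suc k)
    have "fps_X ^ Suc k dvd \<Phi> (it (Suc k)) i - \<Phi> (it k) i"
      by (intro contr Suc.IH Suc.prems Xit)
    then show ?case by (simp add: it_Suc)
  qed simp
  define x where "x i = Abs_fps (\<lambda>m. fps_nth (it (Suc m) i) m)" for i
  have stab: "fps_nth (it (m + Suc n) i) n = fps_nth (it (Suc n) i) n" if "i \<in> I" for m n i
  proof (induction m)
    case (Suc m)
    have "fps_X ^ (m + Suc n) dvd it (Suc (m + Suc n)) i - it (m + Suc n) i" by (rule step[OF that])
    then have "fps_nth (it (Suc (m + Suc n)) i - it (m + Suc n) i) n = 0"
      unfolding fps_X_power_dvd_iff by auto
    then show ?case using Suc by simp
  qed simp
  have xit: "fps_nth (it k i) m = fps_nth (x i) m" if "i \<in> I" "m < k" for i m k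
    using stab[OF that(1), of "k - Suc m" m] that(2) by (simp add: x_def)
  have x_it: "fps_X ^ k dvd x i - it k i" if "i \<in> I" for k i
    unfolding fps_X_power_dvd_iff using xit[OF that] by simp
  have Xx: "fps_X dvd x i" if "i \<in> I" for i
    using Xit[OF that, of 1] xit[OF that, of 0 1] by (simp add: fps_X_dvd_iff)
  show ?thesis
  proof (rule that)
    fix i assume i: "i \<in> I"
    \<comment> \<open>Up to order \<open>M\<close> the limit agrees with the iterate
      \<open>Suc M\<close>, which lies in the ball.\<close>
    have "l1_bounded \<sigma> \<tau> (x i)"
      unfolding l1_bounded_def
    proof
      fix M
      have "(\<Sum>m\<le>M. \<bar>fps_nth (x i) m\<bar> * \<sigma> ^ m) = (\<Sum>m\<le>M. \<bar>fps_nth (it (Suc M) i) m\<bar> * \<sigma> ^ m)"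
        using xit[OF i] by (intro sum.cong) auto
      then show "(\<Sum>m\<le>M. \<bar>fps_nth (x i) m\<bar> * \<sigma> ^ m) \<le> \<tau>"
        using bit[OF i] by (auto simp: l1_bounded_def)
    qed
    then show "cvg (x i)" using \<sigma>(1) l1_bounded_imp_cvg by blast
    show "fps_nth (x i) 0 = 0" using Xx[OF i] by (simp add: fps_X_dvd_iff)
    have "fps_X ^ k dvd \<Phi> x i - x i" for k
    proof -
      have "fps_X ^ Suc k dvd \<Phi> x i - \<Phi> (it k) i" by (intro contr x_it Xx Xit i)
      then have "fps_X ^ k dvd \<Phi> x i - \<Phi> (it k) i" by (meson dvd_trans le_imp_power_dvd lessI less_imp_le)
      then have "fps_X ^ k dvd (\<Phi> x i - \<Phi> (it k) i) + (it (Suc k) i - it k i) - (x i - it k i)"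
        by (rule dvd_diff[OF dvd_add[OF _ step[OF i]] x_it[OF i]])
      then show ?thesis by (simp add: it_Suc)
    qed
    then have "\<Phi> x i - x i = 0" by (rule fps_all_X_power_dvd)
    then show "x i = f i + (\<Sum>j\<in>I. g i j * x j) + (\<Sum>j\<in>I. \<Sum>k\<in>I. h i j k * x j * x k)"
      by (simp add: \<Phi>_def)
  qed
qed

section \<open>Orthogonal diagonalisation over index sets\<close>

text \<open>Matrices are functions read on a finite index set. Passing to a block is then passing to
  a subset, and the inductions on \<open>card I\<close> need no renumbering.\<close>

definition congr :: "nat set \<Rightarrow> (nat \<Rightarrow> nat \<Rightarrow> 'a::comm_ring_1) \<Rightarrow> (nat \<Rightarrow> nat \<Rightarrow> 'a) \<Rightarrow> nat \<Rightarrow> nat \<Rightarrow> 'a" where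
  "congr I U K i j = (\<Sum>k\<in>I. \<Sum>l\<in>I. U k i * K k l * U l j)"

definition orth :: "nat set \<Rightarrow> (nat \<Rightarrow> nat \<Rightarrow> 'a::comm_ring_1) \<Rightarrow> bool" where
  "orth I U \<longleftrightarrow> (\<forall>i\<in>I. \<forall>j\<in>I. (\<Sum>k\<in>I. U k i * U k j) = (if i = j then 1 else 0))"

definition compose :: "nat set \<Rightarrow> (nat \<Rightarrow> nat \<Rightarrow> 'a::comm_ring_1) \<Rightarrow> (nat \<Rightarrow> nat \<Rightarrow> 'a) \<Rightarrow> nat \<Rightarrow> nat \<Rightarrow> 'a" where
  "compose I U V i j = (\<Sum>k\<in>I. U i k * V k j)"

text \<open>The predicate \<open>P\<close> singles out a subring from which the entries are taken.\<close>

definition diagonalizable ::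
  "('a \<Rightarrow> bool) \<Rightarrow> nat set \<Rightarrow> (nat \<Rightarrow> nat \<Rightarrow> 'a::comm_ring_1) \<Rightarrow> bool" where
  "diagonalizable P I K \<longleftrightarrow> (\<exists>U. (\<forall>i\<in>I. \<forall>j\<in>I. P (U i j)) \<and> orth I U \<and>
     (\<forall>i\<in>I. \<forall>j\<in>I. i \<noteq> j \<longrightarrow> congr I U K i j = 0))"

definition subring_pred :: "('a::comm_ring_1 \<Rightarrow> bool) \<Rightarrow> bool" where
  "subring_pred P \<longleftrightarrow> P 0 \<and> P 1 \<and> (\<forall>x y. P x \<longrightarrow> P y \<longrightarrow> P (x + y)) \<and> (\<forall>x y. P x \<longrightarrow> P y \<longrightarrow> P (x * y))"

lemma subring_pred_sum: "subring_pred P \<Longrightarrow> (\<And>i. i \<in> I \<Longrightarrow> P (f i)) \<Longrightarrow> P (sum f I)"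
  by (induction I rule: infinite_finite_induct) (auto simp: subring_pred_def)

lemma congr_compose: "congr I (compose I U V) K = congr I V (congr I U K)"
proof (intro ext)
  fix i j
  have "congr I (compose I U V) K i j
      = (\<Sum>k\<in>I. \<Sum>l\<in>I. \<Sum>p\<in>I. \<Sum>q\<in>I. V p i * (U k p * K k l * U l q) * V q j)"
    unfolding congr_def compose_def
    by (intro sum.cong refl) (simp add: sum_distrib_left sum_distrib_right mult_ac)
  also have "\<dots> = (\<Sum>p\<in>I. \<Sum>q\<in>I. \<Sum>k\<in>I. \<Sum>l\<in>I. V p i * (U k p * K k l * U l q) * V q j)"
  proof -
    have "(\<Sum>k\<in>I. \<Sum>l\<in>I. \<Sum>p\<in>I. \<Sum>q\<in>I. g k l p q) = (\<Sum>p\<in>I. \<Sum>q\<in>I. \<Sum>k\<in>I. \<Sum>l\<in>I. g k l p q)"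
      for g :: "nat \<Rightarrow> nat \<Rightarrow> nat \<Rightarrow> nat \<Rightarrow> 'a"
    proof -
      have "(\<Sum>k\<in>I. \<Sum>l\<in>I. \<Sum>p\<in>I. \<Sum>q\<in>I. g k l p q) = (\<Sum>k\<in>I. \<Sum>p\<in>I. \<Sum>l\<in>I. \<Sum>q\<in>I. g k l p q)"
        by (rule sum.cong[OF refl], rule sum.swap)
      also have "\<dots> = (\<Sum>p\<in>I. \<Sum>k\<in>I. \<Sum>q\<in>I. \<Sum>l\<in>I. g k l p q)"
        by (rule trans[OF sum.swap], rule sum.cong[OF refl], rule sum.cong[OF refl], rule sum.swap)
      also have "\<dots> = (\<Sum>p\<in>I. \<Sum>q\<in>I. \<Sum>k\<in>I. \<Sum>l\<in>I. g k l p q)"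
        by (rule sum.cong[OF refl], rule sum.swap)
      finally show ?thesis .
    qed
    then show ?thesis .
  qed
  also have "\<dots> = congr I V (congr I U K) i j"
    unfolding congr_def by (simp add: sum_distrib_left sum_distrib_right)
  finally show "congr I (compose I U V) K i j = congr I V (congr I U K) i j" .
qed

lemma orth_iff_congr:
  assumes "finite I"
  shows "orth I U \<longleftrightarrow> (\<forall>i\<in>I. \<forall>j\<in>I. congr I U (\<lambda>k l. if k = l then 1 else 0) i j = (if i = j then 1 else 0))"
proof -
  have "congr I U (\<lambda>k l. if k = l then 1 else 0) i j = (\<Sum>k\<in>I. U k i * U k j)" for i j
    unfolding congr_def
  proof (intro sum.cong refl)
    fix k assume "k \<in> I"
    have "(\<Sum>l\<in>I. U k i * (if k = l then 1 else 0) * U l j) = (\<Sum>l\<in>I. if k = l then U k i * U l j else 0)"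
      by (intro sum.cong) auto
    then show "(\<Sum>l\<in>I. U k i * (if k = l then 1 else 0) * U l j) = U k i * U k j"
      using assms \<open>k \<in> I\<close> by simp
  qed
  then show ?thesis by (simp add: orth_def)
qed

lemma congr_id:
  assumes "finite I" "i \<in> I" "j \<in> I"
  shows "congr I (\<lambda>i j. if i = j then 1 else 0) K i j = K i j"
proof -
  have "congr I (\<lambda>i j. if i = j then 1 else 0) K i j
      = (\<Sum>k\<in>I. if k = i then \<Sum>l\<in>I. if l = j then K k l else 0 else 0)"
    unfolding congr_def by (intro sum.cong refl) (auto intro!: sum.cong)
  then show ?thesis using assms by simp
qed

lemma orth_id: "finite I \<Longrightarrow> orth I (\<lambda>i j. if i = j then 1 else 0)"
  by (simp add: orth_iff_congr congr_id)

lemma congr_cong: "(\<And>k l. k \<in> I \<Longrightarrow> l \<in> I \<Longrightarrow> K k l = L k l) \<Longrightarrow> congr I U K i j = congr I U L i j"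
  unfolding congr_def by (intro sum.cong refl) auto

lemma orth_compose:
  assumes "finite I" "orth I U" "orth I V"
  shows "orth I (compose I U V)"
proof -
  have "congr I V (congr I U (\<lambda>k l. if k = l then 1 else 0)) i j = (if i = j then 1 else 0)"
    if "i \<in> I" "j \<in> I" for i j
  proof -
    have "congr I V (congr I U (\<lambda>k l. if k = l then 1 else 0)) i j
        = congr I V (\<lambda>k l. if k = l then 1 else 0) i j"
      using assms(2) by (intro congr_cong) (auto simp: orth_iff_congr[OF assms(1)])
    then show ?thesis using assms(3) that by (auto simp: orth_iff_congr[OF assms(1)])
  qed
  then show ?thesis by (auto simp: orth_iff_congr[OF assms(1)] congr_compose)
qed

lemma diagonalizable_congr:
  assumes "finite I" "subring_pred P" "orth I U" "\<And>i j. i \<in> I \<Longrightarrow> j \<in> I \<Longrightarrow> P (U i j)"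
    and "diagonalizable P I (congr I U K)"
  shows "diagonalizable P I K"
proof -
  obtain V where V: "\<forall>i\<in>I. \<forall>j\<in>I. P (V i j)" "orth I V"
    "\<forall>i\<in>I. \<forall>j\<in>I. i \<noteq> j \<longrightarrow> congr I V (congr I U K) i j = 0"
    using assms(5) unfolding diagonalizable_def by blast
  show ?thesis
    unfolding diagonalizable_def
  proof (intro exI[of _ "compose I U V"] conjI)
    show "\<forall>i\<in>I. \<forall>j\<in>I. P (compose I U V i j)"
    proof (intro ballI)
      have mult: "P x \<Longrightarrow> P y \<Longrightarrow> P (x * y)" for x y using assms(2) by (simp add: subring_pred_def)
      fix i j assume "i \<in> I" "j \<in> I"
      then show "P (compose I U V i j)"
        unfolding compose_def using assms(4) V(1) by (intro subring_pred_sum[OF assms(2)] mult) auto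
    qed
  qed (use V orth_compose[OF assms(1,3) V(2)] in \<open>auto simp: congr_compose\<close>)
qed

lemma congr_affine:
  assumes "finite I" "orth I U" "i \<in> I" "j \<in> I"
  shows "congr I U (\<lambda>k l. (if k = l then a else 0) + c * L k l) i j
    = (if i = j then a else 0) + c * congr I U L i j"
proof -
  have "congr I U (\<lambda>k l. (if k = l then a else 0) + c * L k l) i j
      = a * congr I U (\<lambda>k l. if k = l then 1 else 0) i j + c * congr I U L i j"
    unfolding congr_def sum_distrib_left sum.distrib[symmetric]
    by (intro sum.cong refl) (auto simp: algebra_simps)
  also have "congr I U (\<lambda>k l. if k = l then 1 else 0) i j = (if i = j then 1 else 0)"
    using assms by (auto simp: orth_iff_congr)
  finally show ?thesis by simp
qed

lemma diagonalizable_affine: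
  assumes "finite I" "diagonalizable P I L"
    and "\<And>i j. i \<in> I \<Longrightarrow> j \<in> I \<Longrightarrow> K i j = (if i = j then a else 0) + c * L i j"
  shows "diagonalizable P I K"
proof -
  obtain V where V: "\<forall>i\<in>I. \<forall>j\<in>I. P (V i j)" "orth I V"
    "\<forall>i\<in>I. \<forall>j\<in>I. i \<noteq> j \<longrightarrow> congr I V L i j = 0"
    using assms(2) unfolding diagonalizable_def by blast
  have "congr I V K i j = (if i = j then a else 0) + c * congr I V L i j" if "i \<in> I" "j \<in> I" for i j
  proof -
    have "congr I V K i j = congr I V (\<lambda>k l. (if k = l then a else 0) + c * L k l) i j"
      by (rule congr_cong) (rule assms(3))
    then show ?thesis by (simp only: congr_affine[OF assms(1) V(2) that])
  qed
  then show ?thesis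
    unfolding diagonalizable_def using V by (intro exI[of _ V]) auto
qed

lemma diagonalizable_blocks:
  fixes K :: "nat \<Rightarrow> nat \<Rightarrow> 'a::comm_ring_1"
  assumes "finite I" "J \<subseteq> I" "subring_pred P"
    and off: "\<And>i j. i \<in> J \<Longrightarrow> j \<in> I - J \<Longrightarrow> K i j = 0 \<and> K j i = 0"
    and "diagonalizable P J K" "diagonalizable P (I - J) K"
  shows "diagonalizable P I K"
proof -
  obtain U where U: "\<forall>i\<in>J. \<forall>j\<in>J. P (U i j)" "orth J U"
    "\<forall>i\<in>J. \<forall>j\<in>J. i \<noteq> j \<longrightarrow> congr J U K i j = 0"
    using assms(5) unfolding diagonalizable_def by blast
  obtain V where V: "\<forall>i\<in>I-J. \<forall>j\<in>I-J. P (V i j)" "orth (I-J) V"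
    "\<forall>i\<in>I-J. \<forall>j\<in>I-J. i \<noteq> j \<longrightarrow> congr (I-J) V K i j = 0"
    using assms(6) unfolding diagonalizable_def by blast
  define W where "W i j = (if i \<in> J \<and> j \<in> J then U i j else if i \<in> I - J \<and> j \<in> I - J then V i j else 0)" for i j
  have fin: "finite J" "finite (I - J)" using assms(1,2) finite_subset by auto
  have split: "sum f I = sum f J + sum f (I - J)" for f :: "nat \<Rightarrow> 'a"
    using assms(1,2) by (simp add: sum.subset_diff add.commute)
  have c: "congr I W L i j = (if i \<in> J \<and> j \<in> J then congr J U L i j
      else if i \<in> I - J \<and> j \<in> I - J then congr (I-J) V L i j else 0)"
    if L: "\<And>i j. i \<in> J \<Longrightarrow> j \<in> I - J \<Longrightarrow> L i j = 0 \<and> L j i = 0" and ij: "i \<in> I" "j \<in> I"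
    for L :: "nat \<Rightarrow> nat \<Rightarrow> 'a" and i j
  proof -
    have "congr I W L i j = (\<Sum>k\<in>J. \<Sum>l\<in>J. W k i * L k l * W l j) + (\<Sum>k\<in>I-J. \<Sum>l\<in>I-J. W k i * L k l * W l j)"
    proof -
      have "(\<Sum>l\<in>I. W k i * L k l * W l j) = (\<Sum>l\<in>J. W k i * L k l * W l j)" if "k \<in> J" for k
        using L[OF that] by (subst split) simp
      moreover have "(\<Sum>l\<in>I. W k i * L k l * W l j) = (\<Sum>l\<in>I-J. W k i * L k l * W l j)" if "k \<in> I - J" for k
        using L[of _ k] that by (subst split) simp
      ultimately show ?thesis unfolding congr_def by (subst split) simp
    qed
    moreover have "(\<Sum>k\<in>J. \<Sum>l\<in>J. W k i * L k l * W l j) = (if i \<in> J \<and> j \<in> J then congr J U L i j else 0)"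
      unfolding congr_def by (auto simp: W_def)
    moreover have "(\<Sum>k\<in>I-J. \<Sum>l\<in>I-J. W k i * L k l * W l j) = (if i \<in> I - J \<and> j \<in> I - J then congr (I-J) V L i j else 0)"
      using ij unfolding congr_def by (auto simp: W_def)
    ultimately show ?thesis by auto
  qed
  show ?thesis
    unfolding diagonalizable_def
  proof (intro exI[of _ W] conjI)
    show "\<forall>i\<in>I. \<forall>j\<in>I. P (W i j)"
      using U(1) V(1) assms(3) by (auto simp: W_def subring_pred_def)
    have "congr I W (\<lambda>k l. if k = l then 1 else 0) i j = (if i = j then 1 else 0)" if "i \<in> I" "j \<in> I" for i j
      using U(2) V(2) that assms(2) by (subst c) (auto simp: orth_iff_congr fin)
    then show "orth I W" by (simp add: orth_iff_congr assms(1))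
    show "\<forall>i\<in>I. \<forall>j\<in>I. i \<noteq> j \<longrightarrow> congr I W K i j = 0"
    proof (intro ballI impI)
      fix i j assume ij: "i \<in> I" "j \<in> I" "i \<noteq> j"
      show "congr I W K i j = 0"
        using U(3) V(3) ij(3) by (subst c) (use off ij in auto)
    qed
  qed
qed

text \<open>The complex matrix has an eigenvector \<open>z\<close>. The Hermitian form at
  \<open>z\<close> equals its own conjugate, so the eigenvalue is real, and the real or the
  imaginary part of \<open>z\<close> is a nonzero real eigenvector.\<close>

lemma real_symmetric_eigenvector:
  fixes A :: "nat \<Rightarrow> nat \<Rightarrow> real"
  assumes fin: "finite I" and ne: "I \<noteq> {}"
    and sym: "\<And>i j. i \<in> I \<Longrightarrow> j \<in> I \<Longrightarrow> A i j = A j i"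
  obtains v \<nu> where "(\<Sum>i\<in>I. v i * v i) = 1" "\<And>i. i \<in> I \<Longrightarrow> (\<Sum>j\<in>I. A i j * v j) = \<nu> * v i"
proof -
  define n where "n = card I"
  have "n \<noteq> 0" using fin ne by (simp add: n_def)
  obtain f where f: "bij_betw f {..<n} I"
    using ex_bij_betw_nat_finite[OF fin] by (auto simp: n_def atLeast0LessThan)
  define B :: "complex mat" where "B = mat n n (\<lambda>(i,j). of_real (A (f i) (f j)))"
  have B: "B \<in> carrier_mat n n" by (simp add: B_def)
  obtain \<mu> where "\<mu> \<in> spectrum B" using spectrum_non_empty[OF B] \<open>n \<noteq> 0\<close> by auto
  then obtain z where z: "z \<in> carrier_vec n" "z \<noteq> 0\<^sub>v n" "B *\<^sub>v z = \<mu> \<cdot>\<^sub>v z"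
    using B unfolding spectrum_def eigenvalue_def eigenvector_def by auto
  have eig: "(\<Sum>j<n. of_real (A (f i) (f j)) * z $ j) = \<mu> * z $ i" if "i < n" for i
  proof -
    have "(B *\<^sub>v z) $ i = (\<mu> \<cdot>\<^sub>v z) $ i" by (simp add: z(3))
    then show ?thesis using that z(1) B
      by (simp add: B_def scalar_prod_def atLeast0LessThan)
  qed
  have fI: "f i \<in> I" if "i < n" for i using f that by (auto simp: bij_betw_def)
  define S where "S = (\<Sum>i<n. (cmod (z $ i))\<^sup>2)"
  have "\<exists>i<n. z $ i \<noteq> 0"
  proof (rule ccontr)
    assume "\<not> ?thesis"
    then have "z = 0\<^sub>v n" using z(1) by (intro eq_vecI) auto
    then show False using z(2) by simp
  qed
  then obtain i1 where i1: "i1 < n" "z $ i1 \<noteq> 0" by blast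
  have "S > 0" unfolding S_def by (rule sum_pos2[of _ i1]) (use i1 in auto)
  have "\<mu> * of_real S = (\<Sum>i<n. \<Sum>j<n. cnj (z $ i) * of_real (A (f i) (f j)) * z $ j)"
  proof -
    have "\<mu> * of_real S = (\<Sum>i<n. cnj (z $ i) * (\<mu> * z $ i))"
      unfolding S_def of_real_sum sum_distrib_left
      by (intro sum.cong refl) (simp only: complex_norm_square mult_ac)
    also have "\<dots> = (\<Sum>i<n. cnj (z $ i) * (\<Sum>j<n. of_real (A (f i) (f j)) * z $ j))"
      using eig by (intro sum.cong refl) auto
    finally show ?thesis by (simp add: sum_distrib_left mult.assoc)
  qed
  moreover have "cnj (\<Sum>i<n. \<Sum>j<n. cnj (z $ i) * of_real (A (f i) (f j)) * z $ j)
      = (\<Sum>i<n. \<Sum>j<n. cnj (z $ i) * of_real (A (f i) (f j)) * z $ j)"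
  proof -
    have "cnj (\<Sum>i<n. \<Sum>j<n. cnj (z $ i) * of_real (A (f i) (f j)) * z $ j)
        = (\<Sum>i<n. \<Sum>j<n. cnj (z $ j) * of_real (A (f j) (f i)) * z $ i)"
      unfolding cnj_sum using sym fI by (intro sum.cong refl) (simp add: mult_ac)
    also have "\<dots> = (\<Sum>i<n. \<Sum>j<n. cnj (z $ i) * of_real (A (f i) (f j)) * z $ j)"
      by (rule sum.swap)
    finally show ?thesis .
  qed
  ultimately have "cnj \<mu> * of_real S = \<mu> * of_real S"
    by (metis complex_cnj_complex_of_real complex_cnj_mult)
  then have "cnj \<mu> = \<mu>" using \<open>S > 0\<close> by simp
  then have \<mu>: "\<mu> = of_real (Re \<mu>)" by (simp add: complex_eq_iff)
  have re: "(\<Sum>j<n. A (f i) (f j) * Re (z $ j)) = Re \<mu> * Re (z $ i)"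
    and im: "(\<Sum>j<n. A (f i) (f j) * Im (z $ j)) = Re \<mu> * Im (z $ i)" if "i < n" for i
  proof -
    have "Re (\<Sum>j<n. of_real (A (f i) (f j)) * z $ j) = Re (of_real (Re \<mu>) * z $ i)"
      "Im (\<Sum>j<n. of_real (A (f i) (f j)) * z $ j) = Im (of_real (Re \<mu>) * z $ i)"
      using eig[OF that] \<mu> by simp_all
    then show "(\<Sum>j<n. A (f i) (f j) * Re (z $ j)) = Re \<mu> * Re (z $ i)"
      "(\<Sum>j<n. A (f i) (f j) * Im (z $ j)) = Re \<mu> * Im (z $ i)" by simp_all
  qed
  obtain w :: "nat \<Rightarrow> real" where w: "\<exists>i<n. w i \<noteq> 0" "\<And>i. i < n \<Longrightarrow> (\<Sum>j<n. A (f i) (f j) * w j) = Re \<mu> * w i"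
  proof (cases "\<exists>i<n. Re (z $ i) \<noteq> 0")
    case True
    then show ?thesis using that[of "\<lambda>i. Re (z $ i)"] re by auto
  next
    case False
    then have "\<exists>i<n. Im (z $ i) \<noteq> 0" using i1 by (auto simp: complex_eq_iff)
    then show ?thesis using that[of "\<lambda>i. Im (z $ i)"] im by auto
  qed
  define T where "T = (\<Sum>i<n. w i * w i)"
  obtain i2 where i2: "i2 < n" "w i2 \<noteq> 0" using w(1) by blast
  have "T > 0" unfolding T_def
    by (rule sum_pos2[of _ i2]) (use i2 in \<open>auto simp: zero_less_mult_iff neq_iff\<close>)
  define g where "g = the_inv_into {..<n} f"
  define v where "v i = w (g i) / sqrt T" for i
  have gf: "g (f i) = i" if "i < n" for i
    using f that by (auto simp: g_def bij_betw_def the_inv_into_f_f)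
  have re_sum: "(\<Sum>i\<in>I. h i) = (\<Sum>i<n. h (f i))" for h :: "nat \<Rightarrow> real"
    using sum.reindex_bij_betw[OF f, of h] by simp
  show ?thesis
  proof (rule that)
    have "(\<Sum>i\<in>I. v i * v i) = (\<Sum>i<n. w i * w i / T)"
      unfolding re_sum using \<open>T > 0\<close> by (intro sum.cong refl) (simp add: v_def gf)
    also have "\<dots> = 1" unfolding sum_divide_distrib[symmetric] T_def[symmetric] using \<open>T > 0\<close> by simp
    finally show "(\<Sum>i\<in>I. v i * v i) = 1" .
    fix i assume "i \<in> I"
    then obtain p where p: "p < n" "i = f p" using f by (auto simp: bij_betw_def)
    have "(\<Sum>j\<in>I. A i j * v j) = (\<Sum>j<n. A (f p) (f j) * w j / sqrt T)"
      unfolding re_sum p(2) by (intro sum.cong refl) (simp add: v_def gf)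
    also have "\<dots> = Re \<mu> * v i"
      unfolding sum_divide_distrib[symmetric] w(2)[OF p(1)] by (simp add: v_def gf p)
    finally show "(\<Sum>j\<in>I. A i j * v j) = Re \<mu> * v i" .
  qed
qed

text \<open>A Householder reflection.\<close>

lemma orth_with_given_column:
  fixes v :: "nat \<Rightarrow> real"
  assumes fin: "finite I" and i0: "i0 \<in> I" and v: "(\<Sum>i\<in>I. v i * v i) = 1"
  obtains U where "orth I U" "\<And>i. i \<in> I \<Longrightarrow> U i i0 = v i"
proof (cases "v i0 = 1")
  case True
  have "(\<Sum>i\<in>I - {i0}. v i * v i) = 0"
    using v True by (simp add: sum.remove[OF fin i0])
  then have "v i = 0" if "i \<in> I - {i0}" for i
    using that fin by (subst (asm) sum_nonneg_eq_0_iff) auto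
  then show ?thesis using True fin
    by (intro that[of "\<lambda>i j. if i = j then 1 else 0"] orth_id) auto
next
  case False
  \<comment> \<open>\<open>w\<close> is \<open>v\<close> minus the unit vector of \<open>i0\<close>
    and has squared length \<open>2 * \<gamma>\<close>; the reflection along \<open>w\<close>
    exchanges these two unit vectors.\<close>
  define w where "w i = v i - (if i = i0 then 1 else 0)" for i
  define \<gamma> where "\<gamma> = 1 - v i0"
  have g: "\<gamma> \<noteq> 0" using False by (simp add: \<gamma>_def)
  have ww: "(\<Sum>i\<in>I. w i * w i) = 2 * \<gamma>"
  proof -
    have "(\<Sum>i\<in>I. w i * w i) = (\<Sum>i\<in>I. v i * v i - 2 * (if i = i0 then v i else 0) + (if i = i0 then 1 else 0))"
      by (intro sum.cong refl) (auto simp: w_def algebra_simps)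
    also have "\<dots> = 2 * \<gamma>"
      using fin i0 v by (simp add: sum.distrib sum_subtractf sum_distrib_left[symmetric] \<gamma>_def)
    finally show ?thesis .
  qed
  define U where "U i j = (if i = j then 1 else 0) - w i * w j / \<gamma>" for i j
  show ?thesis
  proof (rule that)
    show "orth I U"
      unfolding orth_def
    proof (intro ballI)
      fix i j assume ij: "i \<in> I" "j \<in> I"
      have "(\<Sum>k\<in>I. U k i * U k j)
          = (\<Sum>k\<in>I. (if k = i then (if i = j then 1 else 0) else 0) - (if k = i then w i * w j / \<gamma> else 0)
              - (if k = j then w i * w j / \<gamma> else 0) + w k * w k * (w i * w j / (\<gamma> * \<gamma>)))"
        by (intro sum.cong refl) (auto simp: U_def algebra_simps)
      also have "\<dots> = (if i = j then 1 else 0) - w i * w j / \<gamma> - w i * w j / \<gamma>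
          + (\<Sum>k\<in>I. w k * w k) * (w i * w j / (\<gamma> * \<gamma>))"
        using ij fin by (simp add: sum.distrib sum_subtractf flip: sum_distrib_right sum_divide_distrib)
      also have "\<dots> = (if i = j then 1 else 0)"
        unfolding ww using g by (simp add: field_simps)
      finally show "(\<Sum>k\<in>I. U k i * U k j) = (if i = j then 1 else 0)" .
    qed
    show "U i i0 = v i" if "i \<in> I" for i
      using g by (simp add: U_def w_def \<gamma>_def field_simps)
  qed
qed

text \<open>Cancelling with the adjugate works over any commutative ring, where \<open>det A\<close>
  is only known to be a unit; the entries will be power series.\<close>

lemma left_inverse_imp_right_inverse:
  fixes A B :: "'a::comm_ring_1 mat"
  assumes A: "A \<in> carrier_mat n n" and B: "B \<in> carrier_mat n n" and AB: "A * B = 1\<^sub>m n"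
  shows "B * A = 1\<^sub>m n"
proof -
  note ad = adj_mat[OF A]
  have d: "det B * det A = 1" using det_mult[OF A B] AB by (simp add: mult.commute)
  have "adj_mat A * (A * B) * A = (adj_mat A * A) * (B * A)"
    using A B ad(1) by (simp add: assoc_mult_mat[of _ n n _ n _ n])
  then have "det A \<cdot>\<^sub>m (B * A) = det A \<cdot>\<^sub>m 1\<^sub>m n"
    using A B ad by (simp add: AB mult_smult_assoc_mat[of _ n n _ n])
  then have e: "det A * (B * A) $$ (i, j) = det A * 1\<^sub>m n $$ (i, j)" if "i < n" "j < n" for i j
    using that A B by (metis carrier_matD index_mult_mat(2,3) index_one_mat(2,3) index_smult_mat(1))
  show ?thesis
  proof (rule eq_matI)
    show "(B * A) $$ (i, j) = 1\<^sub>m n $$ (i, j)" if "i < dim_row (1\<^sub>m n :: 'a mat)" "j < dim_col (1\<^sub>m n :: 'a mat)" for i j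
      using e[of i j] that d by (metis index_one_mat(2,3) mult.assoc mult_1)
  qed (use A B in auto)
qed

lemma orth_transpose:
  fixes U :: "nat \<Rightarrow> nat \<Rightarrow> 'a::comm_ring_1"
  assumes fin: "finite I" and U: "orth I U"
  shows "orth I (\<lambda>i j. U j i)"
proof -
  define n where "n = card I"
  obtain f where f: "bij_betw f {..<n} I"
    using ex_bij_betw_nat_finite[OF fin] by (auto simp: n_def atLeast0LessThan)
  define M where "M = mat n n (\<lambda>(i,j). U (f i) (f j))"
  have M: "M \<in> carrier_mat n n" "transpose_mat M \<in> carrier_mat n n" by (simp_all add: M_def)
  have fI: "f i \<in> I" if "i < n" for i using f that by (auto simp: bij_betw_def)
  have finj: "f i = f j \<longleftrightarrow> i = j" if "i < n" "j < n" for i j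
    using f that by (auto simp: bij_betw_def inj_on_def)
  have re_sum: "(\<Sum>i\<in>I. h i) = (\<Sum>i<n. h (f i))" for h :: "nat \<Rightarrow> 'a"
    using sum.reindex_bij_betw[OF f, of h] by simp
  have "transpose_mat M * M = 1\<^sub>m n"
  proof (rule eq_matI)
    fix i j assume ij: "i < dim_row (1\<^sub>m n :: 'a mat)" "j < dim_col (1\<^sub>m n :: 'a mat)"
    then have "(transpose_mat M * M) $$ (i, j) = (\<Sum>k<n. U (f k) (f i) * U (f k) (f j))"
      by (simp add: M_def scalar_prod_def atLeast0LessThan)
    also have "\<dots> = 1\<^sub>m n $$ (i, j)"
      using U ij fI finj unfolding re_sum[of "\<lambda>k. U k (f i) * U k (f j)", symmetric] by (auto simp: orth_def)
    finally show "(transpose_mat M * M) $$ (i, j) = 1\<^sub>m n $$ (i, j)" .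
  qed (simp_all add: M_def)
  then have r: "M * transpose_mat M = 1\<^sub>m n"
    using left_inverse_imp_right_inverse[OF M(2,1)] by simp
  show ?thesis
    unfolding orth_def
  proof (intro ballI)
    fix i j assume "i \<in> I" "j \<in> I"
    then obtain p q where pq: "p < n" "i = f p" "q < n" "j = f q" using f by (auto simp: bij_betw_def)
    have "(\<Sum>k\<in>I. U i k * U j k) = (M * transpose_mat M) $$ (p, q)"
      unfolding re_sum using pq by (simp add: M_def scalar_prod_def atLeast0LessThan)
    then show "(\<Sum>k\<in>I. U i k * U j k) = (if i = j then 1 else 0)"
      unfolding r using pq finj by auto
  qed
qed

lemma congr_symmetric:
  assumes "\<And>i j. i \<in> I \<Longrightarrow> j \<in> I \<Longrightarrow> K i j = K j i"
  shows "congr I U K i j = congr I U K j i"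
  unfolding congr_def
  by (subst sum.swap) (intro sum.cong refl, simp add: assms mult_ac)

text \<open>Deflation: an orthogonal matrix whose column \<open>i0\<close> is an eigenvector clears
  row and column \<open>i0\<close> off the diagonal, and induction treats the remaining
  indices.\<close>

lemma real_symmetric_diagonalizable:
  fixes A :: "nat \<Rightarrow> nat \<Rightarrow> real"
  assumes "finite I" "\<And>i j. i \<in> I \<Longrightarrow> j \<in> I \<Longrightarrow> A i j = A j i"
  shows "diagonalizable (\<lambda>_. True) I A"
  using assms
proof (induction "card I" arbitrary: I A)
  case 0
  then show ?case by (auto simp: diagonalizable_def orth_def)
next
  case (Suc n)
  have sr: "subring_pred (\<lambda>_::real. True)" by (simp add: subring_pred_def)
  from Suc obtain i0 where i0: "i0 \<in> I" by fastforce
  then have ne: "I \<noteq> {}" by auto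
  obtain v \<nu> where v: "(\<Sum>i\<in>I. v i * v i) = 1" "\<And>i. i \<in> I \<Longrightarrow> (\<Sum>j\<in>I. A i j * v j) = \<nu> * v i"
    using real_symmetric_eigenvector[where A = A, OF Suc.prems(1) ne Suc.prems(2)] by blast
  obtain U where U: "orth I U" "\<And>i. i \<in> I \<Longrightarrow> U i i0 = v i"
    using orth_with_given_column[OF Suc.prems(1) i0 v(1)] by blast
  have symB: "congr I U A i j = congr I U A j i" for i j
    by (rule congr_symmetric[OF Suc.prems(2)])
  have off: "congr I U A i i0 = 0" if "i \<in> I - {i0}" for i
  proof -
    have "congr I U A i i0 = (\<Sum>k\<in>I. U k i * (\<Sum>l\<in>I. A k l * v l))"
      unfolding congr_def by (simp add: U(2) sum_distrib_left mult.assoc)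
    also have "\<dots> = (\<Sum>k\<in>I. U k i * U k i0) * \<nu>"
      unfolding sum_distrib_right by (intro sum.cong refl) (simp add: v(2) U(2))
    also have "(\<Sum>k\<in>I. U k i * U k i0) = 0"
      using U(1) i0 that by (auto simp: orth_def)
    finally show ?thesis by simp
  qed
  have "diagonalizable (\<lambda>_. True) I (congr I U A)"
  proof (rule diagonalizable_blocks[OF Suc.prems(1), of "{i0}"])
    show "diagonalizable (\<lambda>_. True) {i0} (congr I U A)"
      by (auto simp: diagonalizable_def orth_def intro!: exI[of _ "\<lambda>_ _. 1"])
    show "diagonalizable (\<lambda>_. True) (I - {i0}) (congr I U A)"
      using Suc.hyps(2) Suc.prems(1) i0 symB by (intro Suc.hyps(1)) auto
  qed (use i0 sr off symB in auto)
  then show ?case by (rule diagonalizable_congr[OF Suc.prems(1) sr U(1), rotated]) simp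
qed

section \<open>Analytic orthogonal diagonalisation\<close>

text \<open>The orthogonal matrix is sought as \<open>1 + Z\<close>. The symmetric part of \<open>Z\<close> is determined by
  orthogonality, the antisymmetric part by the vanishing of the entries outside of the blocks;
  both conditions together are a quadratic fixed point equation.\<close>

lemma analytic_block_splitting:
  fixes K :: "nat \<Rightarrow> nat \<Rightarrow> real fps"
  assumes fin: "finite I"
    and cK: "\<And>i j. i \<in> I \<Longrightarrow> j \<in> I \<Longrightarrow> cvg (K i j)"
    and sym: "\<And>i j. i \<in> I \<Longrightarrow> j \<in> I \<Longrightarrow> K i j = K j i"
    and K0: "\<And>i j. i \<in> I \<Longrightarrow> j \<in> I \<Longrightarrow> fps_nth (K i j) 0 = (if i = j then \<alpha> i else 0)"
  obtains U where "\<And>i j. i \<in> I \<Longrightarrow> j \<in> I \<Longrightarrow> cvg (U i j)" "orth I U"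
    "\<And>i j. i \<in> I \<Longrightarrow> j \<in> I \<Longrightarrow> \<alpha> i \<noteq> \<alpha> j \<Longrightarrow> congr I U K i j = 0"
proof -
  define L where "L i j = K i j - (if i = j then fps_const (\<alpha> i) else 0)" for i j
  have cL: "cvg (L i j)" if "i \<in> I" "j \<in> I" for i j using cK[OF that] by (auto simp: L_def)
  have L0: "fps_nth (L i j) 0 = 0" if "i \<in> I" "j \<in> I" for i j using K0[OF that] by (auto simp: L_def)
  have symL: "L i j = L j i" if "i \<in> I" "j \<in> I" for i j using sym[OF that] by (auto simp: L_def)
  have KL: "K i j = L i j + (if i = j then fps_const (\<alpha> i) else 0)" for i j by (simp add: L_def)
  \<comment> \<open>\<open>d\<close> inverts the gap between two eigenvalues of the constant term;
    within one cluster nothing has to be cleared and it is 0. The ansatz is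
    \<open>Z = d * b - hf * ZZ\<close> entrywise. In an entry of the transformed matrix outside of
    the blocks the constant term of \<open>K\<close> turns the antisymmetric part into
    \<open>- b\<close> and the symmetric part into \<open>- s * ZZ\<close>, so that clearing the
    entry determines \<open>b\<close>. The maps \<open>f\<close>, \<open>g\<close> and
    \<open>h\<close> are the parts of degree 0, 1 and 2 of this equation.\<close>
  define \<delta> where "\<delta> i j = (if \<alpha> i = \<alpha> j then 0 else 1 / (\<alpha> j - \<alpha> i))" for i j
  define d where "d i j = fps_const (\<delta> i j)" for i j
  define s where "s i j = fps_const ((\<alpha> i + \<alpha> j) / 2)" for i j
  define f where "f p = (case p of (i,j) \<Rightarrow> d i j * L i j)" for p
  define g where "g p q = (case p of (i,j) \<Rightarrow> case q of (a,b) \<Rightarrow>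
      d i j * ((if b = i then L a j else 0) + (if b = j then L i a else 0)))" for p q
  define hf where "hf = (fps_const (1/2) :: real fps)"
  define h where "h p q r = (case p of (i,j) \<Rightarrow> case q of (a,b) \<Rightarrow> case r of (a',b') \<Rightarrow>
      (if b = i \<and> b' = j then d i j * K a a' + (if a = a' then - (hf + d i j * s i j) else 0) else 0))"
    for p q r
  have d0: "\<alpha> i = \<alpha> j \<Longrightarrow> d i j = 0" for i j by (simp add: d_def \<delta>_def)
  obtain x where x: "\<And>p. p \<in> I \<times> I \<Longrightarrow> cvg (x p)" "\<And>p. p \<in> I \<times> I \<Longrightarrow> fps_nth (x p) 0 = 0"
    "\<And>p. p \<in> I \<times> I \<Longrightarrow> x p = f p + (\<Sum>q\<in>I \<times> I. g p q * x q) + (\<Sum>q\<in>I \<times> I. \<Sum>r\<in>I \<times> I. h p q r * x q * x r)"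
  proof (rule quadratic_fixed_point[of "I \<times> I" f g h])
    show "finite (I \<times> I)" using fin by auto
    show "cvg (f p)" if "p \<in> I \<times> I" for p
      using that cL by (auto simp: f_def d_def)
    show "cvg (g p q)" if "p \<in> I \<times> I" "q \<in> I \<times> I" for p q
      using that by (auto simp: g_def d_def intro!: cvg_mult cvg_add cL)
    show "cvg (h p q r)" if "p \<in> I \<times> I" "q \<in> I \<times> I" "r \<in> I \<times> I" for p q r
      using that by (auto simp: h_def d_def s_def hf_def simp del: fps_const_mult fps_const_neg
          intro!: cvg_mult cvg_add cvg_uminus cvg_diff cK)
    show "fps_nth (f p) 0 = 0" if "p \<in> I \<times> I" for p
      using that L0 by (auto simp: f_def)
    show "fps_nth (g p q) 0 = 0" if "p \<in> I \<times> I" "q \<in> I \<times> I" for p q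
      using that L0 by (auto simp: g_def)
  qed blast
  define Z where "Z i j = x (i,j)" for i j
  define ZZ where "ZZ i j = (\<Sum>k\<in>I. Z k i * Z k j)" for i j
  define ZL where "ZL i j = (\<Sum>k\<in>I. Z k i * L k j)" for i j
  define LZ where "LZ i j = (\<Sum>k\<in>I. L i k * Z k j)" for i j
  define ZKZ where "ZKZ i j = (\<Sum>k\<in>I. \<Sum>l\<in>I. Z k i * K k l * Z l j)" for i j
  define b where "b i j = L i j + ZL i j + LZ i j + ZKZ i j - s i j * ZZ i j" for i j
  have Z: "Z i j = d i j * b i j - hf * ZZ i j" if ij: "i \<in> I" "j \<in> I" for i j
  proof -
    have g: "(\<Sum>q\<in>I \<times> I. g (i,j) q * x q) = d i j * (ZL i j + LZ i j)"
    proof -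
      have "(\<Sum>q\<in>I \<times> I. g (i,j) q * x q) = (\<Sum>a\<in>I. \<Sum>c\<in>I.
            (if c = i then d i j * (L a j * Z a c) else 0) + (if c = j then d i j * (L i a * Z a c) else 0))"
        unfolding sum.cartesian_product'
        by (intro sum.cong refl) (auto simp: g_def Z_def algebra_simps)
      also have "\<dots> = d i j * (ZL i j + LZ i j)"
        using ij fin by (simp add: sum.distrib ZL_def LZ_def sum_distrib_left distrib_left mult_ac)
      finally show ?thesis .
    qed
    have h: "(\<Sum>q\<in>I \<times> I. \<Sum>r\<in>I \<times> I. h (i,j) q r * x q * x r)
        = d i j * ZKZ i j - (hf + d i j * s i j) * ZZ i j"
    proof -
      have "(\<Sum>q\<in>I \<times> I. \<Sum>r\<in>I \<times> I. h (i,j) q r * x q * x r)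
          = (\<Sum>a\<in>I. \<Sum>c\<in>I. \<Sum>a'\<in>I. \<Sum>c'\<in>I. if c' = j then if c = i then
               d i j * (Z a c * K a a' * Z a' c') - (if a' = a then (hf + d i j * s i j) * (Z a c * Z a' c') else 0)
              else 0 else 0)"
        unfolding sum.cartesian_product'
        by (intro sum.cong refl) (auto simp: h_def Z_def algebra_simps)
      also have "\<dots> = (\<Sum>a\<in>I. \<Sum>c\<in>I. if c = i then \<Sum>a'\<in>I.
               d i j * (Z a c * K a a' * Z a' j) - (if a' = a then (hf + d i j * s i j) * (Z a c * Z a' j) else 0)
              else 0)"
        using ij fin by (intro sum.cong refl) auto
      also have "\<dots> = (\<Sum>a\<in>I. \<Sum>a'\<in>I.
               d i j * (Z a i * K a a' * Z a' j) - (if a' = a then (hf + d i j * s i j) * (Z a i * Z a' j) else 0))"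
        by (rule sum.cong[OF refl]) (use ij fin in simp)
      also have "\<dots> = d i j * ZKZ i j - (hf + d i j * s i j) * ZZ i j"
        using fin by (simp add: sum_subtractf ZKZ_def ZZ_def sum_distrib_left del: fps_const_mult)
      finally show ?thesis .
    qed
    have "Z i j = d i j * L i j + d i j * (ZL i j + LZ i j) + (d i j * ZKZ i j - (hf + d i j * s i j) * ZZ i j)"
      unfolding g[symmetric] h[symmetric] using x(3)[of "(i,j)"] ij by (simp add: Z_def f_def)
    then show ?thesis by (simp add: b_def algebra_simps)
  qed
  have ZZ_sym: "ZZ i j = ZZ j i" for i j unfolding ZZ_def by (simp add: mult.commute)
  have ZL_sym: "ZL i j = LZ j i" if "i \<in> I" "j \<in> I" for i j
    unfolding ZL_def LZ_def using that symL by (intro sum.cong refl) (simp add: mult.commute)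
  have ZKZ_sym: "ZKZ i j = ZKZ j i" for i j
    unfolding ZKZ_def by (subst sum.swap) (intro sum.cong refl, simp add: sym mult_ac)
  have b_sym: "b i j = b j i" if "i \<in> I" "j \<in> I" for i j
    unfolding b_def using that symL ZL_sym ZZ_sym[of i j] ZKZ_sym[of i j]
    by (simp add: s_def add.commute)
  have d_anti: "d j i = - d i j" for i j
    unfolding d_def by (simp add: \<delta>_def field_simps) (simp add: minus_divide_right)?
  have two: "hf * x + hf * x = x" for x
    by (simp add: hf_def distrib_right[symmetric])
  have Zsum: "Z i j + Z j i = - ZZ i j" if "i \<in> I" "j \<in> I" for i j
  proof -
    have "Z i j + Z j i = - (hf * ZZ i j + hf * ZZ i j)"
      unfolding Z[OF that] Z[OF that(2,1)] b_sym[OF that(2,1)] d_anti[of i j] ZZ_sym[of j i]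
      by (simp add: algebra_simps)
    then show ?thesis by (simp only: two)
  qed
  define U where "U i j = (if i = j then 1 else 0) + Z i j" for i j
  show ?thesis
  proof (rule that[of U])
    show "cvg (U i j)" if "i \<in> I" "j \<in> I" for i j
      using x(1) that by (auto simp: U_def Z_def)
    show "orth I U"
      unfolding orth_def
    proof (intro ballI)
      fix i j assume ij: "i \<in> I" "j \<in> I"
      have "(\<Sum>k\<in>I. U k i * U k j) = (\<Sum>k\<in>I. (if k = i then if i = j then 1 else 0 else 0)
          + (if k = i then Z k j else 0) + (if k = j then Z k i else 0) + Z k i * Z k j)"
        by (intro sum.cong refl) (auto simp: U_def algebra_simps)
      also have "\<dots> = (if i = j then 1 else 0) + (Z i j + Z j i) + ZZ i j"
        using ij fin by (simp add: sum.distrib ZZ_def)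
      finally show "(\<Sum>k\<in>I. U k i * U k j) = (if i = j then 1 else 0)"
        using Zsum[OF ij] by simp
    qed
    show "congr I U K i j = 0" if ij: "i \<in> I" "j \<in> I" and ne: "\<alpha> i \<noteq> \<alpha> j" for i j
    proof -
      have "i \<noteq> j" using ne by auto
      have "congr I U K i j = (\<Sum>k\<in>I. \<Sum>l\<in>I. (if l = j then if k = i then K k l else 0 else 0)
          + (if l = j then Z k i * K k l else 0) + (if k = i then K k l * Z l j else 0) + Z k i * K k l * Z l j)"
        unfolding congr_def by (intro sum.cong refl) (auto simp: U_def algebra_simps)
      also have "\<dots> = K i j + (\<Sum>k\<in>I. Z k i * K k j) + (\<Sum>l\<in>I. K i l * Z l j) + ZKZ i j"
      proof -
        have "(\<Sum>k\<in>I. \<Sum>l\<in>I. if k = i then K k l * Z l j else 0) = (\<Sum>l\<in>I. K i l * Z l j)"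
          by (subst sum.swap) (use ij fin in simp)
        then show ?thesis using ij fin by (simp add: sum.distrib ZKZ_def)
      qed
      also have "(\<Sum>k\<in>I. Z k i * K k j) = ZL i j + Z j i * fps_const (\<alpha> j)"
      proof -
        have "(\<Sum>k\<in>I. Z k i * K k j) = (\<Sum>k\<in>I. Z k i * L k j + (if k = j then Z k i * fps_const (\<alpha> k) else 0))"
          by (intro sum.cong refl) (auto simp: KL algebra_simps)
        then show ?thesis using ij fin by (simp add: sum.distrib ZL_def)
      qed
      also have "(\<Sum>l\<in>I. K i l * Z l j) = LZ i j + fps_const (\<alpha> i) * Z i j"
      proof -
        have "(\<Sum>l\<in>I. K i l * Z l j) = (\<Sum>l\<in>I. L i l * Z l j + (if l = i then fps_const (\<alpha> l) * Z l j else 0))"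
          by (intro sum.cong refl) (auto simp: KL algebra_simps)
        then show ?thesis using ij fin by (simp add: sum.distrib LZ_def)
      qed
      also have "K i j = L i j" using \<open>i \<noteq> j\<close> by (simp add: KL)
      finally have c: "congr I U K i j = b i j + s i j * ZZ i j + Z j i * fps_const (\<alpha> j) + fps_const (\<alpha> i) * Z i j"
        by (simp add: b_def algebra_simps)
      have sh: "s i j = hf * (fps_const (\<alpha> i) + fps_const (\<alpha> j))"
        by (simp add: s_def hf_def)
      have "(fps_const (\<alpha> j) - fps_const (\<alpha> i)) * d i j = 1"
        using ne by (simp add: d_def \<delta>_def)
      then have e: "(fps_const (\<alpha> j) - fps_const (\<alpha> i)) * (d i j * b i j) = b i j"
        by (metis mult.assoc mult_1)
      have "Z j i * fps_const (\<alpha> j) + fps_const (\<alpha> i) * Z i j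
          = - ((fps_const (\<alpha> j) - fps_const (\<alpha> i)) * (d i j * b i j)) - s i j * ZZ i j"
        unfolding Z[OF ij] Z[OF ij(2,1)] b_sym[OF ij(2,1)] d_anti[of i j] ZZ_sym[of j i] sh
        by (simp add: algebra_simps del: fps_const_mult fps_const_add fps_const_sub)
      then have "congr I U K i j = (b i j + s i j * ZZ i j) + (- b i j - s i j * ZZ i j)"
        unfolding c e by (simp only: add.assoc)
      then show ?thesis by simp
    qed
  qed
qed

text \<open>Rellich's theorem: after subtraction of a scalar matrix and division by a power of the
  parameter the constant term is not scalar, so that the matrix splits into smaller blocks.\<close>

theorem analytic_symmetric_diagonalizable:
  fixes K :: "nat \<Rightarrow> nat \<Rightarrow> real fps"
  assumes "finite I" "\<And>i j. i \<in> I \<Longrightarrow> j \<in> I \<Longrightarrow> cvg (K i j)"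
    and "\<And>i j. i \<in> I \<Longrightarrow> j \<in> I \<Longrightarrow> K i j = K j i"
  shows "diagonalizable cvg I K"
  using assms
proof (induction "card I" arbitrary: I K rule: less_induct)
  case less
  note fin = less.prems(1) and cK = less.prems(2) and sym = less.prems(3)
  have sr: "subring_pred cvg" by (auto simp: subring_pred_def)
  show ?case
  proof (cases "\<exists>i0\<in>I. \<exists>i\<in>I. \<exists>j\<in>I. K i j \<noteq> (if i = j then K i0 i0 else 0)")
    case False
    then show ?thesis
      unfolding diagonalizable_def
      by (intro exI[of _ "\<lambda>i j. if i = j then 1 else 0"] conjI orth_id fin ballI impI)
         (auto simp: congr_id[OF fin])
  next
    case True
    then obtain i0 where i0: "i0 \<in> I" and nsc: "\<exists>i\<in>I. \<exists>j\<in>I. K i j \<noteq> (if i = j then K i0 i0 else 0)" by blast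
    define L where "L i j = K i j - (if i = j then K i0 i0 else 0)" for i j
    have cL: "cvg (L i j)" if "i \<in> I" "j \<in> I" for i j using cK that i0 by (auto simp: L_def)
    have symL: "L i j = L j i" if "i \<in> I" "j \<in> I" for i j using sym[OF that] by (auto simp: L_def)
    obtain i1 j1 where ij1: "i1 \<in> I" "j1 \<in> I" "L i1 j1 \<noteq> 0" using nsc by (auto simp: L_def)
    define P where "P m \<longleftrightarrow> (\<exists>i\<in>I. \<exists>j\<in>I. fps_nth (L i j) m \<noteq> 0)" for m
    have "\<exists>m. P m" using ij1 by (auto simp: P_def fps_eq_iff)
    define m where "m = (LEAST m. P m)"
    have Pm: "P m" unfolding m_def using \<open>\<exists>m. P m\<close> by (rule LeastI_ex)
    have m_min: "fps_nth (L i j) l = 0" if "l < m" "i \<in> I" "j \<in> I" for l i j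
      using not_less_Least[of l P] that by (auto simp: m_def P_def)
    define M where "M i j = fps_shift m (L i j)" for i j
    have LM: "L i j = fps_X ^ m * M i j" if "i \<in> I" "j \<in> I" for i j
      using m_min[OF _ that] by (intro fps_ext) (auto simp: M_def fps_X_power_mult_nth)
    have KM: "K i j = (if i = j then K i0 i0 else 0) + fps_X ^ m * M i j" if "i \<in> I" "j \<in> I" for i j
      using LM[OF that] by (simp add: L_def algebra_simps)
    have cM: "cvg (M i j)" if "i \<in> I" "j \<in> I" for i j using cL[OF that] by (auto simp: M_def)
    have symM: "M i j = M j i" if "i \<in> I" "j \<in> I" for i j using symL[OF that] by (simp add: M_def)
    define A where "A i j = fps_nth (M i j) 0" for i j
    \<comment> \<open>This diagonal entry vanishes while some other entry does not, so the symmetric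
      matrix \<open>A\<close> is not scalar and has two distinct eigenvalues. Both index sets of the
      splitting are therefore smaller than \<open>I\<close>.\<close>
    have A0: "A i0 i0 = 0" by (simp add: A_def M_def L_def)
    obtain i2 j2 where ij2: "i2 \<in> I" "j2 \<in> I" "A i2 j2 \<noteq> 0" using Pm by (auto simp: P_def A_def M_def)
    obtain Om where Om: "orth I Om" "\<And>i j. i \<in> I \<Longrightarrow> j \<in> I \<Longrightarrow> i \<noteq> j \<Longrightarrow> congr I Om A i j = 0"
      using real_symmetric_diagonalizable[OF fin, of A] symM by (auto simp: diagonalizable_def A_def)
    define \<alpha> where "\<alpha> i = congr I Om A i i" for i
    have "\<exists>j\<in>I. \<alpha> j \<noteq> \<alpha> i0"
    proof (rule ccontr)
      assume "\<not> ?thesis"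
      then have sc: "congr I Om A i j = (if i = j then \<alpha> i0 else 0)" if "i \<in> I" "j \<in> I" for i j
        using Om(2) that by (auto simp: \<alpha>_def)
      define T where "T i j = Om j i" for i j
      have OT: "(\<Sum>k\<in>I. Om i k * Om j k) = (if i = j then 1 else 0)" if "i \<in> I" "j \<in> I" for i j
        using orth_transpose[OF fin Om(1)] that by (auto simp: orth_def)
      have T: "T = (\<lambda>i j. Om j i)" by (simp add: T_def fun_eq_iff)
      have "A i j = (if i = j then \<alpha> i0 else 0)" if ij: "i \<in> I" "j \<in> I" for i j
      proof -
        have "congr I (compose I Om T) A i j = congr I T (congr I Om A) i j" by (simp add: congr_compose)
        also have "\<dots> = congr I T (\<lambda>k l. (if k = l then \<alpha> i0 else 0) + 0 * A k l) i j"
          by (intro congr_cong) (simp add: sc)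
        also have "\<dots> = (if i = j then \<alpha> i0 else 0)"
          using orth_transpose[OF fin Om(1)] ij by (subst congr_affine[OF fin]) (auto simp: T)
        also have "congr I (compose I Om T) A i j = (\<Sum>k\<in>I. if k = i then \<Sum>l\<in>I. if l = j then A k l else 0 else 0)"
          unfolding congr_def by (intro sum.cong refl) (auto simp: compose_def T_def OT ij intro!: sum.cong)
        also have "\<dots> = A i j" using ij fin by simp
        finally show ?thesis .
      qed
      then show False using A0 ij2 i0 by (metis (full_types))
    qed
    then obtain j0 where j0: "j0 \<in> I" "\<alpha> j0 \<noteq> \<alpha> i0" by blast
    define C where "C i j = fps_const (Om i j)" for i j
    have orthC: "orth I C"
    proof -
      have "(\<Sum>k\<in>I. C k i * C k j) = fps_const (\<Sum>k\<in>I. Om k i * Om k j)" for i j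
        by (intro fps_ext) (auto simp: C_def fps_sum_nth)
      then show ?thesis using Om(1) by (auto simp: orth_def)
    qed
    define N where "N = congr I C M"
    have cN: "cvg (N i j)" if "i \<in> I" "j \<in> I" for i j
      unfolding N_def congr_def C_def using cM by (intro cvg_sum cvg_mult) auto
    have symN: "N i j = N j i" for i j unfolding N_def by (rule congr_symmetric[OF symM])
    have N0: "fps_nth (N i j) 0 = (if i = j then \<alpha> i else 0)" if "i \<in> I" "j \<in> I" for i j
    proof -
      have "fps_nth (N i j) 0 = congr I Om A i j"
        by (simp add: N_def congr_def C_def A_def fps_sum_nth)
      then show ?thesis using Om(2) that by (auto simp: \<alpha>_def)
    qed
    obtain U where U: "\<And>i j. i \<in> I \<Longrightarrow> j \<in> I \<Longrightarrow> cvg (U i j)" "orth I U"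
      "\<And>i j. i \<in> I \<Longrightarrow> j \<in> I \<Longrightarrow> \<alpha> i \<noteq> \<alpha> j \<Longrightarrow> congr I U N i j = 0"
      using analytic_block_splitting[of I N \<alpha>, OF fin cN symN N0] by blast
    define R where "R = congr I U N"
    have cR: "cvg (R i j)" if "i \<in> I" "j \<in> I" for i j
      unfolding R_def congr_def using cN U(1) that by (intro cvg_sum cvg_mult) auto
    have symR: "R i j = R j i" for i j unfolding R_def by (rule congr_symmetric[OF symN])
    define J where "J = {i\<in>I. \<alpha> i = \<alpha> i0}"
    have J: "J \<subseteq> I" "i0 \<in> J" "j0 \<in> I - J" using i0 j0 by (auto simp: J_def)
    have card: "card J < card I" "card (I - J) < card I"
      using J fin by (auto intro!: psubset_card_mono)
    have "diagonalizable cvg I R"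
    proof (rule diagonalizable_blocks[OF fin J(1) sr])
      show "R i j = 0 \<and> R j i = 0" if "i \<in> J" "j \<in> I - J" for i j
        using that U(3) by (auto simp: R_def J_def)
      show "diagonalizable cvg J R"
        using J(1) fin card cR symR by (intro less.hyps) (auto intro: finite_subset simp: J_def)
      show "diagonalizable cvg (I - J) R"
        using fin card cR symR by (intro less.hyps) auto
    qed
    then have "diagonalizable cvg I N"
      unfolding R_def by (rule diagonalizable_congr[OF fin sr U(2), rotated]) (rule U(1))
    then have "diagonalizable cvg I M"
      unfolding N_def by (rule diagonalizable_congr[OF fin sr orthC, rotated]) (simp add: C_def)
    then show ?thesis by (rule diagonalizable_affine[OF fin]) (rule KM)
  qed
qed

section \<open>Leading coefficients of a graded eigenvalue equation\<close>

lemma fps_mult_nth_low: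
  fixes F G :: "real fps"
  assumes "\<And>u. u < t \<Longrightarrow> fps_nth G u = 0"
  shows "fps_nth (F * G) t = fps_nth F 0 * fps_nth G t"
proof -
  have "fps_nth (F * G) t = (\<Sum>u=0..t. fps_nth G u * fps_nth F (t - u))"
    by (subst mult.commute) (simp add: fps_mult_nth)
  also have "\<dots> = (\<Sum>u\<in>{t}. fps_nth G u * fps_nth F (t - u))"
    using assms by (intro sum.mono_neutral_right) auto
  finally show ?thesis by simp
qed

text \<open>The matrix has entries \<open>X ^ (E p + E q) * M p q\<close>; \<open>lam = 0\<close> is treated as an
  eigenvalue of infinite order. Substituting \<open>x p = X ^ E p * y p\<close> reduces the equation of row \<open>p\<close>
  to \<open>X ^ E p * (\<Sum>q. M p q * x q) = lam * y p\<close>.\<close>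

lemma graded_eigenvector:
  fixes M :: "nat \<Rightarrow> nat \<Rightarrow> real fps" and y :: "nat \<Rightarrow> real fps" and lam :: "real fps" and E :: "nat \<Rightarrow> nat"
  defines "a \<equiv> subdegree lam"
  defines "x \<equiv> \<lambda>q. fps_X ^ E q * y q"
  assumes fin: "finite I"
    and eq: "\<And>p. p \<in> I \<Longrightarrow> (\<Sum>q\<in>I. fps_X ^ (E p + E q) * M p q * y q) = lam * y p"
    and nonsing: "\<And>t p. (\<And>p. p \<in> I \<Longrightarrow> lam = 0 \<or> 2 * E p < a \<Longrightarrow>
        (\<Sum>q\<in>{q\<in>I. lam = 0 \<or> 2 * E q < a}. fps_nth (M p q) 0 * fps_nth (x q) t) = 0) \<Longrightarrow>
        p \<in> I \<Longrightarrow> lam = 0 \<or> 2 * E p < a \<Longrightarrow> fps_nth (x p) t = 0"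
  shows "\<And>p. p \<in> I \<Longrightarrow> lam = 0 \<or> 2 * E p \<noteq> a \<Longrightarrow> fps_nth (y p) 0 = 0"
    and "lam \<noteq> 0 \<Longrightarrow> \<exists>v.
      (\<forall>p\<in>I. 2 * E p < a \<longrightarrow> (\<Sum>q\<in>{q\<in>I. 2 * E q < a}. fps_nth (M p q) 0 * v q)
         + (\<Sum>q\<in>{q\<in>I. 2 * E q = a}. fps_nth (M p q) 0 * fps_nth (y q) 0) = 0) \<and>
      (\<forall>p\<in>I. 2 * E p = a \<longrightarrow> (\<Sum>q\<in>{q\<in>I. 2 * E q < a}. fps_nth (M p q) 0 * v q)
         + (\<Sum>q\<in>{q\<in>I. 2 * E q = a}. fps_nth (M p q) 0 * fps_nth (y q) 0) = fps_nth lam a * fps_nth (y p) 0)"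
proof -
  have row: "fps_X ^ E p * (\<Sum>q\<in>I. M p q * x q) = lam * y p" if "p \<in> I" for p
    unfolding eq[OF that, symmetric] sum_distrib_left x_def
    by (intro sum.cong refl) (simp add: power_add mult_ac)
  have row_nth: "fps_nth (\<Sum>q\<in>I. M p q * x q) t = fps_nth (lam * y p) (E p + t)" if "p \<in> I" for p t
    unfolding row[OF that, symmetric] by (simp add: fps_X_power_mult_nth)
  have lam_low: "fps_nth (lam * y p) m = 0" if "lam = 0 \<or> m < a" for p m
    using that by (auto simp: fps_mult_nth a_def intro!: sum.neutral nth_less_subdegree_zero)
  have x_nth: "fps_nth (x q) u = (if u < E q then 0 else fps_nth (y q) (u - E q))" for q u
    by (simp add: x_def fps_X_power_mult_nth)
  have low: "fps_nth (\<Sum>q\<in>I. M p q * x q) t = (\<Sum>q\<in>I. fps_nth (M p q) 0 * fps_nth (x q) t)"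
    if "\<And>q u. q \<in> I \<Longrightarrow> u < t \<Longrightarrow> fps_nth (x q) u = 0" for p t
    using that by (simp add: fps_sum_nth fps_mult_nth_low)
  \<comment> \<open>A row of the leading block meets on the right an order \<open>E p + t\<close>
    below \<open>a\<close>, and on the left, by induction, only coefficients of order
    \<open>t\<close>. Indices outside of the block have \<open>E q > t\<close>, where
    \<open>x q\<close> has not started yet. So the coefficients of order \<open>t\<close> form a
    kernel vector of the leading block.\<close>
  have x0: "fps_nth (x q) t = 0" if "q \<in> I" "lam = 0 \<or> 2 * t < a" for q t
    using that
  proof (induction t arbitrary: q rule: less_induct)
    case (less t)
    have out: "fps_nth (x q) t = 0" if "q \<in> I" "\<not> (lam = 0 \<or> 2 * E q < a)" for q
      using that less.prems(2) by (auto simp: x_nth)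
    have "(\<Sum>q\<in>{q\<in>I. lam = 0 \<or> 2 * E q < a}. fps_nth (M p q) 0 * fps_nth (x q) t) = 0"
      if p: "p \<in> I" "lam = 0 \<or> 2 * E p < a" for p
    proof -
      have "(\<Sum>q\<in>{q\<in>I. lam = 0 \<or> 2 * E q < a}. fps_nth (M p q) 0 * fps_nth (x q) t)
          = (\<Sum>q\<in>I. fps_nth (M p q) 0 * fps_nth (x q) t)"
        using out fin by (intro sum.mono_neutral_left) auto
      also have "\<dots> = fps_nth (\<Sum>q\<in>I. M p q * x q) t"
        using less by (intro low[symmetric]) auto
      also have "\<dots> = 0"
        unfolding row_nth[OF p(1)] using p(2) less.prems(2) by (intro lam_low) auto
      finally show ?thesis .
    qed
    then show ?case using nonsing[of t q] out less.prems(1) by blast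
  qed
  show y0: "fps_nth (y p) 0 = 0" if p: "p \<in> I" "lam = 0 \<or> 2 * E p \<noteq> a" for p
  proof (cases "lam = 0 \<or> 2 * E p < a")
    case True
    then show ?thesis using x0[OF p(1), of "E p"] by (simp add: x_nth)
  next
    case False
    \<comment> \<open>The order of \<open>lam\<close> is too small for row \<open>p\<close>: at
      order \<open>a\<close> the left side has either not started or involves only coefficients of
      \<open>x\<close> of order below half of \<open>a\<close>, which vanish.\<close>
    then have "a < 2 * E p" "lam \<noteq> 0" using p by auto
    have "fps_nth lam a * fps_nth (y p) 0 = fps_nth (lam * y p) a"
      by (subst mult.commute, subst (2) mult.commute) (auto simp: a_def intro!: fps_mult_nth_low[symmetric])
    also have "\<dots> = 0"
    proof (cases "a < E p")
      case True
      then show ?thesis by (simp add: row[OF p(1), symmetric] fps_X_power_mult_nth)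
    next
      case False
      then have "fps_nth (lam * y p) a = fps_nth (\<Sum>q\<in>I. M p q * x q) (a - E p)"
        by (subst row_nth[OF p(1)]) simp
      also have "\<dots> = 0"
      proof -
        have l: "2 * u < a" if "u \<le> a - E p" for u
          using that \<open>a < 2 * E p\<close> False by linarith
        then have z: "fps_nth (x q) u = 0" if "q \<in> I" "u \<le> a - E p" for q u
          using that x0 by blast
        have "fps_nth (\<Sum>q\<in>I. M p q * x q) (a - E p) = (\<Sum>q\<in>I. fps_nth (M p q) 0 * fps_nth (x q) (a - E p))"
          by (rule low) (simp add: z)
        then show ?thesis by (simp add: z)
      qed
      finally show ?thesis .
    qed
    finally show ?thesis using \<open>lam \<noteq> 0\<close> by (simp add: a_def)
  qed
  assume lam: "lam \<noteq> 0"
  show "\<exists>v.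
      (\<forall>p\<in>I. 2 * E p < a \<longrightarrow> (\<Sum>q\<in>{q\<in>I. 2 * E q < a}. fps_nth (M p q) 0 * v q)
         + (\<Sum>q\<in>{q\<in>I. 2 * E q = a}. fps_nth (M p q) 0 * fps_nth (y q) 0) = 0) \<and>
      (\<forall>p\<in>I. 2 * E p = a \<longrightarrow> (\<Sum>q\<in>{q\<in>I. 2 * E q < a}. fps_nth (M p q) 0 * v q)
         + (\<Sum>q\<in>{q\<in>I. 2 * E q = a}. fps_nth (M p q) 0 * fps_nth (y q) 0) = fps_nth lam a * fps_nth (y p) 0)"
  \<comment> \<open>For odd \<open>a\<close> no index satisfies \<open>2 * E p = a\<close>. For
    \<open>a = 2 * e\<close> the vector \<open>v\<close> consists of the coefficients of
    \<open>x\<close> of order \<open>e\<close>; on the block with \<open>E q = e\<close> these are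
    the constant coefficients of \<open>y\<close>.\<close>
  proof (cases "even a")
    case False
    then have "2 * E p \<noteq> a" for p by auto
    then show ?thesis by (intro exI[of _ "\<lambda>_. 0"]) auto
  next
    case True
    then obtain e where e: "a = 2 * e" by (elim evenE)
    have split: "(\<Sum>q\<in>{q\<in>I. 2 * E q < a}. fps_nth (M p q) 0 * fps_nth (x q) e)
         + (\<Sum>q\<in>{q\<in>I. 2 * E q = a}. fps_nth (M p q) 0 * fps_nth (y q) 0)
         = fps_nth (lam * y p) (E p + e)" if "p \<in> I" for p
    proof -
      have "(\<Sum>q\<in>{q\<in>I. 2 * E q = a}. fps_nth (M p q) 0 * fps_nth (y q) 0)
          = (\<Sum>q\<in>{q\<in>I. 2 * E q = a}. fps_nth (M p q) 0 * fps_nth (x q) e)"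
        by (intro sum.cong refl) (auto simp: x_nth e)
      then have "(\<Sum>q\<in>{q\<in>I. 2 * E q < a}. fps_nth (M p q) 0 * fps_nth (x q) e)
         + (\<Sum>q\<in>{q\<in>I. 2 * E q = a}. fps_nth (M p q) 0 * fps_nth (y q) 0)
         = (\<Sum>q\<in>{q\<in>I. 2 * E q < a} \<union> {q\<in>I. 2 * E q = a}. fps_nth (M p q) 0 * fps_nth (x q) e)"
        using fin by (subst sum.union_disjoint) auto
      also have "\<dots> = (\<Sum>q\<in>I. fps_nth (M p q) 0 * fps_nth (x q) e)"
        using fin by (intro sum.mono_neutral_left) (auto simp: x_nth e)
      also have "\<dots> = fps_nth (lam * y p) (E p + e)"
        unfolding row_nth[OF that, symmetric] using x0 by (subst low) (auto simp: e)
      finally show ?thesis .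
    qed
    have "fps_nth (lam * y p) a = fps_nth lam a * fps_nth (y p) 0" for p
      by (subst mult.commute, subst (2) mult.commute) (auto simp: a_def intro!: fps_mult_nth_low)
    then show ?thesis
      using split lam_low by (intro exI[of _ "\<lambda>q. fps_nth (x q) e"]) (auto simp: e mult_2[symmetric])
  qed
qed

section \<open>Power series expansions of real functions\<close>

lemma has_fps_expansion_divide_power:
  fixes f :: "real \<Rightarrow> real"
  assumes f: "f has_fps_expansion F" and low: "\<And>m. m < N \<Longrightarrow> fps_nth F m = 0"
  shows "(\<lambda>t. if t = 0 then fps_nth F N else f t / t ^ N) has_fps_expansion (fps_shift N F)"
proof (cases "F = 0")
  case True
  then have "eventually (\<lambda>z. eval_fps 0 z = f z) (nhds 0)" using f by (simp add: has_fps_expansion_def)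
  then have "eventually (\<lambda>z. eval_fps 0 z = (if z = 0 then fps_nth F N else f z / z ^ N)) (nhds 0)"
    by eventually_elim (simp add: True)
  then show ?thesis by (simp add: has_fps_expansion_def True)
next
  case False
  then have "N \<le> subdegree F" using low by (intro subdegree_geI) auto
  then show ?thesis using f by (intro has_fps_expansion_shift) auto
qed

lemma leading_coeff_limit:
  fixes f :: "real \<Rightarrow> real"
  assumes f: "f has_fps_expansion F" and low: "\<And>m. m < N \<Longrightarrow> fps_nth F m = 0"
  shows "((\<lambda>t. f t / t ^ N) \<longlongrightarrow> fps_nth F N) (at_right 0)"
proof -
  have "(\<lambda>t. if t = 0 then fps_nth F N else f t / t ^ N) has_fps_expansion (fps_shift N F)"
    by (rule has_fps_expansion_divide_power[OF f low])
  then have "continuous (at 0) (\<lambda>t. if t = 0 then fps_nth F N else f t / t ^ N)"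
    by (rule has_fps_expansion_imp_continuous)
  then have "((\<lambda>t. if t = 0 then fps_nth F N else f t / t ^ N) \<longlongrightarrow> fps_nth F N) (at 0)"
    by (simp add: isCont_def)
  then have "((\<lambda>t. if t = 0 then fps_nth F N else f t / t ^ N) \<longlongrightarrow> fps_nth F N) (at_right 0)"
    by (rule tendsto_mono[rotated]) (simp add: at_le)
  moreover have "eventually (\<lambda>t. (if t = 0 then fps_nth F N else f t / t ^ N) = f t / t ^ N) (at_right (0::real))"
    by (auto simp: eventually_at_right_field intro: exI[of _ 1])
  ultimately show ?thesis by (rule Lim_transform_eventually)
qed

text \<open>This is how positivity reaches the leading forms: a quadratic form of the kernel is
  nonnegative for small positive parameters, hence so is its lowest coefficient.\<close>

lemma leading_coeff_nonneg:
  fixes f :: "real \<Rightarrow> real"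
  assumes f: "f has_fps_expansion F" and low: "\<And>m. m < N \<Longrightarrow> fps_nth F m = 0"
    and nn: "eventually (\<lambda>t. 0 \<le> f t) (at_right 0)"
  shows "0 \<le> fps_nth F N"
proof (rule tendsto_lowerbound[OF leading_coeff_limit[OF f low]])
  show "eventually (\<lambda>t. 0 \<le> f t / t ^ N) (at_right 0)"
    using nn eventually_at_right_less[of 0] by eventually_elim auto
qed auto

text \<open>By induction the lowest coefficient and its negative are both nonnegative, so
  information on one side of 0 is enough.\<close>

lemma fps_expansion_zero_right:
  fixes f :: "real \<Rightarrow> real"
  assumes f: "f has_fps_expansion F" and z: "eventually (\<lambda>t. f t = 0) (at_right 0)"
  shows "F = 0"
proof -
  have "fps_nth F N = 0" for N
  proof (induction N rule: less_induct)
    case (less N)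
    have "0 \<le> fps_nth F N"
      by (rule leading_coeff_nonneg[OF f less]) (use z in \<open>auto elim: eventually_mono\<close>)
    moreover have "0 \<le> fps_nth (- F) N"
      by (rule leading_coeff_nonneg[OF has_fps_expansion_minus[OF f]])
         (use z less in \<open>auto elim: eventually_mono\<close>)
    ultimately show ?case by simp
  qed
  then show ?thesis by (intro fps_ext) simp
qed

lemma fps_expansion_unique:
  fixes f g :: "real \<Rightarrow> real"
  assumes "f has_fps_expansion F" "g has_fps_expansion G" "eventually (\<lambda>t. f t = g t) (nhds 0)"
  shows "F = G"
proof -
  have "(\<lambda>t. f t - g t) has_fps_expansion F - G" by (intro has_fps_expansion_diff assms)
  moreover have "eventually (\<lambda>t. f t - g t = 0) (at_right 0)"
    using filter_leD[OF at_within_le_nhds assms(3)] by (auto elim: eventually_mono)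
  ultimately show ?thesis using fps_expansion_zero_right by fastforce
qed

lemma fps_expansion_eventually_eq:
  fixes f g :: "real \<Rightarrow> real"
  assumes "f has_fps_expansion F" "g has_fps_expansion F"
  shows "eventually (\<lambda>t. f t = g t) (nhds 0)"
  using assms unfolding has_fps_expansion_def by (auto elim: eventually_elim2)

lemma has_fps_expansion_imp_cvg: "f has_fps_expansion F \<Longrightarrow> cvg F"
  by (simp add: has_fps_expansion_def cvg_def)

lemma has_fps_expansion_at_0: "(f :: real \<Rightarrow> real) has_fps_expansion F \<Longrightarrow> f 0 = fps_nth F 0"
  using eventually_nhds_x_imp_x[of "\<lambda>z. eval_fps F z = f z" 0]
  by (auto simp: has_fps_expansion_def eval_fps_at_0)

lemma has_fps_expansion_scale:
  fixes f :: "real \<Rightarrow> real"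
  assumes f: "f has_fps_expansion F"
  shows "(\<lambda>t. f (c * t)) has_fps_expansion Abs_fps (\<lambda>m. fps_nth F m * c ^ m)"
proof -
  let ?G = "Abs_fps (\<lambda>m. fps_nth F m * c ^ m)"
  obtain \<rho> C where \<rho>: "0 < \<rho>" "l1_bounded \<rho> C F"
    using cvg_imp_l1_bounded has_fps_expansion_imp_cvg[OF f] by blast
  define \<sigma> where "\<sigma> = \<rho> / (1 + \<bar>c\<bar>)"
  have \<sigma>: "0 < \<sigma>" "\<bar>c\<bar> * \<sigma> \<le> \<rho>"
    using \<rho>(1) by (auto simp: \<sigma>_def field_simps)
  have "l1_bounded (\<bar>c\<bar> * \<sigma>) C F"
    using \<sigma> \<rho> by (intro l1_bounded_shrink[OF _ _ \<rho>(2)]) auto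
  then have "l1_bounded \<sigma> C ?G"
    unfolding l1_bounded_def by (simp add: abs_mult power_mult_distrib power_abs mult_ac)
  then have "fps_conv_radius ?G > 0"
    using l1_bounded_imp_cvg[OF \<sigma>(1)] by (simp add: cvg_def)
  moreover have "eventually (\<lambda>t. eval_fps ?G t = f (c * t)) (nhds 0)"
  proof -
    have lim: "((\<lambda>t. c * t) \<longlongrightarrow> 0) (nhds 0)"
      by (rule tendsto_eq_intros refl filterlim_ident | simp)+
    have "eventually (\<lambda>z. eval_fps F z = f z) (nhds 0)" using f by (simp add: has_fps_expansion_def)
    from eventually_compose_filterlim[OF this lim]
    have "eventually (\<lambda>t. eval_fps F (c * t) = f (c * t)) (nhds 0)" .
    then show ?thesis by eventually_elim (simp add: eval_fps_def power_mult_distrib mult_ac)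
  qed
  ultimately show ?thesis by (simp add: has_fps_expansion_def)
qed

text \<open>Composition is available for complex functions only; real parts of the complex expansion
  give the real one.\<close>

lemma has_fps_expansion_powr_quadratic:
  fixes a A B :: real
  shows "(\<lambda>t. (1 + (A * t + B * t\<^sup>2)) powr a) has_fps_expansion
    Abs_fps (\<lambda>m. \<Sum>i\<le>m. (a gchoose i) * (real (i choose (m - i)) * A ^ (2 * i - m) * B ^ (m - i)))"
proof -
  let ?F = "Abs_fps (\<lambda>m. \<Sum>i\<le>m. (a gchoose i) * (real (i choose (m - i)) * A ^ (2 * i - m) * B ^ (m - i)))"
  define U where "U = fps_const (of_real A) * fps_X + fps_const (of_real B) * (fps_X :: complex fps) ^ 2"
  have U0: "fps_nth U 0 = 0" by (simp add: U_def power2_eq_square)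
  have hu: "(\<lambda>z::complex. of_real A * z + of_real B * z\<^sup>2) has_fps_expansion U"
    unfolding U_def by (intro fps_expansion_intros)
  have hc: "(\<lambda>z::complex. (1 + z) powr (of_real a)) has_fps_expansion fps_binomial (of_real a)"
    by (rule has_fps_expansion_binomial_complex)
  have comp: "(\<lambda>z::complex. (1 + (of_real A * z + of_real B * z\<^sup>2)) powr (of_real a))
      has_fps_expansion fps_compose (fps_binomial (of_real a)) U"
    using has_fps_expansion_compose[OF hc hu U0] by (simp add: o_def)
  have gb: "(of_real a gchoose i :: complex) = of_real (a gchoose i)" for i
    by (simp add: gbinomial_prod_rev)
  \<comment> \<open>\<open>U\<close> is X times (A + B X), so its powers are binomial expansions.
    For \<open>m - i > i\<close> the binomial coefficient is 0 and the truncated exponent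
    \<open>2 * i - m\<close> does no harm.\<close>
  have Upow: "fps_nth (U ^ i) m = of_real (real (i choose (m - i)) * A ^ (2 * i - m) * B ^ (m - i))" if "i \<le> m" for i m
  proof -
    have "U = fps_X * (fps_const (of_real B) * fps_X + fps_const (of_real A))"
      by (simp add: U_def algebra_simps power2_eq_square)
    then have "U ^ i = fps_X ^ i * (\<Sum>k\<le>i. of_nat (i choose k) * (fps_const (of_real B) * fps_X) ^ k * fps_const (of_real A) ^ (i - k))"
      by (simp add: power_mult_distrib binomial_ring)
    then have "fps_nth (U ^ i) m = fps_nth (\<Sum>k\<le>i. of_nat (i choose k) * (fps_const (of_real B) * fps_X) ^ k * fps_const (of_real A) ^ (i - k)) (m - i)"
      using that by (simp add: fps_X_power_mult_nth)
    also have "\<dots> = (\<Sum>k\<le>i. if k = m - i then of_real (real (i choose (m - i)) * A ^ (2 * i - m) * B ^ (m - i)) else 0)"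
      unfolding fps_sum_nth
    proof (intro sum.cong refl)
      fix k assume "k \<in> {..i}"
      have "of_nat (i choose k) * (fps_const (of_real B) * fps_X) ^ k * fps_const (of_real A) ^ (i - k)
          = fps_const (of_nat (i choose k) * of_real B ^ k * of_real A ^ (i - k)) * (fps_X :: complex fps) ^ k"
      proof -
        have "(of_nat (i choose k) :: complex fps) = fps_const (of_nat (i choose k))" by (simp add: fps_of_nat)
        then show ?thesis
          unfolding power_mult_distrib fps_const_power by (simp only: fps_const_mult[symmetric] mult_ac)
      qed
      then have "fps_nth (of_nat (i choose k) * (fps_const (of_real B) * fps_X) ^ k * fps_const (of_real A) ^ (i - k)) (m - i)
          = (if k = m - i then of_nat (i choose k) * of_real B ^ k * of_real A ^ (i - k) else (0::complex))"
        by (simp add: fps_X_power_nth)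
      then show "fps_nth (of_nat (i choose k) * (fps_const (of_real B) * fps_X) ^ k * fps_const (of_real A) ^ (i - k)) (m - i)
          = (if k = m - i then of_real (real (i choose (m - i)) * A ^ (2 * i - m) * B ^ (m - i)) else (0::complex))"
        using that \<open>k \<in> {..i}\<close> by (auto simp: mult_2 intro!: arg_cong[of _ _ "\<lambda>x. _ * x"])
    qed
    also have "\<dots> = of_real (real (i choose (m - i)) * A ^ (2 * i - m) * B ^ (m - i))"
      by (cases "m - i \<le> i") (auto simp: binomial_eq_0)
    finally show ?thesis .
  qed
  have nth: "fps_nth (fps_compose (fps_binomial (of_real a)) U) m = of_real (fps_nth ?F m)" for m
  proof -
    have "fps_nth (fps_compose (fps_binomial (of_real a)) U) m
        = (\<Sum>i\<le>m. of_real ((a gchoose i) * (real (i choose (m - i)) * A ^ (2 * i - m) * B ^ (m - i))))"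
      unfolding fps_compose_nth atLeast0AtMost by (intro sum.cong refl) (simp add: Upow gb)
    then show ?thesis by simp
  qed
  let ?H = "fps_compose (fps_binomial (of_real a :: complex)) U"
  have "conv_radius (\<lambda>m. norm (fps_nth ?H m)) = conv_radius (\<lambda>m. norm (fps_nth ?F m))"
    by (simp only: nth norm_of_real real_norm_def)
  then have "conv_radius (fps_nth ?H) = conv_radius (fps_nth ?F)"
    by (simp only: conv_radius_norm)
  then have rad: "fps_conv_radius ?F = fps_conv_radius ?H" by (simp add: fps_conv_radius_def)
  have pos: "fps_conv_radius ?H > 0" using comp by (simp add: has_fps_expansion_def)
  have "eventually (\<lambda>t::real. eval_fps ?F t = (1 + (A * t + B * t\<^sup>2)) powr a) (nhds 0)"
  proof -
    have lim: "((\<lambda>t. complex_of_real t) \<longlongrightarrow> 0) (nhds 0)"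
      by (rule tendsto_eq_intros refl filterlim_ident | simp)+
    have "eventually (\<lambda>z. eval_fps ?H z = (1 + (of_real A * z + of_real B * z\<^sup>2)) powr (of_real a)) (nhds 0)"
      using comp by (simp add: has_fps_expansion_def)
    from eventually_compose_filterlim[OF this lim]
    have "eventually (\<lambda>t. eval_fps ?H (complex_of_real t)
        = (1 + (of_real A * of_real t + of_real B * (of_real t)\<^sup>2)) powr (of_real a)) (nhds 0)" .
    moreover have "((\<lambda>t. 1 + (A * t + B * t\<^sup>2)) \<longlongrightarrow> 1) (nhds 0)"
      by (rule tendsto_eq_intros refl filterlim_ident | simp)+
    then have "eventually (\<lambda>t. 1 + (A * t + B * t\<^sup>2) > 0) (nhds 0)"
      by (rule order_tendstoD(1)) simp
    moreover have "eventually (\<lambda>t. t \<in> eball 0 (fps_conv_radius ?F)) (nhds (0::real))"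
      using pos rad by (intro eventually_nhds_in_open) (auto simp: zero_ereal_def)
    ultimately show ?thesis
    proof eventually_elim
      case (elim t)
      have s: "summable (\<lambda>m. fps_nth ?F m * t ^ m)" using elim(3) by (intro summable_fps) simp
      have "complex_of_real (eval_fps ?F t) = (\<Sum>m. of_real (fps_nth ?F m * t ^ m))"
        unfolding eval_fps_def using s by (rule suminf_of_real)
      also have "\<dots> = eval_fps ?H (of_real t)"
        unfolding eval_fps_def nth by simp
      also have "\<dots> = of_real ((1 + (A * t + B * t\<^sup>2)) powr a)"
        using elim(1,2) powr_of_real[of "1 + (A * t + B * t\<^sup>2)" a] by simp
      finally show ?case by (simp only: of_real_eq_iff)
    qed
  qed
  then show ?thesis using pos rad by (simp add: has_fps_expansion_def)
qed

section \<open>Finitely supported functionals\<close>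

text \<open>A list of weighted points represents the functional \<open>f \<mapsto> \<Sum>c f(x)\<close>.\<close>

definition app :: "(real \<times> 'p) list \<Rightarrow> ('p \<Rightarrow> real) \<Rightarrow> real" where
  "app L f = (\<Sum>(c, x)\<leftarrow>L. c * f x)"

definition scale_weights :: "real \<Rightarrow> (real \<times> 'p) list \<Rightarrow> (real \<times> 'p) list" where
  "scale_weights t L = map (\<lambda>(c, x). (t * c, x)) L"

definition reweigh :: "('p \<Rightarrow> real) \<Rightarrow> (real \<times> 'p) list \<Rightarrow> (real \<times> 'p) list" where
  "reweigh w L = map (\<lambda>(c, x). (c * w x, x)) L"

definition move_points :: "('p \<Rightarrow> 'q) \<Rightarrow> (real \<times> 'p) list \<Rightarrow> (real \<times> 'q) list" where
  "move_points g L = map (\<lambda>(c, x). (c, g x)) L"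

lemma app_Nil [simp]: "app [] f = 0" and app_Cons [simp]: "app (p # L) f = fst p * f (snd p) + app L f"
  by (auto simp: app_def case_prod_beta)

lemma app_append [simp]: "app (L @ M) f = app L f + app M f"
  by (induction L) auto

lemma app_scale_weights [simp]: "app (scale_weights t L) f = t * app L f"
  by (induction L) (auto simp: scale_weights_def algebra_simps)

lemma app_reweigh [simp]: "app (reweigh w L) f = app L (\<lambda>x. w x * f x)"
  by (induction L) (auto simp: reweigh_def algebra_simps)

lemma app_move_points [simp]: "app (move_points g L) f = app L (\<lambda>x. f (g x))"
  by (induction L) (auto simp: move_points_def)

lemma app_concat_map: "app (concat (map g is)) f = (\<Sum>i\<leftarrow>is. app (g i) f)"
  by (induction "is") auto

lemma app_cong: "(\<And>x. x \<in> snd ` set L \<Longrightarrow> f x = g x) \<Longrightarrow> app L f = app L g"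
  by (induction L) auto

lemma app_zero: "(\<And>x. x \<in> snd ` set L \<Longrightarrow> f x = 0) \<Longrightarrow> app L f = 0"
  by (induction L) auto

lemma app_cmult: "app L (\<lambda>x. c * f x) = c * app L f"
  by (induction L) (auto simp: algebra_simps)

lemma app_cmult_right: "app L (\<lambda>x. f x * c) = app L f * c"
  by (induction L) (auto simp: algebra_simps)

lemma app_add: "app L (\<lambda>x. f x + g x) = app L f + app L g"
  by (induction L) (auto simp: algebra_simps)

lemma app_sum: "app L (\<lambda>x. \<Sum>i\<in>I. f i x) = (\<Sum>i\<in>I. app L (f i))"
  by (induction L) (auto simp: sum.distrib sum_distrib_left)

lemma app_swap: "app L (\<lambda>x. app M (\<lambda>y. g x y)) = app M (\<lambda>y. app L (\<lambda>x. g x y))"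
  by (induction L) (auto simp: app_add app_cmult app_zero)

lemma app_has_fps_expansion:
  assumes "\<And>x. x \<in> snd ` set L \<Longrightarrow> (f x) has_fps_expansion F x"
  shows "(\<lambda>t. app L (\<lambda>x. f x t)) has_fps_expansion Abs_fps (\<lambda>m. app L (\<lambda>x. fps_nth (F x) m))"
  using assms
proof (induction L)
  case Nil
  have "Abs_fps (\<lambda>m. 0) = (0 :: real fps)" by (intro fps_ext) simp
  then show ?case by simp
next
  case (Cons p L)
  have "Abs_fps (\<lambda>m. app (p # L) (\<lambda>x. fps_nth (F x) m))
      = fps_const (fst p) * F (snd p) + Abs_fps (\<lambda>m. app L (\<lambda>x. fps_nth (F x) m))"
    by (intro fps_ext) simp
  moreover have "(\<lambda>t. fst p * f (snd p) t + app L (\<lambda>x. f x t)) has_fps_expansion \<dots>"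
    using Cons by (intro has_fps_expansion_add has_fps_expansion_cmult_left) auto
  ultimately show ?case by simp
qed

definition weight :: "(real \<times> 'p) list \<Rightarrow> 'p \<Rightarrow> real" where
  "weight L z = app L (\<lambda>x. if x = z then 1 else 0)"

lemma app_weight:
  assumes "finite S" "snd ` set L \<subseteq> S"
  shows "app L f = (\<Sum>z\<in>S. weight L z * f z)"
proof -
  have "app L f = app L (\<lambda>x. \<Sum>z\<in>S. (if x = z then 1 else 0) * f z)"
  proof (rule app_cong)
    fix x assume "x \<in> snd ` set L"
    have "(\<Sum>z\<in>S. (if x = z then 1 else 0) * f z) = (\<Sum>z\<in>S. if x = z then f z else 0)"
      by (rule sum.cong) simp_all
    then show "f x = (\<Sum>z\<in>S. (if x = z then 1 else 0) * f z)"
      using assms \<open>x \<in> snd ` set L\<close> by auto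
  qed
  then show ?thesis by (simp add: app_sum weight_def app_cmult_right)
qed

lemma app_remove_point:
  "app L f = app (filter (\<lambda>p. snd p \<noteq> z) L) f + weight L z * f z"
  by (induction L) (auto simp: weight_def algebra_simps)

text \<open>A list may repeat points, whereas kernel matrices are positive definite at distinct
  points. Collecting the weights of each point repairs this; since all of them may cancel, only
  semidefiniteness is left.\<close>

lemma positive_definite_kernel_app:
  assumes "positive_definite_kernel k"
  shows "0 \<le> app L (\<lambda>x. app L (\<lambda>y. k x y))"
proof -
  define S where "S = snd ` set L"
  have S: "finite S" "snd ` set L \<subseteq> S" by (auto simp: S_def)
  define n where "n = card S"
  obtain x where x: "bij_betw x {..<n} S"
    using ex_bij_betw_nat_finite[OF S(1)] by (auto simp: n_def atLeast0LessThan)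
  define M where "M = mat n n (\<lambda>(i, j). k (x i) (x j))"
  define v where "v = vec n (\<lambda>i. weight L (x i))"
  have pd: "positive_definite_mat n M"
    using assms x unfolding positive_definite_kernel_def M_def bij_betw_def by blast
  have "0 \<le> v \<bullet> (M *\<^sub>v v)"
  proof (cases "v = 0\<^sub>v n")
    case True
    then show ?thesis by (simp add: M_def scalar_prod_def)
  next
    case False
    then show ?thesis using pd unfolding positive_definite_mat_def by (auto simp: v_def less_imp_le)
  qed
  also have "v \<bullet> (M *\<^sub>v v) = (\<Sum>i<n. weight L (x i) * (\<Sum>j<n. weight L (x j) * k (x i) (x j)))"
    by (simp add: v_def M_def scalar_prod_def atLeast0LessThan mult.commute)
  also have "\<dots> = (\<Sum>y\<in>S. weight L y * (\<Sum>z\<in>S. weight L z * k y z))"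
    using sum.reindex_bij_betw[OF x, of "\<lambda>y. weight L y * (\<Sum>j<n. weight L (x j) * k y (x j))"]
      sum.reindex_bij_betw[OF x, of "\<lambda>z. weight L z * k y z" for y] by simp
  also have "\<dots> = app L (\<lambda>x. app L (\<lambda>y. k x y))"
    by (simp add: app_weight[OF S])
  finally show ?thesis .
qed

section \<open>Interpolation and moments\<close>

lemma lagrange_interpolation:
  fixes T :: "real set"
  assumes fin: "finite T"
  obtains lg where "\<And>p. Polynomial.degree p < card T \<Longrightarrow> p = (\<Sum>t\<in>T. Polynomial.smult (poly p t) (lg t))"
proof -
  define lg where "lg t = (\<Prod>u\<in>T - {t}. Polynomial.smult (1 / (t - u)) [:- u, 1:])" for t
  have val: "poly (lg t) s = (if s = t then 1 else 0)" if "s \<in> T" "t \<in> T" for s t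
  proof (cases "s = t")
    case True
    have "poly (Polynomial.smult (1 / (t - u)) [:- u, 1:]) t = 1" if "u \<in> T - {t}" for u
    proof -
      have "t - u \<noteq> 0" using that by auto
      then show ?thesis by (simp add: divide_simps)
    qed
    then show ?thesis unfolding lg_def poly_prod True by (simp add: prod.neutral)
  next
    case False
    then show ?thesis using that fin by (auto simp: lg_def poly_prod intro!: prod_zero bexI[of _ s])
  qed
  have deg: "Polynomial.degree (lg t) < card T" if "t \<in> T" for t
  proof -
    have "Polynomial.degree (lg t) \<le> sum (Polynomial.degree \<circ> (\<lambda>u. Polynomial.smult (1 / (t - u)) [:- u, 1:])) (T - {t})"
      unfolding lg_def by (rule degree_prod_sum_le) (use fin in auto)
    also have "\<dots> \<le> (\<Sum>u\<in>T - {t}. 1)" by (intro sum_mono) auto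
    also have "\<dots> < card T"
    proof -
      have "0 < card T" using fin that card_gt_0_iff by blast
      then show ?thesis using fin that by simp
    qed
    finally show ?thesis .
  qed
  show ?thesis
  proof (rule that[of lg])
    fix p :: "real poly" assume p: "Polynomial.degree p < card T"
    define q where "q = p - (\<Sum>t\<in>T. Polynomial.smult (poly p t) (lg t))"
    have "poly q s = 0" if "s \<in> T" for s
    proof -
      have "(\<Sum>t\<in>T. poly p t * poly (lg t) s) = (\<Sum>t\<in>T. if t = s then poly p t else 0)"
        using that by (intro sum.cong refl) (auto simp: val)
      then show ?thesis using that fin by (simp add: q_def poly_sum)
    qed
    moreover have "Polynomial.degree q < card T"
      unfolding q_def using p deg fin
      by (intro degree_diff_less degree_sum_less) (auto intro: le_less_trans[OF degree_smult_le] le_less_trans[OF le0])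
    ultimately have "q = 0"
    proof (intro ccontr[of "q = 0"])
      assume q: "q \<noteq> 0" and "\<And>s. s \<in> T \<Longrightarrow> poly q s = 0" and d: "Polynomial.degree q < card T"
      then have "T \<subseteq> {x. poly q x = 0}" by blast
      then have "card T \<le> card {x. poly q x = 0}" using q poly_roots_finite by (intro card_mono)
      then show False using card_poly_roots_bound[OF q] d by simp
    qed
    then show "p = (\<Sum>t\<in>T. Polynomial.smult (poly p t) (lg t))" by (simp add: q_def)
  qed
qed

text \<open>\<open>w i t\<close> is the coefficient of degree \<open>i\<close> of the Lagrange basis
  polynomial of the node \<open>t\<close>: the sums read off the coefficients of a polynomial of
  degree at most \<open>N\<close> from its values at 0, ..., N.\<close>

lemma coefficient_functional:
  obtains w :: "nat \<Rightarrow> nat \<Rightarrow> real"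
  where "\<And>i m. m \<le> N \<Longrightarrow> (\<Sum>t\<le>N. w i t * real t ^ m) = (if m = i then 1 else 0)"
proof -
  have c: "card (real ` {..N}) = Suc N" by (subst card_image) auto
  obtain lg where l: "\<And>p. Polynomial.degree p < Suc N \<Longrightarrow> p = (\<Sum>t\<in>real ` {..N}. Polynomial.smult (poly p t) (lg t))"
    using lagrange_interpolation[of "real ` {..N}"] c by auto
  have "(\<Sum>t\<le>N. Polynomial.coeff (lg (real t)) i * real t ^ m) = (if m = i then 1 else 0)" if "m \<le> N" for i m
  proof -
    have "Polynomial.coeff (Polynomial.monom 1 m) i = Polynomial.coeff (\<Sum>t\<in>real ` {..N}. Polynomial.smult (poly (Polynomial.monom 1 m) t) (lg t)) i"
      using l[of "Polynomial.monom 1 m"] that by (simp add: degree_monom_eq)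
    also have "\<dots> = (\<Sum>t\<le>N. real t ^ m * Polynomial.coeff (lg (real t)) i)"
      by (simp add: coeff_sum poly_monom sum.reindex)
    finally show ?thesis by (simp add: mult.commute)
  qed
  then show ?thesis by (rule that[of "\<lambda>i t. Polynomial.coeff (lg (real t)) i"])
qed

text \<open>Extrapolation from \<open>1, \<dots>, N + 1\<close> to \<open>-1\<close> is exact for polynomials but not for \<open>sgn t * t ^ m\<close>.\<close>

lemma odd_functional:
  obtains T :: "(real \<times> real) list"
  where "\<And>m. m \<le> N \<Longrightarrow> app T (\<lambda>t. t ^ m) = 0" "\<And>m. m \<le> N \<Longrightarrow> app T (\<lambda>t. sgn t * t ^ m) \<noteq> 0"
    "0 \<notin> snd ` set T"
proof -
  have c: "card (real ` {1..Suc N}) = Suc N" by (subst card_image) auto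
  obtain lg where l: "\<And>p. Polynomial.degree p < Suc N \<Longrightarrow> p = (\<Sum>t\<in>real ` {1..Suc N}. Polynomial.smult (poly p t) (lg t))"
    using lagrange_interpolation[of "real ` {1..Suc N}"] c by auto
  define w where "w k = poly (lg (real k)) (-1)" for k
  have w: "(\<Sum>k=1..Suc N. w k * real k ^ m) = (-1) ^ m" if "m \<le> N" for m
  proof -
    have "poly (Polynomial.monom 1 m) (-1) = poly (\<Sum>t\<in>real ` {1..Suc N}. Polynomial.smult (poly (Polynomial.monom 1 m) t) (lg t)) (-1)"
      using l[of "Polynomial.monom 1 m"] that by (simp add: degree_monom_eq)
    also have "\<dots> = (\<Sum>k=1..Suc N. real k ^ m * poly (lg (real k)) (-1))"
      by (simp add: poly_sum poly_monom sum.reindex del: sum.cl_ivl_Suc)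
    finally show ?thesis by (simp add: poly_monom w_def mult.commute del: sum.cl_ivl_Suc)
  qed
  define T where "T = (1, -1) # map (\<lambda>k. (- w k, real k)) [1..<Suc (Suc N)]"
  have T: "app T f = f (-1) - (\<Sum>k=1..Suc N. w k * f (real k))" for f
  proof -
    have "app (map (\<lambda>k. (- w k, real k)) ks) f = - (\<Sum>k\<leftarrow>ks. w k * f (real k))" for ks
      by (induction ks) auto
    moreover have "(\<Sum>k\<leftarrow>[1..<Suc (Suc N)]. w k * f (real k)) = (\<Sum>k=1..Suc N. w k * f (real k))"
      by (simp only: interv_sum_list_conv_sum_set_nat set_upt atLeastLessThanSuc_atLeastAtMost)
    ultimately show ?thesis by (simp add: T_def del: upt_Suc sum.cl_ivl_Suc)
  qed
  show ?thesis
  proof (rule that)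
    show "app T (\<lambda>t. t ^ m) = 0" if "m \<le> N" for m using w[OF that] by (simp add: T del: sum.cl_ivl_Suc)
    \<comment> \<open>Only the node -1 is negative, so the sign turns the cancellation into an
      addition: the value is -2 (-1)^m.\<close>
    show "app T (\<lambda>t. sgn t * t ^ m) \<noteq> 0" if "m \<le> N" for m
    proof -
      have "(\<Sum>k=1..Suc N. w k * (sgn (real k) * real k ^ m)) = (\<Sum>k=1..Suc N. w k * real k ^ m)"
        by (intro sum.cong refl) auto
      then show ?thesis using w[OF that] by (simp add: T del: sum.cl_ivl_Suc)
    qed
  qed (auto simp: T_def)
qed

section \<open>Multi-indices, prescribed moments and homogeneous polynomials\<close>

definition multi_indices :: "nat \<Rightarrow> ('d::finite) multi_index set" where
  "multi_indices s = {\<alpha>. (\<Sum>l\<in>UNIV. \<alpha> l) = s}"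

lemma multi_index_le: "\<alpha> \<in> multi_indices s \<Longrightarrow> \<alpha> l \<le> s"
  using member_le_sum[of l UNIV \<alpha>] by (auto simp: multi_indices_def)

lemma finite_multi_indices [simp]: "finite (multi_indices s)"
proof (rule finite_subset)
  show "multi_indices s \<subseteq> PiE UNIV (\<lambda>_. {..s})" using multi_index_le by auto
qed (auto intro: finite_PiE)

text \<open>On the grid of points with coordinates 0, ..., N the products of one-dimensional
  coefficient functionals are dual to the monomials; their combination with coefficients \<tau> has
  the prescribed moments.\<close>

lemma moment_functional:
  fixes \<tau> :: "('d::finite) multi_index \<Rightarrow> real"
  obtains L :: "(real \<times> (real ^ 'd)) list"
  where "\<And>\<alpha> m. \<alpha> \<in> multi_indices m \<Longrightarrow> m \<le> N \<Longrightarrow> app L (\<lambda>x. monomial x \<alpha>) = \<tau> \<alpha>"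
proof -
  obtain w :: "nat \<Rightarrow> nat \<Rightarrow> real"
    where w: "\<And>i m. m \<le> N \<Longrightarrow> (\<Sum>t\<le>N. w i t * real t ^ m) = (if m = i then 1 else 0)"
    using coefficient_functional[of N] by blast
  define G :: "('d \<Rightarrow> nat) set" where "G = PiE UNIV (\<lambda>_. {..N})"
  have "finite G" by (auto simp: G_def intro: finite_PiE)
  then obtain gs where gs: "set gs = G" "distinct gs" using finite_distinct_list by blast
  define B where "B = (\<Union>m\<le>N. multi_indices m :: 'd multi_index set)"
  have finB: "finite B" by (auto simp: B_def)
  define c where "c g = (\<Sum>\<alpha>\<in>B. \<tau> \<alpha> * (\<Prod>l\<in>UNIV. w (\<alpha> l) (g l)))" for g
  define L where "L = map (\<lambda>g. (c g, vec_lambda (\<lambda>l. real (g l)) :: real ^ 'd)) gs"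
  have app_L: "app L f = (\<Sum>g\<in>G. c g * f (vec_lambda (\<lambda>l. real (g l))))" for f
  proof -
    have "app L f = (\<Sum>g\<leftarrow>gs. c g * f (vec_lambda (\<lambda>l. real (g l))))"
      unfolding L_def by (induction gs) auto
    then show ?thesis using gs by (simp add: sum_list_distinct_conv_sum_set)
  qed
  show ?thesis
  proof (rule that)
    fix \<beta> :: "'d multi_index" and m assume \<beta>: "\<beta> \<in> multi_indices m" "m \<le> N"
    have \<beta>N: "\<beta> l \<le> N" for l using multi_index_le[OF \<beta>(1), of l] \<beta>(2) by simp
    have "\<beta> \<in> B" using \<beta> by (auto simp: B_def)
    have "app L (\<lambda>x. monomial x \<beta>) = (\<Sum>g\<in>G. \<Sum>\<alpha>\<in>B. \<tau> \<alpha> * (\<Prod>l\<in>UNIV. w (\<alpha> l) (g l) * real (g l) ^ \<beta> l))"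
      unfolding app_L c_def monomial_def by (simp add: sum_distrib_right prod.distrib mult.assoc)
    also have "\<dots> = (\<Sum>\<alpha>\<in>B. \<tau> \<alpha> * (\<Sum>g\<in>G. \<Prod>l\<in>UNIV. w (\<alpha> l) (g l) * real (g l) ^ \<beta> l))"
      by (subst sum.swap) (simp add: sum_distrib_left)
    also have "\<dots> = (\<Sum>\<alpha>\<in>B. \<tau> \<alpha> * (\<Prod>l\<in>UNIV. \<Sum>t\<le>N. w (\<alpha> l) t * real t ^ \<beta> l))"
      unfolding G_def by (subst prod_sum_PiE) auto
    also have "\<dots> = (\<Sum>\<alpha>\<in>B. if \<alpha> = \<beta> then \<tau> \<alpha> else 0)"
    proof (intro sum.cong refl)
      fix \<alpha> :: "'d multi_index"
      have "(\<Prod>l\<in>UNIV. if \<beta> l = \<alpha> l then 1 else (0::real)) = (if \<alpha> = \<beta> then 1 else 0)"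
        by (auto simp: fun_eq_iff) (metis UNIV_I)?
      then show "\<tau> \<alpha> * (\<Prod>l\<in>UNIV. \<Sum>t\<le>N. w (\<alpha> l) t * real t ^ \<beta> l) = (if \<alpha> = \<beta> then \<tau> \<alpha> else 0)"
        by (simp add: w \<beta>N)
    qed
    also have "\<dots> = \<tau> \<beta>" using finB \<open>\<beta> \<in> B\<close> by simp
    finally show "app L (\<lambda>x. monomial x \<beta>) = \<tau> \<beta>" .
  qed
qed

definition homogeneous :: "nat \<Rightarrow> (real ^ 'd::finite \<Rightarrow> real) \<Rightarrow> bool" where
  "homogeneous m f \<longleftrightarrow> (\<exists>c. \<forall>z. f z = (\<Sum>\<alpha>\<in>multi_indices m. c \<alpha> * monomial z \<alpha>))"

lemma multi_indices_0: "multi_indices 0 = {\<lambda>_. 0}"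
  by (auto simp: multi_indices_def)

lemma homogeneous_const: "homogeneous 0 (\<lambda>_. c)"
  unfolding homogeneous_def multi_indices_0 by (intro exI[of _ "\<lambda>_. c"]) (simp add: monomial_def)

lemma homogeneous_cmult: "homogeneous m f \<Longrightarrow> homogeneous m (\<lambda>z. a * f z)"
  unfolding homogeneous_def
proof (elim exE)
  fix c assume "\<forall>z. f z = (\<Sum>\<alpha>\<in>multi_indices m. c \<alpha> * monomial z \<alpha>)"
  then show "\<exists>c. \<forall>z. a * f z = (\<Sum>\<alpha>\<in>multi_indices m. c \<alpha> * monomial z \<alpha>)"
    by (intro exI[of _ "\<lambda>\<alpha>. a * c \<alpha>"]) (simp add: sum_distrib_left mult.assoc)
qed

lemma homogeneous_sum:
  assumes "\<And>i. i \<in> I \<Longrightarrow> homogeneous m (f i)"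
  shows "homogeneous m (\<lambda>z. \<Sum>i\<in>I. f i z)"
proof -
  obtain c where "\<And>i z. i \<in> I \<Longrightarrow> f i z = (\<Sum>\<alpha>\<in>multi_indices m. c i \<alpha> * monomial z \<alpha>)"
    using assms unfolding homogeneous_def by metis
  then show ?thesis unfolding homogeneous_def
    by (intro exI[of _ "\<lambda>\<alpha>. \<Sum>i\<in>I. c i \<alpha>"]) (simp add: sum_distrib_right, subst sum.swap, simp)
qed

lemma monomial_upd_Suc: "monomial z (\<alpha>(l := Suc (\<alpha> l))) = vec_nth z l * monomial z \<alpha>"
proof -
  have "monomial z (\<alpha>(l := Suc (\<alpha> l))) = vec_nth z l ^ Suc (\<alpha> l) * (\<Prod>k\<in>UNIV - {l}. vec_nth z k ^ \<alpha> k)"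
    unfolding monomial_def by (subst prod.remove[of _ l]) (auto intro!: prod.cong)
  also have "\<dots> = vec_nth z l * monomial z \<alpha>"
    unfolding monomial_def by (subst (2) prod.remove[of _ l]) auto
  finally show ?thesis .
qed

lemma sum_upd_Suc: "(\<Sum>k\<in>UNIV. (\<alpha>(l := Suc (\<alpha> l))) k) = Suc (\<Sum>k\<in>(UNIV::'d::finite set). \<alpha> k)"
proof -
  have "(\<Sum>k\<in>UNIV. (\<alpha>(l := Suc (\<alpha> l))) k) = Suc (\<alpha> l) + (\<Sum>k\<in>UNIV - {l}. \<alpha> k)"
    by (subst sum.remove[of _ l]) (auto intro!: sum.cong)
  also have "\<dots> = Suc (\<Sum>k\<in>UNIV. \<alpha> k)"
    by (subst (2) sum.remove[of _ l]) auto
  finally show ?thesis .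
qed

lemma upd_Suc_multi_indices: "\<alpha> \<in> multi_indices m \<Longrightarrow> \<alpha>(l := Suc (\<alpha> l)) \<in> multi_indices (Suc m)"
  using sum_upd_Suc[of \<alpha> l] by (simp only: multi_indices_def mem_Collect_eq)

lemma homogeneous_times_coordinate:
  assumes "homogeneous m f"
  shows "homogeneous (Suc m) (\<lambda>z. vec_nth z l * f z)"
proof -
  obtain c where c: "\<And>z. f z = (\<Sum>\<alpha>\<in>multi_indices m. c \<alpha> * monomial z \<alpha>)"
    using assms unfolding homogeneous_def by blast
  define g where "g \<alpha> = \<alpha>(l := Suc (\<alpha> l))" for \<alpha> :: "'a multi_index"
  define c' where "c' \<alpha> = (if \<alpha> l = 0 then 0 else c (\<alpha>(l := \<alpha> l - 1)))" for \<alpha>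
  have inj: "inj_on g (multi_indices m)"
    by (rule inj_onI) (metis (mono_tags, lifting) fun_upd_eqD fun_upd_triv fun_upd_upd g_def nat.inject)
  have "vec_nth z l * f z = (\<Sum>\<alpha>\<in>multi_indices (Suc m). c' \<alpha> * monomial z \<alpha>)" for z
  proof -
    have "vec_nth z l * f z = (\<Sum>\<alpha>\<in>multi_indices m. c' (g \<alpha>) * monomial z (g \<alpha>))"
      unfolding c sum_distrib_left g_def monomial_upd_Suc by (intro sum.cong refl) (simp add: c'_def)
    also have "\<dots> = (\<Sum>\<alpha>\<in>g ` multi_indices m. c' \<alpha> * monomial z \<alpha>)"
      by (simp add: sum.reindex[OF inj])
    also have "\<dots> = (\<Sum>\<alpha>\<in>multi_indices (Suc m). c' \<alpha> * monomial z \<alpha>)"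
    proof (rule sum.mono_neutral_left)
      show "g ` multi_indices m \<subseteq> multi_indices (Suc m)"
        using upd_Suc_multi_indices by (auto simp: g_def)
      show "\<forall>\<alpha>\<in>multi_indices (Suc m) - g ` multi_indices m. c' \<alpha> * monomial z \<alpha> = 0"
      proof
        fix \<alpha> assume \<alpha>: "\<alpha> \<in> multi_indices (Suc m) - g ` multi_indices m"
        have "\<alpha> l = 0"
        proof (rule ccontr)
          assume "\<alpha> l \<noteq> 0"
          then have e: "\<alpha> = g (\<alpha>(l := \<alpha> l - 1))" by (auto simp: g_def)
          have "Suc (\<Sum>k\<in>UNIV. (\<alpha>(l := \<alpha> l - 1)) k) = (\<Sum>k\<in>UNIV. \<alpha> k)"
            using sum_upd_Suc[of "\<alpha>(l := \<alpha> l - 1)" l] e unfolding g_def by metis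
          then have "\<alpha>(l := \<alpha> l - 1) \<in> multi_indices m" using \<alpha> by (auto simp: multi_indices_def)
          then show False using \<alpha> e by blast
        qed
        then show "c' \<alpha> * monomial z \<alpha> = 0" by (simp add: c'_def)
      qed
    qed simp
    finally show ?thesis .
  qed
  then show ?thesis unfolding homogeneous_def by blast
qed

lemma homogeneous_times_inner: "homogeneous m f \<Longrightarrow> homogeneous (Suc m) (\<lambda>z. inner y z * f z)"
  by (simp add: inner_vec_def sum_distrib_right mult.assoc)
     (intro homogeneous_sum homogeneous_cmult homogeneous_times_coordinate)

lemma homogeneous_times_norm_square:
  assumes "homogeneous m f"
  shows "homogeneous (Suc (Suc m)) (\<lambda>z. (norm z)\<^sup>2 * f z)"
proof -
  have "homogeneous (Suc (Suc m)) (\<lambda>z. \<Sum>l\<in>UNIV. vec_nth z l * (vec_nth z l * f z))"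
    by (intro homogeneous_sum homogeneous_times_coordinate assms)
  moreover have "(norm z)\<^sup>2 * f z = (\<Sum>l\<in>UNIV. vec_nth z l * (vec_nth z l * f z))" for z
    by (simp add: power2_norm_eq_inner inner_vec_def sum_distrib_right mult.assoc)
  ultimately show ?thesis by simp
qed

lemma homogeneous_inner_norm:
  "homogeneous (j + 2 * i) (\<lambda>z. (inner y z) ^ j * ((norm z)\<^sup>2) ^ i)"
proof (induction j)
  case 0
  show ?case
  proof (induction i)
    case 0
    then show ?case using homogeneous_const[of 1] by simp
  next
    case (Suc i)
    then show ?case using homogeneous_times_norm_square[of "2 * i" "\<lambda>z. ((norm z)\<^sup>2) ^ i"] by simp
  qed
next
  case (Suc j)
  then show ?case
    using homogeneous_times_inner[of "j + 2 * i" "\<lambda>z. (inner y z) ^ j * ((norm z)\<^sup>2) ^ i" y] by (simp add: mult.assoc)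
qed

lemma app_homogeneous:
  assumes "homogeneous m f" "\<And>\<alpha>. \<alpha> \<in> multi_indices m \<Longrightarrow> app L (\<lambda>x. monomial x \<alpha>) = 0"
  shows "app L f = 0"
proof -
  obtain c where c: "\<And>z. f z = (\<Sum>\<alpha>\<in>multi_indices m. c \<alpha> * monomial z \<alpha>)"
    using assms(1) unfolding homogeneous_def by blast
  show ?thesis unfolding c app_sum app_cmult using assms(2) by simp
qed

section \<open>Powers of the distance\<close>

lemma abs_power_odd: "\<bar>t :: real\<bar> ^ (2 * m + 1) = sgn t * t ^ (2 * m + 1)"
  by (simp add: power_abs[symmetric] abs_mult sgn_mult sgn_if abs_if)

text \<open>The coefficient of \<open>\<delta> ^ m\<close> in \<open>norm (v - \<delta> z) ^ (2 r - 1)\<close>; it is obtained from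
  \<open>norm (v - \<delta> z)\<^sup>2 = norm v\<^sup>2 (1 + A \<delta> + B \<delta>\<^sup>2)\<close>.\<close>

definition norm_coeff :: "nat \<Rightarrow> real ^ 'd::finite \<Rightarrow> real ^ 'd \<Rightarrow> nat \<Rightarrow> real" where
  "norm_coeff r v z m = norm v ^ (2 * r - 1) * (\<Sum>i\<le>m. ((real r - 1 / 2) gchoose i) *
     (real (i choose (m - i)) * (- 2 * inner v z / (norm v)\<^sup>2) ^ (2 * i - m) * ((norm z)\<^sup>2 / (norm v)\<^sup>2) ^ (m - i)))"

lemma norm_has_fps_expansion:
  fixes v z :: "real ^ 'd::finite"
  assumes v: "v \<noteq> 0" and r: "r \<ge> 1"
  shows "(\<lambda>\<delta>. norm (v - \<delta> *\<^sub>R z) ^ (2 * r - 1)) has_fps_expansion Abs_fps (norm_coeff r v z)"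
proof -
  define A where "A = - 2 * inner v z / (norm v)\<^sup>2"
  define B where "B = (norm z)\<^sup>2 / (norm v)\<^sup>2"
  let ?a = "real r - 1 / 2"
  have sq: "(norm (v - \<delta> *\<^sub>R z))\<^sup>2 = (norm v)\<^sup>2 * (1 + (A * \<delta> + B * \<delta>\<^sup>2))" for \<delta>
  proof -
    have "(norm (v - \<delta> *\<^sub>R z))\<^sup>2 = (norm v)\<^sup>2 - 2 * \<delta> * inner v z + \<delta>\<^sup>2 * (norm z)\<^sup>2"
      unfolding power2_norm_eq_inner
      by (simp add: inner_diff_left inner_diff_right inner_commute power2_eq_square algebra_simps)
    moreover have "(norm v)\<^sup>2 * A = - 2 * inner v z" "(norm v)\<^sup>2 * B = (norm z)\<^sup>2"
      using v by (simp_all add: A_def B_def)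
    moreover have "(norm v)\<^sup>2 * (1 + (A * \<delta> + B * \<delta>\<^sup>2)) = (norm v)\<^sup>2 + (norm v)\<^sup>2 * A * \<delta> + (norm v)\<^sup>2 * B * \<delta>\<^sup>2"
      by (simp add: algebra_simps)
    ultimately show ?thesis by (simp only:) (simp add: algebra_simps)
  qed
  have eq: "norm (v - \<delta> *\<^sub>R z) ^ (2 * r - 1) = norm v ^ (2 * r - 1) * (1 + (A * \<delta> + B * \<delta>\<^sup>2)) powr ?a" for \<delta>
  proof -
    have nn: "0 \<le> 1 + (A * \<delta> + B * \<delta>\<^sup>2)"
      using sq[of \<delta>] v by (metis power2_less_0 not_less zero_le_mult_iff zero_less_norm_iff zero_less_power)
    have "norm (v - \<delta> *\<^sub>R z) = norm v * sqrt (1 + (A * \<delta> + B * \<delta>\<^sup>2))"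
      by (rule power2_eq_imp_eq) (use sq[of \<delta>] nn in \<open>auto simp: power_mult_distrib\<close>)
    then have "norm (v - \<delta> *\<^sub>R z) ^ (2 * r - 1) = norm v ^ (2 * r - 1) * sqrt (1 + (A * \<delta> + B * \<delta>\<^sup>2)) ^ (2 * r - 1)"
      by (simp add: power_mult_distrib)
    also have "sqrt (1 + (A * \<delta> + B * \<delta>\<^sup>2)) ^ (2 * r - 1) = (1 + (A * \<delta> + B * \<delta>\<^sup>2)) powr ?a"
    proof (cases "1 + (A * \<delta> + B * \<delta>\<^sup>2) = 0")
      case True
      then show ?thesis using r by simp
    next
      case False
      then have "0 < 1 + (A * \<delta> + B * \<delta>\<^sup>2)" using nn by simp
      moreover have "?a = 1 / 2 * real (2 * r - 1)" using r by (simp add: of_nat_diff)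
      ultimately show ?thesis
        by (metis powr_half_sqrt powr_powr powr_realpow nn real_sqrt_gt_0_iff)
    qed
    finally show ?thesis .
  qed
  have "(\<lambda>\<delta>. norm v ^ (2 * r - 1) * (1 + (A * \<delta> + B * \<delta>\<^sup>2)) powr ?a) has_fps_expansion
     fps_const (norm v ^ (2 * r - 1)) * Abs_fps (\<lambda>m. \<Sum>i\<le>m. (?a gchoose i) * (real (i choose (m - i)) * A ^ (2 * i - m) * B ^ (m - i)))"
    by (intro has_fps_expansion_cmult_left has_fps_expansion_powr_quadratic)
  moreover have "\<dots> = Abs_fps (norm_coeff r v z)"
    by (intro fps_ext) (simp add: norm_coeff_def A_def B_def)
  ultimately show ?thesis unfolding eq by simp
qed

text \<open>As a function of \<open>z\<close> the coefficient of order \<open>m\<close> is a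
  homogeneous polynomial of degree \<open>m\<close>: the term \<open>i\<close> has degree
  \<open>2 * i - m\<close> from the inner product and \<open>2 * (m - i)\<close> from the squared
  norm.\<close>

lemma app_norm_coeff_low:
  assumes "\<And>\<alpha>. \<alpha> \<in> multi_indices m \<Longrightarrow> app L (\<lambda>x. monomial x \<alpha>) = 0"
  shows "app L (\<lambda>z. norm_coeff r v z m) = 0"
proof -
  have "homogeneous m (\<lambda>z. norm_coeff r v z m)"
    unfolding norm_coeff_def
  proof (intro homogeneous_cmult homogeneous_sum)
    fix i assume i: "i \<in> {..m}"
    show "homogeneous m (\<lambda>z. real (i choose (m - i)) * (- 2 * inner v z / (norm v)\<^sup>2) ^ (2 * i - m) * ((norm z)\<^sup>2 / (norm v)\<^sup>2) ^ (m - i))"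
    proof (cases "m - i \<le> i")
      case True
      let ?c = "real (i choose (m - i)) * (- 2 / (norm v)\<^sup>2) ^ (2 * i - m) * (1 / (norm v)\<^sup>2) ^ (m - i)"
      have "homogeneous ((2 * i - m) + 2 * (m - i)) (\<lambda>z. ?c * ((inner v z) ^ (2 * i - m) * ((norm z)\<^sup>2) ^ (m - i)))"
        by (intro homogeneous_cmult homogeneous_inner_norm)
      moreover have "(2 * i - m) + 2 * (m - i) = m" using True i by simp
      ultimately have h: "homogeneous m (\<lambda>z. ?c * ((inner v z) ^ (2 * i - m) * ((norm z)\<^sup>2) ^ (m - i)))" by (simp only:)
      have e: "?c * ((inner v z) ^ (2 * i - m) * ((norm z)\<^sup>2) ^ (m - i)) = real (i choose (m - i)) * (- 2 * inner v z / (norm v)\<^sup>2) ^ (2 * i - m) * ((norm z)\<^sup>2 / (norm v)\<^sup>2) ^ (m - i)" for z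
        by (simp only: power_mult_distrib power_divide times_divide_eq_left times_divide_eq_right mult_1_left mult_1_right power_one mult_ac)
      show ?thesis using h unfolding e .
    next
      case False
      then have "real (i choose (m - i)) = 0" by simp
      moreover have "homogeneous m (\<lambda>z. 0 * ((inner v z) ^ m * ((norm z)\<^sup>2) ^ 0))"
        by (intro homogeneous_cmult) (use homogeneous_inner_norm[of m 0 v] in simp)
      ultimately show ?thesis by (simp only: mult_zero_left)
    qed
  qed
  then show ?thesis using assms by (rule app_homogeneous)
qed

text \<open>This uses that the coefficient is homogeneous of degree \<open>2 r - 1 - m\<close> and of parity \<open>m\<close> in \<open>v\<close>.\<close>

lemma norm_coeff_scaled:
  fixes t :: real
  assumes t: "t \<noteq> 0" and m: "m \<le> 2 * r - 1" and r: "r \<ge> 1"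
  shows "norm_coeff r (t *\<^sub>R v) z m = sgn t * t ^ (2 * r - 1 - m) * norm_coeff r v z m"
proof -
  have tt: "\<bar>t\<bar> ^ (2 * r - 1) = sgn t * t ^ (2 * r - 1 - m) * t ^ m"
  proof -
    have "2 * r - 1 = 2 * (r - 1) + 1" using r by simp
    then have "\<bar>t\<bar> ^ (2 * r - 1) = sgn t * t ^ (2 * r - 1)" by (simp only: abs_power_odd)
    moreover have "t ^ (2 * r - 1) = t ^ (2 * r - 1 - m) * t ^ m"
      by (simp only: power_add[symmetric] le_add_diff_inverse2[OF m])
    ultimately show ?thesis by (simp only: mult.assoc)
  qed
  have tm: "real (i choose (m - i)) * (- 2 * inner (t *\<^sub>R v) z / (norm (t *\<^sub>R v))\<^sup>2) ^ (2 * i - m) * ((norm z)\<^sup>2 / (norm (t *\<^sub>R v))\<^sup>2) ^ (m - i)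
      = (1 / t ^ m) * (real (i choose (m - i)) * (- 2 * inner v z / (norm v)\<^sup>2) ^ (2 * i - m) * ((norm z)\<^sup>2 / (norm v)\<^sup>2) ^ (m - i))"
    if i: "i \<le> m" for i
  proof (cases "m - i \<le> i")
    case True
    have 0: "(norm (t *\<^sub>R v))\<^sup>2 = (t * t) * (norm v)\<^sup>2"
      by (simp add: power_mult_distrib power2_eq_square[of t])
    have 1: "- 2 * inner (t *\<^sub>R v) z / (norm (t *\<^sub>R v))\<^sup>2 = (1 / t) * (- 2 * inner v z / (norm v)\<^sup>2)"
      unfolding 0 using t by simp
    have 2: "(norm z)\<^sup>2 / (norm (t *\<^sub>R v))\<^sup>2 = (1 / t)\<^sup>2 * ((norm z)\<^sup>2 / (norm v)\<^sup>2)"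
      unfolding 0 by (simp add: power2_eq_square[of "1 / t"])
    have 3: "(1 / t) ^ (2 * i - m) * ((1 / t)\<^sup>2) ^ (m - i) = 1 / t ^ m"
  proof -
    have "(2 * i - m) + 2 * (m - i) = m" using True i by simp
    moreover have "(1 / t) ^ (2 * i - m) * ((1 / t)\<^sup>2) ^ (m - i) = (1 / t) ^ ((2 * i - m) + 2 * (m - i))"
      by (simp only: power_add power_mult)
    ultimately show ?thesis by (simp only: power_one_over)
  qed
    show ?thesis unfolding 1 2 power_mult_distrib 3[symmetric] by (simp only: mult_ac)
  next
    case False
    then have "real (i choose (m - i)) = 0" by simp
    then show ?thesis by (simp only: mult_zero_left mult_zero_right)
  qed
  have "(\<Sum>i\<le>m. ((real r - 1 / 2) gchoose i) * (real (i choose (m - i)) * (- 2 * inner (t *\<^sub>R v) z / (norm (t *\<^sub>R v))\<^sup>2) ^ (2 * i - m) * ((norm z)\<^sup>2 / (norm (t *\<^sub>R v))\<^sup>2) ^ (m - i)))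
      = (1 / t ^ m) * (\<Sum>i\<le>m. ((real r - 1 / 2) gchoose i) * (real (i choose (m - i)) * (- 2 * inner v z / (norm v)\<^sup>2) ^ (2 * i - m) * ((norm z)\<^sup>2 / (norm v)\<^sup>2) ^ (m - i)))"
    unfolding sum_distrib_left by (intro sum.cong refl) (simp only: tm atMost_iff mult.left_commute)
  then have "norm_coeff r (t *\<^sub>R v) z m = (\<bar>t\<bar> ^ (2 * r - 1) * (1 / t ^ m)) * norm_coeff r v z m"
    unfolding norm_coeff_def by (simp only: norm_scaleR power_mult_distrib mult_ac)
  also have "\<bar>t\<bar> ^ (2 * r - 1) * (1 / t ^ m) = sgn t * t ^ (2 * r - 1 - m)"
    unfolding tt using t by simp
  finally show ?thesis .
qed

section \<open>The Laplacian argument\<close>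

text \<open>Both factors are polynomials in \<open>t\<close>, and the formula is the product rule.
  Every truncated exponent is accompanied by a factor such as \<open>real i * real (i - 1)\<close>
  that vanishes when the truncation takes effect.\<close>

lemma second_derivative_along_axis:
  fixes y z :: "real ^ 'd::finite"
  shows "\<exists>f'. (\<forall>t. ((\<lambda>t. ((norm (y + t *\<^sub>R axis l 1))\<^sup>2) ^ i * (2 * inner (y + t *\<^sub>R axis l 1) z) ^ j)
        has_real_derivative f' t) (at t)) \<and>
      (f' has_real_derivative
        (real i * real (i - 1) * ((norm y)\<^sup>2) ^ (i - 2) * (4 * (vec_nth y l)\<^sup>2) * (2 * inner y z) ^ j
         + 2 * real i * ((norm y)\<^sup>2) ^ (i - 1) * (2 * inner y z) ^ j
         + 8 * real i * real j * ((norm y)\<^sup>2) ^ (i - 1) * (vec_nth y l * vec_nth z l) * (2 * inner y z) ^ (j - 1)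
         + 4 * real j * real (j - 1) * ((norm y)\<^sup>2) ^ i * (vec_nth z l)\<^sup>2 * (2 * inner y z) ^ (j - 2))) (at 0)"
proof -
  let ?n = "(norm y)\<^sup>2" and ?u = "2 * inner y z" and ?a = "2 * vec_nth y l" and ?b = "2 * vec_nth z l"
  have n: "(norm (y + t *\<^sub>R axis l 1))\<^sup>2 = ?n + ?a * t + t\<^sup>2" for t
    unfolding power2_norm_eq_inner
    by (simp add: inner_add_left inner_add_right inner_axis inner_axis' power2_eq_square algebra_simps)
  have u: "2 * inner (y + t *\<^sub>R axis l 1) z = ?u + ?b * t" for t
    by (simp add: inner_add_left inner_axis' algebra_simps)
  let ?f' = "\<lambda>t. real i * (?n + ?a * t + t\<^sup>2) ^ (i - 1) * (?a + 2 * t) * (?u + ?b * t) ^ j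
      + (?n + ?a * t + t\<^sup>2) ^ i * (real j * (?u + ?b * t) ^ (j - 1) * ?b)"
  have d1: "((\<lambda>t. (?n + ?a * t + t\<^sup>2) ^ i * (?u + ?b * t) ^ j) has_real_derivative ?f' t) (at t)" for t
    by (rule derivative_eq_intros refl | simp)+
  have d2: "(?f' has_real_derivative
        (real i * (real (i - 1) * ?n ^ (i - 1 - 1) * ?a) * ?a * ?u ^ j + real i * ?n ^ (i - 1) * 2 * ?u ^ j
         + real i * ?n ^ (i - 1) * ?a * (real j * ?u ^ (j - 1) * ?b)
         + (real i * ?n ^ (i - 1) * ?a * (real j * ?u ^ (j - 1) * ?b) + ?n ^ i * (real j * (real (j - 1) * ?u ^ (j - 1 - 1) * ?b) * ?b)))) (at 0)"
    by (rule derivative_eq_intros refl | simp)+ (simp add: algebra_simps)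
  have e: "(real i * (real (i - 1) * ?n ^ (i - 1 - 1) * ?a) * ?a * ?u ^ j + real i * ?n ^ (i - 1) * 2 * ?u ^ j
         + real i * ?n ^ (i - 1) * ?a * (real j * ?u ^ (j - 1) * ?b)
         + (real i * ?n ^ (i - 1) * ?a * (real j * ?u ^ (j - 1) * ?b) + ?n ^ i * (real j * (real (j - 1) * ?u ^ (j - 1 - 1) * ?b) * ?b)))
     = (real i * real (i - 1) * ?n ^ (i - 2) * (4 * (vec_nth y l)\<^sup>2) * ?u ^ j
         + 2 * real i * ?n ^ (i - 1) * ?u ^ j
         + 8 * real i * real j * ?n ^ (i - 1) * (vec_nth y l * vec_nth z l) * ?u ^ (j - 1)
         + 4 * real j * real (j - 1) * ?n ^ i * (vec_nth z l)\<^sup>2 * ?u ^ (j - 2))"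
  proof -
    have "I * (I1 * N2 * (2 * Y)) * (2 * Y) * U + I * N1 * 2 * U + I * N1 * (2 * Y) * (J * U1 * (2 * Z))
        + (I * N1 * (2 * Y) * (J * U1 * (2 * Z)) + N * (J * (J1 * U2 * (2 * Z)) * (2 * Z)))
      = I * I1 * N2 * (4 * Y\<^sup>2) * U + 2 * I * N1 * U + 8 * I * J * N1 * (Y * Z) * U1 + 4 * J * J1 * N * Z\<^sup>2 * U2"
      for I I1 N N1 N2 Y Z J J1 U U1 U2 :: real
      by (simp add: algebra_simps power2_eq_square)
    then show ?thesis by (simp only: diff_diff_left one_add_one)
  qed
  show ?thesis unfolding n u by (intro exI[of _ ?f'] conjI allI d1 d2[unfolded e])
qed

lemma has_derivative_app:
  assumes "\<And>x. x \<in> snd ` set L \<Longrightarrow> ((f x) has_real_derivative f' x) (at t)"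
  shows "((\<lambda>t. app L (\<lambda>x. f x t)) has_real_derivative app L f') (at t)"
  using assms
proof (induction L)
  case (Cons p L)
  have "((\<lambda>t. fst p * f (snd p) t + app L (\<lambda>x. f x t)) has_real_derivative fst p * f' (snd p) + app L f') (at t)"
    using Cons by (intro DERIV_add DERIV_cmult) auto
  then show ?case by simp
qed simp

text \<open>The coefficient of t^s in \<open>app L\<close> of (1 + 2 t <y,z> + t^2 |y|^2 |z|^2)^b.
  For b = r - 1/2 it is, up to a sign and a power of |y|, the coefficient of order s of |y -
  \<delta> z|^(2 r - 1); without denominators it is a polynomial in \<open>y\<close>.\<close>

definition radial_sum :: "real \<Rightarrow> nat \<Rightarrow> (real \<times> (real ^ 'd::finite)) list \<Rightarrow> real ^ 'd \<Rightarrow> real" where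
  "radial_sum b s L y = (\<Sum>i\<le>s. (b gchoose (s - i)) * real ((s - i) choose i) * ((norm y)\<^sup>2) ^ i *
     app L (\<lambda>z. (2 * inner y z) ^ (s - 2 * i) * ((norm z)\<^sup>2) ^ i))"

lemma second_derivative_of_zero:
  fixes g :: "real \<Rightarrow> real"
  assumes g: "\<And>t. (g has_real_derivative g' t) (at t)" and D: "(g' has_real_derivative D) (at 0)"
    and z: "eventually (\<lambda>t. g t = 0) (nhds 0)"
  shows "g' 0 = 0" "D = 0"
proof -
  have "eventually (\<lambda>s. eventually (\<lambda>t. g t = 0) (nhds s)) (nhds 0)"
    using z by (simp add: eventually_eventually)
  then have ev: "eventually (\<lambda>s. g' s = 0) (nhds 0)"
  proof eventually_elim
    case (elim s)
    have "((\<lambda>_. 0) has_real_derivative g' s) (at s)"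
      using g[of s] DERIV_cong_ev[OF refl elim refl] by blast
    then show ?case using DERIV_unique DERIV_const by blast
  qed
  then show "g' 0 = 0" by (rule eventually_nhds_x_imp_x)
  have "((\<lambda>_. 0) has_real_derivative D) (at 0)"
    using D DERIV_cong_ev[OF refl ev refl] by blast
  then show "D = 0" using DERIV_unique DERIV_const by blast
qed

lemma eventually_line_nonzero:
  fixes y e :: "real ^ 'd::finite"
  assumes "y \<noteq> 0"
  shows "eventually (\<lambda>t. y + t *\<^sub>R e \<noteq> 0) (nhds 0)"
proof -
  have "((\<lambda>t. y + t *\<^sub>R e) \<longlongrightarrow> y + 0 *\<^sub>R e) (nhds 0)"
    by (intro tendsto_intros filterlim_ident)
  then show ?thesis using assms tendsto_imp_eventually_ne by fastforce
qed

text \<open>The base of the generating function is |z|^2 |t y + z/|z|^2|^2, and the Laplacian of |t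
  y + v|^(2b) is 2b (2b + d - 2) t^2 |t y + v|^(2b - 2). Comparing coefficients gives this
  recurrence, with \<open>d\<close> the dimension.\<close>

lemma radial_coeff_recurrence:
  fixes b d :: real
  assumes "2 \<le> s" "i < s"
  shows "(b gchoose (s - Suc i)) * real ((s - Suc i) choose Suc i) * (2 * real (Suc i) * (2 * real i + d + 2 * real (s - 2 * Suc i)))
     + (b gchoose (s - i)) * real ((s - i) choose i) * (4 * real (s - 2 * i) * real (s - 2 * i - 1))
   = 2 * b * (2 * b + d - 2) * (((b - 1) gchoose (s - 2 - i)) * real ((s - 2 - i) choose i))"
proof (cases "2 * i + 2 \<le> s")
  case True
  define q where "q = s - i - 2"
  have s: "s = q + i + 2" and iq: "i \<le> q" using True by (auto simp: q_def)
  have e1: "s - Suc i = Suc q" and e2: "s - i = Suc (Suc q)" and e3: "s - 2 - i = q" and e4: "s - 2 * Suc i = q - i"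
    and e5: "s - 2 * i = Suc (Suc q) - i" and e6: "Suc (Suc q) - i - 1 = Suc q - i"
    using s iq by auto
  define P where "P = real (q choose i)"
  define G where "G = b gchoose Suc q"
  define X where "X = (b - 1) gchoose q"
  have bX: "b * X = real (Suc q) * G"
    unfolding X_def G_def by (rule gbinomial_absorption[symmetric])
  have G2: "real (Suc (Suc q)) * (b gchoose Suc (Suc q)) = (b - real (Suc q)) * G"
    unfolding G_def by (simp only: gbinomial_absorption gbinomial_absorb_comp)
  have c1: "real (Suc i) * real (Suc q choose Suc i) = real (Suc q) * P"
    unfolding P_def of_nat_mult[symmetric] by (simp only: binomial_absorption diff_Suc_1)
  have c2: "real (Suc q - i) * real (Suc q choose i) = real (Suc q) * P"
    unfolding P_def of_nat_mult[symmetric] by (simp only: binomial_absorb_comp diff_Suc_1)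
  have c3: "real (Suc (Suc q) - i) * real (Suc (Suc q) choose i) = real (Suc (Suc q)) * real (Suc q choose i)"
    unfolding of_nat_mult[symmetric] by (simp only: binomial_absorb_comp diff_Suc_1)
  have r: "real (q - i) = real q - real i" using iq by simp
  have "(b gchoose Suc q) * real (Suc q choose Suc i) * (2 * real (Suc i) * (2 * real i + d + 2 * real (q - i)))
      = 2 * G * (real (Suc i) * real (Suc q choose Suc i)) * (2 * real q + d)"
    unfolding r G_def by (simp only: mult_ac) (simp add: algebra_simps)
  also have "\<dots> = 2 * G * (real (Suc q) * P) * (2 * real q + d)" by (simp only: c1)
  finally have t1: "(b gchoose Suc q) * real (Suc q choose Suc i) * (2 * real (Suc i) * (2 * real i + d + 2 * real (q - i)))
      = 2 * G * (real (Suc q) * P) * (2 * real q + d)" .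
  have "(b gchoose Suc (Suc q)) * real (Suc (Suc q) choose i) * (4 * real (Suc (Suc q) - i) * real (Suc q - i))
      = 4 * (b gchoose Suc (Suc q)) * real (Suc q - i) * (real (Suc (Suc q) - i) * real (Suc (Suc q) choose i))"
    by (simp only: mult_ac)
  also have "\<dots> = 4 * (real (Suc (Suc q)) * (b gchoose Suc (Suc q))) * (real (Suc q - i) * real (Suc q choose i))"
    unfolding c3 by (simp only: mult_ac)
  also have "\<dots> = 4 * ((b - real (Suc q)) * G) * (real (Suc q) * P)" by (simp only: G2 c2)
  finally have t2: "(b gchoose Suc (Suc q)) * real (Suc (Suc q) choose i) * (4 * real (Suc (Suc q) - i) * real (Suc q - i))
      = 4 * ((b - real (Suc q)) * G) * (real (Suc q) * P)" .
  have "2 * b * (2 * b + d - 2) * (X * P) = 2 * (2 * b + d - 2) * (b * X) * P" by (simp only: mult_ac)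
  also have "\<dots> = 2 * (2 * b + d - 2) * (real (Suc q) * G) * P" by (simp only: bX)
  finally have t3: "2 * b * (2 * b + d - 2) * (X * P) = 2 * (2 * b + d - 2) * (real (Suc q) * G) * P" .
  show ?thesis
    unfolding e5 e6 e1 e2 e3 e4 t1 t2 P_def[symmetric] X_def[symmetric] t3
    by (simp add: algebra_simps)
next
  \<comment> \<open>Beyond \<open>2 * i + 2 \<le> s\<close> each of the three terms contains a
    vanishing binomial coefficient or a vanishing factor.\<close>
  case False
  have 1: "(s - Suc i) choose Suc i = 0" using False by (intro binomial_eq_0) auto
  have 2: "real ((s - i) choose i) * (real (s - 2 * i) * real (s - 2 * i - 1)) = 0"
  proof (cases "2 * i \<le> s")
    case True
    then have "s - 2 * i = 0 \<or> s - 2 * i - 1 = 0" using False by auto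
    then show ?thesis by auto
  next
    case False
    then have "(s - i) choose i = 0" by (intro binomial_eq_0) auto
    then show ?thesis by simp
  qed
  have 3: "(s - 2 - i) choose i = 0" using False assms by (intro binomial_eq_0) auto
  have "(b gchoose (s - i)) * real ((s - i) choose i) * (4 * real (s - 2 * i) * real (s - 2 * i - 1))
      = 4 * (b gchoose (s - i)) * (real ((s - i) choose i) * (real (s - 2 * i) * real (s - 2 * i - 1)))"
    by (simp only: mult_ac)
  then show ?thesis unfolding 2 1 3 by simp
qed

text \<open>Applying the Laplacian turns the parameters \<open>(b, s)\<close> into \<open>(b - 1, s - 2)\<close>.\<close>

lemma radial_sum_laplacian:
  fixes L :: "(real \<times> (real ^ 'd::finite)) list"
  assumes zero: "\<And>y. y \<noteq> 0 \<Longrightarrow> radial_sum b s L y = 0" and s: "2 \<le> s" and y: "y \<noteq> 0"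
  shows "2 * b * (2 * b + real CARD('d) - 2) * radial_sum (b - 1) (s - 2) (reweigh (\<lambda>z. (norm z)\<^sup>2) L) y = 0"
proof -
  define c where "c i = (b gchoose (s - i)) * real ((s - i) choose i)" for i
  let ?n = "(norm y)\<^sup>2"
  let ?u = "\<lambda>z. 2 * inner y z"
  define D where "D i l z = (let j = s - 2 * i in
        (real i * real (i - 1) * ?n ^ (i - 2) * (4 * (vec_nth y l)\<^sup>2) * (?u z) ^ j
         + 2 * real i * ?n ^ (i - 1) * (?u z) ^ j
         + 8 * real i * real j * ?n ^ (i - 1) * (vec_nth y l * vec_nth z l) * (?u z) ^ (j - 1)
         + 4 * real j * real (j - 1) * ?n ^ i * (vec_nth z l)\<^sup>2 * (?u z) ^ (j - 2)))" for i l and z :: "real ^ 'd"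
  \<comment> \<open>The sum is zero along the axis through \<open>y\<close> as long as 0 is avoided,
    so every pure second derivative vanishes on its own; they are added up afterwards.\<close>
  have lap_l: "(\<Sum>i\<le>s. c i * app L (\<lambda>z. D i l z * ((norm z)\<^sup>2) ^ i)) = 0" for l
  proof -
    define f where "f i z t = ((norm (y + t *\<^sub>R axis l 1))\<^sup>2) ^ i * (2 * inner (y + t *\<^sub>R axis l 1) z) ^ (s - 2 * i)" for i z t
    have "\<exists>f'. (\<forall>t. ((f i z) has_real_derivative f' t) (at t)) \<and> (f' has_real_derivative D i l z) (at 0)" for i z
      using second_derivative_along_axis[of y l i z "s - 2 * i"] unfolding f_def D_def Let_def by blast
    then obtain f' where f': "\<And>i z t. ((f i z) has_real_derivative f' i z t) (at t)"
      "\<And>i z. ((f' i z) has_real_derivative D i l z) (at 0)" by metis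
    show ?thesis
    proof (rule second_derivative_of_zero(2)[where g' = "\<lambda>t. \<Sum>i\<le>s. c i * app L (\<lambda>z. f' i z t * ((norm z)\<^sup>2) ^ i)"])
      show "((\<lambda>t. \<Sum>i\<le>s. c i * app L (\<lambda>z. f i z t * ((norm z)\<^sup>2) ^ i)) has_real_derivative
          (\<Sum>i\<le>s. c i * app L (\<lambda>z. f' i z t * ((norm z)\<^sup>2) ^ i))) (at t)" for t
        by (intro DERIV_sum DERIV_cmult has_derivative_app DERIV_cmult_right f')
      show "((\<lambda>t. \<Sum>i\<le>s. c i * app L (\<lambda>z. f' i z t * ((norm z)\<^sup>2) ^ i)) has_real_derivative
          (\<Sum>i\<le>s. c i * app L (\<lambda>z. D i l z * ((norm z)\<^sup>2) ^ i))) (at 0)"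
        by (intro DERIV_sum DERIV_cmult has_derivative_app DERIV_cmult_right f')
      show "eventually (\<lambda>t. (\<Sum>i\<le>s. c i * app L (\<lambda>z. f i z t * ((norm z)\<^sup>2) ^ i)) = 0) (nhds 0)"
        using eventually_line_nonzero[OF y, of "axis l 1"]
      proof eventually_elim
        case (elim t)
        have "(\<Sum>i\<le>s. c i * app L (\<lambda>z. f i z t * ((norm z)\<^sup>2) ^ i)) = radial_sum b s L (y + t *\<^sub>R axis l 1)"
          unfolding radial_sum_def c_def f_def
          by (intro sum.cong refl) (simp add: app_cmult mult.assoc)
        then show ?case using zero[OF elim] by simp
      qed
    qed
  qed
  have D_sum: "(\<Sum>l\<in>UNIV. D i l z) = 2 * real i * (2 * real (i - 1) + real CARD('d) + 2 * real (s - 2 * i)) * ?n ^ (i - 1) * (?u z) ^ (s - 2 * i)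
      + 4 * real (s - 2 * i) * real (s - 2 * i - 1) * ?n ^ i * (?u z) ^ (s - 2 * i - 2) * (norm z)\<^sup>2" for i z
  proof -
    define j where "j = s - 2 * i"
    have n1: "(\<Sum>l\<in>UNIV. (vec_nth w l)\<^sup>2) = (norm w)\<^sup>2" for w :: "real ^ 'd"
      unfolding power2_norm_eq_inner inner_vec_def by (simp add: power2_eq_square)
    have n2: "(\<Sum>l\<in>UNIV. vec_nth y l * vec_nth z l) = inner y z" by (simp add: inner_vec_def)
    have "(\<Sum>l\<in>UNIV. D i l z) = real i * real (i - 1) * ?n ^ (i - 2) * (4 * ?n) * (?u z) ^ j
         + real CARD('d) * (2 * real i * ?n ^ (i - 1) * (?u z) ^ j)
         + 8 * real i * real j * ?n ^ (i - 1) * inner y z * (?u z) ^ (j - 1)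
         + 4 * real j * real (j - 1) * ?n ^ i * (norm z)\<^sup>2 * (?u z) ^ (j - 2)"
      unfolding D_def Let_def j_def[symmetric] sum.distrib
      by (simp add: sum_distrib_left[symmetric] sum_distrib_right[symmetric] n1 n2)
    also have "real i * real (i - 1) * ?n ^ (i - 2) * (4 * ?n) = 4 * real i * real (i - 1) * ?n ^ (i - 1)"
    proof (cases "i \<le> 1")
      case True
      then have "i = 0 \<or> i = 1" by auto
      then show ?thesis by auto
    next
      case False
      then have "?n ^ (i - 1) = ?n ^ (i - 2) * ?n"
        by (metis Suc_1 Suc_diff_Suc not_less_eq_eq power_Suc2 One_nat_def not_le)
      then show ?thesis by (simp only: mult_ac)
    qed
    also have "8 * real i * real j * ?n ^ (i - 1) * inner y z * (?u z) ^ (j - 1) = 4 * real i * real j * ?n ^ (i - 1) * (?u z) ^ j"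
    proof (cases j)
      case (Suc k)
      then show ?thesis by simp
    qed simp
    finally show ?thesis unfolding j_def[symmetric] by (simp add: algebra_simps)
  qed
  define E where "E i = app L (\<lambda>z. (norm z)\<^sup>2 * ((?u z) ^ (s - 2 - 2 * i) * ((norm z)\<^sup>2) ^ i))" for i
  have E2: "app L (\<lambda>z. (?u z) ^ (s - 2 * i - 2) * (norm z)\<^sup>2 * ((norm z)\<^sup>2) ^ i) = E i" for i
    unfolding E_def by (simp add: mult_ac diff_right_commute)
  have E1: "app L (\<lambda>z. (?u z) ^ (s - 2 * Suc i) * ((norm z)\<^sup>2) ^ Suc i) = E i" for i
    unfolding E_def by (simp add: mult_ac diff_right_commute)
  define \<alpha> where "\<alpha> i = 2 * real i * (2 * real (i - 1) + real CARD('d) + 2 * real (s - 2 * i))" for i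
  define \<gamma> where "\<gamma> i = 4 * real (s - 2 * i) * real (s - 2 * i - 1)" for i
  have "0 = (\<Sum>l\<in>UNIV. \<Sum>i\<le>s. c i * app L (\<lambda>z. D i l z * ((norm z)\<^sup>2) ^ i))" by (simp add: lap_l)
  also have "\<dots> = (\<Sum>i\<le>s. c i * app L (\<lambda>z. (\<Sum>l\<in>UNIV. D i l z) * ((norm z)\<^sup>2) ^ i))"
    by (subst sum.swap) (simp add: sum_distrib_left[symmetric] app_sum sum_distrib_right)
  also have "\<dots> = (\<Sum>i\<le>s. c i * \<alpha> i * ?n ^ (i - 1) * app L (\<lambda>z. (?u z) ^ (s - 2 * i) * ((norm z)\<^sup>2) ^ i)
        + c i * \<gamma> i * ?n ^ i * E i)"
  proof (intro sum.cong refl)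
    fix i
    have "app L (\<lambda>z. (\<Sum>l\<in>UNIV. D i l z) * ((norm z)\<^sup>2) ^ i)
       = app L (\<lambda>z. (\<alpha> i * ?n ^ (i - 1)) * ((?u z) ^ (s - 2 * i) * ((norm z)\<^sup>2) ^ i)
           + (\<gamma> i * ?n ^ i) * ((?u z) ^ (s - 2 * i - 2) * (norm z)\<^sup>2 * ((norm z)\<^sup>2) ^ i))"
      by (intro app_cong) (simp only: D_sum \<alpha>_def \<gamma>_def distrib_right mult.assoc)
    also have "\<dots> = \<alpha> i * ?n ^ (i - 1) * app L (\<lambda>z. (?u z) ^ (s - 2 * i) * ((norm z)\<^sup>2) ^ i) + \<gamma> i * ?n ^ i * E i"
      unfolding app_add app_cmult E2 ..
    finally show "c i * app L (\<lambda>z. (\<Sum>l\<in>UNIV. D i l z) * ((norm z)\<^sup>2) ^ i)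
      = c i * \<alpha> i * ?n ^ (i - 1) * app L (\<lambda>z. (?u z) ^ (s - 2 * i) * ((norm z)\<^sup>2) ^ i) + c i * \<gamma> i * ?n ^ i * E i"
      by (simp add: algebra_simps)
  qed
  also have "\<dots> = (\<Sum>i\<le>s. c i * \<alpha> i * ?n ^ (i - 1) * app L (\<lambda>z. (?u z) ^ (s - 2 * i) * ((norm z)\<^sup>2) ^ i))
        + (\<Sum>i\<le>s. c i * \<gamma> i * ?n ^ i * E i)" by (rule sum.distrib)
  \<comment> \<open>The differentiation has lowered the power of |y|^2 in this part. Shifting the
    index aligns it with the other part; the term of index 0 is lost because
    \<open>\<alpha> 0 = 0\<close>.\<close>
  also have "(\<Sum>i\<le>s. c i * \<alpha> i * ?n ^ (i - 1) * app L (\<lambda>z. (?u z) ^ (s - 2 * i) * ((norm z)\<^sup>2) ^ i))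
      = (\<Sum>i<s. c (Suc i) * \<alpha> (Suc i) * ?n ^ i * E i)"
    unfolding lessThan_Suc_atMost[symmetric] sum.lessThan_Suc_shift E1 by (simp add: \<alpha>_def)
  also have "(\<Sum>i\<le>s. c i * \<gamma> i * ?n ^ i * E i) = (\<Sum>i<s. c i * \<gamma> i * ?n ^ i * E i)"
    unfolding lessThan_Suc_atMost[symmetric] using s by (simp add: c_def binomial_eq_0)
  also have "(\<Sum>i<s. c (Suc i) * \<alpha> (Suc i) * ?n ^ i * E i) + (\<Sum>i<s. c i * \<gamma> i * ?n ^ i * E i)
      = (\<Sum>i<s. 2 * b * (2 * b + real CARD('d) - 2) * ((((b - 1) gchoose (s - 2 - i)) * real ((s - 2 - i) choose i)) * ?n ^ i * E i))"
    unfolding sum.distrib[symmetric]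
  proof (intro sum.cong refl)
    fix i assume "i \<in> {..<s}"
    then have r: "c (Suc i) * \<alpha> (Suc i) + c i * \<gamma> i
        = 2 * b * (2 * b + real CARD('d) - 2) * (((b - 1) gchoose (s - 2 - i)) * real ((s - 2 - i) choose i))"
      using radial_coeff_recurrence[OF s, of i b "real CARD('d)"] by (simp only: c_def \<alpha>_def \<gamma>_def diff_Suc_1 lessThan_iff)
    have "c (Suc i) * \<alpha> (Suc i) * ?n ^ i * E i + c i * \<gamma> i * ?n ^ i * E i = (c (Suc i) * \<alpha> (Suc i) + c i * \<gamma> i) * (?n ^ i * E i)"
      by (simp only: distrib_right mult.assoc)
    then show "c (Suc i) * \<alpha> (Suc i) * ?n ^ i * E i + c i * \<gamma> i * ?n ^ i * E i
        = 2 * b * (2 * b + real CARD('d) - 2) * ((((b - 1) gchoose (s - 2 - i)) * real ((s - 2 - i) choose i)) * ?n ^ i * E i)"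
      unfolding r by (simp only: mult.assoc)
  qed
  also have "\<dots> = 2 * b * (2 * b + real CARD('d) - 2) * (\<Sum>i<s. (((b - 1) gchoose (s - 2 - i)) * real ((s - 2 - i) choose i)) * ?n ^ i * E i)"
    by (simp only: sum_distrib_left)
  also have "(\<Sum>i<s. (((b - 1) gchoose (s - 2 - i)) * real ((s - 2 - i) choose i)) * ?n ^ i * E i)
      = radial_sum (b - 1) (s - 2) (reweigh (\<lambda>z. (norm z)\<^sup>2) L) y"
    unfolding radial_sum_def app_reweigh E_def
    using s by (intro sum.mono_neutral_right) (auto simp: binomial_eq_0 not_le)
  finally show ?thesis by simp
qed

lemma gbinomial_half_nonzero:
  assumes "s < m"
  shows "(real m - 1 / 2) gchoose s \<noteq> 0"
proof -
  have "real m - 1 / 2 - real i \<noteq> 0" if "i < s" for i using assms that by linarith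
  then show ?thesis by (auto simp: gbinomial_prod_rev)
qed

text \<open>The Laplacian gives the same hypothesis for the functional reweighed by |z|^2, with
  \<open>m - 1\<close> and \<open>s - 2\<close>; the factor it produces is nonzero since
  \<open>2 \<le> s < m\<close>. By induction all terms with \<open>i > 0\<close> vanish, and the
  term that is left has a nonzero half-integral binomial coefficient.\<close>

lemma radial_sum_zero:
  fixes L :: "(real \<times> (real ^ 'd::finite)) list"
  assumes "s < m" "\<And>y. y \<noteq> 0 \<Longrightarrow> radial_sum (real m - 1 / 2) s L y = 0" "2 * i \<le> s" "y \<noteq> 0"
  shows "app L (\<lambda>z. (2 * inner y z) ^ (s - 2 * i) * ((norm z)\<^sup>2) ^ i) = 0"
  using assms
proof (induction s arbitrary: m L i y rule: less_induct)
  case (less s)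
  have high: "app L (\<lambda>z. (2 * inner y z) ^ (s - 2 * Suc i) * ((norm z)\<^sup>2) ^ Suc i) = 0"
    if "2 * Suc i \<le> s" "y \<noteq> 0" for i y
  proof -
    have s: "2 \<le> s" using that by simp
    have "radial_sum (real (m - 1) - 1 / 2) (s - 2) (reweigh (\<lambda>z. (norm z)\<^sup>2) L) y = 0" if "y \<noteq> 0" for y
    proof -
      have "2 * (real m - 1 / 2) * (2 * (real m - 1 / 2) + real CARD('d) - 2) \<noteq> 0"
      proof -
        have "real m \<ge> 3" using s less.prems(1) by linarith
        moreover have "real CARD('d) \<ge> 0" by simp
        ultimately have "2 * (real m - 1 / 2) \<noteq> 0 \<and> 2 * (real m - 1 / 2) + real CARD('d) - 2 \<noteq> 0" by auto
        then show ?thesis by (metis mult_eq_0_iff)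
      qed
      moreover have "real (m - 1) - 1 / 2 = real m - 1 / 2 - 1" using s less.prems(1) by simp
      ultimately show ?thesis using radial_sum_laplacian[OF less.prems(2) s that] by (metis mult_eq_0_iff)
    qed
    then have "app (reweigh (\<lambda>z. (norm z)\<^sup>2) L) (\<lambda>z. (2 * inner y z) ^ (s - 2 - 2 * i) * ((norm z)\<^sup>2) ^ i) = 0"
      using s that less.prems(1) by (intro less.IH[of "s - 2" "m - 1"]) auto
    then show ?thesis by (simp add: mult_ac)
  qed
  show ?case
  proof (cases i)
    case (Suc k)
    then show ?thesis using high[of k y] less.prems by simp
  next
    case 0
    have "0 = radial_sum (real m - 1 / 2) s L y" using less.prems by simp
    also have "\<dots> = (\<Sum>i\<in>{0}. ((real m - 1 / 2) gchoose (s - i)) * real ((s - i) choose i) * ((norm y)\<^sup>2) ^ i *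
       app L (\<lambda>z. (2 * inner y z) ^ (s - 2 * i) * ((norm z)\<^sup>2) ^ i))"
      unfolding radial_sum_def
    proof (intro sum.mono_neutral_right ballI)
      fix i assume i: "i \<in> {..s} - {0}"
      then obtain k where k: "i = Suc k" by (cases i) auto
      show "((real m - 1 / 2) gchoose (s - i)) * real ((s - i) choose i) * ((norm y)\<^sup>2) ^ i *
         app L (\<lambda>z. (2 * inner y z) ^ (s - 2 * i) * ((norm z)\<^sup>2) ^ i) = 0"
      proof (cases "2 * i \<le> s")
        case True
        then show ?thesis using high[of k y] less.prems(4) k by simp
      next
        case False
        then have "(s - i) choose i = 0" by (intro binomial_eq_0) auto
        then show ?thesis by simp
      qed
    qed auto
    also have "\<dots> = ((real m - 1 / 2) gchoose s) * app L (\<lambda>z. (2 * inner y z) ^ s)" by simp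
    finally show ?thesis using gbinomial_half_nonzero[OF less.prems(1)] 0 by simp
  qed
qed

text \<open>Polarisation by differentiation: a derivative of the power in direction of an axis
  splits off one coordinate of \<open>z\<close>. Derivatives are taken at nonzero \<open>y\<close>
  only, so the restriction on \<open>y\<close> survives the induction.\<close>

lemma app_inner_powers_zero:
  fixes L :: "(real \<times> (real ^ 'd::finite)) list"
  assumes "\<And>y. y \<noteq> 0 \<Longrightarrow> app L (\<lambda>z. (inner y z) ^ s) = 0" "\<alpha> \<in> multi_indices s"
  shows "app L (\<lambda>z. monomial z \<alpha>) = 0"
  using assms
proof (induction s arbitrary: L \<alpha>)
  case 0
  have "(axis undefined 1 :: real ^ 'd) \<noteq> 0" by (simp add: axis_eq_0_iff)
  then have "app L (\<lambda>z. 1) = 0" using 0(1) by fastforce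
  then show ?case using 0(2) by (simp add: multi_indices_0 monomial_def)
next
  case (Suc s)
  obtain l where l: "\<alpha> l \<noteq> 0" using Suc.prems(2) by (fastforce simp: multi_indices_def)
  define \<beta> where "\<beta> = \<alpha>(l := \<alpha> l - 1)"
  have \<alpha>: "\<alpha> = \<beta>(l := Suc (\<beta> l))" using l by (auto simp: \<beta>_def)
  have \<beta>: "\<beta> \<in> multi_indices s"
    using Suc.prems(2) sum_upd_Suc[of \<beta> l] unfolding \<alpha>[symmetric] by (simp add: multi_indices_def)
  have "app (reweigh (\<lambda>z. vec_nth z l) L) (\<lambda>z. (inner y z) ^ s) = 0" if y: "y \<noteq> 0" for y
  proof -
    let ?f' = "\<lambda>t z. real (Suc s) * (inner (y + t *\<^sub>R axis l 1) z) ^ s * vec_nth z l"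
    have d: "((\<lambda>t. app L (\<lambda>z. (inner (y + t *\<^sub>R axis l 1) z) ^ Suc s)) has_real_derivative app L (?f' t)) (at t)" for t
    proof (rule has_derivative_app)
      fix z
      have i: "inner (y + t *\<^sub>R axis l 1) z = inner y z + t * vec_nth z l" for t
        by (simp add: inner_add_left inner_axis')
      show "((\<lambda>t. (inner (y + t *\<^sub>R axis l 1) z) ^ Suc s) has_real_derivative ?f' t z) (at t)"
        unfolding i by (rule derivative_eq_intros refl | simp)+
    qed
    have ev: "eventually (\<lambda>t. app L (\<lambda>z. (inner (y + t *\<^sub>R axis l 1) z) ^ Suc s) = 0) (nhds 0)"
      using eventually_line_nonzero[OF y, of "axis l 1"] by eventually_elim (rule Suc.prems(1))
    have "((\<lambda>_. 0) has_real_derivative app L (?f' 0)) (at 0)"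
      using d[of 0] DERIV_cong_ev[OF refl ev refl] by blast
    then have "app L (?f' 0) = 0" using DERIV_unique DERIV_const by blast
    moreover have "app L (?f' 0) = real (Suc s) * app L (\<lambda>z. vec_nth z l * (inner y z) ^ s)"
      unfolding app_cmult[symmetric] by (intro app_cong) (simp add: mult_ac)
    ultimately show ?thesis by (simp del: of_nat_Suc)
  qed
  from Suc.IH[OF this \<beta>] show ?case
    unfolding \<alpha> monomial_upd_Suc by simp
qed

section \<open>Strict definiteness\<close>

definition annihilates :: "nat \<Rightarrow> (real \<times> (real ^ 'd::finite)) list \<Rightarrow> bool" where
  "annihilates N L \<longleftrightarrow> (\<forall>m\<le>N. \<forall>\<alpha>\<in>multi_indices m. app L (\<lambda>x. monomial x \<alpha>) = 0)"

definition dist_form :: "nat \<Rightarrow> (real \<times> (real ^ 'd::finite)) list \<Rightarrow> (real \<times> (real ^ 'd)) list \<Rightarrow> real" where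
  "dist_form m L M = app L (\<lambda>x. app M (\<lambda>y. norm (x - y) ^ m))"

lemma dist_form_append_left: "dist_form m (L @ L') M = dist_form m L M + dist_form m L' M"
  by (simp add: dist_form_def)

lemma dist_form_append_right: "dist_form m L (M @ M') = dist_form m L M + dist_form m L M'"
  by (simp add: dist_form_def app_add)

lemma dist_form_scale_left: "dist_form m (scale_weights t L) M = t * dist_form m L M"
  by (simp add: dist_form_def)

lemma dist_form_scale_right: "dist_form m L (scale_weights t M) = t * dist_form m L M"
  by (simp add: dist_form_def app_cmult)

lemma dist_form_commute: "dist_form m L M = dist_form m M L"
  unfolding dist_form_def by (subst app_swap) (simp add: norm_minus_commute)

lemmas dist_form_bilinear = dist_form_append_left dist_form_append_right dist_form_scale_left dist_form_scale_right

text \<open>The device behind both strictness proofs: where a semidefinite form vanishes, it also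
  vanishes against every test direction.\<close>

lemma nonneg_linear_quadratic_imp_zero:
  fixes B C :: real
  assumes "\<And>t. 0 \<le> 2 * t * B + t\<^sup>2 * C"
  shows "B = 0"
proof (rule ccontr)
  assume B: "B \<noteq> 0"
  \<comment> \<open>Chosen so that \<open>s * C < 2\<close>; then \<open>t = - s * B\<close> makes
    the polynomial negative.\<close>
  define s where "s = 1 / (\<bar>C\<bar> + 1)"
  have s: "s > 0" "s * C < 2" by (auto simp: s_def divide_simps add_nonneg_pos)
  have "2 * (- s * B) * B + (- s * B)\<^sup>2 * C = s * B\<^sup>2 * (s * C - 2)"
    by (simp add: algebra_simps power2_eq_square)
  moreover have "s * B\<^sup>2 * (s * C - 2) < 0"
    using s B by (intro mult_pos_neg) auto
  ultimately show False using assms[of "- s * B"] by simp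
qed

text \<open>\<open>w\<close> holds the Taylor coefficients of the kernel at the origin. In degrees
  up to \<open>2 * r - 2\<close> the odd terms are absent by regularity and the even powers of the
  distance are polynomials, which is what \<open>low_terms\<close> records.\<close>

locale radial_kernel =
  fixes \<psi> :: "real \<Rightarrow> real" and \<Psi> :: "real fps" and k :: "real ^ 'd::finite \<Rightarrow> real ^ 'd \<Rightarrow> real"
    and r :: nat and w :: "'d multi_index \<Rightarrow> 'd multi_index \<Rightarrow> real"
  assumes radial: "\<And>y z. k y z = \<psi> (norm (y - z))"
    and pd: "positive_definite_kernel k"
    and analytic: "\<psi> has_fps_expansion \<Psi>"
    and r_pos: "r \<ge> 1" and regular: "fps_nth \<Psi> (2 * r - 1) \<noteq> 0"
    and low_terms: "\<And>m x y. m \<le> 2 * r - 2 \<Longrightarrow> fps_nth \<Psi> m * norm (x - y) ^ m =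
      (\<Sum>u\<le>m. \<Sum>\<alpha>\<in>multi_indices u. \<Sum>\<beta>\<in>multi_indices (m - u). w \<alpha> \<beta> * monomial x \<alpha> * monomial y \<beta>)"
begin

section \<open>The rescaled kernel form, its expansion and the distance form\<close>

lemma kernel_form_nonneg:
  fixes L :: "(real \<times> (real ^ 'd)) list"
  assumes "0 \<le> \<epsilon>"
  shows "0 \<le> app L (\<lambda>x. app L (\<lambda>y. \<psi> (\<epsilon> * norm (x - y))))"
proof -
  have "norm (\<epsilon> *\<^sub>R x - \<epsilon> *\<^sub>R y) = \<epsilon> * norm (x - y)" for x y :: "real ^ 'd"
    using assms by (simp add: scaleR_diff_right[symmetric])
  then show ?thesis
    using positive_definite_kernel_app[OF pd, of "move_points (\<lambda>x :: real ^ 'd. \<epsilon> *\<^sub>R x) L"]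
    by (simp add: radial)
qed

lemma kernel_form_expansion:
  fixes L M :: "(real \<times> (real ^ 'd)) list"
  shows "(\<lambda>\<epsilon>. app L (\<lambda>x. app M (\<lambda>y. \<psi> (\<epsilon> * norm (x - y))))) has_fps_expansion
     Abs_fps (\<lambda>m. fps_nth \<Psi> m * dist_form m L M)"
proof -
  have ex: "(\<lambda>\<epsilon>. \<psi> (\<epsilon> * norm (x - y))) has_fps_expansion Abs_fps (\<lambda>m. fps_nth \<Psi> m * norm (x - y) ^ m)" for x y :: "real ^ 'd"
    using has_fps_expansion_scale[OF analytic, of "norm (x - y)"] by (simp add: mult.commute)
  have "(\<lambda>\<epsilon>. app L (\<lambda>x. app M (\<lambda>y. \<psi> (\<epsilon> * norm (x - y))))) has_fps_expansion
     Abs_fps (\<lambda>m. app L (\<lambda>x. fps_nth (Abs_fps (\<lambda>m. app M (\<lambda>y. fps_nth (Abs_fps (\<lambda>m. fps_nth \<Psi> m * norm (x - y) ^ m)) m))) m))"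
    by (intro app_has_fps_expansion ex)
  moreover have "\<dots> = Abs_fps (\<lambda>m. fps_nth \<Psi> m * dist_form m L M)"
    by (intro fps_ext) (simp add: dist_form_def app_cmult)
  ultimately show ?thesis by simp
qed

lemma low_dist_form:
  assumes "m \<le> 2 * r - 2"
  shows "fps_nth \<Psi> m * dist_form m L M = (\<Sum>u\<le>m. \<Sum>\<alpha>\<in>multi_indices u. \<Sum>\<beta>\<in>multi_indices (m - u).
     w \<alpha> \<beta> * app L (\<lambda>x. monomial x \<alpha>) * app M (\<lambda>x. monomial x \<beta>))"
proof -
  have "fps_nth \<Psi> m * dist_form m L M = app L (\<lambda>x. app M (\<lambda>y. fps_nth \<Psi> m * norm (x - y) ^ m))"
    by (simp add: dist_form_def app_cmult)
  also have "\<dots> = (\<Sum>u\<le>m. \<Sum>\<alpha>\<in>multi_indices u. \<Sum>\<beta>\<in>multi_indices (m - u).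
     app L (\<lambda>x. app M (\<lambda>y. w \<alpha> \<beta> * monomial x \<alpha> * monomial y \<beta>)))"
    unfolding low_terms[OF assms] app_sum ..
  also have "\<dots> = (\<Sum>u\<le>m. \<Sum>\<alpha>\<in>multi_indices u. \<Sum>\<beta>\<in>multi_indices (m - u).
     w \<alpha> \<beta> * app L (\<lambda>x. monomial x \<alpha>) * app M (\<lambda>x. monomial x \<beta>))"
    by (intro sum.cong refl) (simp add: app_cmult app_cmult_right)
  finally show ?thesis .
qed

lemma low_dist_form_zero:
  fixes L M :: "(real \<times> (real ^ 'd)) list"
  assumes "annihilates (r - 1) L" "annihilates (r - 1) M" "m \<le> 2 * r - 2"
  shows "fps_nth \<Psi> m * dist_form m L M = 0"
  unfolding low_dist_form[OF assms(3)]
proof (intro sum.neutral ballI)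
  fix u and \<alpha> \<beta> :: "'d multi_index" assume u: "u \<in> {..m}" and ab: "\<alpha> \<in> multi_indices u" "\<beta> \<in> multi_indices (m - u)"
  have "u \<le> r - 1 \<or> m - u \<le> r - 1" using assms(3) by auto
  then show "w \<alpha> \<beta> * app L (\<lambda>x. monomial x \<alpha>) * app M (\<lambda>x. monomial x \<beta>) = 0"
    using assms(1,2) ab unfolding annihilates_def by auto
qed

text \<open>On functionals without moments of degree below \<open>r\<close> the expansion of the
  kernel form starts no earlier than at order \<open>2 * r - 1\<close>, and the coefficient of that
  order inherits its sign.\<close>

lemma dist_form_nonneg:
  fixes L :: "(real \<times> (real ^ 'd)) list"
  assumes "annihilates (r - 1) L"
  shows "0 \<le> fps_nth \<Psi> (2 * r - 1) * dist_form (2 * r - 1) L L"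
proof -
  have "0 \<le> fps_nth (Abs_fps (\<lambda>m. fps_nth \<Psi> m * dist_form m L L)) (2 * r - 1)"
  proof (rule leading_coeff_nonneg[OF kernel_form_expansion])
    show "fps_nth (Abs_fps (\<lambda>m. fps_nth \<Psi> m * dist_form m L L)) m = 0" if "m < 2 * r - 1" for m
      using low_dist_form_zero[OF assms assms, of m] that by simp
    show "eventually (\<lambda>t. 0 \<le> app L (\<lambda>x. app L (\<lambda>y. \<psi> (t * norm (x - y))))) (at_right 0)"
      using eventually_at_right_less[of "0::real"]
      by eventually_elim (auto intro: kernel_form_nonneg)
  qed
  then show ?thesis by simp
qed

lemma dist_form_radical:
  fixes L M :: "(real \<times> (real ^ 'd)) list"
  assumes L: "annihilates (r - 1) L" and M: "annihilates (r - 1) M"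
    and z: "dist_form (2 * r - 1) L L = 0"
  shows "dist_form (2 * r - 1) L M = 0"
proof -
  define N where "N = 2 * r - 1"
  have "0 \<le> 2 * t * (fps_nth \<Psi> (2 * r - 1) * dist_form (2 * r - 1) L M)
      + t\<^sup>2 * (fps_nth \<Psi> (2 * r - 1) * dist_form (2 * r - 1) M M)" for t
  proof -
    have "annihilates (r - 1) (L @ scale_weights t M)"
      using L M by (simp add: annihilates_def)
    from dist_form_nonneg[OF this] show ?thesis
      unfolding N_def[symmetric] by (simp add: dist_form_bilinear z[folded N_def] dist_form_commute[of _ M L] algebra_simps power2_eq_square)
  qed
  then have "fps_nth \<Psi> (2 * r - 1) * dist_form (2 * r - 1) L M = 0"
    by (rule nonneg_linear_quadratic_imp_zero)
  then show ?thesis using regular by simp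
qed

text \<open>If the form vanishes at \<open>L\<close>, then \<open>y \<mapsto> \<Sum>c norm (x - y) ^ (2 r - 1)\<close> coincides with a polynomial
  on every finite set; this is impossible near a node of nonzero weight.\<close>

lemma dist_form_strict:
  fixes L :: "(real \<times> (real ^ 'd)) list"
  assumes L: "annihilates (r - 1) L" and z: "dist_form (2 * r - 1) L L = 0"
  shows "weight L x0 = 0"
proof -
  define N where "N = 2 * r - 1"
  obtain T :: "(real \<times> real) list" where T: "\<And>m. m \<le> N \<Longrightarrow> app T (\<lambda>t. t ^ m) = 0"
    "\<And>m. m \<le> N \<Longrightarrow> app T (\<lambda>t. sgn t * t ^ m) \<noteq> 0"
    using odd_functional[of N] by metis
  define l :: 'd where "l = undefined"
  define e :: "real ^ 'd" where "e = axis l 1"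
  have ne: "norm e = 1" by (simp add: e_def)
  \<comment> \<open>A copy of \<open>T\<close> of scale \<delta> on the line through
    \<open>x0\<close>. Monomials restricted to this line are polynomials in the line parameter, so
    \<open>T\<close> annihilates them.\<close>
  define M where "M \<delta> = move_points (\<lambda>t. x0 + (\<delta> * t) *\<^sub>R e) T" for \<delta>
  have annM: "annihilates (r - 1) (M \<delta>)" for \<delta>
    unfolding annihilates_def
  proof (intro allI impI ballI)
    fix m and \<alpha> :: "'d multi_index" assume m: "m \<le> r - 1" and \<alpha>: "\<alpha> \<in> multi_indices m"
    define P where "P = (\<Prod>l'\<in>UNIV - {l}. vec_nth x0 l' ^ \<alpha> l')"
    have "monomial (x0 + (\<delta> * t) *\<^sub>R e) \<alpha> = (\<Sum>j\<le>\<alpha> l. (P * real (\<alpha> l choose j) * \<delta> ^ j * vec_nth x0 l ^ (\<alpha> l - j)) * t ^ j)" for t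
    proof -
      have "monomial (x0 + (\<delta> * t) *\<^sub>R e) \<alpha> = (vec_nth x0 l + \<delta> * t) ^ \<alpha> l * P"
        unfolding monomial_def P_def
        by (subst prod.remove[of _ l]) (auto simp: e_def axis_def intro!: prod.cong)
      also have "(vec_nth x0 l + \<delta> * t) ^ \<alpha> l = (\<Sum>j\<le>\<alpha> l. real (\<alpha> l choose j) * (\<delta> * t) ^ j * vec_nth x0 l ^ (\<alpha> l - j))"
        by (subst add.commute) (rule binomial_ring)
      finally show ?thesis by (simp add: sum_distrib_left power_mult_distrib mult_ac)
    qed
    then have "app (M \<delta>) (\<lambda>x. monomial x \<alpha>) = (\<Sum>j\<le>\<alpha> l. (P * real (\<alpha> l choose j) * \<delta> ^ j * vec_nth x0 l ^ (\<alpha> l - j)) * app T (\<lambda>t. t ^ j))"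
      by (simp add: M_def app_sum app_cmult)
    also have "\<dots> = 0"
    proof (intro sum.neutral ballI)
      fix j assume "j \<in> {..\<alpha> l}"
      then have "j \<le> N" using multi_index_le[OF \<alpha>, of l] m r_pos by (auto simp: N_def)
      then show "P * real (\<alpha> l choose j) * \<delta> ^ j * vec_nth x0 l ^ (\<alpha> l - j) * app T (\<lambda>t. t ^ j) = 0" by (simp add: T(1))
    qed
    finally show "app (M \<delta>) (\<lambda>x. monomial x \<alpha>) = 0" .
  qed
  \<comment> \<open>The nodes different from \<open>x0\<close> give an analytic function of \<delta>
    whose coefficient of order \<open>N\<close> vanishes, because \<open>T\<close> annihilates
    \<open>t ^ N\<close>. The node \<open>x0\<close> itself contributes its weight times
    \<open>\<kappa> * \<delta> ^ N\<close>, and \<kappa> is nonzero.\<close>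
  define L' where "L' = filter (\<lambda>p. snd p \<noteq> x0) L"
  define \<kappa> where "\<kappa> = app T (\<lambda>t. sgn t * t ^ N)"
  define f where "f \<delta> = app L' (\<lambda>x. app T (\<lambda>t. norm ((x - x0) - \<delta> *\<^sub>R (t *\<^sub>R e)) ^ N))" for \<delta>
  have zero: "f \<delta> + weight L x0 * \<kappa> * \<delta> ^ N = 0" if "0 < \<delta>" for \<delta>
  proof -
    have abs: "norm (- (\<delta> *\<^sub>R (t *\<^sub>R e))) ^ N = \<delta> ^ N * (sgn t * t ^ N)" for t
    proof -
      have "N = 2 * (r - 1) + 1" using r_pos by (simp add: N_def)
      then have "\<bar>t\<bar> ^ N = sgn t * t ^ N" by (simp only: abs_power_odd)
      then show ?thesis using that ne by (simp add: power_mult_distrib abs_mult)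
    qed
    have "0 = dist_form N L (M \<delta>)" using dist_form_radical[OF L annM z] by (simp add: N_def)
    also have "\<dots> = app L (\<lambda>x. app T (\<lambda>t. norm ((x - x0) - \<delta> *\<^sub>R (t *\<^sub>R e)) ^ N))"
      unfolding dist_form_def M_def by (simp add: algebra_simps)
    also have "\<dots> = f \<delta> + weight L x0 * app T (\<lambda>t. norm ((x0 - x0) - \<delta> *\<^sub>R (t *\<^sub>R e)) ^ N)"
      unfolding f_def L'_def by (rule app_remove_point)
    also have "app T (\<lambda>t. norm ((x0 - x0) - \<delta> *\<^sub>R (t *\<^sub>R e)) ^ N) = \<kappa> * \<delta> ^ N"
      using abs by (simp add: app_cmult \<kappa>_def)
    finally show ?thesis by simp
  qed
  define G where "G = Abs_fps (\<lambda>m. app L' (\<lambda>x. app T (\<lambda>t. norm_coeff r (x - x0) e m * t ^ m)))"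
  have fG: "f has_fps_expansion G"
  proof -
    have "(\<lambda>\<delta>. norm ((x - x0) - \<delta> *\<^sub>R (t *\<^sub>R e)) ^ N) has_fps_expansion Abs_fps (\<lambda>m. norm_coeff r (x - x0) e m * t ^ m)"
      if "x \<in> snd ` set L'" for x t
      using has_fps_expansion_scale[OF norm_has_fps_expansion[of "x - x0" r e], of t] that r_pos
      by (auto simp: L'_def N_def mult.commute)
    then have "f has_fps_expansion Abs_fps (\<lambda>m. app L' (\<lambda>x. fps_nth (Abs_fps (\<lambda>m. app T (\<lambda>t. fps_nth (Abs_fps (\<lambda>m. norm_coeff r (x - x0) e m * t ^ m)) m))) m))"
      unfolding f_def by (intro app_has_fps_expansion)
    then show ?thesis by (simp add: G_def)
  qed
  have "(\<lambda>\<delta>. f \<delta> + weight L x0 * \<kappa> * \<delta> ^ N) has_fps_expansion G + fps_const (weight L x0 * \<kappa>) * fps_X ^ N"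
    by (intro has_fps_expansion_add fG has_fps_expansion_cmult_left has_fps_expansion_fps_X_power)
  moreover have "eventually (\<lambda>\<delta>. f \<delta> + weight L x0 * \<kappa> * \<delta> ^ N = 0) (at_right 0)"
    using eventually_at_right_less[of "0::real"] by eventually_elim (rule zero)
  ultimately have "G + fps_const (weight L x0 * \<kappa>) * fps_X ^ N = 0"
    by (rule fps_expansion_zero_right)
  then have "fps_nth (G + fps_const (weight L x0 * \<kappa>) * fps_X ^ N) N = 0" by simp
  then have "fps_nth G N + weight L x0 * \<kappa> = 0" by (simp add: fps_X_power_nth)
  moreover have "fps_nth G N = 0" by (simp add: G_def app_cmult T(1) app_zero)
  moreover have "\<kappa> \<noteq> 0" unfolding \<kappa>_def by (rule T(2)) simp
  ultimately show ?thesis by simp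
qed

text \<open>\<open>b\<close> is a coefficient vector of degree less than \<open>r\<close> that is isotropic for \<open>w\<close>; its leading part
  \<open>a\<close> is completed to a functional that reproduces \<open>b\<close> at leading order.\<close>

lemma leading_part_nonneg:
  fixes b :: "'d multi_index \<Rightarrow> real" and a :: "(real \<times> (real ^ 'd)) list"
  assumes s: "s < r"
    and iso: "(\<Sum>i\<le>s. \<Sum>j\<le>s. \<Sum>\<alpha>\<in>multi_indices i. \<Sum>\<beta>\<in>multi_indices j. w \<alpha> \<beta> * b \<alpha> * b \<beta>) = 0"
    and a: "\<And>m \<alpha>. m \<le> 2 * r - 1 \<Longrightarrow> \<alpha> \<in> multi_indices m \<Longrightarrow>
        app a (\<lambda>x. monomial x \<alpha>) = (if m = s then b \<alpha> else 0)"
  shows "0 \<le> fps_nth \<Psi> (2 * r - 1) * dist_form (2 * r - 1) a a"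
proof -
  \<comment> \<open>\<open>L i\<close> will carry the part of \<open>b\<close> of degree
    \<open>i\<close> and no other moments up to degree \<open>2 * r - 1\<close>, so that different
    degrees can be scaled separately.\<close>
  have "\<exists>L. \<forall>m \<alpha>. m \<le> 2 * r - 1 \<longrightarrow> \<alpha> \<in> multi_indices m \<longrightarrow>
      app L (\<lambda>x. monomial x \<alpha>) = (if m = i then b \<alpha> else 0)" for i
  proof -
    obtain L :: "(real \<times> (real ^ 'd)) list" where
      L: "\<And>\<alpha> m. \<alpha> \<in> multi_indices m \<Longrightarrow> m \<le> 2 * r - 1 \<Longrightarrow>
        app L (\<lambda>x. monomial x \<alpha>) = (if (\<Sum>l\<in>UNIV. \<alpha> l) = i then b \<alpha> else 0)"
      using moment_functional[of "2 * r - 1" "\<lambda>\<alpha>. if (\<Sum>l\<in>UNIV. \<alpha> l) = i then b \<alpha> else 0"] by metis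
    show ?thesis by (intro exI[of _ L]) (auto simp: L, auto simp: multi_indices_def)
  qed
  then obtain L0 where L0: "\<And>i m \<alpha>. m \<le> 2 * r - 1 \<Longrightarrow> \<alpha> \<in> multi_indices m \<Longrightarrow>
      app (L0 i) (\<lambda>x. monomial x \<alpha>) = (if m = i then b \<alpha> else 0)" by metis
  define L where "L i = (if i = s then a else L0 i)" for i
  have L: "app (L i) (\<lambda>x. monomial x \<alpha>) = (if m = i then b \<alpha> else 0)"
    if "m \<le> 2 * r - 1" "\<alpha> \<in> multi_indices m" for i m \<alpha>
    using a[OF that] L0[OF that] by (simp add: L_def)
  define B where "B i j = (\<Sum>\<alpha>\<in>multi_indices i. \<Sum>\<beta>\<in>multi_indices j. w \<alpha> \<beta> * b \<alpha> * b \<beta>)" for i j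
  have form: "fps_nth \<Psi> m * dist_form m (L i) (L j) = (if m = i + j then B i j else 0)"
    if m: "m \<le> 2 * r - 2" for m i j
  proof -
    have "fps_nth \<Psi> m * dist_form m (L i) (L j) = (\<Sum>u\<le>m. \<Sum>\<alpha>\<in>multi_indices u. \<Sum>\<beta>\<in>multi_indices (m - u).
       w \<alpha> \<beta> * (if u = i then b \<alpha> else 0) * (if m - u = j then b \<beta> else 0))"
      unfolding low_dist_form[OF m]
    proof (intro sum.cong refl)
      fix u and \<alpha> \<beta> :: "'d multi_index"
      assume u: "u \<in> {..m}" and ab: "\<alpha> \<in> multi_indices u" "\<beta> \<in> multi_indices (m - u)"
      have "u \<le> 2 * r - 1" "m - u \<le> 2 * r - 1" using u m by auto
      then show "w \<alpha> \<beta> * app (L i) (\<lambda>x. monomial x \<alpha>) * app (L j) (\<lambda>x. monomial x \<beta>)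
          = w \<alpha> \<beta> * (if u = i then b \<alpha> else 0) * (if m - u = j then b \<beta> else 0)"
        using L[OF _ ab(1)] L[OF _ ab(2)] by simp
    qed
    also have "\<dots> = (\<Sum>u\<le>m. if u = i then (if m - u = j then B i j else 0) else 0)"
      by (intro sum.cong refl) (auto simp: B_def)
    also have "\<dots> = (if i \<le> m \<and> m - i = j then B i j else 0)" by simp
    also have "\<dots> = (if m = i + j then B i j else 0)" by (cases "i \<le> m") auto
    finally show ?thesis .
  qed
  define F where "F i j = Abs_fps (\<lambda>m. fps_nth \<Psi> m * dist_form m (L i) (L j))" for i j
  define f where "f i j \<epsilon> = app (L i) (\<lambda>x. app (L j) (\<lambda>y. \<psi> (\<epsilon> * norm (x - y))))" for i j \<epsilon>
  have fF: "(f i j) has_fps_expansion (F i j)" for i j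
    unfolding f_def F_def by (rule kernel_form_expansion)
  \<comment> \<open>The kernel form at the sum of the \<open>L i\<close> with weights
    \<open>\<epsilon> ^ (s - i)\<close>. Through these weights all contributions of orders below
    \<open>2 * r - 1\<close> meet in the single power \<open>\<epsilon> ^ (2 * s)\<close>, where
    they add up to the isotropic value 0.\<close>
  define g where "g \<epsilon> = (\<Sum>i\<le>s. \<Sum>j\<le>s. \<epsilon> ^ (2 * s - (i + j)) * f i j \<epsilon>)" for \<epsilon>
  define G where "G = (\<Sum>i\<le>s. \<Sum>j\<le>s. fps_X ^ (2 * s - (i + j)) * F i j)"
  have gG: "g has_fps_expansion G"
    unfolding g_def G_def
    by (intro has_fps_expansion_sum has_fps_expansion_mult has_fps_expansion_fps_X_power fF)
  have g_nonneg: "0 \<le> g \<epsilon>" if "0 < \<epsilon>" for \<epsilon>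
  proof -
    define C where "C = concat (map (\<lambda>i. scale_weights (\<epsilon> ^ (s - i)) (L i)) [0..<Suc s])"
    have C: "app C h = (\<Sum>i\<le>s. \<epsilon> ^ (s - i) * app (L i) h)" for h
      unfolding C_def app_concat_map
      by (simp add: interv_sum_list_conv_sum_set_nat atLeast0LessThan lessThan_Suc_atMost del: upt_Suc)
    have "0 \<le> app C (\<lambda>x. app C (\<lambda>y. \<psi> (\<epsilon> * norm (x - y))))"
      by (rule kernel_form_nonneg) (use that in simp)
    also have "\<dots> = (\<Sum>i\<le>s. \<Sum>j\<le>s. (\<epsilon> ^ (s - i) * \<epsilon> ^ (s - j)) * f j i \<epsilon>)"
      unfolding C app_sum app_cmult f_def by (simp add: sum_distrib_left mult.assoc)
    also have "\<dots> = (\<Sum>i\<le>s. \<Sum>j\<le>s. (\<epsilon> ^ (s - i) * \<epsilon> ^ (s - j)) * f i j \<epsilon>)"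
      by (subst sum.swap) (simp only: mult.commute)
    also have "\<dots> = g \<epsilon>"
      unfolding g_def
    proof (intro sum.cong refl)
      fix i j assume "i \<in> {..s}" "j \<in> {..s}"
      then have "(s - i) + (s - j) = 2 * s - (i + j)" by auto
      then show "\<epsilon> ^ (s - i) * \<epsilon> ^ (s - j) * f i j \<epsilon> = \<epsilon> ^ (2 * s - (i + j)) * f i j \<epsilon>"
        by (simp only: power_add[symmetric])
    qed
    finally show ?thesis .
  qed
  have G_nth: "fps_nth G m = (\<Sum>i\<le>s. \<Sum>j\<le>s. if m < 2 * s - (i + j) then 0 else
      fps_nth \<Psi> (m - (2 * s - (i + j))) * dist_form (m - (2 * s - (i + j))) (L i) (L j))" for m
    unfolding G_def fps_sum_nth fps_X_power_mult_nth F_def fps_nth_Abs_fps ..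
  have low: "fps_nth G m = 0" if "m < 2 * r - 1" for m
  proof -
    have "fps_nth G m = (\<Sum>i\<le>s. \<Sum>j\<le>s. if m = 2 * s then B i j else 0)"
      unfolding G_nth
    proof (intro sum.cong refl)
      fix i j assume ij: "i \<in> {..s}" "j \<in> {..s}"
      show "(if m < 2 * s - (i + j) then 0 else
          fps_nth \<Psi> (m - (2 * s - (i + j))) * dist_form (m - (2 * s - (i + j))) (L i) (L j)) = (if m = 2 * s then B i j else 0)"
      proof (cases "m < 2 * s - (i + j)")
        case True
        then have "m \<noteq> 2 * s" by auto
        then show ?thesis using True by simp
      next
        case False
        have "m - (2 * s - (i + j)) \<le> 2 * r - 2" using that by linarith
        moreover have "m - (2 * s - (i + j)) = i + j \<longleftrightarrow> m = 2 * s" using False ij by auto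
        ultimately show ?thesis using False form[of "m - (2 * s - (i + j))" i j] by (simp only: if_False)
      qed
    qed
    also have "\<dots> = 0"
    proof (cases "m = 2 * s")
      case True
      then show ?thesis using iso unfolding B_def by (simp only: if_True simp_thms)
    qed (simp only: if_False simp_thms sum.neutral_const)
    finally show ?thesis .
  qed
  have "0 \<le> fps_nth G (2 * r - 1)"
  proof (rule leading_coeff_nonneg[OF gG low])
    show "eventually (\<lambda>t. 0 \<le> g t) (at_right 0)"
      using eventually_at_right_less[of "0::real"] by eventually_elim (rule g_nonneg)
  qed
  \<comment> \<open>For \<open>i + j < 2 * s\<close> the form is taken at an order at most
    \<open>2 * r - 2\<close>, where it could only contribute if that order were
    \<open>i + j\<close>; this would give \<open>2 * r - 1 = 2 * s\<close>, against parity.\<close>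
  also have "fps_nth G (2 * r - 1) = (\<Sum>i\<le>s. \<Sum>j\<le>s. if i = s \<and> j = s then fps_nth \<Psi> (2 * r - 1) * dist_form (2 * r - 1) a a else 0)"
    unfolding G_nth
  proof (intro sum.cong refl)
    fix i j assume ij: "i \<in> {..s}" "j \<in> {..s}"
    let ?m = "2 * r - 1 - (2 * s - (i + j))"
    have nl: "\<not> 2 * r - 1 < 2 * s - (i + j)" using s by linarith
    show "(if 2 * r - 1 < 2 * s - (i + j) then 0 else fps_nth \<Psi> ?m * dist_form ?m (L i) (L j))
        = (if i = s \<and> j = s then fps_nth \<Psi> (2 * r - 1) * dist_form (2 * r - 1) a a else 0)"
    proof (cases "i = s \<and> j = s")
      case True
      then show ?thesis using nl by (simp add: L_def)
    next
      case False
      then have "i + j < 2 * s" using ij by auto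
      then have m: "?m \<le> 2 * r - 2" "?m \<noteq> i + j"
      proof -
        assume lt: "i + j < 2 * s"
        then show "?m \<le> 2 * r - 2" by linarith
        show "?m \<noteq> i + j"
        proof
          assume "?m = i + j"
          then have "2 * r = 2 * s + 1" using lt nl s by linarith
          then show False by presburger
        qed
      qed
      then have "fps_nth \<Psi> ?m * dist_form ?m (L i) (L j) = 0"
        using form[OF m(1), of i j] by (simp only: if_False)
      then show ?thesis using False nl by (simp only: if_False)
    qed
  qed
  also have "\<dots> = fps_nth \<Psi> (2 * r - 1) * dist_form (2 * r - 1) a a"
  proof -
    have "(\<Sum>j\<le>s. if i = s \<and> j = s then c else 0) = (if i = s then c else 0)" for i and c :: real
      by (cases "i = s") simp_all
    then show ?thesis by (simp only: sum.delta finite_atMost atMost_iff order_refl if_True)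
  qed
  finally show ?thesis .
qed

text \<open>Rescaled copies of \<open>a\<close> concentrate at 0, where \<open>a\<close> acts as a differential operator on
  \<open>norm y ^ (2 r - 1)\<close>.\<close>

lemma leading_part_coeff_zero:
  fixes b :: "'d multi_index \<Rightarrow> real" and a :: "(real \<times> (real ^ 'd)) list"
  assumes s: "s < r"
    and iso: "(\<Sum>i\<le>s. \<Sum>j\<le>s. \<Sum>\<alpha>\<in>multi_indices i. \<Sum>\<beta>\<in>multi_indices j. w \<alpha> \<beta> * b \<alpha> * b \<beta>) = 0"
    and a: "\<And>m \<alpha>. m \<le> 2 * r - 1 \<Longrightarrow> \<alpha> \<in> multi_indices m \<Longrightarrow>
        app a (\<lambda>x. monomial x \<alpha>) = (if m = s then b \<alpha> else 0)"
    and y: "y \<noteq> 0"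
  shows "app a (\<lambda>z. norm_coeff r y z s) = 0"
proof -
  define N where "N = 2 * r - 1"
  have sN: "2 * s < N" "s \<le> N" using s by (auto simp: N_def)
  obtain T :: "(real \<times> real) list" where T: "\<And>m. m \<le> N \<Longrightarrow> app T (\<lambda>t. t ^ m) = 0"
    "\<And>m. m \<le> N \<Longrightarrow> app T (\<lambda>t. sgn t * t ^ m) \<noteq> 0" "0 \<notin> snd ` set T"
    using odd_functional[of N] by metis
  \<comment> \<open>The test functional: \<open>T\<close> on the line spanned by \<open>y\<close>.
    Its nodes avoid 0, so the norm is analytic near each of them, and all its moments up to degree
    \<open>N\<close> vanish.\<close>
  define c where "c = move_points (\<lambda>t. t *\<^sub>R y) T"
  have c0: "x \<noteq> 0" if "x \<in> snd ` set c" for x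
    using that T(3) y by (force simp: c_def move_points_def)
  have mon: "monomial (t *\<^sub>R x) \<alpha> = t ^ m * monomial x \<alpha>" if "\<alpha> \<in> multi_indices m" for t m \<alpha> and x :: "real ^ 'd"
  proof -
    have "(\<Prod>l\<in>UNIV. t ^ \<alpha> l) = t ^ m" using that by (simp add: power_sum[symmetric] multi_indices_def)
    then show ?thesis by (simp add: monomial_def power_mult_distrib prod.distrib)
  qed
  have c_ann: "app c (\<lambda>x. monomial x \<alpha>) = 0" if "m \<le> N" "\<alpha> \<in> multi_indices m" for m \<alpha>
    by (simp add: c_def mon[OF that(2)] app_cmult_right T(1)[OF that(1)])
  define h where "h \<delta> = app a (\<lambda>z. app c (\<lambda>x. norm (x - \<delta> *\<^sub>R z) ^ N))" for \<delta>
  define H where "H = Abs_fps (\<lambda>m. app a (\<lambda>z. app c (\<lambda>x. norm_coeff r x z m)))"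
  have hH: "h has_fps_expansion H"
  proof -
    have ex: "(\<lambda>\<delta>. norm (x - \<delta> *\<^sub>R z) ^ N) has_fps_expansion Abs_fps (norm_coeff r x z)" if "x \<in> snd ` set c" for x z
      using norm_has_fps_expansion[OF c0[OF that] r_pos] by (simp add: N_def)
    have "h has_fps_expansion Abs_fps (\<lambda>m. app a (\<lambda>z. fps_nth (Abs_fps (\<lambda>m. app c (\<lambda>x. fps_nth (Abs_fps (norm_coeff r x z)) m))) m))"
      unfolding h_def by (intro app_has_fps_expansion ex)
    then show ?thesis by (simp add: H_def)
  qed
  have H_low: "fps_nth H m = 0" if "m < s" for m
  proof -
    have "fps_nth H m = app c (\<lambda>x. app a (\<lambda>z. norm_coeff r x z m))"
      unfolding H_def by (simp add: app_swap[of a])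
    also have "\<dots> = 0"
      by (rule app_zero, rule app_norm_coeff_low) (use that sN a[of m] in \<open>auto simp: N_def\<close>)
    finally show ?thesis .
  qed
  define q where "q = fps_nth \<Psi> N"
  \<comment> \<open>Moving \<open>a\<close> by the factor \<delta>, adding
    \<open>t * \<delta> ^ s\<close> times \<open>c\<close> and dividing by
    \<open>\<delta> ^ s\<close> leaves the moments of \<open>a\<close> unchanged, so nonnegativity
    applies to the result. Up to a positive factor its three terms have orders at least
    \<open>N\<close>, \<open>2 * s\<close> and \<open>2 * s\<close>. As \<open>2 * s < N\<close>,
    the lowest order is a quadratic polynomial in \<open>t\<close> without constant term.\<close>
  have "0 \<le> 2 * t * (q * fps_nth H s) + t\<^sup>2 * (q * dist_form N c c)" for t
  proof -
    define g where "g \<delta> = q * dist_form N a a * \<delta> ^ N + 2 * t * q * (\<delta> ^ s * h \<delta>) + t\<^sup>2 * q * dist_form N c c * \<delta> ^ (2 * s)" for \<delta>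
    define G where "G = fps_const (q * dist_form N a a) * fps_X ^ N + fps_const (2 * t * q) * (fps_X ^ s * H)
        + fps_const (t\<^sup>2 * q * dist_form N c c) * fps_X ^ (2 * s)"
    have gG: "g has_fps_expansion G"
      unfolding g_def G_def
      by (intro has_fps_expansion_add has_fps_expansion_cmult_left has_fps_expansion_mult has_fps_expansion_fps_X_power hH)
    have G_nth: "fps_nth G m = (if m = N then q * dist_form N a a else 0) + 2 * t * q * (if m < s then 0 else fps_nth H (m - s))
        + (if m = 2 * s then t\<^sup>2 * q * dist_form N c c else 0)" for m
      by (simp add: G_def fps_X_power_mult_nth fps_X_power_nth)
    have "0 \<le> fps_nth G (2 * s)"
    proof (rule leading_coeff_nonneg[OF gG])
      show "fps_nth G m = 0" if "m < 2 * s" for m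
        using that sN H_low[of "m - s"] by (auto simp: G_nth)
      show "eventually (\<lambda>\<delta>. 0 \<le> g \<delta>) (at_right 0)"
        using eventually_at_right_less[of "0::real"]
      proof eventually_elim
        case (elim \<delta>)
        define C where "C = scale_weights (1 / \<delta> ^ s) (move_points (\<lambda>z. \<delta> *\<^sub>R z) a @ scale_weights (t * \<delta> ^ s) c)"
        have "app C (\<lambda>x. monomial x \<alpha>) = (if m = s then b \<alpha> else 0)" if "m \<le> 2 * r - 1" "\<alpha> \<in> multi_indices m" for m \<alpha>
          using that a[OF that] c_ann[of m \<alpha>] elim by (simp add: C_def mon[OF that(2)] app_cmult N_def)
        from leading_part_nonneg[OF s iso this]
        have "0 \<le> q * dist_form N C C" by (simp add: q_def N_def)
        also have "dist_form N C C = (1 / \<delta> ^ s)\<^sup>2 * (dist_form N (move_points (\<lambda>z. \<delta> *\<^sub>R z) a) (move_points (\<lambda>z. \<delta> *\<^sub>R z) a)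
            + 2 * (t * \<delta> ^ s) * dist_form N (move_points (\<lambda>z. \<delta> *\<^sub>R z) a) c + (t * \<delta> ^ s)\<^sup>2 * dist_form N c c)"
          unfolding C_def dist_form_bilinear dist_form_commute[of N c "move_points (\<lambda>z. \<delta> *\<^sub>R z) a"]
          by (simp add: power2_eq_square algebra_simps)
        also have "dist_form N (move_points (\<lambda>z. \<delta> *\<^sub>R z) a) (move_points (\<lambda>z. \<delta> *\<^sub>R z) a) = \<delta> ^ N * dist_form N a a"
        proof -
          have "norm (\<delta> *\<^sub>R x - \<delta> *\<^sub>R z) ^ N = \<delta> ^ N * norm (x - z) ^ N" for x z :: "real ^ 'd"
            using elim by (simp add: scaleR_diff_right[symmetric] power_mult_distrib)
          then show ?thesis by (simp add: dist_form_def app_cmult)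
        qed
        also have "dist_form N (move_points (\<lambda>z. \<delta> *\<^sub>R z) a) c = h \<delta>"
          by (simp add: dist_form_def h_def norm_minus_commute)
        finally have "0 \<le> q * ((1 / \<delta> ^ s)\<^sup>2 * (\<delta> ^ N * dist_form N a a + 2 * (t * \<delta> ^ s) * h \<delta> + (t * \<delta> ^ s)\<^sup>2 * dist_form N c c))" .
        moreover have "q * (e * (X * A + 2 * (t * Y) * Z + (t * Y)\<^sup>2 * B)) = e * (q * A * X + 2 * t * q * (Y * Z) + t\<^sup>2 * q * B * (Y * Y))"
          for e X A Y Z B :: real by (simp add: algebra_simps power2_eq_square)
        moreover have "\<delta> ^ (2 * s) = \<delta> ^ s * \<delta> ^ s" by (simp only: mult_2 power_add)
        ultimately have "0 \<le> (1 / \<delta> ^ s)\<^sup>2 * g \<delta>" unfolding g_def by (simp only:)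
        moreover have "0 < (1 / \<delta> ^ s)\<^sup>2" using elim by simp
        ultimately show "0 \<le> g \<delta>" by (simp only: zero_le_mult_iff) linarith
      qed
    qed
    then show ?thesis using sN by (simp add: G_nth algebra_simps)
  qed
  then have "q * fps_nth H s = 0" by (rule nonneg_linear_quadratic_imp_zero)
  then have "fps_nth H s = 0" using regular by (simp add: q_def N_def)
  moreover have "fps_nth H s = app T (\<lambda>t. sgn t * t ^ (N - s)) * app a (\<lambda>z. norm_coeff r y z s)"
  proof -
    have "fps_nth H s = app T (\<lambda>t. app a (\<lambda>z. norm_coeff r (t *\<^sub>R y) z s))"
      unfolding H_def c_def by (simp add: app_swap[of a])
    also have "\<dots> = app T (\<lambda>t. (sgn t * t ^ (N - s)) * app a (\<lambda>z. norm_coeff r y z s))"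
    proof (rule app_cong)
      fix t assume "t \<in> snd ` set T"
      then have "t \<noteq> 0" using T(3) by auto
      then show "app a (\<lambda>z. norm_coeff r (t *\<^sub>R y) z s) = sgn t * t ^ (N - s) * app a (\<lambda>z. norm_coeff r y z s)"
        using sN r_pos unfolding N_def app_cmult[symmetric]
        by (intro app_cong norm_coeff_scaled) auto
    qed
    finally show ?thesis by (simp add: app_cmult_right)
  qed
  moreover have "app T (\<lambda>t. sgn t * t ^ (N - s)) \<noteq> 0" by (rule T(2)) simp
  ultimately show ?thesis by simp
qed

text \<open>Multiplication by |y|^(2s) clears the denominators, and reversing the sum matches the
  two indexings. The sign stems from the minus in y - \<delta> z, since the exponents
  \<open>s - 2 * i\<close> all have the parity of \<open>s\<close>.\<close>

lemma norm_coeff_radial_sum: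
  assumes "y \<noteq> 0"
  shows "app a (\<lambda>z. norm_coeff r y z s) * ((norm y)\<^sup>2) ^ s
    = (- 1) ^ s * norm y ^ (2 * r - 1) * radial_sum (real r - 1 / 2) s a y"
proof -
  have tm: "real ((s - i) choose i) * (- 2 * inner y z / (norm y)\<^sup>2) ^ (s - 2 * i) * ((norm z)\<^sup>2 / (norm y)\<^sup>2) ^ i * ((norm y)\<^sup>2) ^ s
      = (- 1) ^ s * (real ((s - i) choose i) * ((norm y)\<^sup>2) ^ i * ((2 * inner y z) ^ (s - 2 * i) * ((norm z)\<^sup>2) ^ i))" for i z
  proof (cases "2 * i \<le> s")
    case True
    define n where "n = (norm y)\<^sup>2"
    have n: "n \<noteq> 0" using assms by (simp add: n_def)
    have ps: "n ^ s = n ^ (s - 2 * i) * n ^ i * n ^ i"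
    proof -
      have "s = (s - 2 * i) + i + i" using True by simp
      then show ?thesis by (metis power_add)
    qed
    have sg: "(- 1 :: real) ^ s = (- 1) ^ (s - 2 * i)"
    proof -
      have "s = (s - 2 * i) + 2 * i" using True by simp
      then have "(- 1 :: real) ^ s = (- 1) ^ ((s - 2 * i) + 2 * i)" by simp
      then show ?thesis by (simp only: power_add) simp
    qed
    have u: "(- 2 * inner y z / n) ^ (s - 2 * i) = (- 1) ^ (s - 2 * i) * (2 * inner y z) ^ (s - 2 * i) / n ^ (s - 2 * i)"
      by (simp only: power_mult_distrib[symmetric] power_divide[symmetric]) simp
    have v: "((norm z)\<^sup>2 / n) ^ i = ((norm z)\<^sup>2) ^ i / n ^ i" by (rule power_divide)
    show ?thesis unfolding n_def[symmetric] u v ps sg using n by (simp add: field_simps)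
  next
    case False
    then have "real ((s - i) choose i) = 0" by simp
    then show ?thesis by (simp only: mult_zero_left mult_zero_right)
  qed
  have nc: "norm_coeff r y z s * ((norm y)\<^sup>2) ^ s = (\<Sum>i\<le>s. ((- 1) ^ s * norm y ^ (2 * r - 1)) * (((real r - 1 / 2) gchoose (s - i)) *
      real ((s - i) choose i) * ((norm y)\<^sup>2) ^ i * ((2 * inner y z) ^ (s - 2 * i) * ((norm z)\<^sup>2) ^ i)))" for z
  proof -
    have "norm_coeff r y z s * ((norm y)\<^sup>2) ^ s = norm y ^ (2 * r - 1) * (\<Sum>i\<le>s. ((real r - 1 / 2) gchoose i) *
       (real (i choose (s - i)) * (- 2 * inner y z / (norm y)\<^sup>2) ^ (2 * i - s) * ((norm z)\<^sup>2 / (norm y)\<^sup>2) ^ (s - i) * ((norm y)\<^sup>2) ^ s))"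
      unfolding norm_coeff_def by (simp only: sum_distrib_left sum_distrib_right mult.assoc)
    also have "(\<Sum>i\<le>s. ((real r - 1 / 2) gchoose i) *
       (real (i choose (s - i)) * (- 2 * inner y z / (norm y)\<^sup>2) ^ (2 * i - s) * ((norm z)\<^sup>2 / (norm y)\<^sup>2) ^ (s - i) * ((norm y)\<^sup>2) ^ s))
      = (\<Sum>i\<le>s. ((real r - 1 / 2) gchoose (s - i)) *
       (real ((s - i) choose i) * (- 2 * inner y z / (norm y)\<^sup>2) ^ (s - 2 * i) * ((norm z)\<^sup>2 / (norm y)\<^sup>2) ^ i * ((norm y)\<^sup>2) ^ s))"
    proof (rule sum.reindex_bij_witness[of _ "\<lambda>i. s - i" "\<lambda>i. s - i"])
      fix i assume "i \<in> {..s}"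
      then have "s - (s - i) = i" "2 * i - s = s - 2 * (s - i)" by auto
      then show "((real r - 1 / 2) gchoose (s - (s - i))) *
       (real ((s - (s - i)) choose (s - i)) * (- 2 * inner y z / (norm y)\<^sup>2) ^ (s - 2 * (s - i)) * ((norm z)\<^sup>2 / (norm y)\<^sup>2) ^ (s - i) * ((norm y)\<^sup>2) ^ s)
       = ((real r - 1 / 2) gchoose i) *
       (real (i choose (s - i)) * (- 2 * inner y z / (norm y)\<^sup>2) ^ (2 * i - s) * ((norm z)\<^sup>2 / (norm y)\<^sup>2) ^ (s - i) * ((norm y)\<^sup>2) ^ s)"
        by simp
    qed auto
    finally show ?thesis unfolding tm by (simp only: sum_distrib_left mult_ac)
  qed
  show ?thesis
    unfolding app_cmult_right[symmetric] nc app_sum radial_sum_def sum_distrib_left app_cmult ..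
qed

text \<open>Only the part of top degree \<open>s\<close> of \<open>b\<close> matters. The functional
  \<open>a\<close> with exactly these moments annihilates the coefficient of order \<open>s\<close>
  of the distance power at every nonzero \<open>y\<close>, hence all powers of inner products, hence
  all monomials of degree \<open>s\<close>; but its moments are the values of
  \<open>b\<close>.\<close>

theorem wronskian_strict:
  fixes b :: "'d multi_index \<Rightarrow> real"
  assumes iso: "(\<Sum>i<r. \<Sum>j<r. \<Sum>\<alpha>\<in>multi_indices i. \<Sum>\<beta>\<in>multi_indices j. w \<alpha> \<beta> * b \<alpha> * b \<beta>) = 0"
    and i: "i < r" "\<alpha> \<in> multi_indices i"
  shows "b \<alpha> = 0"
proof (rule ccontr)
  assume "b \<alpha> \<noteq> 0"
  define S where "S = {i. i < r \<and> (\<exists>\<alpha>\<in>multi_indices i. b \<alpha> \<noteq> 0)}"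
  have S: "finite S" "S \<noteq> {}" using i \<open>b \<alpha> \<noteq> 0\<close> by (auto simp: S_def)
  define s where "s = Max S"
  have "s \<in> S" unfolding s_def using S by (rule Max_in)
  then obtain \<beta> where \<beta>: "s < r" "\<beta> \<in> multi_indices s" "b \<beta> \<noteq> 0" by (auto simp: S_def)
  have high: "b \<alpha> = 0" if "s < j" "j < r" "\<alpha> \<in> multi_indices j" for j \<alpha>
  proof (rule ccontr)
    assume "b \<alpha> \<noteq> 0"
    then have "j \<in> S" using that by (auto simp: S_def)
    then show False using Max_ge[OF S(1), of j] that(1) by (simp add: s_def)
  qed
  have iso': "(\<Sum>i\<le>s. \<Sum>j\<le>s. \<Sum>\<alpha>\<in>multi_indices i. \<Sum>\<beta>\<in>multi_indices j. w \<alpha> \<beta> * b \<alpha> * b \<beta>) = 0"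
  proof -
    have sub: "{..s} \<subseteq> {..<r}" using \<beta>(1) by auto
    have "(\<Sum>i\<le>s. \<Sum>j\<le>s. \<Sum>\<alpha>\<in>multi_indices i. \<Sum>\<beta>\<in>multi_indices j. w \<alpha> \<beta> * b \<alpha> * b \<beta>)
      = (\<Sum>i\<le>s. \<Sum>j<r. \<Sum>\<alpha>\<in>multi_indices i. \<Sum>\<beta>\<in>multi_indices j. w \<alpha> \<beta> * b \<alpha> * b \<beta>)"
      by (rule sum.cong[OF refl], rule sum.mono_neutral_left) (use sub high in \<open>auto intro!: sum.neutral simp: not_le\<close>)
    also have "\<dots> = (\<Sum>i<r. \<Sum>j<r. \<Sum>\<alpha>\<in>multi_indices i. \<Sum>\<beta>\<in>multi_indices j. w \<alpha> \<beta> * b \<alpha> * b \<beta>)"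
      by (rule sum.mono_neutral_left) (use sub high in \<open>auto intro!: sum.neutral simp: not_le\<close>)
    finally show ?thesis using iso by simp
  qed
  obtain a :: "(real \<times> (real ^ 'd)) list" where
    a0: "\<And>\<alpha> m. \<alpha> \<in> multi_indices m \<Longrightarrow> m \<le> 2 * r - 1 \<Longrightarrow>
      app a (\<lambda>x. monomial x \<alpha>) = (if (\<Sum>l\<in>UNIV. \<alpha> l) = s then b \<alpha> else 0)"
    using moment_functional[of "2 * r - 1" "\<lambda>\<alpha>. if (\<Sum>l\<in>UNIV. \<alpha> l) = s then b \<alpha> else 0"] by metis
  have a: "app a (\<lambda>x. monomial x \<alpha>) = (if m = s then b \<alpha> else 0)" if "m \<le> 2 * r - 1" "\<alpha> \<in> multi_indices m" for m \<alpha>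
    using a0[OF that(2,1)] that(2) by (simp add: multi_indices_def)
  have rs: "radial_sum (real r - 1 / 2) s a y = 0" if "y \<noteq> 0" for y
    using norm_coeff_radial_sum[OF that, of a s] leading_part_coeff_zero[OF \<beta>(1) iso' a that] that by simp
  have "app a (\<lambda>z. (inner y z) ^ s) = 0" if "y \<noteq> 0" for y
  proof -
    have "app a (\<lambda>z. (2 * inner y z) ^ s) = 0"
      using radial_sum_zero[OF \<beta>(1) rs _ that, of 0] by simp
    then show ?thesis by (simp add: power_mult_distrib app_cmult)
  qed
  then have "app a (\<lambda>z. monomial z \<beta>) = 0" using \<beta>(2) by (rule app_inner_powers_zero)
  then show False using a[of s \<beta>] \<beta> by simp
qed

end

section \<open>Taylor expansion of radial functions\<close>

lemma monomial_at_0: "monomial (0 :: real ^ 'd::finite) \<gamma> = (if \<gamma> = (\<lambda>_. 0) then 1 else 0)"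
proof (cases "\<gamma> = (\<lambda>_. 0)")
  case False
  then obtain l where "\<gamma> l \<noteq> 0" by auto
  then have "\<exists>l\<in>UNIV. vec_nth (0 :: real ^ 'd) l ^ \<gamma> l = 0" by (intro bexI[of _ l]) auto
  then show ?thesis using False by (simp add: monomial_def)
qed (simp add: monomial_def)

text \<open>A function of class \<open>remainder j\<close> is, near 0, a sum of terms \<open>z ^ \<gamma> * norm z ^ m * \<eta> (norm z)\<close> with
  analytic \<open>\<eta>\<close> and \<open>\<bar>\<gamma>\<bar> + m \<ge> j\<close>; the exponent \<open>m\<close> may be negative, and the value at 0 is 0.\<close>

definition remainder_sum ::
  "('d::finite multi_index \<times> int \<times> (real \<Rightarrow> real)) list \<Rightarrow> real ^ 'd \<Rightarrow> real" where
  "remainder_sum T z = (\<Sum>(\<gamma>, m, \<eta>)\<leftarrow>T. monomial z \<gamma> * (norm z powi m * \<eta> (norm z)))"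

definition remainder_terms :: "int \<Rightarrow> ('d::finite multi_index \<times> int \<times> (real \<Rightarrow> real)) list \<Rightarrow> bool" where
  "remainder_terms j T \<longleftrightarrow> (\<forall>(\<gamma>, m, \<eta>)\<in>set T. (\<exists>F. \<eta> has_fps_expansion F) \<and> j \<le> int (\<Sum>l\<in>UNIV. \<gamma> l) + m)"

definition remainder :: "int \<Rightarrow> (real ^ 'd::finite \<Rightarrow> real) \<Rightarrow> bool" where
  "remainder j \<rho> \<longleftrightarrow> \<rho> 0 = 0 \<and>
     (\<exists>T. remainder_terms j T \<and> eventually (\<lambda>z. z \<noteq> 0 \<longrightarrow> \<rho> z = remainder_sum T z) (nhds 0))"

lemma remainder_cong_ev:
  assumes "remainder j \<rho>" "eventually (\<lambda>z. \<rho> z = \<sigma> z) (nhds 0)"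
  shows "remainder j \<sigma>"
proof -
  obtain T where T: "remainder_terms j T" "eventually (\<lambda>z. z \<noteq> 0 \<longrightarrow> \<rho> z = remainder_sum T z) (nhds 0)"
    using assms(1) by (auto simp: remainder_def)
  have "eventually (\<lambda>z. z \<noteq> 0 \<longrightarrow> \<sigma> z = remainder_sum T z) (nhds 0)"
    using T(2) assms(2) by eventually_elim auto
  moreover have "\<sigma> 0 = 0" using eventually_nhds_x_imp_x[OF assms(2)] assms(1) by (simp add: remainder_def)
  ultimately show ?thesis using T(1) by (auto simp: remainder_def)
qed

lemma remainder_cmult:
  assumes "remainder j \<rho>"
  shows "remainder j (\<lambda>z. c * \<rho> z)"
proof -
  obtain T where T: "remainder_terms j T" "eventually (\<lambda>z. z \<noteq> 0 \<longrightarrow> \<rho> z = remainder_sum T z) (nhds 0)"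
    using assms by (auto simp: remainder_def)
  define T' where "T' = map (\<lambda>(\<gamma>, m, \<eta>). (\<gamma>, m, \<lambda>t. c * \<eta> t)) T"
  have "remainder_sum T' z = c * remainder_sum T z" for z
    unfolding T'_def by (induction T) (auto simp: remainder_sum_def algebra_simps)
  moreover have "remainder_terms j T'"
    using T(1) unfolding remainder_terms_def T'_def by (fastforce intro: has_fps_expansion_cmult_left)
  moreover have "eventually (\<lambda>z. z \<noteq> 0 \<longrightarrow> c * \<rho> z = c * remainder_sum T z) (nhds 0)"
    using T(2) by eventually_elim auto
  ultimately show ?thesis using assms by (auto simp: remainder_def)
qed

lemma has_fps_expansion_DERIV:
  fixes \<eta> :: "real \<Rightarrow> real"
  assumes "\<eta> has_fps_expansion F"
  shows "eventually (\<lambda>t. (\<eta> has_real_derivative deriv \<eta> t) (at t)) (nhds 0)"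
proof -
  have e: "eventually (\<lambda>t. eval_fps F t = \<eta> t) (nhds 0)" and pos: "fps_conv_radius F > 0"
    using assms by (auto simp: has_fps_expansion_def)
  have "eventually (\<lambda>t. eventually (\<lambda>s. eval_fps F s = \<eta> s) (nhds t)) (nhds 0)"
    using e by (simp add: eventually_eventually)
  moreover have "eventually (\<lambda>t. t \<in> eball 0 (fps_conv_radius F)) (nhds (0::real))"
    using pos by (intro eventually_nhds_in_open) (auto simp: zero_ereal_def)
  ultimately show ?thesis
  proof eventually_elim
    case (elim t)
    have "(eval_fps F has_real_derivative eval_fps (fps_deriv F) t) (at t)"
      using elim(2) by (intro has_field_derivative_eval_fps) (auto simp: in_eball_iff)
    then have "(\<eta> has_real_derivative eval_fps (fps_deriv F) t) (at t)"
      using DERIV_cong_ev[OF refl elim(1) refl] by blast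
    then show ?case by (metis DERIV_imp_deriv)
  qed
qed

lemma monomial_line_derivative:
  "((\<lambda>t. monomial (z + t *\<^sub>R axis l 1) \<gamma>) has_real_derivative real (\<gamma> l) * monomial z (\<gamma>(l := \<gamma> l - 1))) (at 0)"
proof -
  define P where "P = (\<Prod>k\<in>UNIV - {l}. vec_nth z k ^ \<gamma> k)"
  have m: "monomial (z + t *\<^sub>R axis l 1) \<gamma> = (vec_nth z l + t) ^ \<gamma> l * P" for t
    unfolding monomial_def P_def by (subst prod.remove[of _ l]) (auto simp: axis_def intro!: prod.cong)
  have "monomial z (\<gamma>(l := \<gamma> l - 1)) = vec_nth z l ^ (\<gamma> l - 1) * P"
    unfolding monomial_def P_def by (subst prod.remove[of _ l]) (auto intro!: prod.cong)
  then show ?thesis unfolding m by (auto intro!: derivative_eq_intros)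
qed

lemma norm_line_derivative:
  fixes z :: "real ^ 'd::finite"
  assumes "z \<noteq> 0"
  shows "((\<lambda>t. norm (z + t *\<^sub>R axis l 1)) has_real_derivative vec_nth z l / norm z) (at 0)"
proof -
  have n: "norm (z + t *\<^sub>R axis l 1) = sqrt ((norm z)\<^sup>2 + 2 * t * vec_nth z l + t\<^sup>2)" for t
  proof -
    have "(norm (z + t *\<^sub>R axis l 1))\<^sup>2 = (norm z)\<^sup>2 + 2 * t * vec_nth z l + t\<^sup>2"
      unfolding power2_norm_eq_inner
      by (simp add: inner_add_left inner_add_right inner_axis inner_axis' power2_eq_square algebra_simps)
    then show ?thesis by (metis norm_ge_zero real_sqrt_unique)
  qed
  show ?thesis unfolding n using assms
    by (auto intro!: derivative_eq_intros simp: field_simps)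
qed

definition line_derivative_terms ::
  "'d::finite \<Rightarrow> 'd multi_index \<times> int \<times> (real \<Rightarrow> real) \<Rightarrow> ('d multi_index \<times> int \<times> (real \<Rightarrow> real)) list" where
  "line_derivative_terms l = (\<lambda>(\<gamma>, m, \<eta>).
     [(\<gamma>(l := \<gamma> l - 1), m, \<lambda>t. real (\<gamma> l) * \<eta> t),
      (\<gamma>(l := Suc (\<gamma> l)), m - 2, \<lambda>t. of_int m * \<eta> t),
      (\<gamma>(l := Suc (\<gamma> l)), m - 1, deriv \<eta>)])"

lemma remainder_sum_append: "remainder_sum (T @ T') z = remainder_sum T z + remainder_sum T' z"
  by (simp add: remainder_sum_def)

lemma remainder_sum_line_derivative:
  fixes z :: "real ^ 'd::finite"
  assumes z: "z \<noteq> 0"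
    and d: "\<And>\<gamma> m \<eta>. (\<gamma>, m, \<eta>) \<in> set T \<Longrightarrow> (\<eta> has_real_derivative deriv \<eta> (norm z)) (at (norm z))"
  shows "((\<lambda>t. remainder_sum T (z + t *\<^sub>R axis l 1)) has_real_derivative
     remainder_sum (concat (map (line_derivative_terms l) T)) z) (at 0)"
  using d
proof (induction T)
  case Nil
  then show ?case by (simp add: remainder_sum_def)
next
  case (Cons p T)
  obtain \<gamma> m \<eta> where p: "p = (\<gamma>, m, \<eta>)" by (cases p) auto
  let ?N = "\<lambda>t. norm (z + t *\<^sub>R axis l 1)"
  let ?n' = "vec_nth z l / norm z"
  have nz: "norm z \<noteq> 0" using z by simp
  have d1: "((\<lambda>t. ?N t powi m) has_real_derivative of_int m * norm z powi (m - 1) * ?n') (at 0)"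
  proof -
    have "((\<lambda>s. s powi m) has_real_derivative of_int m * norm z powi (m - 1)) (at (norm z))"
      using nz by (auto intro!: derivative_eq_intros)
    then have "((\<lambda>s. s powi m) has_real_derivative of_int m * norm z powi (m - 1)) (at (?N 0))" by simp
    from DERIV_chain2[OF this norm_line_derivative[OF z]] show ?thesis by simp
  qed
  have d2: "((\<lambda>t. \<eta> (?N t)) has_real_derivative deriv \<eta> (norm z) * ?n') (at 0)"
  proof -
    have "(\<eta> has_real_derivative deriv \<eta> (norm z)) (at (?N 0))" using Cons.prems[of \<gamma> m \<eta>] p by simp
    from DERIV_chain2[OF this norm_line_derivative[OF z]] show ?thesis by simp
  qed
  have "((\<lambda>t. monomial (z + t *\<^sub>R axis l 1) \<gamma> * (?N t powi m * \<eta> (?N t))) has_real_derivative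
      (real (\<gamma> l) * monomial z (\<gamma>(l := \<gamma> l - 1))) * (norm z powi m * \<eta> (norm z))
      + (of_int m * norm z powi (m - 1) * ?n' * \<eta> (norm z) + deriv \<eta> (norm z) * ?n' * norm z powi m) * monomial z \<gamma>) (at 0)"
    using DERIV_mult[OF monomial_line_derivative DERIV_mult[OF d1 d2], of z l \<gamma>] by simp
  moreover have "(real (\<gamma> l) * monomial z (\<gamma>(l := \<gamma> l - 1))) * (norm z powi m * \<eta> (norm z))
      + (of_int m * norm z powi (m - 1) * ?n' * \<eta> (norm z) + deriv \<eta> (norm z) * ?n' * norm z powi m) * monomial z \<gamma>
      = remainder_sum (line_derivative_terms l p) z"
  proof -
    have "norm z powi (m - 1) = norm z powi (m - 2) * norm z" "norm z powi m = norm z powi (m - 1) * norm z"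
      using nz power_int_minus_mult[of "norm z" "m - 1"] power_int_minus_mult[of "norm z" m] by simp_all
    then show ?thesis
      using nz by (simp add: remainder_sum_def line_derivative_terms_def p monomial_upd_Suc field_simps)
  qed
  ultimately have "((\<lambda>t. monomial (z + t *\<^sub>R axis l 1) \<gamma> * (?N t powi m * \<eta> (?N t))) has_real_derivative
      remainder_sum (line_derivative_terms l p) z) (at 0)" by simp
  moreover have "((\<lambda>t. remainder_sum T (z + t *\<^sub>R axis l 1)) has_real_derivative
     remainder_sum (concat (map (line_derivative_terms l) T)) z) (at 0)"
    by (rule Cons.IH) (use Cons.prems in \<open>auto\<close>)
  ultimately show ?case using DERIV_add
    unfolding list.map concat.simps remainder_sum_append
    by (auto simp: remainder_sum_def p)
qed

lemma remainder_terms_line_derivative: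
  assumes "remainder_terms (j + 1) T"
  shows "remainder_terms j (concat (map (line_derivative_terms l) T))"
proof -
  have "(\<exists>F. \<eta>' has_fps_expansion F) \<and> j \<le> int (\<Sum>k\<in>UNIV. \<gamma>' k) + m'"
    if T: "(\<gamma>, m, \<eta>) \<in> set T" and t: "(\<gamma>', m', \<eta>') \<in> set (line_derivative_terms l (\<gamma>, m, \<eta>))" for \<gamma> m \<eta> \<gamma>' m' \<eta>'
  proof -
    obtain F where F: "\<eta> has_fps_expansion F" and ord: "j + 1 \<le> int (\<Sum>k\<in>UNIV. \<gamma> k) + m"
      using assms T unfolding remainder_terms_def by fast
    have low: "int (\<Sum>k\<in>UNIV. \<gamma> k) \<le> int (\<Sum>k\<in>UNIV. (\<gamma>(l := \<gamma> l - 1)) k) + 1"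
    proof (cases "\<gamma> l")
      case 0
      then have "\<gamma>(l := \<gamma> l - 1) = \<gamma>" by auto
      then show ?thesis by simp
    next
      case (Suc q)
      then have "\<gamma> = (\<gamma>(l := \<gamma> l - 1))(l := Suc ((\<gamma>(l := \<gamma> l - 1)) l))" by auto
      then have "(\<Sum>k\<in>UNIV. \<gamma> k) = Suc (\<Sum>k\<in>UNIV. (\<gamma>(l := \<gamma> l - 1)) k)" by (metis sum_upd_Suc)
      then show ?thesis by simp
    qed
    from t consider "\<gamma>' = \<gamma>(l := \<gamma> l - 1)" "m' = m" "\<eta>' = (\<lambda>t. real (\<gamma> l) * \<eta> t)"
      | "\<gamma>' = \<gamma>(l := Suc (\<gamma> l))" "m' = m - 2" "\<eta>' = (\<lambda>t. of_int m * \<eta> t)"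
      | "\<gamma>' = \<gamma>(l := Suc (\<gamma> l))" "m' = m - 1" "\<eta>' = deriv \<eta>"
      by (auto simp: line_derivative_terms_def)
    then show ?thesis
    proof cases
      case 1
      then show ?thesis using low ord has_fps_expansion_cmult_left[OF F] by auto
    next
      case 2
      then show ?thesis using ord has_fps_expansion_cmult_left[OF F] by (simp only: sum_upd_Suc) auto
    next
      case 3
      then show ?thesis using ord has_fps_expansion_deriv[OF F] by (simp only: sum_upd_Suc) auto
    qed
  qed
  then show ?thesis unfolding remainder_terms_def by auto
qed

text \<open>Each term is at most a constant times |z| to its total degree. The bound serves
  differentiation at the origin, where the formal derivative terms have no meaning of their
  own.\<close>

lemma remainder_quadratic_bound:
  fixes \<rho> :: "real ^ 'd::finite \<Rightarrow> real"
  assumes "remainder 2 \<rho>"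
  shows "\<exists>C. eventually (\<lambda>z. \<bar>\<rho> z\<bar> \<le> C * (norm z)\<^sup>2) (nhds 0)"
proof -
  obtain T where T: "remainder_terms 2 T" "eventually (\<lambda>z. z \<noteq> 0 \<longrightarrow> \<rho> z = remainder_sum T z) (nhds 0)"
    using assms by (auto simp: remainder_def)
  have "\<exists>C. eventually (\<lambda>z. \<bar>remainder_sum T z\<bar> \<le> C * (norm z)\<^sup>2) (nhds (0 :: real ^ 'd))"
    using T(1)
  proof (induction T)
    case Nil
    then show ?case by (intro exI[of _ 0]) (simp add: remainder_sum_def)
  next
    case (Cons p T)
    obtain \<gamma> m \<eta> where p: "p = (\<gamma>, m, \<eta>)" by (cases p) auto
    obtain F where F: "\<eta> has_fps_expansion F" and ord: "2 \<le> int (\<Sum>k\<in>UNIV. \<gamma> k) + m"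
      using Cons.prems p by (auto simp: remainder_terms_def)
    obtain C where C: "eventually (\<lambda>z. \<bar>remainder_sum T z\<bar> \<le> C * (norm z)\<^sup>2) (nhds (0 :: real ^ 'd))"
      using Cons by (auto simp: remainder_terms_def)
    define B where "B = \<bar>\<eta> 0\<bar> + 1"
    have lim: "((\<lambda>z :: real ^ 'd. norm z) \<longlongrightarrow> 0) (nhds 0)"
      by (rule tendsto_eq_intros filterlim_ident refl | simp)+
    have "((\<lambda>t. \<bar>\<eta> t\<bar>) \<longlongrightarrow> \<bar>\<eta> 0\<bar>) (nhds 0)"
    proof -
      have "isCont \<eta> 0" using has_fps_expansion_imp_continuous[OF F] .
      then have "(\<eta> \<longlongrightarrow> \<eta> 0) (nhds 0)" by (simp add: isCont_def tendsto_at_iff_tendsto_nhds)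
      then show ?thesis by (rule tendsto_rabs)
    qed
    then have "eventually (\<lambda>t. \<bar>\<eta> t\<bar> < B) (nhds 0)" by (rule order_tendstoD(2)) (simp add: B_def)
    from eventually_compose_filterlim[OF this lim]
    have e1: "eventually (\<lambda>z :: real ^ 'd. \<bar>\<eta> (norm z)\<bar> < B) (nhds 0)" .
    have "eventually (\<lambda>t. t < 1) (nhds (0::real))" by (rule order_tendstoD(2)[OF filterlim_ident]) simp
    from eventually_compose_filterlim[OF this lim]
    have e2: "eventually (\<lambda>z :: real ^ 'd. norm z < 1) (nhds 0)" .
    have "eventually (\<lambda>z. \<bar>remainder_sum (p # T) z\<bar> \<le> (B + C) * (norm z)\<^sup>2) (nhds (0 :: real ^ 'd))"
      using C e1 e2
    proof eventually_elim
      case (elim z)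
      have "\<bar>monomial z \<gamma> * (norm z powi m * \<eta> (norm z))\<bar> \<le> B * (norm z)\<^sup>2"
      proof (cases "z = 0")
        case False
        have "\<bar>monomial z \<gamma>\<bar> \<le> (\<Prod>k\<in>UNIV. norm z ^ \<gamma> k)"
          unfolding monomial_def abs_prod power_abs
          by (intro prod_mono conjI power_mono) (auto simp: component_le_norm_cart)
        also have "\<dots> = norm z powi int (\<Sum>k\<in>UNIV. \<gamma> k)" by (simp only: power_sum power_int_of_nat)
        finally have "\<bar>monomial z \<gamma>\<bar> * norm z powi m \<le> norm z powi int (\<Sum>k\<in>UNIV. \<gamma> k) * norm z powi m"
          by (intro mult_right_mono) auto
        also have "\<dots> = norm z powi (int (\<Sum>k\<in>UNIV. \<gamma> k) + m)" using False by (simp add: power_int_add)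
        also have "\<dots> \<le> norm z powi 2"
          using ord elim(3) False by (intro power_int_decreasing) auto
        finally have "\<bar>monomial z \<gamma>\<bar> * norm z powi m \<le> (norm z)\<^sup>2" by simp
        then have "(\<bar>monomial z \<gamma>\<bar> * norm z powi m) * \<bar>\<eta> (norm z)\<bar> \<le> (norm z)\<^sup>2 * B"
          using elim(2) by (intro mult_mono) auto
        then show ?thesis by (simp add: abs_mult mult_ac)
      next
        \<comment> \<open>At the origin the term has its conventional value: a nonzero integer power
          of 0 is 0, and with trivial \<gamma> the exponent \<open>m\<close> is at least 2.\<close>
        case True
        have "monomial z \<gamma> * (norm z powi m * \<eta> (norm z)) = 0"
        proof (cases "\<gamma> = (\<lambda>_. 0)")
          case True
          then have "m \<noteq> 0" using ord by auto
          then show ?thesis using \<open>z = 0\<close> by (simp add: power_int_0_left)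
        qed (simp add: True monomial_at_0)
        then show ?thesis by (simp only: abs_zero) (simp add: B_def)
      qed
      then show ?case using elim(1) by (simp add: remainder_sum_def p algebra_simps)
    qed
    then show ?case by blast
  qed
  then obtain C where "eventually (\<lambda>z. \<bar>remainder_sum T z\<bar> \<le> C * (norm z)\<^sup>2) (nhds (0 :: real ^ 'd))" by blast
  then have "eventually (\<lambda>z. \<bar>\<rho> z\<bar> \<le> C * (norm z)\<^sup>2) (nhds 0)"
    using T(2)
  proof eventually_elim
    case (elim z)
    then show ?case using assms by (cases "z = 0") (auto simp: remainder_def)
  qed
  then show ?thesis by blast
qed

lemma remainder_terms_mono: "remainder_terms j T \<Longrightarrow> i \<le> j \<Longrightarrow> remainder_terms i T"
  unfolding remainder_terms_def by fastforce

lemma remainder_mono: "remainder j \<rho> \<Longrightarrow> i \<le> j \<Longrightarrow> remainder i \<rho>"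
  unfolding remainder_def using remainder_terms_mono by blast

text \<open>Away from the origin the terms are differentiated one by one. At the origin the
  quadratic bound, available as \<open>2 \<le> j + 1\<close>, gives the derivative 0, which is also
  the value at 0 required of a remainder.\<close>

lemma remainder_partial_deriv:
  fixes \<rho> :: "real ^ 'd::finite \<Rightarrow> real"
  assumes \<rho>: "remainder (j + 1) \<rho>" and j: "1 \<le> j"
  shows "eventually (\<lambda>z. ((\<lambda>t. \<rho> (z + t *\<^sub>R axis l 1)) has_real_derivative partial_deriv l \<rho> z) (at 0)) (nhds 0)"
    and "remainder j (partial_deriv l \<rho>)"
proof -
  obtain T where T: "remainder_terms (j + 1) T" "eventually (\<lambda>z. z \<noteq> 0 \<longrightarrow> \<rho> z = remainder_sum T z) (nhds 0)"
    using \<rho> by (auto simp: remainder_def)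
  define T' where "T' = concat (map (line_derivative_terms l) T)"
  have \<rho>0: "\<rho> 0 = 0" using \<rho> by (simp add: remainder_def)
  have at0: "((\<lambda>t. \<rho> (0 + t *\<^sub>R axis l 1)) has_real_derivative 0) (at 0)"
  proof -
    obtain C where C: "eventually (\<lambda>z. \<bar>\<rho> z\<bar> \<le> C * (norm z)\<^sup>2) (nhds 0)"
      using remainder_quadratic_bound remainder_mono[OF \<rho>, of 2] j by auto
    have lim: "((\<lambda>t :: real. t *\<^sub>R axis l 1 :: real ^ 'd) \<longlongrightarrow> 0) (nhds 0)"
      by (rule tendsto_eq_intros filterlim_ident refl | simp)+
    from eventually_compose_filterlim[OF C lim]
    have "eventually (\<lambda>t. \<bar>\<rho> (t *\<^sub>R axis l 1)\<bar> \<le> C * t\<^sup>2) (nhds 0)" by simp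
    then have "eventually (\<lambda>t. \<bar>\<rho> (t *\<^sub>R axis l 1)\<bar> \<le> C * t\<^sup>2) (at 0)"
      by (simp add: eventually_nhds_conv_at)
    then have ev: "eventually (\<lambda>t. norm (\<rho> (t *\<^sub>R axis l 1) / t) \<le> \<bar>C\<bar> * \<bar>t\<bar>) (at 0)"
      using eventually_neq_at_within[of 0 0 UNIV]
    proof eventually_elim
      case (elim t)
      then have "t \<noteq> 0" by simp
      have "\<bar>\<rho> (t *\<^sub>R axis l 1)\<bar> \<le> \<bar>C\<bar> * \<bar>t\<bar> * \<bar>t\<bar>"
        using elim(1) by (simp add: power2_eq_square[symmetric] mult.assoc abs_mult_self_eq)
           (meson abs_ge_self dual_order.trans mult_right_mono zero_le_power2)
      then show ?case using \<open>t \<noteq> 0\<close> by (simp add: abs_divide divide_le_eq)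
    qed
    have "((\<lambda>t. \<bar>C\<bar> * \<bar>t\<bar>) \<longlongrightarrow> 0) (at 0)"
      by (rule tendsto_eq_intros refl | simp)+
    then have "((\<lambda>t. \<rho> (t *\<^sub>R axis l 1) / t) \<longlongrightarrow> 0) (at 0)"
      by (rule Lim_null_comparison[OF ev])
    then show ?thesis by (simp add: has_field_derivative_iff \<rho>0)
  qed
  have dT: "eventually (\<lambda>z :: real ^ 'd. \<forall>p\<in>set T. (snd (snd p) has_real_derivative deriv (snd (snd p)) (norm z)) (at (norm z))) (nhds 0)"
  proof (rule eventually_ball_finite)
    show "\<forall>p\<in>set T. eventually (\<lambda>z :: real ^ 'd. (snd (snd p) has_real_derivative deriv (snd (snd p)) (norm z)) (at (norm z))) (nhds 0)"
    proof
      fix p assume "p \<in> set T"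
      then obtain F where F: "snd (snd p) has_fps_expansion F"
        using T(1) by (cases p) (auto simp: remainder_terms_def)
      have lim: "((\<lambda>z :: real ^ 'd. norm z) \<longlongrightarrow> 0) (nhds 0)"
        by (rule tendsto_eq_intros filterlim_ident refl | simp)+
      show "eventually (\<lambda>z :: real ^ 'd. (snd (snd p) has_real_derivative deriv (snd (snd p)) (norm z)) (at (norm z))) (nhds 0)"
        by (rule eventually_compose_filterlim[OF has_fps_expansion_DERIV[OF F] lim])
    qed
  qed simp
  have "eventually (\<lambda>z. eventually (\<lambda>w. w \<noteq> 0 \<longrightarrow> \<rho> w = remainder_sum T w) (nhds z)) (nhds 0)"
    using T(2) by (simp add: eventually_eventually)
  then have "eventually (\<lambda>z. z \<noteq> 0 \<longrightarrow> ((\<lambda>t. \<rho> (z + t *\<^sub>R axis l 1)) has_real_derivative remainder_sum T' z) (at 0)) (nhds 0)"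
    using dT
  proof eventually_elim
    case (elim z)
    show ?case
    proof
      assume z: "z \<noteq> 0"
      have d: "((\<lambda>t. remainder_sum T (z + t *\<^sub>R axis l 1)) has_real_derivative remainder_sum T' z) (at 0)"
        unfolding T'_def by (rule remainder_sum_line_derivative[OF z]) (use elim(2) in force)
      have lim: "((\<lambda>t. z + t *\<^sub>R axis l 1) \<longlongrightarrow> z) (nhds 0)"
        by (rule tendsto_eq_intros filterlim_ident refl | simp)+
      have ev: "eventually (\<lambda>t. \<rho> (z + t *\<^sub>R axis l 1) = remainder_sum T (z + t *\<^sub>R axis l 1)) (nhds 0)"
        using eventually_compose_filterlim[OF elim(1) lim] eventually_line_nonzero[OF z, of "axis l 1"]
        by eventually_elim auto
      show "((\<lambda>t. \<rho> (z + t *\<^sub>R axis l 1)) has_real_derivative remainder_sum T' z) (at 0)"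
        using d DERIV_cong_ev[OF refl ev refl] by blast
    qed
  qed
  then have ev: "eventually (\<lambda>z. ((\<lambda>t. \<rho> (z + t *\<^sub>R axis l 1)) has_real_derivative (if z = 0 then 0 else remainder_sum T' z)) (at 0)) (nhds 0)"
  proof eventually_elim
    case (elim z)
    then show ?case using at0 by (cases "z = 0") auto
  qed
  then show "eventually (\<lambda>z. ((\<lambda>t. \<rho> (z + t *\<^sub>R axis l 1)) has_real_derivative partial_deriv l \<rho> z) (at 0)) (nhds 0)"
    by eventually_elim (metis DERIV_imp_deriv partial_deriv_def)
  have pd: "eventually (\<lambda>z. partial_deriv l \<rho> z = (if z = 0 then 0 else remainder_sum T' z)) (nhds 0)"
    using ev by eventually_elim (simp add: partial_deriv_def DERIV_imp_deriv)
  have "partial_deriv l \<rho> 0 = 0" using eventually_nhds_x_imp_x[OF pd] by simp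
  moreover have "eventually (\<lambda>z. z \<noteq> 0 \<longrightarrow> partial_deriv l \<rho> z = remainder_sum T' z) (nhds 0)"
    using pd by eventually_elim auto
  moreover have "remainder_terms j T'" unfolding T'_def by (rule remainder_terms_line_derivative[OF T(1)])
  ultimately show "remainder j (partial_deriv l \<rho>)" by (auto simp: remainder_def)
qed

section \<open>Polynomials as lists of terms, and expansions up to a remainder\<close>

definition poly_sum :: "(real \<times> 'd::finite multi_index) list \<Rightarrow> real ^ 'd \<Rightarrow> real" where
  "poly_sum P z = (\<Sum>(c, \<gamma>)\<leftarrow>P. c * monomial z \<gamma>)"

definition poly_coeff :: "(real \<times> 'd multi_index) list \<Rightarrow> 'd multi_index \<Rightarrow> real" where
  "poly_coeff P \<alpha> = (\<Sum>(c, \<gamma>)\<leftarrow>P. if \<gamma> = \<alpha> then c else 0)"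

definition poly_deriv :: "'d \<Rightarrow> (real \<times> 'd multi_index) list \<Rightarrow> (real \<times> 'd multi_index) list" where
  "poly_deriv l = map (\<lambda>(c, \<gamma>). (c * real (\<gamma> l), \<gamma>(l := \<gamma> l - 1)))"

lemma poly_coeff_Nil [simp]: "poly_coeff [] \<alpha> = 0"
  and poly_coeff_Cons: "poly_coeff ((c, \<gamma>) # P) \<alpha> = (if \<gamma> = \<alpha> then c else 0) + poly_coeff P \<alpha>"
  by (simp_all add: poly_coeff_def)

lemma poly_sum_zero: "poly_sum P 0 = poly_coeff P (\<lambda>_. 0)"
  unfolding poly_sum_def poly_coeff_def by (induction P) (auto simp: monomial_at_0)

lemma poly_sum_line_derivative:
  "((\<lambda>t. poly_sum P (z + t *\<^sub>R axis l 1)) has_real_derivative poly_sum (poly_deriv l P) z) (at 0)"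
proof (induction P)
  case Nil
  then show ?case by (simp add: poly_sum_def poly_deriv_def)
next
  case (Cons p P)
  obtain c \<gamma> where p: "p = (c, \<gamma>)" by (cases p)
  from DERIV_add[OF DERIV_cmult[OF monomial_line_derivative, of c z l \<gamma>] Cons.IH] show ?case
    by (simp add: poly_sum_def poly_deriv_def p mult.assoc)
qed

lemma poly_coeff_deriv: "poly_coeff (poly_deriv l P) \<alpha> = real (Suc (\<alpha> l)) * poly_coeff P (\<alpha>(l := Suc (\<alpha> l)))"
proof (induction P)
  case Nil
  then show ?case by (simp add: poly_coeff_def poly_deriv_def)
next
  case (Cons p P)
  obtain c \<gamma> where p: "p = (c, \<gamma>)" by (cases p)
  have "(if \<gamma>(l := \<gamma> l - 1) = \<alpha> then c * real (\<gamma> l) else 0) = real (Suc (\<alpha> l)) * (if \<gamma> = \<alpha>(l := Suc (\<alpha> l)) then c else 0)"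
  proof (cases "\<gamma> l")
    case 0
    then show ?thesis by auto
  next
    case (Suc q)
    then have "\<gamma>(l := \<gamma> l - 1) = \<alpha> \<longleftrightarrow> \<gamma> = \<alpha>(l := Suc (\<alpha> l))"
      by (auto simp: fun_eq_iff split: if_splits)
    then show ?thesis using Suc by auto
  qed
  moreover have "poly_deriv l (p # P) = (c * real (\<gamma> l), \<gamma>(l := \<gamma> l - 1)) # poly_deriv l P"
    by (simp add: poly_deriv_def p)
  ultimately show ?case by (simp only: p poly_coeff_Cons Cons.IH distrib_left)
qed

lemma multi_fact_upd_Suc: "multi_fact (\<alpha>(l := Suc (\<alpha> l))) = real (Suc (\<alpha> l)) * multi_fact \<alpha>"
proof -
  have "multi_fact (\<alpha>(l := Suc (\<alpha> l))) = fact (Suc (\<alpha> l)) * (\<Prod>k\<in>UNIV - {l}. fact (\<alpha> k))"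
    unfolding multi_fact_def by (subst prod.remove[of _ l]) (auto intro!: prod.cong)
  also have "\<dots> = real (Suc (\<alpha> l)) * multi_fact \<alpha>"
    unfolding multi_fact_def by (subst (2) prod.remove[of _ l]) (auto simp: algebra_simps)
  finally show ?thesis .
qed

text \<open>Multiplied by its factorial, a coefficient is merely relabelled by a derivative, so no
  factors accumulate along the list.\<close>

lemma poly_coeff_derivs:
  fixes \<alpha> :: "'d::finite multi_index"
  shows "multi_fact \<alpha> * poly_coeff (foldr poly_deriv ls P) \<alpha>
    = multi_fact (\<lambda>l. \<alpha> l + count_list ls l) * poly_coeff P (\<lambda>l. \<alpha> l + count_list ls l)"
proof (induction ls arbitrary: \<alpha>)
  case (Cons l ls)
  have e: "(\<lambda>k. (\<alpha>(l := Suc (\<alpha> l))) k + count_list ls k) = (\<lambda>k. \<alpha> k + count_list (l # ls) k)"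
    by (auto simp: fun_eq_iff)
  have "multi_fact \<alpha> * poly_coeff (foldr poly_deriv (l # ls) P) \<alpha>
      = multi_fact (\<alpha>(l := Suc (\<alpha> l))) * poly_coeff (foldr poly_deriv ls P) (\<alpha>(l := Suc (\<alpha> l)))"
    by (simp only: foldr.simps o_def poly_coeff_deriv multi_fact_upd_Suc mult_ac)
  also have "\<dots> = multi_fact (\<lambda>k. \<alpha> k + count_list (l # ls) k) * poly_coeff P (\<lambda>k. \<alpha> k + count_list (l # ls) k)"
    unfolding Cons.IH e ..
  finally show ?case .
qed simp

definition expansion :: "int \<Rightarrow> (real \<times> 'd::finite multi_index) list \<Rightarrow> (real ^ 'd \<Rightarrow> real) \<Rightarrow> bool" where
  "expansion j P f \<longleftrightarrow> remainder j (\<lambda>z. f z - poly_sum P z)"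

lemma expansion_at_0:
  assumes "expansion j P f"
  shows "f 0 = poly_coeff P (\<lambda>_. 0)"
  using assms by (simp add: expansion_def remainder_def poly_sum_zero)

lemma expansion_cong_ev: "expansion j P f \<Longrightarrow> eventually (\<lambda>z. f z = g z) (nhds 0) \<Longrightarrow> expansion j P g"
  unfolding expansion_def by (erule remainder_cong_ev) (auto elim: eventually_mono)

definition poly_cmult :: "real \<Rightarrow> (real \<times> 'd multi_index) list \<Rightarrow> (real \<times> 'd multi_index) list" where
  "poly_cmult a = map (\<lambda>(c, \<gamma>). (a * c, \<gamma>))"

lemma poly_coeff_cmult: "poly_coeff (poly_cmult a P) \<alpha> = a * poly_coeff P \<alpha>"
  by (induction P) (auto simp: poly_coeff_def poly_cmult_def algebra_simps)

lemma expansion_cmult: "expansion j P f \<Longrightarrow> expansion j (poly_cmult a P) (\<lambda>z. a * f z)"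
proof -
  assume e: "expansion j P f"
  have "poly_sum (poly_cmult a P) z = a * poly_sum P z" for z :: "real ^ 'a"
    by (induction P) (auto simp: poly_sum_def poly_cmult_def algebra_simps)
  then show ?thesis using remainder_cmult[of j "\<lambda>z. f z - poly_sum P z" a] e by (simp add: expansion_def right_diff_distrib)
qed

lemma expansion_partial_deriv:
  fixes f :: "real ^ 'd::finite \<Rightarrow> real"
  assumes e: "expansion (j + 1) P f" and j: "1 \<le> j"
  shows "eventually (\<lambda>z. ((\<lambda>t. f (z + t *\<^sub>R axis l 1)) has_real_derivative partial_deriv l f z) (at 0)) (nhds 0)"
    and "expansion j (poly_deriv l P) (partial_deriv l f)"
proof -
  define \<rho> where "\<rho> z = f z - poly_sum P z" for z
  have \<rho>: "remainder (j + 1) \<rho>" using e by (simp add: expansion_def \<rho>_def[abs_def])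
  have ev: "eventually (\<lambda>z. ((\<lambda>t. f (z + t *\<^sub>R axis l 1)) has_real_derivative
      partial_deriv l \<rho> z + poly_sum (poly_deriv l P) z) (at 0)) (nhds 0)"
    using remainder_partial_deriv(1)[OF \<rho> j, of l]
  proof eventually_elim
    case (elim z)
    from DERIV_add[OF elim poly_sum_line_derivative[of P z l]] show ?case by (simp add: \<rho>_def)
  qed
  then show "eventually (\<lambda>z. ((\<lambda>t. f (z + t *\<^sub>R axis l 1)) has_real_derivative partial_deriv l f z) (at 0)) (nhds 0)"
    by eventually_elim (metis DERIV_imp_deriv partial_deriv_def)
  have "eventually (\<lambda>z. partial_deriv l \<rho> z = partial_deriv l f z - poly_sum (poly_deriv l P) z) (nhds 0)"
    using ev
  proof eventually_elim
    case (elim z)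
    then have "partial_deriv l f z = partial_deriv l \<rho> z + poly_sum (poly_deriv l P) z"
      unfolding partial_deriv_def[of l f] by (rule DERIV_imp_deriv)
    then show ?case by simp
  qed
  then show "expansion j (poly_deriv l P) (partial_deriv l f)"
    unfolding expansion_def by (rule remainder_cong_ev[OF remainder_partial_deriv(2)[OF \<rho> j]])
qed

lemma expansion_derivs:
  assumes "expansion (j + int (length ls)) P f" "1 \<le> j"
  shows "expansion j (foldr poly_deriv ls P) (foldr partial_deriv ls f)"
  using assms
proof (induction ls arbitrary: j)
  case (Cons l ls)
  have "expansion (j + 1) (foldr poly_deriv ls P) (foldr partial_deriv ls f)"
    using Cons.prems by (intro Cons.IH) (auto simp: algebra_simps)
  then show ?case using expansion_partial_deriv(2)[of j] Cons.prems(2) by simp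
qed simp

text \<open>Each derivative in the second argument of \<open>f (x - y)\<close> contributes a sign.\<close>

lemma reflected_derivs:
  fixes f :: "real ^ 'd::finite \<Rightarrow> real"
  assumes "expansion (j + int (length ls)) P f" "1 \<le> j"
  shows "\<exists>U. open U \<and> 0 \<in> U \<and> (\<forall>x y. x - y \<in> U \<longrightarrow>
    foldr partial_deriv ls (\<lambda>y. f (x - y)) y = (- 1) ^ length ls * foldr partial_deriv ls f (x - y))"
  using assms
proof (induction ls arbitrary: j)
  case Nil
  show ?case by (intro exI[of _ UNIV]) auto
next
  case (Cons l ls)
  let ?g = "foldr partial_deriv ls f"
  have e: "expansion ((j + 1) + int (length ls)) P f" using Cons.prems by (simp add: algebra_simps)
  \<comment> \<open>The identity is kept on an open set of differences \<open>x - y\<close>, so that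
    \<open>y\<close> can move along an axis while \<open>x\<close> stays arbitrary.\<close>
  obtain U where U: "open U" "0 \<in> U" "\<And>x y. x - y \<in> U \<Longrightarrow>
    foldr partial_deriv ls (\<lambda>y. f (x - y)) y = (- 1) ^ length ls * ?g (x - y)"
    using Cons.IH[OF e] Cons.prems(2) by auto
  have "expansion (j + 1) (foldr poly_deriv ls P) ?g"
    using expansion_derivs[OF e] Cons.prems(2) by simp
  from expansion_partial_deriv(1)[OF this Cons.prems(2), of l]
  obtain V where V: "open V" "0 \<in> V" "\<And>z. z \<in> V \<Longrightarrow>
      ((\<lambda>t. ?g (z + t *\<^sub>R axis l 1)) has_real_derivative partial_deriv l ?g z) (at 0)"
    unfolding eventually_nhds by blast
  have "foldr partial_deriv (l # ls) (\<lambda>y. f (x - y)) y = (- 1) ^ length (l # ls) * foldr partial_deriv (l # ls) f (x - y)"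
    if xy: "x - y \<in> U \<inter> V" for x y
  proof -
    let ?h = "\<lambda>t. foldr partial_deriv ls (\<lambda>y. f (x - y)) (y + t *\<^sub>R axis l 1)"
    have lim: "((\<lambda>t :: real. (x - y) - t *\<^sub>R axis l 1) \<longlongrightarrow> x - y) (nhds 0)"
      by (rule tendsto_eq_intros filterlim_ident refl | simp)+
    have "eventually (\<lambda>z. z \<in> U) (nhds (x - y))" using U(1) xy by (intro eventually_nhds_in_open) auto
    from eventually_compose_filterlim[OF this lim]
    have ev: "eventually (\<lambda>t. ?h t = (- 1) ^ length ls * ?g ((x - y) - t *\<^sub>R axis l 1)) (nhds 0)"
    proof eventually_elim
      case (elim t)
      then show ?case using U(3)[of x "y + t *\<^sub>R axis l 1"] by (simp add: algebra_simps)
    qed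
    have d: "((\<lambda>t. ?g ((x - y) + t *\<^sub>R axis l 1)) has_real_derivative partial_deriv l ?g (x - y)) (at (- 0))"
      using V(3) xy by simp
    have "((\<lambda>t. (- 1) ^ length ls * ?g ((x - y) - t *\<^sub>R axis l 1)) has_real_derivative
        (- 1) ^ length ls * (partial_deriv l ?g (x - y) * - 1)) (at 0)"
      using DERIV_cmult[OF DERIV_chain2[OF d DERIV_minus[OF DERIV_ident]]] by simp
    then have "(?h has_real_derivative (- 1) ^ length ls * (partial_deriv l ?g (x - y) * - 1)) (at 0)"
      using DERIV_cong_ev[OF refl ev refl] by blast
    then show ?thesis by (simp add: partial_deriv_def[of l "foldr partial_deriv ls (\<lambda>y. f (x - y))"] DERIV_imp_deriv)
  qed
  then show ?case using U V by (intro exI[of _ "U \<inter> V"]) auto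
qed

section \<open>Mixed derivatives of the kernel at the origin\<close>

definition derivative_list :: "('d::finite) multi_index \<Rightarrow> 'd list" where
  "derivative_list \<alpha> = concat (map (\<lambda>l. replicate (\<alpha> l) l) coordinates)"

lemma coordinates: "distinct (coordinates :: 'd::finite list)" "set (coordinates :: 'd::finite list) = UNIV"
proof -
  have "\<exists>ls :: 'd list. distinct ls \<and> set ls = UNIV"
    using finite_distinct_list[of "UNIV :: 'd set"] by auto
  then have "distinct (coordinates :: 'd list) \<and> set (coordinates :: 'd list) = UNIV"
    unfolding coordinates_def by (rule someI_ex)
  then show "distinct (coordinates :: 'd list)" "set (coordinates :: 'd list) = UNIV" by auto
qed

lemma multi_deriv_list: "multi_deriv \<alpha> f = foldr partial_deriv (derivative_list \<alpha>) f"
proof -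
  have "foldr (\<lambda>l. partial_deriv l ^^ \<alpha> l) ls f = foldr partial_deriv (concat (map (\<lambda>l. replicate (\<alpha> l) l) ls)) f" for ls
    by (induction ls) auto
  then show ?thesis by (simp add: multi_deriv_def derivative_list_def)
qed

lemma count_derivative_list: "count_list (derivative_list \<alpha>) l = \<alpha> l"
proof -
  have "count_list (replicate m k) l = (if k = l then m else 0)" for m k
    by (induction m) auto
  then have "count_list (concat (map (\<lambda>l. replicate (\<alpha> l) l) ls)) l = (if l \<in> set ls then \<alpha> l else 0)" if "distinct ls" for ls
    using that by (induction ls) auto
  then show ?thesis unfolding derivative_list_def using coordinates by (simp add: coordinates)
qed

lemma length_derivative_list: "length (derivative_list \<alpha>) = (\<Sum>l\<in>UNIV. \<alpha> l)"
  unfolding derivative_list_def length_concat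
  by (simp add: o_def sum_list_distinct_conv_sum_set[OF coordinates(1)] coordinates(2))

text \<open>The inner derivative is, near 0, a signed derivative of \<open>f\<close> itself, so the
  outer one differentiates an expansion again. The order of the remainder pays for all derivatives
  with 1 to spare, and the value at 0 is that of the polynomial part.\<close>

lemma mixed_derivative:
  fixes f :: "real ^ 'd::finite \<Rightarrow> real"
  assumes e: "expansion (1 + int ((\<Sum>l\<in>UNIV. \<alpha> l) + (\<Sum>l\<in>UNIV. \<beta> l))) P f"
  shows "multi_deriv \<alpha> (\<lambda>x. multi_deriv \<beta> (\<lambda>y. f (x - y)) 0) 0
    = (- 1) ^ (\<Sum>l\<in>UNIV. \<beta> l) * multi_fact (\<lambda>l. \<alpha> l + \<beta> l) * poly_coeff P (\<lambda>l. \<alpha> l + \<beta> l)"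
proof -
  let ?a = "derivative_list \<alpha>" and ?b = "derivative_list \<beta>"
  let ?s = "(- 1) ^ (\<Sum>l\<in>UNIV. \<beta> l) :: real"
  define j where "j = 1 + int (length ?a)"
  have j: "1 \<le> j" by (simp add: j_def)
  have e': "expansion (j + int (length ?b)) P f"
    using e by (simp add: j_def length_derivative_list algebra_simps)
  obtain U where U: "open U" "0 \<in> U" "\<And>x y. x - y \<in> U \<Longrightarrow>
    foldr partial_deriv ?b (\<lambda>y. f (x - y)) y = ?s * foldr partial_deriv ?b f (x - y)"
    using reflected_derivs[OF e' j] by (auto simp: length_derivative_list)
  have "eventually (\<lambda>x. x \<in> U) (nhds 0)" using U by (intro eventually_nhds_in_open) auto
  then have ev: "eventually (\<lambda>x. ?s * foldr partial_deriv ?b f x = multi_deriv \<beta> (\<lambda>y. f (x - y)) 0) (nhds 0)"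
  proof eventually_elim
    case (elim x)
    then show ?case using U(3)[of x 0] by (simp add: multi_deriv_list)
  qed
  have "expansion j (poly_cmult ?s (foldr poly_deriv ?b P)) (\<lambda>x. multi_deriv \<beta> (\<lambda>y. f (x - y)) 0)"
    by (rule expansion_cong_ev[OF expansion_cmult[OF expansion_derivs[OF e' j]] ev])
  then have "expansion 1 (foldr poly_deriv ?a (poly_cmult ?s (foldr poly_deriv ?b P)))
      (multi_deriv \<alpha> (\<lambda>x. multi_deriv \<beta> (\<lambda>y. f (x - y)) 0))"
    unfolding multi_deriv_list[of \<alpha>] j_def by (intro expansion_derivs) auto
  then have "multi_deriv \<alpha> (\<lambda>x. multi_deriv \<beta> (\<lambda>y. f (x - y)) 0) 0
      = poly_coeff (foldr poly_deriv ?a (poly_cmult ?s (foldr poly_deriv ?b P))) (\<lambda>_. 0)"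
    by (rule expansion_at_0)
  also have "\<dots> = multi_fact (\<lambda>_ :: 'd. 0) * \<dots>" by (simp add: multi_fact_def)
  also have "\<dots> = multi_fact \<alpha> * poly_coeff (poly_cmult ?s (foldr poly_deriv ?b P)) \<alpha>"
    unfolding poly_coeff_derivs by (simp add: count_derivative_list)
  also have "\<dots> = ?s * (multi_fact \<alpha> * poly_coeff (foldr poly_deriv ?b P) \<alpha>)"
    by (simp add: poly_coeff_cmult)
  also have "\<dots> = ?s * (multi_fact (\<lambda>l. \<alpha> l + \<beta> l) * poly_coeff P (\<lambda>l. \<alpha> l + \<beta> l))"
    unfolding poly_coeff_derivs count_derivative_list ..
  finally show ?thesis by (simp add: mult.assoc)
qed

text \<open>A multi-index determines its degree, so one function \<open>c\<close> serves all
  degrees. Its value 0 in odd degrees is later used for the symmetry of the Taylor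
  coefficients.\<close>

lemma homogeneous_norm_powers:
  obtains c :: "('d::finite) multi_index \<Rightarrow> real"
  where "\<And>m z. even m \<Longrightarrow> norm z ^ m = (\<Sum>\<gamma>\<in>multi_indices m. c \<gamma> * monomial z \<gamma>)"
    "\<And>m \<gamma>. odd m \<Longrightarrow> \<gamma> \<in> multi_indices m \<Longrightarrow> c \<gamma> = 0"
proof -
  have "homogeneous (2 * i) (\<lambda>z :: real ^ 'd. norm z ^ (2 * i))" for i
    using homogeneous_inner_norm[of 0 i] by (simp add: power_mult)
  then obtain d where d: "\<And>i z. norm z ^ (2 * i) = (\<Sum>\<gamma>\<in>multi_indices (2 * i). d i \<gamma> * monomial (z :: real ^ 'd) \<gamma>)"
    unfolding homogeneous_def by metis
  define c where "c \<gamma> = (if even (\<Sum>l\<in>UNIV. \<gamma> l) then d ((\<Sum>l\<in>UNIV. \<gamma> l) div 2) \<gamma> else 0)" for \<gamma> :: "'d multi_index"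
  show ?thesis
  proof (rule that[of c])
    fix m :: nat and z :: "real ^ 'd" assume m: "even m"
    have "norm z ^ m = (\<Sum>\<gamma>\<in>multi_indices m. d (m div 2) \<gamma> * monomial z \<gamma>)"
      using d[of z "m div 2"] m by simp
    also have "\<dots> = (\<Sum>\<gamma>\<in>multi_indices m. c \<gamma> * monomial z \<gamma>)"
      using m by (intro sum.cong refl) (auto simp: c_def multi_indices_def)
    finally show "norm z ^ m = (\<Sum>\<gamma>\<in>multi_indices m. c \<gamma> * monomial z \<gamma>)" .
  qed (auto simp: c_def multi_indices_def)
qed

lemma monomial_diff:
  fixes x y :: "real ^ 'd::finite"
  shows "monomial (x - y) \<gamma> = (\<Sum>\<beta>\<in>PiE UNIV (\<lambda>l. {..\<gamma> l}).
     multi_fact \<gamma> / (multi_fact (\<lambda>l. \<gamma> l - \<beta> l) * multi_fact \<beta>) * (- 1) ^ (\<Sum>l\<in>UNIV. \<beta> l) * monomial x (\<lambda>l. \<gamma> l - \<beta> l) * monomial y \<beta>)"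
proof -
  have "monomial (x - y) \<gamma> = (\<Prod>l\<in>UNIV. \<Sum>b\<le>\<gamma> l. real (\<gamma> l choose b) * (- vec_nth y l) ^ b * vec_nth x l ^ (\<gamma> l - b))"
    unfolding monomial_def
  proof (intro prod.cong refl)
    fix l
    show "vec_nth (x - y) l ^ \<gamma> l = (\<Sum>b\<le>\<gamma> l. real (\<gamma> l choose b) * (- vec_nth y l) ^ b * vec_nth x l ^ (\<gamma> l - b))"
      using binomial_ring[of "- vec_nth y l" "vec_nth x l" "\<gamma> l"] by simp
  qed
  also have "\<dots> = (\<Sum>\<beta>\<in>PiE UNIV (\<lambda>l. {..\<gamma> l}). \<Prod>l\<in>UNIV. real (\<gamma> l choose \<beta> l) * (- vec_nth y l) ^ \<beta> l * vec_nth x l ^ (\<gamma> l - \<beta> l))"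
    by (subst prod_sum_PiE) auto
  also have "\<dots> = (\<Sum>\<beta>\<in>PiE UNIV (\<lambda>l. {..\<gamma> l}).
     multi_fact \<gamma> / (multi_fact (\<lambda>l. \<gamma> l - \<beta> l) * multi_fact \<beta>) * (- 1) ^ (\<Sum>l\<in>UNIV. \<beta> l) * monomial x (\<lambda>l. \<gamma> l - \<beta> l) * monomial y \<beta>)"
  proof (intro sum.cong refl)
    fix \<beta> assume "\<beta> \<in> PiE UNIV (\<lambda>l. {..\<gamma> l})"
    then have le: "\<beta> l \<le> \<gamma> l" for l by auto
    have "(\<Prod>l\<in>UNIV. real (\<gamma> l choose \<beta> l) * (- vec_nth y l) ^ \<beta> l * vec_nth x l ^ (\<gamma> l - \<beta> l))
        = (\<Prod>l\<in>UNIV. fact (\<gamma> l) / (fact (\<gamma> l - \<beta> l) * fact (\<beta> l)) * (- 1) ^ \<beta> l * vec_nth x l ^ (\<gamma> l - \<beta> l) * vec_nth y l ^ \<beta> l)"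
    proof (intro prod.cong refl)
      fix l
      have "real (\<gamma> l choose \<beta> l) = fact (\<gamma> l) / (fact (\<gamma> l - \<beta> l) * fact (\<beta> l))"
        by (simp add: binomial_fact[OF le] mult.commute)
      moreover have "(- vec_nth y l) ^ \<beta> l = (- 1) ^ \<beta> l * vec_nth y l ^ \<beta> l" by (rule power_minus)
      ultimately show "real (\<gamma> l choose \<beta> l) * (- vec_nth y l) ^ \<beta> l * vec_nth x l ^ (\<gamma> l - \<beta> l)
          = fact (\<gamma> l) / (fact (\<gamma> l - \<beta> l) * fact (\<beta> l)) * (- 1) ^ \<beta> l * vec_nth x l ^ (\<gamma> l - \<beta> l) * vec_nth y l ^ \<beta> l"
        by (simp only: mult_ac)
    qed
    also have "\<dots> = multi_fact \<gamma> / (multi_fact (\<lambda>l. \<gamma> l - \<beta> l) * multi_fact \<beta>) * (- 1) ^ (\<Sum>l\<in>UNIV. \<beta> l) * monomial x (\<lambda>l. \<gamma> l - \<beta> l) * monomial y \<beta>"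
      unfolding multi_fact_def monomial_def prod.distrib prod_dividef power_sum ..
    finally show "(\<Prod>l\<in>UNIV. real (\<gamma> l choose \<beta> l) * (- vec_nth y l) ^ \<beta> l * vec_nth x l ^ (\<gamma> l - \<beta> l))
      = multi_fact \<gamma> / (multi_fact (\<lambda>l. \<gamma> l - \<beta> l) * multi_fact \<beta>) * (- 1) ^ (\<Sum>l\<in>UNIV. \<beta> l) * monomial x (\<lambda>l. \<gamma> l - \<beta> l) * monomial y \<beta>" .
  qed
  finally show ?thesis .
qed

text \<open>Regularity leaves only even powers of the distance below degree
  \<open>2 * r - 1\<close>, and these are polynomials. The derivatives of the Wronskian have total
  order at most \<open>2 * r - 2\<close> and see only this polynomial part, although the odd power
  that follows need not be smooth.\<close>

theorem radial_kernel_taylor: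
  fixes \<psi> :: "real \<Rightarrow> real" and k :: "real ^ 'd::finite \<Rightarrow> real ^ 'd \<Rightarrow> real"
  assumes radial: "\<And>y z. k y z = \<psi> (norm (y - z))"
    and analytic: "\<psi> has_fps_expansion \<Psi>"
    and reg: "regularity_index \<Psi> r"
  obtains w :: "'d multi_index \<Rightarrow> 'd multi_index \<Rightarrow> real"
  where "\<And>m x y. m \<le> 2 * r - 2 \<Longrightarrow> fps_nth \<Psi> m * norm (x - y) ^ m =
      (\<Sum>u\<le>m. \<Sum>\<alpha>\<in>multi_indices u. \<Sum>\<beta>\<in>multi_indices (m - u). w \<alpha> \<beta> * monomial x \<alpha> * monomial y \<beta>)"
    and "\<And>a b \<alpha> \<beta>. a < r \<Longrightarrow> b < r \<Longrightarrow> \<alpha> \<in> multi_indices a \<Longrightarrow> \<beta> \<in> multi_indices b \<Longrightarrow>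
      multi_deriv \<alpha> (\<lambda>x. multi_deriv \<beta> (\<lambda>y. k x y) 0) 0 / (multi_fact \<alpha> * multi_fact \<beta>) = w \<alpha> \<beta>"
    and "\<And>\<alpha> \<beta>. w \<alpha> \<beta> = w \<beta> \<alpha>"
proof -
  obtain c :: "'d multi_index \<Rightarrow> real"
    where c: "\<And>m z. even m \<Longrightarrow> norm z ^ m = (\<Sum>\<gamma>\<in>multi_indices m. c \<gamma> * monomial z \<gamma>)"
      "\<And>m \<gamma>. odd m \<Longrightarrow> \<gamma> \<in> multi_indices m \<Longrightarrow> c \<gamma> = 0"
    using homogeneous_norm_powers by blast
  have r: "r \<ge> 1" and odd0: "\<And>i. 1 \<le> i \<Longrightarrow> i < r \<Longrightarrow> fps_nth \<Psi> (2 * i - 1) = 0"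
    using reg by (auto simp: regularity_index_def)
  define p where "p \<gamma> = fps_nth \<Psi> (\<Sum>l\<in>UNIV. \<gamma> l) * c \<gamma>" for \<gamma>
  have psi_odd: "fps_nth \<Psi> m = 0" if "odd m" "m \<le> 2 * r - 2" for m
  proof -
    obtain i where "m = 2 * i + 1" using \<open>odd m\<close> by (auto elim: oddE)
    then show ?thesis using odd0[of "Suc i"] that(2) by simp
  qed
  have expand: "fps_nth \<Psi> m * norm z ^ m = (\<Sum>\<gamma>\<in>multi_indices m. p \<gamma> * monomial z \<gamma>)" if "m \<le> 2 * r - 2" for m z
  proof (cases "even m")
    case True
    show ?thesis unfolding c(1)[OF True] sum_distrib_left
      by (intro sum.cong refl) (auto simp: p_def multi_indices_def)
  next
    case False
    then show ?thesis using c(2)[OF False] psi_odd[OF False that] by (simp add: p_def)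
  qed
  \<comment> \<open>The coefficient of x^\<alpha> y^\<beta> in the polynomial with coefficients
    \<open>p\<close> at x - y: multinomial factors, and one sign for each factor of y.\<close>
  define w where "w \<alpha> \<beta> = (- 1) ^ (\<Sum>l\<in>UNIV. \<beta> l) * multi_fact (\<lambda>l. \<alpha> l + \<beta> l) / (multi_fact \<alpha> * multi_fact \<beta>) * p (\<lambda>l. \<alpha> l + \<beta> l)"
    for \<alpha> \<beta> :: "'d multi_index"
  show ?thesis
  proof (rule that[of w])
    fix m and x y :: "real ^ 'd" assume m: "m \<le> 2 * r - 2"
    define F where "F \<alpha> \<beta> = w \<alpha> \<beta> * monomial x \<alpha> * monomial y \<beta>" for \<alpha> \<beta>
    have "fps_nth \<Psi> m * norm (x - y) ^ m = (\<Sum>\<gamma>\<in>multi_indices m. \<Sum>\<beta>\<in>PiE UNIV (\<lambda>l. {..\<gamma> l}). F (\<lambda>l. \<gamma> l - \<beta> l) \<beta>)"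
      unfolding expand[OF m] monomial_diff sum_distrib_left
    proof (intro sum.cong refl)
      fix \<gamma> \<beta> :: "'d multi_index" assume "\<beta> \<in> PiE UNIV (\<lambda>l. {..\<gamma> l})"
      then have "\<beta> l \<le> \<gamma> l" for l by auto
      then have e: "(\<lambda>l. \<gamma> l - \<beta> l + \<beta> l) = \<gamma>" by simp
      show "p \<gamma> * (multi_fact \<gamma> / (multi_fact (\<lambda>l. \<gamma> l - \<beta> l) * multi_fact \<beta>) * (- 1) ^ (\<Sum>l\<in>UNIV. \<beta> l) * monomial x (\<lambda>l. \<gamma> l - \<beta> l) * monomial y \<beta>)
          = F (\<lambda>l. \<gamma> l - \<beta> l) \<beta>"
        unfolding F_def w_def e by simp
    qed
    also have "\<dots> = (\<Sum>(\<gamma>, \<beta>)\<in>(SIGMA \<gamma>:multi_indices m. PiE UNIV (\<lambda>l. {..\<gamma> l})). F (\<lambda>l. \<gamma> l - \<beta> l) \<beta>)"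
      by (rule sum.Sigma) (auto intro: finite_PiE)
    also have "\<dots> = (\<Sum>(u, \<alpha>, \<beta>)\<in>(SIGMA u:{..m}. multi_indices u \<times> multi_indices (m - u)). F \<alpha> \<beta>)"
    proof (rule sum.reindex_bij_witness[of _ "\<lambda>(u, \<alpha>, \<beta>). (\<lambda>l. \<alpha> l + \<beta> l, \<beta>)" "\<lambda>(\<gamma>, \<beta>). (\<Sum>l\<in>UNIV. \<gamma> l - \<beta> l, \<lambda>l. \<gamma> l - \<beta> l, \<beta>)"])
      fix g :: "'d multi_index \<times> 'd multi_index" assume g: "g \<in> (SIGMA \<gamma>:multi_indices m. PiE UNIV (\<lambda>l. {..\<gamma> l}))"
      obtain \<gamma> \<beta> where gb: "g = (\<gamma>, \<beta>)" by (cases g)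
      have le: "\<beta> l \<le> \<gamma> l" for l using g gb by auto
      have s: "(\<Sum>l\<in>UNIV. \<gamma> l - \<beta> l) + (\<Sum>l\<in>UNIV. \<beta> l) = m"
        unfolding sum.distrib[symmetric] using g gb le by (simp add: multi_indices_def)
      show "(case case g of (\<gamma>, \<beta>) \<Rightarrow> (\<Sum>l\<in>UNIV. \<gamma> l - \<beta> l, \<lambda>l. \<gamma> l - \<beta> l, \<beta>) of (u, \<alpha>, \<beta>) \<Rightarrow> (\<lambda>l. \<alpha> l + \<beta> l, \<beta>)) = g"
        using le by (simp add: gb)
      show "(case g of (\<gamma>, \<beta>) \<Rightarrow> (\<Sum>l\<in>UNIV. \<gamma> l - \<beta> l, \<lambda>l. \<gamma> l - \<beta> l, \<beta>)) \<in> (SIGMA u:{..m}. multi_indices u \<times> multi_indices (m - u))"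
        using s by (auto simp: gb multi_indices_def)
      show "(case case g of (\<gamma>, \<beta>) \<Rightarrow> (\<Sum>l\<in>UNIV. \<gamma> l - \<beta> l, \<lambda>l. \<gamma> l - \<beta> l, \<beta>) of (u, \<alpha>, \<beta>) \<Rightarrow> F \<alpha> \<beta>)
          = (case g of (\<gamma>, \<beta>) \<Rightarrow> F (\<lambda>l. \<gamma> l - \<beta> l) \<beta>)" by (simp add: gb)
    next
      fix t :: "nat \<times> 'd multi_index \<times> 'd multi_index" assume t: "t \<in> (SIGMA u:{..m}. multi_indices u \<times> multi_indices (m - u))"
      obtain u and \<alpha> \<beta> :: "'d multi_index" where ub: "t = (u, \<alpha>, \<beta>)" by (cases t) auto
      have su: "sum \<alpha> UNIV = u" "sum \<beta> UNIV = m - u" "u \<le> m" using t ub by (auto simp: multi_indices_def)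
      show "(case case t of (u, \<alpha>, \<beta>) \<Rightarrow> (\<lambda>l. \<alpha> l + \<beta> l, \<beta>) of (\<gamma>, \<beta>) \<Rightarrow> (\<Sum>l\<in>UNIV. \<gamma> l - \<beta> l, \<lambda>l. \<gamma> l - \<beta> l, \<beta>)) = t"
        by (simp add: ub su)
      show "(case t of (u, \<alpha>, \<beta>) \<Rightarrow> (\<lambda>l. \<alpha> l + \<beta> l, \<beta>)) \<in> (SIGMA \<gamma>:multi_indices m. PiE UNIV (\<lambda>l. {..\<gamma> l}))"
        by (simp add: ub multi_indices_def sum.distrib su PiE_UNIV_domain)
    qed
    also have "\<dots> = (\<Sum>u\<le>m. \<Sum>\<alpha>\<in>multi_indices u. \<Sum>\<beta>\<in>multi_indices (m - u). F \<alpha> \<beta>)"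
      unfolding sum.cartesian_product by (subst sum.Sigma) auto
    finally show "fps_nth \<Psi> m * norm (x - y) ^ m = (\<Sum>u\<le>m. \<Sum>\<alpha>\<in>multi_indices u. \<Sum>\<beta>\<in>multi_indices (m - u). w \<alpha> \<beta> * monomial x \<alpha> * monomial y \<beta>)"
      by (simp only: F_def)
  next
    fix a b and \<alpha> \<beta> :: "'d multi_index"
    assume ab: "a < r" "b < r" "\<alpha> \<in> multi_indices a" "\<beta> \<in> multi_indices b"
    define N where "N = 2 * r - 1"
    define G where "G = (\<Union>m<N. multi_indices m :: 'd multi_index set)"
    have finG: "finite G" by (auto simp: G_def)
    obtain gs where gs: "set gs = G" "distinct gs" using finite_distinct_list[OF finG] by blast
    define P where "P = map (\<lambda>\<gamma>. (p \<gamma>, \<gamma>)) gs"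
    have Pc: "poly_coeff P \<gamma> = p \<gamma>" if "\<gamma> \<in> G" for \<gamma>
    proof -
      have "poly_coeff P \<gamma> = (\<Sum>\<delta>\<leftarrow>gs. if \<delta> = \<gamma> then p \<delta> else 0)"
        unfolding P_def by (induction gs) (auto simp: poly_coeff_def)
      also have "\<dots> = (\<Sum>\<delta>\<in>G. if \<delta> = \<gamma> then p \<delta> else 0)" using gs by (simp add: sum_list_distinct_conv_sum_set)
      finally show ?thesis using that finG by simp
    qed
    have Ps: "poly_sum P z = (\<Sum>m<N. fps_nth \<Psi> m * norm z ^ m)" for z
    proof -
      have "poly_sum P z = (\<Sum>\<gamma>\<leftarrow>gs. p \<gamma> * monomial z \<gamma>)"
        unfolding P_def by (induction gs) (auto simp: poly_sum_def)
      also have "\<dots> = (\<Sum>\<gamma>\<in>G. p \<gamma> * monomial z \<gamma>)" using gs by (simp add: sum_list_distinct_conv_sum_set)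
      also have "\<dots> = (\<Sum>m<N. \<Sum>\<gamma>\<in>multi_indices m. p \<gamma> * monomial z \<gamma>)"
        unfolding G_def
      proof (rule sum.UNION_disjoint)
        show "\<forall>i\<in>{..<N}. \<forall>j\<in>{..<N}. i \<noteq> j \<longrightarrow> (multi_indices i :: 'd multi_index set) \<inter> multi_indices j = {}"
          by (auto simp: multi_indices_def)
      qed auto
      also have "\<dots> = (\<Sum>m<N. fps_nth \<Psi> m * norm z ^ m)"
        by (intro sum.cong refl) (auto simp: expand N_def)
      finally show ?thesis .
    qed
    define f where "f z = \<psi> (norm z)" for z :: "real ^ 'd"
    have exp_f: "expansion (int N) P f"
    proof -
      define g where "g t = \<psi> t - (\<Sum>m<N. fps_nth \<Psi> m * t ^ m)" for t
      define Gf where "Gf = \<Psi> - (\<Sum>m<N. fps_const (fps_nth \<Psi> m) * fps_X ^ m)"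
      have gG: "g has_fps_expansion Gf"
        unfolding g_def Gf_def
        by (intro has_fps_expansion_diff has_fps_expansion_sum analytic has_fps_expansion_cmult_left has_fps_expansion_fps_X_power)
      have low: "fps_nth Gf m = 0" if "m < N" for m
        using that by (simp add: Gf_def fps_sum_nth fps_X_power_nth if_distrib[of "\<lambda>x. _ * x"] cong: if_cong)
      define \<eta> where "\<eta> t = (if t = 0 then fps_nth Gf N else g t / t ^ N)" for t
      have \<eta>: "\<eta> has_fps_expansion fps_shift N Gf"
        unfolding \<eta>_def by (rule has_fps_expansion_divide_power[OF gG low])
      \<comment> \<open>The tail of \<psi> from degree \<open>N\<close> on is a single term of the
        remainder class, of total degree \<open>N\<close>.\<close>
      define T where "T = [(\<lambda>_ :: 'd. 0 :: nat, int N, \<eta>)]"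
      have "remainder_terms (int N) T" using \<eta> by (auto simp: remainder_terms_def T_def)
      moreover have "f z - poly_sum P z = remainder_sum T z" if "z \<noteq> 0" for z
        using that by (simp add: remainder_sum_def T_def monomial_def \<eta>_def f_def Ps g_def)
      moreover have "f 0 - poly_sum P 0 = 0"
      proof -
        have "g 0 = fps_nth Gf 0" by (rule has_fps_expansion_at_0[OF gG])
        then show ?thesis using low[of 0] r by (simp add: f_def Ps g_def N_def)
      qed
      ultimately show ?thesis unfolding expansion_def remainder_def by auto
    qed
    have sums: "(\<Sum>l\<in>UNIV. \<alpha> l) = a" "(\<Sum>l\<in>UNIV. \<beta> l) = b" using ab by (auto simp: multi_indices_def)
    have e: "expansion (1 + int ((\<Sum>l\<in>UNIV. \<alpha> l) + (\<Sum>l\<in>UNIV. \<beta> l))) P f"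
      unfolding sums using exp_f unfolding expansion_def
      by (rule remainder_mono) (use ab(1,2) in \<open>auto simp: N_def\<close>)
    have kf: "k x y = f (x - y)" for x y by (simp add: radial f_def)
    have "(\<lambda>l. \<alpha> l + \<beta> l) \<in> G"
      using ab sums unfolding G_def by (auto simp: multi_indices_def sum.distrib N_def)
    then show "multi_deriv \<alpha> (\<lambda>x. multi_deriv \<beta> (\<lambda>y. k x y) 0) 0 / (multi_fact \<alpha> * multi_fact \<beta>) = w \<alpha> \<beta>"
      unfolding kf mixed_derivative[OF e] w_def by (simp add: Pc)
  next
    fix \<alpha> \<beta> :: "'d multi_index"
    define a where "a = (\<Sum>l\<in>UNIV. \<alpha> l)"
    define b where "b = (\<Sum>l\<in>UNIV. \<beta> l)"
    have s: "(\<lambda>l. \<alpha> l + \<beta> l) \<in> multi_indices (a + b)" by (simp add: multi_indices_def sum.distrib a_def b_def)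
    show "w \<alpha> \<beta> = w \<beta> \<alpha>"
    \<comment> \<open>In even total degree the two signs agree; in odd total degree both sides are
      0.\<close>
    proof (cases "even (a + b)")
      case True
      then have "(- 1 :: real) ^ a = (- 1) ^ b" by (auto simp: minus_one_power_iff)
      then show ?thesis by (simp add: w_def a_def[symmetric] b_def[symmetric] add.commute mult.commute)
    next
      case False
      then have "c (\<lambda>l. \<alpha> l + \<beta> l) = 0" using c(2) s by blast
      moreover have "(\<lambda>l. \<alpha> l + \<beta> l) = (\<lambda>l. \<beta> l + \<alpha> l)" by (simp add: add.commute)
      ultimately show ?thesis by (simp add: w_def p_def)
    qed
  qed
qed

section \<open>The kernel matrix in graded coordinates\<close>

text \<open>Squaring the variable makes room for the half-integral order of the last block.\<close>

definition fps_dbl :: "real fps \<Rightarrow> real fps" where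
  "fps_dbl F = fps_compose F (fps_X ^ 2)"

lemma fps_dbl_nth: "fps_nth (fps_dbl F) m = (if even m then fps_nth F (m div 2) else 0)"
proof -
  have "fps_nth (fps_dbl F) m = (\<Sum>i=0..m. fps_nth F i * (if m = 2 * i then 1 else 0))"
    unfolding fps_dbl_def fps_compose_nth by (simp add: power_mult[symmetric] fps_X_power_nth)
  also have "\<dots> = (if even m then fps_nth F (m div 2) else 0)"
  proof (cases "even m")
    case True
    then have "(\<Sum>i=0..m. fps_nth F i * (if m = 2 * i then 1 else 0)) = (\<Sum>i=0..m. if i = m div 2 then fps_nth F i else 0)"
      by (intro sum.cong) auto
    then show ?thesis using True by simp
  next
    case False
    then have "m \<noteq> 2 * i" for i by auto
    then show ?thesis using False by simp
  qed
  finally show ?thesis .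
qed

lemma fps_dbl_sum: "fps_dbl (sum f I) = (\<Sum>i\<in>I. fps_dbl (f i))"
  unfolding fps_dbl_def by (rule fps_compose_sum_distrib)

lemma fps_dbl_mult: "fps_dbl (F * G) = fps_dbl F * fps_dbl G"
  unfolding fps_dbl_def by (rule fps_compose_mult_distrib) simp

lemma fps_dbl_eq_0_iff: "fps_dbl F = 0 \<longleftrightarrow> F = 0"
proof
  assume e: "fps_dbl F = 0"
  have "fps_nth F m = 0" for m using fps_dbl_nth[of F "2 * m"] e by simp
  then show "F = 0" by (intro fps_ext) simp
qed (simp add: fps_dbl_def)

lemma subdegree_fps_dbl: "subdegree (fps_dbl F) = 2 * subdegree F"
proof (cases "F = 0")
  case False
  show ?thesis
  proof (rule subdegreeI)
    show "fps_nth (fps_dbl F) (2 * subdegree F) \<noteq> 0" using False by (simp add: fps_dbl_nth)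
    fix i assume "i < 2 * subdegree F"
    then show "fps_nth (fps_dbl F) i = 0" by (auto simp: fps_dbl_nth elim!: evenE)
  qed
qed (simp add: fps_dbl_def)

text \<open>\<open>Q\<close> and the columns of the projection \<open>P\<close> replace an
  orthonormal basis adapted to the degrees. \<open>Q_low\<close> and \<open>P_low\<close> say which
  moments vanish, and \<open>full_rank\<close> says that the rows of each diagonal block of the
  triangular factor are independent.\<close>

locale graded_frame = radial_kernel \<psi> \<Psi> k r w
  for \<psi> :: "real \<Rightarrow> real" and \<Psi> and k :: "real ^ 'd::finite \<Rightarrow> real ^ 'd \<Rightarrow> real" and r
    and w :: "'d multi_index \<Rightarrow> 'd multi_index \<Rightarrow> real" +
  fixes n B :: nat and x :: "nat \<Rightarrow> real ^ 'd" and lev :: "nat \<Rightarrow> nat"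
    and Q P :: "nat \<Rightarrow> nat \<Rightarrow> real"
  assumes inj: "inj_on x {..<n}"
    and lev: "\<And>p. p < B \<Longrightarrow> lev p < r"
    and parseval: "\<And>i j. i < n \<Longrightarrow> j < n \<Longrightarrow> (\<Sum>p<B. Q i p * Q j p) + P i j = (if i = j then 1 else 0)"
    and P_sym: "\<And>i j. i < n \<Longrightarrow> j < n \<Longrightarrow> P i j = P j i"
    and P_idem: "\<And>i j. i < n \<Longrightarrow> j < n \<Longrightarrow> (\<Sum>l<n. P i l * P l j) = P i j"
    and Q_low: "\<And>p m \<alpha>. p < B \<Longrightarrow> m < lev p \<Longrightarrow> \<alpha> \<in> multi_indices m \<Longrightarrow> (\<Sum>i<n. Q i p * monomial (x i) \<alpha>) = 0"
    and P_low: "\<And>j m \<alpha>. j < n \<Longrightarrow> m < r \<Longrightarrow> \<alpha> \<in> multi_indices m \<Longrightarrow> (\<Sum>i<n. P i j * monomial (x i) \<alpha>) = 0"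
    and full_rank: "\<And>i v p. i < r \<Longrightarrow> (\<And>\<alpha>. \<alpha> \<in> multi_indices i \<Longrightarrow>
        (\<Sum>q\<in>{q. q < B \<and> lev q = i}. v q * (\<Sum>j<n. Q j q * monomial (x j) \<alpha>)) = 0) \<Longrightarrow>
        p < B \<Longrightarrow> lev p = i \<Longrightarrow> v p = 0"
begin

definition frame :: "nat \<Rightarrow> nat \<Rightarrow> real" where
  "frame i p = (if p < B then Q i p else P i (p - B))"

text \<open>A frame vector has no moments of degree below its level. On the last block the level is
  \<open>r\<close>, one half more than the exponent used for scaling.\<close>

definition level :: "nat \<Rightarrow> nat" where
  "level p = (if p < B then lev p else r)"

text \<open>Twice the exponent \<open>e p\<close>, hence an integer on the last block too; it
  belongs to the doubled variable of \<open>fps_dbl\<close>.\<close>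

definition order :: "nat \<Rightarrow> nat" where
  "order p = (if p < B then 2 * lev p else 2 * r - 1)"

definition point_list :: "(nat \<Rightarrow> real) \<Rightarrow> (real \<times> (real ^ 'd)) list" where
  "point_list c = map (\<lambda>i. (c i, x i)) [0..<n]"

lemma app_point_list: "app (point_list c) f = (\<Sum>i<n. c i * f (x i))"
proof -
  have "app (map (\<lambda>i. (c i, x i)) is) f = (\<Sum>i\<leftarrow>is. c i * f (x i))" for "is"
    by (induction "is") auto
  then show ?thesis
    by (simp add: point_list_def interv_sum_list_conv_sum_set_nat atLeast0LessThan)
qed

definition moment :: "nat \<Rightarrow> 'd multi_index \<Rightarrow> real" where
  "moment p \<alpha> = (\<Sum>i<n. frame i p * monomial (x i) \<alpha>)"

lemma moment_low: "p < B + n \<Longrightarrow> m < level p \<Longrightarrow> \<alpha> \<in> multi_indices m \<Longrightarrow> moment p \<alpha> = 0"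
  unfolding moment_def frame_def level_def by (cases "p < B") (auto intro: Q_low P_low)

definition gram :: "nat \<Rightarrow> nat \<Rightarrow> real" where
  "gram p q = (\<Sum>\<alpha>\<in>multi_indices (lev p). \<Sum>\<beta>\<in>multi_indices (lev q). w \<alpha> \<beta> * moment p \<alpha> * moment q \<beta>)"

definition K :: "nat \<Rightarrow> nat \<Rightarrow> real fps" where
  "K i j = Abs_fps (\<lambda>m. fps_nth \<Psi> m * norm (x i - x j) ^ m)"

definition frame_K :: "nat \<Rightarrow> nat \<Rightarrow> real fps" where
  "frame_K p q = (\<Sum>i<n. \<Sum>j<n. fps_const (frame i p) * K i j * fps_const (frame j q))"

lemma frame_K_nth: "fps_nth (frame_K p q) m
    = fps_nth \<Psi> m * dist_form m (point_list (\<lambda>i. frame i p)) (point_list (\<lambda>i. frame i q))"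
  unfolding frame_K_def dist_form_def app_point_list K_def
  by (simp add: fps_sum_nth sum_distrib_left mult_ac)

lemma frame_K_low:
  assumes "p < B + n" "q < B + n" "m \<le> 2 * r - 2"
  shows "fps_nth (frame_K p q) m = (\<Sum>u\<le>m. \<Sum>\<alpha>\<in>multi_indices u. \<Sum>\<beta>\<in>multi_indices (m - u).
     w \<alpha> \<beta> * moment p \<alpha> * moment q \<beta>)"
  unfolding frame_K_nth low_dist_form[OF assms(3)] app_point_list moment_def ..

text \<open>The bound on \<open>m\<close> keeps it at most \<open>2 * r - 2\<close>, where the
  Taylor coefficients are available, and below \<open>level p + level q\<close>, so that in every
  pair of degrees with sum \<open>m\<close> one is below its level.\<close>

lemma frame_K_zero:
  assumes "p < B + n" "q < B + n" "2 * m < order p + order q"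
  shows "fps_nth (frame_K p q) m = 0"
proof -
  have lp: "order p \<le> 2 * level p" "order q \<le> 2 * level q" "level p \<le> r" "level q \<le> r"
    "order p \<le> 2 * r - 1" "order q \<le> 2 * r - 1"
    using lev[of p] lev[of q] by (auto simp: order_def level_def)
  then have m: "m \<le> 2 * r - 2" "m < level p + level q" using assms(3) by linarith+
  show ?thesis
    unfolding frame_K_low[OF assms(1,2) m(1)]
  proof (intro sum.neutral ballI)
    fix u and \<alpha> \<beta> :: "'d multi_index" assume u: "u \<in> {..m}" "\<alpha> \<in> multi_indices u" "\<beta> \<in> multi_indices (m - u)"
    have "u \<le> m" using u(1) by simp
    then have "u < level p \<or> m - u < level q" using m(2) by linarith
    then show "w \<alpha> \<beta> * moment p \<alpha> * moment q \<beta> = 0"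
      using moment_low[OF assms(1) _ u(2)] moment_low[OF assms(2) _ u(3)] by auto
  qed
qed

definition M :: "nat \<Rightarrow> nat \<Rightarrow> real fps" where
  "M p q = fps_shift (order p + order q) (fps_dbl (frame_K p q))"

lemma dbl_frame_K:
  assumes "p < B + n" "q < B + n"
  shows "fps_dbl (frame_K p q) = fps_X ^ (order p + order q) * M p q"
proof (rule fps_ext)
  fix m
  show "fps_nth (fps_dbl (frame_K p q)) m = fps_nth (fps_X ^ (order p + order q) * M p q) m"
  proof (cases "m < order p + order q")
    case True
    then show ?thesis using frame_K_zero[OF assms, of "m div 2"]
      by (auto simp: fps_X_power_mult_nth fps_dbl_nth)
  next
    case False
    then show ?thesis by (simp add: fps_X_power_mult_nth M_def)
  qed
qed

lemma M_gram:
  assumes "p < B" "q < B"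
  shows "fps_nth (M p q) 0 = gram p q"
proof -
  have m: "lev p + lev q \<le> 2 * r - 2" using lev[OF assms(1)] lev[OF assms(2)] by linarith
  have "fps_nth (M p q) 0 = fps_nth (frame_K p q) (lev p + lev q)"
    using assms by (simp add: M_def fps_dbl_nth order_def)
  also have "\<dots> = (\<Sum>u\<le>lev p + lev q. if u = lev p then gram p q else 0)"
    unfolding frame_K_low[OF trans_less_add1[OF assms(1)] trans_less_add1[OF assms(2)] m]
  proof (intro sum.cong refl)
    fix u assume u: "u \<in> {..lev p + lev q}"
    show "(\<Sum>\<alpha>\<in>multi_indices u. \<Sum>\<beta>\<in>multi_indices (lev p + lev q - u). w \<alpha> \<beta> * moment p \<alpha> * moment q \<beta>)
        = (if u = lev p then gram p q else 0)"
    proof (cases "u = lev p")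
      case False
      then have "u < level p \<or> lev p + lev q - u < level q" using assms u by (auto simp: level_def)
      then have "(\<Sum>\<alpha>\<in>multi_indices u. \<Sum>\<beta>\<in>multi_indices (lev p + lev q - u). w \<alpha> \<beta> * moment p \<alpha> * moment q \<beta>) = 0"
        using moment_low[of p u] moment_low[of q "lev p + lev q - u"] assms
        by (intro sum.neutral ballI) auto
      then show ?thesis using False by simp
    qed (simp add: gram_def)
  qed
  finally show ?thesis by simp
qed

text \<open>Parity: the doubled series has even exponents only, whereas the sum of the two orders is
  odd. This decouples the last block from the others at leading order.\<close>

lemma M_mixed:
  assumes "p < B \<longleftrightarrow> \<not> q < B"
  shows "fps_nth (M p q) 0 = 0"
proof -
  have "odd (order p + order q)" using assms r_pos by (auto simp: order_def)
  then show ?thesis by (simp add: M_def fps_dbl_nth)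
qed

lemma M_last:
  "fps_nth (M (B + i) (B + j)) 0 = fps_nth \<Psi> (2 * r - 1) * (\<Sum>a<n. \<Sum>b<n. P a i * norm (x a - x b) ^ (2 * r - 1) * P b j)"
proof -
  have "fps_nth (M (B + i) (B + j)) 0 = fps_nth (frame_K (B + i) (B + j)) (2 * r - 1)"
    by (simp add: M_def fps_dbl_nth order_def mult_2[symmetric])
  also have "\<dots> = fps_nth \<Psi> (2 * r - 1) * (\<Sum>a<n. \<Sum>b<n. P a i * norm (x a - x b) ^ (2 * r - 1) * P b j)"
    unfolding frame_K_nth dist_form_def app_point_list by (simp add: frame_def sum_distrib_left mult_ac)
  finally show ?thesis .
qed

text \<open>The quadratic form at \<open>v\<close> is the form of \<open>w\<close> at the vector
  \<open>b\<close> of combined moments. If it vanishes then \<open>b = 0\<close>, and independence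
  of the rows of each diagonal block gives \<open>v = 0\<close>. Any set \<open>A\<close> is
  allowed, because the leading blocks are cut out by an order bound.\<close>

lemma gram_definite:
  assumes A: "A \<subseteq> {..<B}" and z: "\<And>p. p \<in> A \<Longrightarrow> (\<Sum>q\<in>A. gram p q * v q) = 0" and p: "p \<in> A"
  shows "v p = 0"
proof -
  have fA: "finite A" using A finite_subset by auto
  define b where "b \<alpha> = (\<Sum>q\<in>{q\<in>A. lev q = (\<Sum>l\<in>UNIV. \<alpha> l)}. v q * moment q \<alpha>)" for \<alpha>
  have b: "b \<alpha> = (\<Sum>q\<in>{q\<in>A. lev q = i}. v q * moment q \<alpha>)" if "\<alpha> \<in> multi_indices i" for \<alpha> i
    using that by (simp add: b_def multi_indices_def)
  have group: "(\<Sum>i<r. \<Sum>q\<in>{q\<in>A. lev q = i}. f q) = (\<Sum>q\<in>A. f q)" for f :: "nat \<Rightarrow> real"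
    by (rule sum.group) (use fA A lev in auto)
  have "(\<Sum>i<r. \<Sum>j<r. \<Sum>\<alpha>\<in>multi_indices i. \<Sum>\<beta>\<in>multi_indices j. w \<alpha> \<beta> * b \<alpha> * b \<beta>)
      = (\<Sum>i<r. \<Sum>j<r. \<Sum>p\<in>{q\<in>A. lev q = i}. \<Sum>q\<in>{q\<in>A. lev q = j}. v p * gram p q * v q)"
  proof (intro sum.cong refl)
    fix i j
    have "(\<Sum>\<alpha>\<in>multi_indices i. \<Sum>\<beta>\<in>multi_indices j. w \<alpha> \<beta> * b \<alpha> * b \<beta>)
        = (\<Sum>\<alpha>\<in>multi_indices i. \<Sum>\<beta>\<in>multi_indices j. \<Sum>p\<in>{q\<in>A. lev q = i}. \<Sum>q\<in>{q\<in>A. lev q = j}.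
            v p * (w \<alpha> \<beta> * moment p \<alpha> * moment q \<beta>) * v q)"
    proof (intro sum.cong refl)
      fix \<alpha> \<beta> :: "'d multi_index" assume ab: "\<alpha> \<in> multi_indices i" "\<beta> \<in> multi_indices j"
      show "w \<alpha> \<beta> * b \<alpha> * b \<beta> = (\<Sum>p\<in>{q\<in>A. lev q = i}. \<Sum>q\<in>{q\<in>A. lev q = j}.
            v p * (w \<alpha> \<beta> * moment p \<alpha> * moment q \<beta>) * v q)"
        unfolding b[OF ab(1)] b[OF ab(2)] mult.assoc[of "w \<alpha> \<beta>"] sum_product
        by (simp only: sum_distrib_left mult_ac)
    qed
    also have "\<dots> = (\<Sum>\<alpha>\<in>multi_indices i. \<Sum>p\<in>{q\<in>A. lev q = i}. \<Sum>\<beta>\<in>multi_indices j. \<Sum>q\<in>{q\<in>A. lev q = j}.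
            v p * (w \<alpha> \<beta> * moment p \<alpha> * moment q \<beta>) * v q)"
      by (rule sum.cong[OF refl], rule sum.swap)
    also have "\<dots> = (\<Sum>p\<in>{q\<in>A. lev q = i}. \<Sum>\<alpha>\<in>multi_indices i. \<Sum>q\<in>{q\<in>A. lev q = j}. \<Sum>\<beta>\<in>multi_indices j.
            v p * (w \<alpha> \<beta> * moment p \<alpha> * moment q \<beta>) * v q)"
      by (rule trans[OF sum.swap], rule sum.cong[OF refl], rule sum.cong[OF refl], rule sum.swap)
    also have "\<dots> = (\<Sum>p\<in>{q\<in>A. lev q = i}. \<Sum>q\<in>{q\<in>A. lev q = j}. \<Sum>\<alpha>\<in>multi_indices i. \<Sum>\<beta>\<in>multi_indices j.
            v p * (w \<alpha> \<beta> * moment p \<alpha> * moment q \<beta>) * v q)"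
      by (rule sum.cong[OF refl], rule sum.swap)
    also have "\<dots> = (\<Sum>p\<in>{q\<in>A. lev q = i}. \<Sum>q\<in>{q\<in>A. lev q = j}. v p * gram p q * v q)"
      by (intro sum.cong refl) (simp add: gram_def sum_distrib_left sum_distrib_right)
    finally show "(\<Sum>\<alpha>\<in>multi_indices i. \<Sum>\<beta>\<in>multi_indices j. w \<alpha> \<beta> * b \<alpha> * b \<beta>)
        = (\<Sum>p\<in>{q\<in>A. lev q = i}. \<Sum>q\<in>{q\<in>A. lev q = j}. v p * gram p q * v q)" .
  qed
  also have "\<dots> = (\<Sum>i<r. \<Sum>p\<in>{q\<in>A. lev q = i}. \<Sum>j<r. \<Sum>q\<in>{q\<in>A. lev q = j}. v p * gram p q * v q)"
    by (rule sum.cong[OF refl], rule sum.swap)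
  also have "\<dots> = (\<Sum>p\<in>A. \<Sum>q\<in>A. v p * gram p q * v q)" unfolding group ..
  also have "\<dots> = (\<Sum>p\<in>A. v p * (\<Sum>q\<in>A. gram p q * v q))" by (simp only: sum_distrib_left mult.assoc)
  also have "\<dots> = 0" using z by simp
  finally have iso: "(\<Sum>i<r. \<Sum>j<r. \<Sum>\<alpha>\<in>multi_indices i. \<Sum>\<beta>\<in>multi_indices j. w \<alpha> \<beta> * b \<alpha> * b \<beta>) = 0" .
  define v' where "v' q = (if q \<in> A then v q else 0)" for q
  have pB: "p < B" using p A by auto
  have "v' p = 0"
  proof (rule full_rank[OF lev[OF pB] _ pB refl])
    fix \<alpha> :: "'d multi_index" assume \<alpha>: "\<alpha> \<in> multi_indices (lev p)"
    have "0 = b \<alpha>" using wronskian_strict[OF iso lev[OF pB] \<alpha>] by simp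
    also have "\<dots> = (\<Sum>q\<in>{q\<in>A. lev q = lev p}. v q * moment q \<alpha>)" by (rule b[OF \<alpha>])
    also have "\<dots> = (\<Sum>q\<in>{q. q < B \<and> lev q = lev p}. v' q * (\<Sum>j<n. Q j q * monomial (x j) \<alpha>))"
      using A by (intro sum.mono_neutral_cong_left) (auto simp: v'_def moment_def frame_def)
    finally show "(\<Sum>q\<in>{q. q < B \<and> lev q = lev p}. v' q * (\<Sum>j<n. Q j q * monomial (x j) \<alpha>)) = 0" by simp
  qed
  then show ?thesis using p by (simp add: v'_def)
qed

text \<open>Dependence of the columns of \<open>P\<close> makes a restriction to the range of
  \<open>P\<close> necessary. There the weights \<xi> define a functional without moments of degree
  below \<open>r\<close>, and strictness of the distance form applies at each of the distinct
  points.\<close>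

lemma last_block_definite:
  assumes P: "\<And>i. i < n \<Longrightarrow> (\<Sum>j<n. P i j * \<xi> j) = \<xi> i"
    and z: "\<And>i. i < n \<Longrightarrow> (\<Sum>j<n. fps_nth (M (B + i) (B + j)) 0 * \<xi> j) = 0" and i: "i < n"
  shows "\<xi> i = 0"
proof -
  define D where "D a b = norm (x a - x b) ^ (2 * r - 1)" for a b
  define S where "S i j = (\<Sum>a<n. \<Sum>b<n. P a i * D a b * P b j)" for i j
  have "(\<Sum>j<n. S i j * \<xi> j) = 0" if "i < n" for i
  proof -
    have "fps_nth \<Psi> (2 * r - 1) * (\<Sum>j<n. S i j * \<xi> j) = 0"
      using z[OF that] unfolding M_last S_def[symmetric] D_def[symmetric]
      by (simp only: sum_distrib_left mult.assoc)
    then show ?thesis using regular by simp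
  qed
  then have "0 = (\<Sum>i<n. \<xi> i * (\<Sum>j<n. S i j * \<xi> j))" by simp
  also have "\<dots> = (\<Sum>i<n. \<Sum>j<n. \<Sum>a<n. \<Sum>b<n. (\<xi> i * P a i) * D a b * (P b j * \<xi> j))"
    by (simp only: S_def sum_distrib_left sum_distrib_right mult.assoc)
  also have "\<dots> = (\<Sum>i<n. \<Sum>a<n. \<Sum>j<n. \<Sum>b<n. (\<xi> i * P a i) * D a b * (P b j * \<xi> j))"
    by (rule sum.cong[OF refl], rule sum.swap)
  also have "\<dots> = (\<Sum>a<n. \<Sum>i<n. \<Sum>b<n. \<Sum>j<n. (\<xi> i * P a i) * D a b * (P b j * \<xi> j))"
    by (rule trans[OF sum.swap], rule sum.cong[OF refl], rule sum.cong[OF refl], rule sum.swap)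
  also have "\<dots> = (\<Sum>a<n. \<Sum>b<n. (\<Sum>i<n. P a i * \<xi> i) * D a b * (\<Sum>j<n. P b j * \<xi> j))"
    by (rule sum.cong[OF refl], rule trans[OF sum.swap])
       (intro sum.cong refl, simp only: sum_distrib_left sum_distrib_right mult_ac)
  also have "\<dots> = (\<Sum>a<n. \<Sum>b<n. \<xi> a * D a b * \<xi> b)" using P by (intro sum.cong refl) simp
  also have "\<dots> = dist_form (2 * r - 1) (point_list \<xi>) (point_list \<xi>)"
    unfolding dist_form_def app_point_list D_def by (simp add: sum_distrib_left mult_ac)
  finally have d: "dist_form (2 * r - 1) (point_list \<xi>) (point_list \<xi>) = 0" by simp
  have ann: "annihilates (r - 1) (point_list \<xi>)"
    unfolding annihilates_def app_point_list
  proof (intro allI impI ballI)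
    fix m and \<alpha> :: "'d multi_index" assume m: "m \<le> r - 1" "\<alpha> \<in> multi_indices m"
    have "(\<Sum>i<n. \<xi> i * monomial (x i) \<alpha>) = (\<Sum>i<n. \<Sum>j<n. P i j * \<xi> j * monomial (x i) \<alpha>)"
      using P by (intro sum.cong refl) (simp add: sum_distrib_right[symmetric])
    also have "\<dots> = (\<Sum>j<n. \<xi> j * (\<Sum>i<n. P i j * monomial (x i) \<alpha>))"
      by (subst sum.swap) (simp add: sum_distrib_left mult_ac)
    also have "\<dots> = 0" using P_low[OF _ _ m(2)] m(1) r_pos by simp
    finally show "(\<Sum>i<n. \<xi> i * monomial (x i) \<alpha>) = 0" .
  qed
  have "weight (point_list \<xi>) (x i) = (\<Sum>j<n. if j = i then \<xi> j else 0)"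
    unfolding weight_def app_point_list using inj i by (intro sum.cong refl) (auto simp: inj_on_def)
  then show ?thesis using dist_form_strict[OF ann d, of "x i"] i by simp
qed

lemma frame_parseval:
  assumes "i < n" "j < n"
  shows "(\<Sum>p<B + n. frame i p * frame j p) = (if i = j then 1 else 0)"
proof -
  have "(\<Sum>p<B + n. frame i p * frame j p) = (\<Sum>p<B. frame i p * frame j p) + (\<Sum>l<n. frame i (B + l) * frame j (B + l))"
  proof -
    have "{..<B + n} = {..<B} \<union> {B..<B + n}" by auto
    moreover have "(\<Sum>p\<in>{B..<B + n}. frame i p * frame j p) = (\<Sum>l<n. frame i (B + l) * frame j (B + l))"
      by (rule sum.reindex_bij_witness[of _ "\<lambda>l. B + l" "\<lambda>p. p - B"]) auto
    ultimately show ?thesis by (simp add: sum.union_disjoint ivl_disj_int)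
  qed
  also have "\<dots> = (\<Sum>p<B. Q i p * Q j p) + (\<Sum>l<n. P i l * P l j)"
    using assms P_sym by (simp add: frame_def)
  also have "\<dots> = (if i = j then 1 else 0)" using parseval P_idem assms by simp
  finally show ?thesis .
qed

text \<open>The frame coordinates of an eigenvector satisfy the graded equation in the doubled
  variable. The first two conclusions confine its value at 0 to one block; in the third, eliminating
  \<open>v\<close> will produce the Schur complement.\<close>

theorem leading_eigenvector:
  fixes u :: "nat \<Rightarrow> real fps" and lam :: "real fps"
  assumes eig: "\<And>i. i < n \<Longrightarrow> (\<Sum>j<n. K i j * u j) = lam * u i"
  defines "y \<equiv> \<lambda>p. \<Sum>i<n. Q i p * fps_nth (u i) 0"
    and "z \<equiv> \<lambda>i. \<Sum>j<n. P i j * fps_nth (u j) 0"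
    and "a \<equiv> subdegree lam"
  shows "\<And>p. p < B \<Longrightarrow> lam = 0 \<or> 2 * lev p \<noteq> a \<Longrightarrow> y p = 0"
    and "\<And>i. i < n \<Longrightarrow> lam = 0 \<or> 2 * r - 1 \<noteq> a \<Longrightarrow> z i = 0"
    and "\<And>i. i < r \<Longrightarrow> lam \<noteq> 0 \<Longrightarrow> a = 2 * i \<Longrightarrow> \<exists>v.
      (\<forall>p. p < B \<and> lev p < i \<longrightarrow> (\<Sum>q\<in>{q. q < B \<and> lev q < i}. gram p q * v q)
         + (\<Sum>q\<in>{q. q < B \<and> lev q = i}. gram p q * y q) = 0) \<and>
      (\<forall>p. p < B \<and> lev p = i \<longrightarrow> (\<Sum>q\<in>{q. q < B \<and> lev q < i}. gram p q * v q)
         + (\<Sum>q\<in>{q. q < B \<and> lev q = i}. gram p q * y q) = fps_nth lam a * y p)"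
    and "\<And>i. i < n \<Longrightarrow> lam \<noteq> 0 \<Longrightarrow> a = 2 * r - 1 \<Longrightarrow>
      fps_nth \<Psi> (2 * r - 1) * (\<Sum>j<n. (\<Sum>c<n. \<Sum>d<n. P c i * norm (x c - x d) ^ (2 * r - 1) * P d j) * z j)
        = fps_nth lam a * z i"
proof -
  define Y where "Y p = (\<Sum>i<n. fps_const (frame i p) * u i)" for p
  \<comment> \<open>The Parseval identity recovers \<open>u\<close> from its redundant coordinates,
    so the eigenvalue equation can be rewritten in them although the frame is not a basis.\<close>
  have u_Y: "u i = (\<Sum>p<B + n. fps_const (frame i p) * Y p)" if i: "i < n" for i
  proof -
    have "(\<Sum>p<B + n. fps_const (frame i p) * Y p) = (\<Sum>p<B + n. \<Sum>j<n. fps_const (frame i p * frame j p) * u j)"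
      unfolding Y_def sum_distrib_left by (intro sum.cong refl) (simp add: mult.assoc[symmetric])
    also have "\<dots> = (\<Sum>j<n. (\<Sum>p<B + n. fps_const (frame i p * frame j p)) * u j)"
      by (subst sum.swap) (simp add: sum_distrib_right)
    also have "\<dots> = (\<Sum>j<n. if j = i then u j else 0)"
    proof (intro sum.cong refl)
      fix j assume "j \<in> {..<n}"
      have "(\<Sum>p<B + n. fps_const (frame i p * frame j p)) = fps_const (\<Sum>p<B + n. frame i p * frame j p)"
        by (intro fps_ext) (auto simp: fps_sum_nth)
      then show "(\<Sum>p<B + n. fps_const (frame i p * frame j p)) * u j = (if j = i then u j else 0)"
        using frame_parseval[OF i] \<open>j \<in> {..<n}\<close> by auto
    qed
    finally show ?thesis using i by simp
  qed
  have eq: "(\<Sum>q<B + n. frame_K p q * Y q) = lam * Y p" for p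
  proof -
    have "lam * Y p = (\<Sum>i<n. lam * (fps_const (frame i p) * u i))"
      unfolding Y_def sum_distrib_left ..
    also have "\<dots> = (\<Sum>i<n. fps_const (frame i p) * (\<Sum>j<n. K i j * u j))"
      by (intro sum.cong refl) (simp only: eig lessThan_iff mult.left_commute)
    also have "\<dots> = (\<Sum>i<n. \<Sum>j<n. \<Sum>q<B + n. fps_const (frame i p) * K i j * fps_const (frame j q) * Y q)"
      unfolding sum_distrib_left
    proof (intro sum.cong refl)
      fix i j assume "j \<in> {..<n}"
      then have "fps_const (frame i p) * (K i j * u j) = fps_const (frame i p) * (K i j * (\<Sum>q<B + n. fps_const (frame j q) * Y q))"
        using u_Y[of j] by simp
      then show "fps_const (frame i p) * (K i j * u j) = (\<Sum>q<B + n. fps_const (frame i p) * K i j * fps_const (frame j q) * Y q)"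
        by (simp only: sum_distrib_left mult.assoc)
    qed
    also have "\<dots> = (\<Sum>i<n. \<Sum>q<B + n. \<Sum>j<n. fps_const (frame i p) * K i j * fps_const (frame j q) * Y q)"
      by (rule sum.cong[OF refl], rule sum.swap)
    also have "\<dots> = (\<Sum>q<B + n. frame_K p q * Y q)"
      by (subst sum.swap) (simp only: frame_K_def sum_distrib_right)
    finally show ?thesis by simp
  qed
  define L where "L = fps_dbl lam"
  define y' where "y' p = fps_dbl (Y p)" for p
  have L0: "L = 0 \<longleftrightarrow> lam = 0" by (simp add: L_def fps_dbl_eq_0_iff)
  have La: "subdegree L = 2 * a" by (simp add: L_def a_def subdegree_fps_dbl)
  have Llead: "fps_nth L (2 * a) = fps_nth lam a" by (simp add: L_def fps_dbl_nth)
  have eq': "(\<Sum>q\<in>{..<B + n}. fps_X ^ (order p + order q) * M p q * y' q) = L * y' p" if "p \<in> {..<B + n}" for p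
  proof -
    have "L * y' p = fps_dbl (\<Sum>q<B + n. frame_K p q * Y q)" by (simp add: L_def y'_def eq fps_dbl_mult)
    also have "\<dots> = (\<Sum>q<B + n. fps_X ^ (order p + order q) * M p q * y' q)"
      unfolding fps_dbl_sum fps_dbl_mult y'_def using dbl_frame_K that by (intro sum.cong refl) auto
    finally show ?thesis by simp
  qed
  have y'0: "fps_nth (y' p) 0 = y p" if "p < B" for p
    using that by (simp add: y'_def fps_dbl_nth Y_def y_def fps_sum_nth frame_def)
  have z'0: "fps_nth (y' (B + i)) 0 = z i" if "i < n" for i
    using that P_sym by (simp add: y'_def fps_dbl_nth Y_def z_def fps_sum_nth frame_def)
  \<comment> \<open>Mixed leading coefficients vanish, so the two kinds of indices are treated
    separately. The indices of the last block have equal order, so all of them occur or none. Each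
    coefficient vector of \<open>Y\<close> on that block is \<open>P\<close> applied to a
    coefficient vector of \<open>u\<close>, hence fixed by \<open>P\<close>, as definiteness
    requires.\<close>
  have nonsing: "fps_nth (fps_X ^ order p * y' p) t = 0"
    if hyp: "\<And>p. p \<in> {..<B + n} \<Longrightarrow> L = 0 \<or> 2 * order p < subdegree L \<Longrightarrow>
        (\<Sum>q\<in>{q\<in>{..<B + n}. L = 0 \<or> 2 * order q < subdegree L}. fps_nth (M p q) 0 * fps_nth (fps_X ^ order q * y' q) t) = 0"
      and p: "p \<in> {..<B + n}" "L = 0 \<or> 2 * order p < subdegree L" for t p
  proof -
    define \<xi> where "\<xi> q = fps_nth (fps_X ^ order q * y' q) t" for q
    define A where "A = {q\<in>{..<B + n}. L = 0 \<or> 2 * order q < subdegree L}"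
    have fA: "finite A" by (simp add: A_def)
    have hyp': "(\<Sum>q\<in>A. fps_nth (M p q) 0 * \<xi> q) = 0" if "p \<in> A" for p
      using hyp[of p] that unfolding A_def \<xi>_def by blast
    have "\<xi> p = 0"
    proof (cases "p < B")
      case True
      show ?thesis
      proof (rule gram_definite[of "A \<inter> {..<B}"])
        fix p' assume p': "p' \<in> A \<inter> {..<B}"
        have "(\<Sum>q\<in>A \<inter> {..<B}. gram p' q * \<xi> q) = (\<Sum>q\<in>A. fps_nth (M p' q) 0 * \<xi> q)"
          using p' fA M_mixed[of p'] by (intro sum.mono_neutral_cong_left) (auto simp: M_gram)
        then show "(\<Sum>q\<in>A \<inter> {..<B}. gram p' q * \<xi> q) = 0" using hyp' p' by simp
      qed (use True p in \<open>auto simp: A_def\<close>)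
    next
      case False
      define i where "i = p - B"
      have i: "i < n" "p = B + i" using False p(1) by (auto simp: i_def)
      have cond: "L = 0 \<or> 2 * (2 * r - 1) < subdegree L" using p(2) False by (simp add: order_def)
      have inA: "B + j \<in> A" if "j < n" for j
        using that cond by (auto simp: A_def order_def)
      have "\<xi> (B + i) = 0"
      proof (rule last_block_definite[of "\<lambda>j. \<xi> (B + j)"])
        fix j assume j: "j < n"
        have "(\<Sum>l<n. fps_nth (M (B + j) (B + l)) 0 * \<xi> (B + l)) = (\<Sum>q\<in>{B..<B + n}. fps_nth (M (B + j) q) 0 * \<xi> q)"
          by (rule sum.reindex_bij_witness[of _ "\<lambda>p. p - B" "\<lambda>l. B + l"]) auto
        also have "\<dots> = (\<Sum>q\<in>A. fps_nth (M (B + j) q) 0 * \<xi> q)"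
        proof (rule sum.mono_neutral_left[OF fA])
          show "{B..<B + n} \<subseteq> A" using inA by (metis atLeastLessThan_iff le_add_diff_inverse less_diff_conv2 add.commute subsetI less_diff_conv nat_add_left_cancel_less)
          show "\<forall>q\<in>A - {B..<B + n}. fps_nth (M (B + j) q) 0 * \<xi> q = 0"
            using M_mixed[of "B + j"] by (auto simp: A_def)
        qed
        also have "\<dots> = 0" by (rule hyp'[OF inA[OF j]])
        finally show "(\<Sum>l<n. fps_nth (M (B + j) (B + l)) 0 * \<xi> (B + l)) = 0" .
        have Y: "fps_nth (Y (B + l)) s = (\<Sum>m<n. P l m * fps_nth (u m) s)" if "l < n" for l s
          using that P_sym by (simp add: Y_def frame_def fps_sum_nth)
        have PY: "(\<Sum>l<n. P j l * fps_nth (Y (B + l)) s) = fps_nth (Y (B + j)) s" for s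
        proof -
          have "(\<Sum>l<n. P j l * fps_nth (Y (B + l)) s) = (\<Sum>l<n. \<Sum>m<n. P j l * P l m * fps_nth (u m) s)"
            using Y by (intro sum.cong refl) (simp add: sum_distrib_left mult.assoc)
          also have "\<dots> = (\<Sum>m<n. (\<Sum>l<n. P j l * P l m) * fps_nth (u m) s)"
            by (subst sum.swap) (simp only: sum_distrib_right)
          finally show ?thesis using Y j P_idem by simp
        qed
        have \<xi>: "\<xi> (B + l) = (if t < 2 * r - 1 \<or> odd (t - (2 * r - 1)) then 0 else fps_nth (Y (B + l)) ((t - (2 * r - 1)) div 2))" for l
        proof -
          have "(if t < N then 0 else if even (t - N) then c else 0) = (if t < N \<or> odd (t - N) then 0 else c)" for N and c :: real
            by auto
          moreover have "order (B + l) = 2 * r - 1" by (simp add: order_def)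
          ultimately show ?thesis unfolding \<xi>_def y'_def fps_X_power_mult_nth fps_dbl_nth by (simp only:)
        qed
        show "(\<Sum>l<n. P j l * \<xi> (B + l)) = \<xi> (B + j)"
        proof (cases "t < 2 * r - 1 \<or> odd (t - (2 * r - 1))")
          case True
          show ?thesis unfolding \<xi> by (simp only: True if_True mult_zero_right sum.neutral_const)
        next
          case False
          show ?thesis unfolding \<xi> by (simp only: False if_False PY)
        qed
      qed (rule i(1))
      then show ?thesis using i by simp
    qed
    then show ?thesis by (simp add: \<xi>_def)
  qed
  note main = graded_eigenvector[of "{..<B + n}" order M y' L, OF finite_lessThan eq' nonsing]
  have zero: "fps_nth (y' p) 0 = 0" if "p < B + n" "lam = 0 \<or> order p \<noteq> a" for p
    using main(1)[of p] that by (auto simp: L0 La)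
  show "y p = 0" if "p < B" "lam = 0 \<or> 2 * lev p \<noteq> a" for p
    using zero[of p] y'0[of p] that by (simp add: order_def)
  show "z i = 0" if "i < n" "lam = 0 \<or> 2 * r - 1 \<noteq> a" for i
    using zero[of "B + i"] z'0[of i] that by (simp add: order_def)
  have ex: "\<exists>v. (\<forall>p\<in>{..<B + n}. order p < a \<longrightarrow> (\<Sum>q\<in>{q\<in>{..<B + n}. order q < a}. fps_nth (M p q) 0 * v q)
         + (\<Sum>q\<in>{q\<in>{..<B + n}. order q = a}. fps_nth (M p q) 0 * fps_nth (y' q) 0) = 0) \<and>
      (\<forall>p\<in>{..<B + n}. order p = a \<longrightarrow> (\<Sum>q\<in>{q\<in>{..<B + n}. order q < a}. fps_nth (M p q) 0 * v q)
         + (\<Sum>q\<in>{q\<in>{..<B + n}. order q = a}. fps_nth (M p q) 0 * fps_nth (y' q) 0) = fps_nth lam a * fps_nth (y' p) 0)"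
    if "lam \<noteq> 0"
    using main(2) that unfolding La L0 Llead by (simp only: mult_less_cancel1 mult_cancel1) auto
  show "\<exists>v.
      (\<forall>p. p < B \<and> lev p < i \<longrightarrow> (\<Sum>q\<in>{q. q < B \<and> lev q < i}. gram p q * v q)
         + (\<Sum>q\<in>{q. q < B \<and> lev q = i}. gram p q * y q) = 0) \<and>
      (\<forall>p. p < B \<and> lev p = i \<longrightarrow> (\<Sum>q\<in>{q. q < B \<and> lev q < i}. gram p q * v q)
         + (\<Sum>q\<in>{q. q < B \<and> lev q = i}. gram p q * y q) = fps_nth lam a * y p)"
    if i: "i < r" and lam: "lam \<noteq> 0" and a: "a = 2 * i" for i
  proof -
    have o1: "q < B + n \<and> order q < a \<longleftrightarrow> q < B \<and> lev q < i" for q using a i by (auto simp: order_def)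
    have o2: "q < B + n \<and> order q = a \<longleftrightarrow> q < B \<and> lev q = i" for q
    proof -
      have "2 * r - 1 \<noteq> 2 * i" using i by presburger
      then show ?thesis using a by (auto simp: order_def)
    qed
    obtain v where v: "\<And>p. p < B + n \<and> order p < a \<Longrightarrow> (\<Sum>q\<in>{q. q < B + n \<and> order q < a}. fps_nth (M p q) 0 * v q)
         + (\<Sum>q\<in>{q. q < B + n \<and> order q = a}. fps_nth (M p q) 0 * fps_nth (y' q) 0) = 0"
      "\<And>p. p < B + n \<and> order p = a \<Longrightarrow> (\<Sum>q\<in>{q. q < B + n \<and> order q < a}. fps_nth (M p q) 0 * v q)
         + (\<Sum>q\<in>{q. q < B + n \<and> order q = a}. fps_nth (M p q) 0 * fps_nth (y' q) 0) = fps_nth lam a * fps_nth (y' p) 0"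
      using ex[OF lam] by (auto simp: lessThan_iff)
    have s: "(\<Sum>q\<in>{q. q < B \<and> lev q < i}. gram p q * v q) + (\<Sum>q\<in>{q. q < B \<and> lev q = i}. gram p q * y q)
        = (\<Sum>q\<in>{q. q < B + n \<and> order q < a}. fps_nth (M p q) 0 * v q)
         + (\<Sum>q\<in>{q. q < B + n \<and> order q = a}. fps_nth (M p q) 0 * fps_nth (y' q) 0)" if "p < B" for p
      unfolding o1 o2 using that y'0 M_gram by (intro arg_cong2[of _ _ _ _ "(+)"] sum.cong refl) auto
    show ?thesis
    proof (intro exI[of _ v] conjI allI impI)
      fix p assume p: "p < B \<and> lev p < i"
      show "(\<Sum>q\<in>{q. q < B \<and> lev q < i}. gram p q * v q) + (\<Sum>q\<in>{q. q < B \<and> lev q = i}. gram p q * y q) = 0"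
        using v(1)[of p] p unfolding s[OF conjunct1[OF p]] o1 by blast
    next
      fix p assume p: "p < B \<and> lev p = i"
      show "(\<Sum>q\<in>{q. q < B \<and> lev q < i}. gram p q * v q) + (\<Sum>q\<in>{q. q < B \<and> lev q = i}. gram p q * y q) = fps_nth lam a * y p"
        unfolding s[OF conjunct1[OF p]] y'0[OF conjunct1[OF p], symmetric] by (rule v(2)) (simp only: o2 p)
    qed
  qed
  show "fps_nth \<Psi> (2 * r - 1) * (\<Sum>j<n. (\<Sum>c<n. \<Sum>d<n. P c i * norm (x c - x d) ^ (2 * r - 1) * P d j) * z j)
        = fps_nth lam a * z i"
    if i: "i < n" and lam: "lam \<noteq> 0" and a: "a = 2 * r - 1" for i
  proof -
    have o1: "q < B + n \<and> order q < a \<longleftrightarrow> q < B" for q using a lev[of q] by (auto simp: order_def)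
    have o2: "q < B + n \<and> order q = a \<longleftrightarrow> q \<in> {B..<B + n}" for q
      using a lev[of q] by (auto simp: order_def)
    obtain v where v: "\<And>p. p < B + n \<and> order p = a \<Longrightarrow> (\<Sum>q\<in>{q. q < B + n \<and> order q < a}. fps_nth (M p q) 0 * v q)
         + (\<Sum>q\<in>{q. q < B + n \<and> order q = a}. fps_nth (M p q) 0 * fps_nth (y' q) 0) = fps_nth lam a * fps_nth (y' p) 0"
      using ex[OF lam] by (auto simp: lessThan_iff)
    have "fps_nth lam a * z i = fps_nth lam a * fps_nth (y' (B + i)) 0" by (simp add: z'0 i)
    also have "\<dots> = (\<Sum>q\<in>{q. q < B + n \<and> order q < a}. fps_nth (M (B + i) q) 0 * v q)
         + (\<Sum>q\<in>{q. q < B + n \<and> order q = a}. fps_nth (M (B + i) q) 0 * fps_nth (y' q) 0)"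
      by (rule v[symmetric]) (use i o2[of "B + i"] in simp)
    also have "(\<Sum>q\<in>{q. q < B + n \<and> order q < a}. fps_nth (M (B + i) q) 0 * v q) = 0"
      unfolding o1 using M_mixed[of "B + i"] by (intro sum.neutral) auto
    also have "(\<Sum>q\<in>{q. q < B + n \<and> order q = a}. fps_nth (M (B + i) q) 0 * fps_nth (y' q) 0)
        = (\<Sum>j<n. fps_nth (M (B + i) (B + j)) 0 * z j)"
      unfolding o2 by (rule sum.reindex_bij_witness[of _ "\<lambda>l. B + l" "\<lambda>p. p - B"]) (auto simp: z'0[symmetric])
    also have "\<dots> = fps_nth \<Psi> (2 * r - 1) * (\<Sum>j<n. (\<Sum>c<n. \<Sum>d<n. P c i * norm (x c - x d) ^ (2 * r - 1) * P d j) * z j)"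
      unfolding M_last by (subst sum_distrib_left) (intro sum.cong refl mult.assoc)
    finally show ?thesis by simp
  qed
qed

end

section \<open>Blocks\<close>

lemma offset_0 [simp]: "offset b 0 = 0" and offset_Suc [simp]: "offset b (Suc i) = offset b i + b i"
  by (simp_all add: offset_def)

lemma offset_mono: "i \<le> j \<Longrightarrow> offset b i \<le> offset b j"
  unfolding offset_def by (rule sum_mono2) auto

text \<open>Blocks may be empty; the least index whose block ends beyond \<open>p\<close> is that of
  the nonempty block containing \<open>p\<close>.\<close>

definition block_of :: "(nat \<Rightarrow> nat) \<Rightarrow> nat \<Rightarrow> nat" where
  "block_of b p = (LEAST i. p < offset b (Suc i))"

lemma block_of_less_iff:
  assumes "p < offset b r"
  shows "block_of b p < i \<longleftrightarrow> p < offset b i"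
proof
  obtain r' where "r = Suc r'" using assms by (cases r) auto
  then have "p < offset b (Suc r')" using assms by simp
  then have L: "p < offset b (Suc (block_of b p))" unfolding block_of_def by (rule LeastI)
  show "p < offset b i" if "block_of b p < i"
    using L offset_mono[of "Suc (block_of b p)" i b] that by linarith
  show "block_of b p < i" if "p < offset b i"
  proof (cases i)
    case (Suc i')
    then have "block_of b p \<le> i'" unfolding block_of_def using that by (intro Least_le) simp
    then show ?thesis using Suc by simp
  qed (use that in simp)
qed

lemma block_of_eq:
  assumes "offset b i \<le> p" "p < offset b (Suc i)"
  shows "block_of b p = i"
  using block_of_less_iff[OF assms(2), of i] block_of_less_iff[OF assms(2), of "Suc i"] assms by linarith

lemma block_of_iff:
  assumes "p < offset b r"
  shows "block_of b p = i \<longleftrightarrow> offset b i \<le> p \<and> p < offset b i + b i"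
  using block_of_less_iff[OF assms, of i] block_of_less_iff[OF assms, of "Suc i"] by auto

lemma block_cases:
  assumes "p < offset b r"
  obtains i q where "i < r" "q < b i" "p = offset b i + q" "block_of b p = i"
proof -
  have "block_of b p < r" using block_of_less_iff[OF assms] assms by blast
  moreover have "offset b (block_of b p) \<le> p" "p < offset b (block_of b p) + b (block_of b p)"
    using block_of_iff[OF assms, of "block_of b p"] by auto
  ultimately show ?thesis using that[of "block_of b p" "p - offset b (block_of b p)"] by auto
qed

lemma block_add_less: "i < r \<Longrightarrow> q < b i \<Longrightarrow> offset b i + q < offset b r"
  using offset_mono[of "Suc i" r b] by simp

lemma block_of_add: "q < b i \<Longrightarrow> block_of b (offset b i + q) = i"
  by (rule block_of_eq) auto

lemma sum_block:
  assumes "i < r"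
  shows "(\<Sum>q\<in>{q. q < offset b r \<and> block_of b q = i}. f q) = (\<Sum>q<b i. f (offset b i + q))"
proof (rule sum.reindex_bij_witness[of _ "\<lambda>q. offset b i + q" "\<lambda>p. p - offset b i"])
  fix p assume "p \<in> {q. q < offset b r \<and> block_of b q = i}"
  then show "offset b i + (p - offset b i) = p" "p - offset b i \<in> {..<b i}" "f (offset b i + (p - offset b i)) = f p"
    using block_of_iff[of p b r i] by auto
qed (use assms block_add_less block_of_add in auto)

lemma blk_carrier: "blk p q A i j \<in> carrier_mat (p i) (q j)"
  by (simp add: blk_def sub_mat_def)

lemma blk_index: "i' < p i \<Longrightarrow> j' < q j \<Longrightarrow> blk p q A i j $$ (i', j') = A $$ (offset p i + i', offset q j + j')"
  by (simp add: blk_def sub_mat_def)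

lemma diag_block_mat_carrier:
  assumes "\<And>i. i < r \<Longrightarrow> f i \<in> carrier_mat (b i) (h i)"
  shows "diag_block_mat (map f [0..<r]) \<in> carrier_mat (offset b r) (offset h r)"
  using assms
proof (induction r)
  case (Suc r)
  then have "diag_block_mat (map f [0..<r]) \<in> carrier_mat (offset b r) (offset h r)" "f r \<in> carrier_mat (b r) (h r)" by auto
  then show ?case by (auto simp: diag_block_mat_last Let_def)
qed simp

lemma diag_block_mat_index:
  fixes f :: "nat \<Rightarrow> real mat"
  assumes "\<And>i. i < r \<Longrightarrow> f i \<in> carrier_mat (b i) (h i)" "p < offset b r" "j < offset h r"
  shows "diag_block_mat (map f [0..<r]) $$ (p, j) = (if block_of b p = block_of h j
    then f (block_of b p) $$ (p - offset b (block_of b p), j - offset h (block_of h j)) else 0)"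
  using assms
proof (induction r)
  case (Suc r)
  let ?A = "diag_block_mat (map f [0..<r])"
  have A: "?A \<in> carrier_mat (offset b r) (offset h r)" using Suc.prems(1) by (intro diag_block_mat_carrier) auto
  have fr: "f r \<in> carrier_mat (b r) (h r)" using Suc.prems(1) by auto
  have e: "diag_block_mat (map f [0..<Suc r]) $$ (p, j) = (if p < offset b r
      then if j < offset h r then ?A $$ (p, j) else 0
      else if j < offset h r then 0 else f r $$ (p - offset b r, j - offset h r))"
    using A fr Suc.prems(2,3) by (simp add: diag_block_mat_last Let_def)
  have bp: "p < offset b r \<longleftrightarrow> block_of b p < r" "block_of b p < Suc r"
    using block_of_less_iff[OF Suc.prems(2), of r] block_of_less_iff[OF Suc.prems(2), of "Suc r"] Suc.prems(2) by auto
  have bj: "j < offset h r \<longleftrightarrow> block_of h j < r" "block_of h j < Suc r"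
    using block_of_less_iff[OF Suc.prems(3), of r] block_of_less_iff[OF Suc.prems(3), of "Suc r"] Suc.prems(3) by auto
  show ?case
  proof (cases "p < offset b r \<and> j < offset h r")
    case True
    then show ?thesis unfolding e using Suc.IH Suc.prems(1) by simp
  next
    case False
    show ?thesis
    proof (cases "p < offset b r \<or> j < offset h r")
      case True
      then have "block_of b p \<noteq> block_of h j" using False bp bj by auto
      then show ?thesis unfolding e using False True by auto
    next
      case False
      then have "block_of b p = r" "block_of h j = r" using bp bj by auto
      then show ?thesis unfolding e using False by simp
    qed
  qed
qed simp

section \<open>Monomials up to a given degree\<close>

lemma upto_degree_Suc: "upto_degree mons (Suc s) = upto_degree mons s @ mons (Suc s)"
  by (simp add: upto_degree_def)

lemma length_upto_degree: "length (upto_degree mons s) = offset (monomial_count mons) (Suc s)"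
  by (induction s) (simp_all add: upto_degree_Suc monomial_count_def, simp add: upto_degree_def monomial_count_def)

lemma set_mons: "monomial_ordering mons \<Longrightarrow> set (mons s) = multi_indices s"
  by (simp add: monomial_ordering_def multi_indices_def)

lemma set_upto_degree: "monomial_ordering mons \<Longrightarrow> set (upto_degree mons s) = (\<Union>m\<le>s. multi_indices m)"
  by (induction s) (auto simp: upto_degree_Suc set_mons atMost_Suc, auto simp: upto_degree_def set_mons)

lemma distinct_upto_degree: "monomial_ordering mons \<Longrightarrow> distinct (upto_degree mons s)"
proof (induction s)
  case 0
  then show ?case by (simp add: upto_degree_def monomial_ordering_def)
next
  case (Suc s)
  then show ?case by (auto simp: upto_degree_Suc set_upto_degree set_mons monomial_ordering_def)
      (auto simp: multi_indices_def)
qed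

lemma upto_degree_nth:
  assumes "monomial_ordering mons" "j < offset (monomial_count mons) (Suc s)"
  shows "upto_degree mons s ! j \<in> multi_indices (block_of (monomial_count mons) j)"
  using assms(2)
proof (induction s)
  case 0
  then have "block_of (monomial_count mons) j = 0" by (intro block_of_eq) auto
  moreover have "mons 0 ! j \<in> set (mons 0)" using 0 by (simp add: monomial_count_def)
  ultimately show ?case using set_mons[OF assms(1)] by (simp add: upto_degree_def)
next
  case (Suc s)
  show ?case
  proof (cases "j < offset (monomial_count mons) (Suc s)")
    case True
    then show ?thesis using Suc.IH by (simp add: upto_degree_Suc nth_append length_upto_degree del: offset_Suc)
  next
    case False
    then have "block_of (monomial_count mons) j = Suc s" using Suc.prems by (intro block_of_eq) auto
    moreover have "mons (Suc s) ! (j - offset (monomial_count mons) (Suc s)) \<in> set (mons (Suc s))"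
    proof (intro nth_mem)
      have "monomial_count mons (Suc s) = length (mons (Suc s))" by (simp only: monomial_count_def)
      moreover have "j < offset (monomial_count mons) (Suc s) + monomial_count mons (Suc s)"
        using Suc.prems by (simp only: offset_Suc)
      ultimately show "j - offset (monomial_count mons) (Suc s) < length (mons (Suc s))" using False by linarith
    qed
    ultimately show ?thesis using False set_mons[OF assms(1)]
      by (simp add: upto_degree_Suc nth_append length_upto_degree del: offset_Suc)
  qed
qed

lemma upto_degree_prefix:
  assumes "s \<le> t" "j < offset (monomial_count mons) (Suc s)"
  shows "upto_degree mons t ! j = upto_degree mons s ! j"
  using assms(1)
proof (induction rule: dec_induct)
  case (step t)
  have "j < offset (monomial_count mons) (Suc t)"
    using assms(2) offset_mono[of "Suc s" "Suc t" "monomial_count mons"] step by linarith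
  then show ?case using step by (simp add: upto_degree_Suc nth_append length_upto_degree del: offset_Suc)
qed simp

lemma sum_upto_degree_block:
  fixes F :: "('d::finite) multi_index \<Rightarrow> real"
  assumes mo: "monomial_ordering mons" and i: "i \<le> s"
  shows "(\<Sum>j<offset (monomial_count mons) (Suc s). if block_of (monomial_count mons) j = i then F (upto_degree mons s ! j) else 0)
    = (\<Sum>\<alpha>\<in>multi_indices i. F \<alpha>)"
proof -
  let ?h = "monomial_count mons"
  have deg: "upto_degree mons s ! j \<in> multi_indices i \<longleftrightarrow> block_of ?h j = i" if "j < offset ?h (Suc s)" for j
    using upto_degree_nth[OF mo that] by (auto simp: multi_indices_def)
  have "(\<Sum>j<offset ?h (Suc s). if block_of ?h j = i then F (upto_degree mons s ! j) else 0)
      = (\<Sum>j<length (upto_degree mons s). if upto_degree mons s ! j \<in> multi_indices i then F (upto_degree mons s ! j) else 0)"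
    unfolding length_upto_degree using deg by (intro sum.cong refl) auto
  also have "\<dots> = (\<Sum>\<alpha>\<leftarrow>upto_degree mons s. if \<alpha> \<in> multi_indices i then F \<alpha> else 0)"
    by (simp add: sum_list_sum_nth atLeast0LessThan)
  also have "\<dots> = (\<Sum>\<alpha>\<in>set (upto_degree mons s). if \<alpha> \<in> multi_indices i then F \<alpha> else 0)"
    by (rule sum_list_distinct_conv_sum_set[OF distinct_upto_degree[OF mo]])
  also have "\<dots> = (\<Sum>\<alpha>\<in>multi_indices i. F \<alpha>)"
    using i by (intro sum.mono_neutral_cong_right) (auto simp: set_upto_degree[OF mo])
  finally show ?thesis .
qed

section \<open>Rank\<close>

lemma (in vec_space) maximal_independent_columns:
  assumes A: "A \<in> carrier_mat n nc"
  obtains U where "U \<subseteq> set (cols A)" "lin_indpt U" "card U = rank A" "finite U"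
proof -
  obtain S where S: "maximal S (\<lambda>T. T \<subseteq> set (cols A) \<and> lin_indpt T)"
    using maximal_exists[of "(\<lambda>T. T \<subseteq> set (cols A) \<and> lin_indpt T)" "card (set (cols A))" "{}"]
    by (meson List.finite_set card_mono empty_iff empty_subsetI finite_lin_indpt2 rev_finite_subset)
  then have "S \<subseteq> set (cols A)" "lin_indpt S" by (auto simp: maximal_def)
  moreover have "card S = rank A" using rank_card_indpt[OF A S] by simp
  moreover have "finite S" using calculation(1) finite_subset by blast
  ultimately show ?thesis using that by blast
qed

lemma (in vec_space) rank_le_card_span:
  assumes A: "A \<in> carrier_mat n nc" and S: "finite S" "S \<subseteq> carrier_vec n" and sub: "set (cols A) \<subseteq> span S"
  shows "rank A \<le> card S"
proof -
  obtain U where U: "U \<subseteq> set (cols A)" "lin_indpt U" "card U = rank A" "finite U"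
    using maximal_independent_columns[OF A] by blast
  have "U \<subseteq> span S" using U(1) sub by (rule subset_trans)
  then obtain C :: "'a vec set" where "int (card C) \<le> int (card S) - int (card U)"
    using replacement[of U S] S U by auto
  then show ?thesis using U(3) by simp
qed

lemma (in vec_space) rank_mono_columns:
  assumes "A \<in> carrier_mat n na" "B \<in> carrier_mat n nb" "set (cols A) \<subseteq> set (cols B)"
  shows "rank A \<le> rank B"
proof -
  obtain U where U: "U \<subseteq> set (cols A)" "lin_indpt U" "card U = rank A" "finite U"
    using maximal_independent_columns[OF assms(1)] by blast
  then show ?thesis using rank_ge_card_indpt[OF assms(2), of U] assms(3) by auto
qed

text \<open>A dependence among the rows of \<open>C\<close> with nonzero coefficient at
  \<open>q0\<close> eliminates that row: the product then factors through \<open>m - 1\<close>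
  columns and cannot have rank \<open>m\<close>.\<close>

lemma (in vec_space) full_rank_factor:
  assumes B: "B \<in> carrier_mat n m" and C: "C \<in> carrier_mat m nc" and rk: "rank (B * C) = m"
    and w: "\<And>j. j < nc \<Longrightarrow> (\<Sum>q<m. w q * C $$ (q, j)) = 0" and q0: "q0 < m"
  shows "w q0 = 0"
proof (rule ccontr)
  assume nz: "w q0 \<noteq> 0"
  \<comment> \<open>\<open>f\<close> enumerates the indices other than \<open>q0\<close>, with
    inverse \<open>g\<close>; \<open>B'\<close> absorbs column \<open>q0\<close> of \<open>B\<close>
    into the others.\<close>
  define f where "f q = (if q < q0 then q else Suc q)" for q
  define g where "g q = (if q < q0 then q else q - 1)" for q
  define B' where "B' = mat n (m - 1) (\<lambda>(i, q). B $$ (i, f q) - w (f q) / w q0 * B $$ (i, q0))"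
  have B': "B' \<in> carrier_mat n (m - 1)" by (simp add: B'_def)
  have BC: "B * C \<in> carrier_mat n nc" using B C by simp
  have colB: "col (B * C) j = B' *\<^sub>v vec (m - 1) (\<lambda>q. C $$ (f q, j))" if j: "j < nc" for j
  proof (rule eq_vecI)
    fix i assume "i < dim_vec (B' *\<^sub>v vec (m - 1) (\<lambda>q. C $$ (f q, j)))"
    then have i: "i < n" using B' by simp
    have Cq0: "C $$ (q0, j) = - (\<Sum>q\<in>{..<m} - {q0}. w q / w q0 * C $$ (q, j))"
    proof -
      have "w q0 * C $$ (q0, j) + (\<Sum>q\<in>{..<m} - {q0}. w q * C $$ (q, j)) = 0"
        using w[OF j] q0 by (simp add: sum.remove[of "{..<m}" q0])
      then have "C $$ (q0, j) = - (\<Sum>q\<in>{..<m} - {q0}. w q * C $$ (q, j)) / w q0"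
        using nz by (simp add: field_simps eq_neg_iff_add_eq_0)
      then show ?thesis by (simp add: sum_divide_distrib)
    qed
    have "(B' *\<^sub>v vec (m - 1) (\<lambda>q. C $$ (f q, j))) $ i = (\<Sum>q<m - 1. (B $$ (i, f q) - w (f q) / w q0 * B $$ (i, q0)) * C $$ (f q, j))"
      using i by (simp add: B'_def scalar_prod_def atLeast0LessThan)
    also have "\<dots> = (\<Sum>q\<in>{..<m} - {q0}. (B $$ (i, q) - w q / w q0 * B $$ (i, q0)) * C $$ (q, j))"
      by (rule sum.reindex_bij_witness[of _ g f]) (use q0 in \<open>auto simp: f_def g_def\<close>)
    also have "\<dots> = (\<Sum>q\<in>{..<m} - {q0}. B $$ (i, q) * C $$ (q, j)) + B $$ (i, q0) * C $$ (q0, j)"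
      unfolding Cq0 mult_minus_right sum_distrib_left sum_negf[symmetric] sum.distrib[symmetric]
      by (intro sum.cong refl) (simp add: algebra_simps)
    also have "\<dots> = (\<Sum>q<m. B $$ (i, q) * C $$ (q, j))"
      using q0 by (simp add: sum.remove[of "{..<m}" q0])
    also have "\<dots> = col (B * C) j $ i"
      using B C i j by (simp add: scalar_prod_def atLeast0LessThan)
    finally show "col (B * C) j $ i = (B' *\<^sub>v vec (m - 1) (\<lambda>q. C $$ (f q, j))) $ i" by simp
  qed (use B C B' in simp)
  have "set (cols (B * C)) \<subseteq> span (set (cols B'))"
  proof
    fix c assume "c \<in> set (cols (B * C))"
    then obtain j where j: "j < nc" "c = col (B * C) j"
      using BC by (metis carrier_matD(2) cols_length cols_nth in_set_conv_nth)
    have "c \<in> col_space B'"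
      unfolding col_space_eq[OF B'] j(2) colB[OF j(1)] using B' by (auto intro!: bexI[of _ "vec (m - 1) (\<lambda>q. C $$ (f q, j))"])
    then show "c \<in> span (set (cols B'))" by (simp add: col_space_def)
  qed
  then have "rank (B * C) \<le> card (set (cols B'))"
    using cols_dim[of B'] B' by (intro rank_le_card_span[OF BC]) auto
  also have "\<dots> \<le> m - 1" using card_length[of "cols B'"] B' by simp
  finally show False using rk q0 by simp
qed

lemma (in vec_space) full_column_rank_injective:
  assumes A: "A \<in> carrier_mat n nc" and rk: "rank A = nc" and v: "v \<in> carrier_vec nc" "A *\<^sub>v v = 0\<^sub>v n"
  shows "v = 0\<^sub>v nc"
proof (rule ccontr)
  assume nz: "v \<noteq> 0\<^sub>v nc"
  have sc: "set (cols A) \<subseteq> carrier_vec n" using cols_dim[of A] A by simp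
  \<comment> \<open>Linear dependence refers to the set of columns, so repetitions have to be
    excluded; they would push the rank below \<open>nc\<close>.\<close>
  have "rank A \<le> card (set (cols A))"
    using in_own_span[OF sc] by (intro rank_le_card_span[OF A _ sc]) auto
  then have d: "distinct (cols A)"
    using rk A card_length[of "cols A"] card_distinct[of "cols A"] by simp
  show False using lin_depI[OF A v(1) nz v(2) d] full_rank_lin_indpt[OF A rk d] by blast
qed

section \<open>Analytic spectral decompositions\<close>

lemma fps_expansion_sum:
  fixes f :: "'i \<Rightarrow> real \<Rightarrow> real"
  shows "(\<And>i. i \<in> I \<Longrightarrow> f i has_fps_expansion F i) \<Longrightarrow> (\<lambda>t. \<Sum>i\<in>I. f i t) has_fps_expansion (\<Sum>i\<in>I. F i)"
  by (induction I rule: infinite_finite_induct) (auto intro: has_fps_expansion_add)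

locale analytic_matrix =
  fixes n :: nat and K :: "real \<Rightarrow> real mat" and F :: "nat \<Rightarrow> nat \<Rightarrow> real fps"
  assumes carrier: "K \<epsilon> \<in> carrier_mat n n"
    and expansion: "i < n \<Longrightarrow> j < n \<Longrightarrow> (\<lambda>\<epsilon>. K \<epsilon> $$ (i, j)) has_fps_expansion F i j"
begin

lemma mult_expansion:
  assumes "\<And>j. j < n \<Longrightarrow> (\<lambda>\<epsilon>. u \<epsilon> $ j) has_fps_expansion U j" and i: "i < n"
  shows "(\<lambda>\<epsilon>. \<Sum>j<n. K \<epsilon> $$ (i, j) * u \<epsilon> $ j) has_fps_expansion (\<Sum>j<n. F i j * U j)"
  by (intro fps_expansion_sum has_fps_expansion_mult assms expansion) auto

lemma mult_mat_vec_nth: "v \<in> carrier_vec n \<Longrightarrow> i < n \<Longrightarrow> (K \<epsilon> *\<^sub>v v) $ i = (\<Sum>j<n. K \<epsilon> $$ (i, j) * v $ j)"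
  using carrier[of \<epsilon>] by (simp add: scalar_prod_def atLeast0LessThan)

text \<open>The columns of the diagonalising matrix are the eigenvectors. Identities between
  convergent series turn into identities between functions near 0.\<close>

lemma decomposition_exists:
  assumes sym: "\<And>i j. i < n \<Longrightarrow> j < n \<Longrightarrow> F i j = F j i"
  shows "\<exists>ev \<Lambda> u. analytic_spectral_decomposition n K ev \<Lambda> u"
proof -
  have "diagonalizable cvg {..<n} F"
    using expansion sym by (intro analytic_symmetric_diagonalizable) (auto intro: has_fps_expansion_imp_cvg)
  then obtain U where U: "\<And>i j. i < n \<Longrightarrow> j < n \<Longrightarrow> cvg (U i j)" "orth {..<n} U"
    "\<And>i j. i < n \<Longrightarrow> j < n \<Longrightarrow> i \<noteq> j \<Longrightarrow> congr {..<n} U F i j = 0"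
    unfolding diagonalizable_def Ball_def lessThan_iff by blast
  define \<Lambda> where "\<Lambda> k = congr {..<n} U F k k" for k
  have orth: "(\<Sum>i<n. U i k * U i l) = (if k = l then 1 else 0)" if "k < n" "l < n" for k l
    using U(2) that by (auto simp: orth_def)
  have orth': "(\<Sum>k<n. U i k * U j k) = (if i = j then 1 else 0)" if "i < n" "j < n" for i j
    using orth_transpose[OF finite_lessThan U(2)] that by (auto simp: orth_def)
  have eig: "(\<Sum>j<n. F i j * U j k) = \<Lambda> k * U i k" if i: "i < n" and k: "k < n" for i k
  proof -
    have "(\<Sum>l<n. U i l * congr {..<n} U F l k) = (\<Sum>l<n. \<Sum>p<n. \<Sum>j<n. (U i l * U p l) * (F p j * U j k))"
      unfolding congr_def sum_distrib_left by (simp only: mult.assoc)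
    also have "\<dots> = (\<Sum>p<n. \<Sum>j<n. \<Sum>l<n. (U i l * U p l) * (F p j * U j k))"
      by (subst sum.swap) (rule sum.cong[OF refl], rule sum.swap)
    also have "\<dots> = (\<Sum>p<n. \<Sum>j<n. (if i = p then F p j * U j k else 0))"
      unfolding sum_distrib_right[symmetric] using orth' i by (intro sum.cong refl) auto
    also have "\<dots> = (\<Sum>p<n. if i = p then \<Sum>j<n. F p j * U j k else 0)"
      by (intro sum.cong refl) simp
    also have "\<dots> = (\<Sum>j<n. F i j * U j k)" using i by simp
    finally have "(\<Sum>j<n. F i j * U j k) = (\<Sum>l<n. U i l * congr {..<n} U F l k)" by simp
    also have "\<dots> = (\<Sum>l<n. if l = k then U i l * \<Lambda> k else 0)"
      using U(3) k by (intro sum.cong refl) (auto simp: \<Lambda>_def)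
    finally have "(\<Sum>j<n. F i j * U j k) = (\<Sum>l<n. if l = k then U i l * \<Lambda> k else 0)" .
    then show ?thesis using k by (simp add: mult.commute)
  qed
  define u where "u k \<epsilon> = vec n (\<lambda>i. eval_fps (U i k) \<epsilon>)" for k \<epsilon>
  define ev where "ev k = eval_fps (\<Lambda> k)" for k
  have sr: "subring_pred cvg"
    by (auto simp: subring_pred_def intro: cvg_add cvg_mult)
  have expU: "(\<lambda>\<epsilon>. u k \<epsilon> $ i) has_fps_expansion U i k" if "i < n" "k < n" for i k
    using U(1)[OF that] that by (simp add: u_def cvg_def has_fps_expansion_def)
  have cF: "cvg (F i j)" if "i < n" "j < n" for i j
    using expansion[OF that] by (rule has_fps_expansion_imp_cvg)
  have exp\<Lambda>: "ev k has_fps_expansion \<Lambda> k" if k: "k < n" for k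
  proof -
    have "cvg (\<Lambda> k)" unfolding \<Lambda>_def congr_def
      using U(1) cF k by (intro subring_pred_sum[OF sr] cvg_mult) auto
    then show ?thesis by (simp add: ev_def cvg_def has_fps_expansion_def)
  qed
  have eig_ev: "\<forall>\<^sub>F \<epsilon> in nhds 0. \<forall>k\<in>{..<n}. \<forall>i\<in>{..<n}. (\<Sum>j<n. K \<epsilon> $$ (i, j) * u k \<epsilon> $ j) = ev k \<epsilon> * u k \<epsilon> $ i"
  proof (intro eventually_ball_finite ballI finite_lessThan)
    fix k i assume ki: "k \<in> {..<n}" "i \<in> {..<n}"
    have "(\<lambda>\<epsilon>. \<Sum>j<n. K \<epsilon> $$ (i, j) * u k \<epsilon> $ j) has_fps_expansion \<Lambda> k * U i k"
      using mult_expansion[of "u k" "\<lambda>j. U j k" i] expU eig ki by simp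
    moreover have "(\<lambda>\<epsilon>. ev k \<epsilon> * u k \<epsilon> $ i) has_fps_expansion \<Lambda> k * U i k"
      using ki by (intro has_fps_expansion_mult exp\<Lambda> expU) auto
    ultimately show "\<forall>\<^sub>F \<epsilon> in nhds 0. (\<Sum>j<n. K \<epsilon> $$ (i, j) * u k \<epsilon> $ j) = ev k \<epsilon> * u k \<epsilon> $ i"
      by (rule fps_expansion_eventually_eq)
  qed
  have orth_ev: "\<forall>\<^sub>F \<epsilon> in nhds 0. \<forall>k\<in>{..<n}. \<forall>l\<in>{..<n}. (\<Sum>i<n. u k \<epsilon> $ i * u l \<epsilon> $ i) = (if k = l then 1 else 0)"
  proof (intro eventually_ball_finite ballI finite_lessThan)
    fix k l assume kl: "k \<in> {..<n}" "l \<in> {..<n}"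
    have "(\<lambda>\<epsilon>. \<Sum>i<n. u k \<epsilon> $ i * u l \<epsilon> $ i) has_fps_expansion (\<Sum>i<n. U i k * U i l)"
      using kl by (intro fps_expansion_sum has_fps_expansion_mult expU) auto
    moreover have "(\<lambda>\<epsilon>. if k = l then 1 else 0 :: real) has_fps_expansion (if k = l then 1 else 0)"
      by simp
    ultimately show "\<forall>\<^sub>F \<epsilon> in nhds 0. (\<Sum>i<n. u k \<epsilon> $ i * u l \<epsilon> $ i) = (if k = l then 1 else 0)"
      using kl by (intro fps_expansion_eventually_eq[of _ "if k = l then 1 else 0"]) (auto simp: orth)
  qed
  have "analytic_spectral_decomposition n K ev \<Lambda> u"
    unfolding analytic_spectral_decomposition_def
  proof (intro conjI allI impI)
    show "\<forall>\<^sub>F \<epsilon> in nhds 0. K \<epsilon> \<in> carrier_mat n n \<and> (\<forall>k<n. u k \<epsilon> \<in> carrier_vec n \<and>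
        K \<epsilon> *\<^sub>v u k \<epsilon> = ev k \<epsilon> \<cdot>\<^sub>v u k \<epsilon> \<and> (\<forall>l<n. u k \<epsilon> \<bullet> u l \<epsilon> = (if k = l then 1 else 0)))"
      using eig_ev orth_ev
    proof eventually_elim
      case (elim \<epsilon>)
      have uc: "u k \<epsilon> \<in> carrier_vec n" for k by (simp add: u_def)
      have "K \<epsilon> *\<^sub>v u k \<epsilon> = ev k \<epsilon> \<cdot>\<^sub>v u k \<epsilon>" if k: "k < n" for k
      proof (rule eq_vecI)
        show "(K \<epsilon> *\<^sub>v u k \<epsilon>) $ i = (ev k \<epsilon> \<cdot>\<^sub>v u k \<epsilon>) $ i" if "i < dim_vec (ev k \<epsilon> \<cdot>\<^sub>v u k \<epsilon>)" for i
        proof -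
          have i: "i < n" using that uc[of k] by simp
          then show ?thesis using elim(1) k uc[of k] unfolding mult_mat_vec_nth[OF uc i] by simp
        qed
      qed (use carrier[of \<epsilon>] uc[of k] in simp)
      moreover have "u k \<epsilon> \<bullet> u l \<epsilon> = (if k = l then 1 else 0)" if "k < n" "l < n" for k l
        using elim(2) that uc[of l] by (simp add: scalar_prod_def atLeast0LessThan)
      ultimately show ?case using carrier uc by blast
    qed
  qed (use exp\<Lambda> expU in blast)+
  then show ?thesis by blast
qed

text \<open>The converse passage: uniqueness of expansions turns any given decomposition into formal
  eigenpairs.\<close>

lemma decomposition_fps:
  assumes dec: "analytic_spectral_decomposition n K ev \<Lambda> u"
  obtains U where "\<And>k i. k < n \<Longrightarrow> i < n \<Longrightarrow> u k 0 $ i = fps_nth (U k i) 0"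
    "\<And>k i. k < n \<Longrightarrow> i < n \<Longrightarrow> (\<Sum>j<n. F i j * U k j) = \<Lambda> k * U k i"
    "\<And>k l. k < n \<Longrightarrow> l < n \<Longrightarrow> (\<Sum>i<n. U k i * U l i) = (if k = l then 1 else 0)"
proof -
  note d = dec[unfolded analytic_spectral_decomposition_def]
  have "\<forall>k i. \<exists>G. k < n \<longrightarrow> i < n \<longrightarrow> (\<lambda>\<epsilon>. u k \<epsilon> $ i) has_fps_expansion G" using d by blast
  then obtain U where U: "\<And>k i. k < n \<Longrightarrow> i < n \<Longrightarrow> (\<lambda>\<epsilon>. u k \<epsilon> $ i) has_fps_expansion U k i" by metis
  have \<Lambda>: "ev k has_fps_expansion \<Lambda> k" if "k < n" for k using d that by blast
  have ev: "\<forall>\<^sub>F \<epsilon> in nhds 0. (\<forall>k<n. u k \<epsilon> \<in> carrier_vec n \<and> K \<epsilon> *\<^sub>v u k \<epsilon> = ev k \<epsilon> \<cdot>\<^sub>v u k \<epsilon> \<and>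
           (\<forall>l<n. u k \<epsilon> \<bullet> u l \<epsilon> = (if k = l then 1 else 0)))"
    using d by (auto elim: eventually_mono)
  show ?thesis
  proof (rule that)
    show "u k 0 $ i = fps_nth (U k i) 0" if "k < n" "i < n" for k i
      using has_fps_expansion_at_0[OF U[OF that]] .
    show "(\<Sum>j<n. F i j * U k j) = \<Lambda> k * U k i" if k: "k < n" and i: "i < n" for k i
    proof (rule fps_expansion_unique)
      show "(\<lambda>\<epsilon>. \<Sum>j<n. K \<epsilon> $$ (i, j) * u k \<epsilon> $ j) has_fps_expansion (\<Sum>j<n. F i j * U k j)"
        using U k i by (intro mult_expansion) auto
      show "(\<lambda>\<epsilon>. ev k \<epsilon> * u k \<epsilon> $ i) has_fps_expansion \<Lambda> k * U k i"
        using U \<Lambda> k i by (intro has_fps_expansion_mult) auto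
      show "\<forall>\<^sub>F \<epsilon> in nhds 0. (\<Sum>j<n. K \<epsilon> $$ (i, j) * u k \<epsilon> $ j) = ev k \<epsilon> * u k \<epsilon> $ i"
        using ev
      proof eventually_elim
        case (elim \<epsilon>)
        have uc: "u k \<epsilon> \<in> carrier_vec n" and e: "K \<epsilon> *\<^sub>v u k \<epsilon> = ev k \<epsilon> \<cdot>\<^sub>v u k \<epsilon>" using elim k by auto
        have "(K \<epsilon> *\<^sub>v u k \<epsilon>) $ i = (ev k \<epsilon> \<cdot>\<^sub>v u k \<epsilon>) $ i" by (simp only: e)
        then show ?case using mult_mat_vec_nth[OF uc i, of \<epsilon>] uc i by simp
      qed
    qed
    show "(\<Sum>i<n. U k i * U l i) = (if k = l then 1 else 0)" if k: "k < n" and l: "l < n" for k l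
    proof (rule fps_expansion_unique)
      show "(\<lambda>\<epsilon>. \<Sum>i<n. u k \<epsilon> $ i * u l \<epsilon> $ i) has_fps_expansion (\<Sum>i<n. U k i * U l i)"
        using k l by (intro fps_expansion_sum has_fps_expansion_mult U) auto
      show "(\<lambda>\<epsilon>. if k = l then 1 else 0 :: real) has_fps_expansion (if k = l then 1 else 0)" by simp
      show "\<forall>\<^sub>F \<epsilon> in nhds 0. (\<Sum>i<n. u k \<epsilon> $ i * u l \<epsilon> $ i) = (if k = l then 1 else 0)"
        using ev
      proof eventually_elim
        case (elim \<epsilon>)
        have "u l \<epsilon> \<in> carrier_vec n" "u k \<epsilon> \<bullet> u l \<epsilon> = (if k = l then 1 else 0)" using elim k l by auto
        then show ?case by (simp add: scalar_prod_def atLeast0LessThan)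
      qed
    qed
  qed
qed

text \<open>The vectors \<open>u k 0\<close> form an orthonormal basis, so a matrix is determined by
  its action on them. As \<open>eig\<close> speaks of all formal eigenpairs, one matrix fits every
  decomposition, and independence of the choices follows.\<close>

theorem spectral_equivalentI:
  assumes sym: "\<And>i j. i < n \<Longrightarrow> j < n \<Longrightarrow> F i j = F j i"
    and E: "\<And>\<epsilon>. E \<epsilon> \<in> carrier_mat n n"
    and eig: "\<And>u lam \<epsilon> i. (\<And>i. i < n \<Longrightarrow> (\<Sum>j<n. F i j * u j) = lam * u i) \<Longrightarrow> i < n \<Longrightarrow>
      (\<Sum>j<n. E \<epsilon> $$ (i, j) * fps_nth (u j) 0) = leading_term lam \<epsilon> * fps_nth (u i) 0"
  shows "is_asymptotic_spectral_equivalent n K E"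
  unfolding is_asymptotic_spectral_equivalent_def
proof (intro conjI allI impI)
  show "\<exists>ev \<Lambda> u. analytic_spectral_decomposition n K ev \<Lambda> u" by (rule decomposition_exists[OF sym])
  fix ev \<Lambda> u \<epsilon> assume "analytic_spectral_decomposition n K ev \<Lambda> u"
  then obtain U where U: "\<And>k i. k < n \<Longrightarrow> i < n \<Longrightarrow> u k 0 $ i = fps_nth (U k i) 0"
    "\<And>k i. k < n \<Longrightarrow> i < n \<Longrightarrow> (\<Sum>j<n. F i j * U k j) = \<Lambda> k * U k i"
    "\<And>k l. k < n \<Longrightarrow> l < n \<Longrightarrow> (\<Sum>i<n. U k i * U l i) = (if k = l then 1 else 0)"
    using decomposition_fps by blast
  have "(\<Sum>i<n. fps_nth (U k i) 0 * fps_nth (U l i) 0) = (if k = l then 1 else 0)" if "k < n" "l < n" for k l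
    using arg_cong[OF U(3)[OF that], of "\<lambda>G. fps_nth G 0"] by (simp add: fps_sum_nth split: if_splits)
  then have "orth {..<n} (\<lambda>i k. fps_nth (U k i) 0)" by (simp add: orth_def)
  from orth_transpose[OF finite_lessThan this]
  have orth: "(\<Sum>k<n. fps_nth (U k i) 0 * fps_nth (U k j) 0) = (if i = j then 1 else 0)" if "i < n" "j < n" for i j
    using that by (auto simp: orth_def)
  show "E \<epsilon> = mat n n (\<lambda>(i, j). \<Sum>k<n. leading_term (\<Lambda> k) \<epsilon> * (u k 0 $ i) * (u k 0 $ j))"
  proof (rule eq_matI)
    fix i j assume "i < dim_row (mat n n (\<lambda>(i, j). \<Sum>k<n. leading_term (\<Lambda> k) \<epsilon> * (u k 0 $ i) * (u k 0 $ j)))"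
      "j < dim_col (mat n n (\<lambda>(i, j). \<Sum>k<n. leading_term (\<Lambda> k) \<epsilon> * (u k 0 $ i) * (u k 0 $ j)))"
    then have i: "i < n" and j: "j < n" by auto
    have "(\<Sum>k<n. leading_term (\<Lambda> k) \<epsilon> * (u k 0 $ i) * (u k 0 $ j))
        = (\<Sum>k<n. \<Sum>l<n. E \<epsilon> $$ (i, l) * (fps_nth (U k l) 0 * fps_nth (U k j) 0))"
      using i j by (intro sum.cong refl)
        (simp add: U(1) eig[OF U(2), symmetric] sum_distrib_right mult.assoc)
    also have "\<dots> = (\<Sum>l<n. \<Sum>k<n. E \<epsilon> $$ (i, l) * (fps_nth (U k l) 0 * fps_nth (U k j) 0))"
      by (rule sum.swap)
    also have "\<dots> = (\<Sum>l<n. if l = j then E \<epsilon> $$ (i, l) else 0)"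
      unfolding sum_distrib_left[symmetric] using orth j by (intro sum.cong refl) auto
    also have "\<dots> = E \<epsilon> $$ (i, j)" using j by simp
    finally show "E \<epsilon> $$ (i, j) = mat n n (\<lambda>(i, j). \<Sum>k<n. leading_term (\<Lambda> k) \<epsilon> * (u k 0 $ i) * (u k 0 $ j)) $$ (i, j)"
      using i j by simp
  qed (use E[of \<epsilon>] in auto)
qed

end

section \<open>The pseudoinverse of a matrix of full column rank\<close>

text \<open>\<open>A * X\<close> and \<open>A * Y\<close> are symmetric idempotents with the range
  of \<open>A\<close>, hence equal; \<open>X * A\<close> and \<open>Y * A\<close> agree by the dual
  argument. Both together give \<open>X = Y\<close>.\<close>

lemma is_pseudoinverse_unique:
  assumes X: "is_pseudoinverse A X" and Y: "is_pseudoinverse A Y"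
  shows "X = Y"
proof -
  obtain n c where A: "A \<in> carrier_mat n c" by blast
  have Xc: "X \<in> carrier_mat c n" and Yc: "Y \<in> carrier_mat c n"
    using X Y A by (auto simp: is_pseudoinverse_def)
  have X': "A * X * A = A" "X * A * X = X" "transpose_mat (A * X) = A * X" "transpose_mat (X * A) = X * A"
    and Y': "A * Y * A = A" "Y * A * Y = Y" "transpose_mat (A * Y) = A * Y" "transpose_mat (Y * A) = Y * A"
    using X Y by (auto simp: is_pseudoinverse_def)
  have AX: "A * X \<in> carrier_mat n n" and AY: "A * Y \<in> carrier_mat n n"
    and XA: "X * A \<in> carrier_mat c c" and YA: "Y * A \<in> carrier_mat c c" using A Xc Yc by auto
  have "A * Y = transpose_mat ((A * X * A) * Y)" using X' Y' by simp
  also have "(A * X * A) * Y = (A * X) * (A * Y)" using A Xc Yc by (intro assoc_mult_mat) auto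
  also have "transpose_mat \<dots> = (A * Y) * (A * X)" using transpose_mult[OF AX AY] X' Y' by simp
  also have "\<dots> = (A * Y * A) * X" using A Xc Yc by (intro assoc_mult_mat[symmetric]) auto
  finally have 1: "A * Y = A * X" using Y' by simp
  have "Y * A = transpose_mat (Y * (A * X * A))" using X' Y' by simp
  also have "Y * (A * X * A) = (Y * A) * (X * A)"
    using assoc_mult_mat[OF A Xc A] assoc_mult_mat[OF Yc A XA] by simp
  also have "transpose_mat \<dots> = (X * A) * (Y * A)" using transpose_mult[OF YA XA] X' Y' by simp
  also have "\<dots> = X * (A * Y * A)"
    using assoc_mult_mat[OF A Yc A] assoc_mult_mat[OF Xc A YA] by simp
  finally have 2: "Y * A = X * A" using Y' by simp
  have "X = X * (A * X)" using X'(2) assoc_mult_mat[OF Xc A Xc] by simp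
  also have "\<dots> = (Y * A) * Y" unfolding 1[symmetric] 2 using assoc_mult_mat[OF Xc A Yc] by simp
  finally show ?thesis using Y' by simp
qed

lemma invertible_if_injective:
  fixes G :: "real mat"
  assumes G: "G \<in> carrier_mat n n" and inj: "\<And>v. v \<in> carrier_vec n \<Longrightarrow> G *\<^sub>v v = 0\<^sub>v n \<Longrightarrow> v = 0\<^sub>v n"
  obtains Gi where "mat_inverse G = Some Gi" "Gi \<in> carrier_mat n n" "G * Gi = 1\<^sub>m n" "Gi * G = 1\<^sub>m n"
proof -
  have "det G \<noteq> 0" unfolding det_0_iff_vec_prod_zero_field[OF G] using inj by blast
  from det_non_zero_imp_unit[OF G this, of "()"] obtain Gi where "mat_inverse G = Some Gi"
    using mat_inverse(1)[OF G, of "()"] by (cases "mat_inverse G") auto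
  with mat_inverse(2)[OF G this] show ?thesis using that by blast
qed

text \<open>The witness is (A^T A)^(-1) A^T, where A^T A is injective because v . A^T A v is the
  squared length of A v.\<close>

lemma is_pseudoinverse_pseudoinverse:
  assumes A: "A \<in> carrier_mat n c" and inj: "\<And>v. v \<in> carrier_vec c \<Longrightarrow> A *\<^sub>v v = 0\<^sub>v n \<Longrightarrow> v = 0\<^sub>v c"
  shows "is_pseudoinverse A (pseudoinverse A)"
proof -
  let ?At = "transpose_mat A"
  have At: "?At \<in> carrier_mat c n" using A by simp
  define G where "G = ?At * A"
  have G: "G \<in> carrier_mat c c" using A by (simp add: G_def)
  have Gt: "transpose_mat G = G" using transpose_mult[OF At A] by (simp add: G_def)
  have "v = 0\<^sub>v c" if v: "v \<in> carrier_vec c" and z: "G *\<^sub>v v = 0\<^sub>v c" for v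
  proof (rule inj[OF v])
    have Av: "A *\<^sub>v v \<in> carrier_vec n" using A v by simp
    have "(A *\<^sub>v v) \<bullet> (A *\<^sub>v v) = v \<bullet> (?At *\<^sub>v (A *\<^sub>v v))"
      using transpose_vec_mult_scalar[OF A v Av] comm_scalar_prod[OF v, of "?At *\<^sub>v (A *\<^sub>v v)"] Av At by simp
    also have "?At *\<^sub>v (A *\<^sub>v v) = 0\<^sub>v c" using z assoc_mult_mat_vec[OF At A v] by (simp add: G_def)
    finally have "(\<Sum>i<n. (A *\<^sub>v v) $ i * (A *\<^sub>v v) $ i) = 0"
      using v Av A by (simp add: scalar_prod_def atLeast0LessThan del: index_mult_mat_vec)
    then have "\<forall>i<n. (A *\<^sub>v v) $ i = 0" by (simp add: sum_nonneg_eq_0_iff)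
    then show "A *\<^sub>v v = 0\<^sub>v n" using A by (intro eq_vecI) auto
  qed
  then obtain Gi where Gi: "Gi \<in> carrier_mat c c" "G * Gi = 1\<^sub>m c" "Gi * G = 1\<^sub>m c"
    using invertible_if_injective[OF G] by blast
  have Git: "transpose_mat Gi \<in> carrier_mat c c" using Gi(1) by simp
  have "transpose_mat Gi * G = 1\<^sub>m c" using transpose_mult[OF G Gi(1)] Gi(2) Gt by simp
  then have Gis: "transpose_mat Gi = Gi"
    using assoc_mult_mat[OF Git G Gi(1)] Gi(2) left_mult_one_mat[OF Gi(1)] right_mult_one_mat[OF Git] by simp
  define X where "X = Gi * ?At"
  have X: "X \<in> carrier_mat c n" using Gi A by (simp add: X_def)
  have XA: "X * A = 1\<^sub>m c" using assoc_mult_mat[OF Gi(1) At A] Gi(3) by (simp add: X_def G_def)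
  have "transpose_mat X = A * Gi" using transpose_mult[OF Gi(1) At] Gis by (simp add: X_def)
  then have "transpose_mat (A * X) = A * Gi * ?At" using transpose_mult[OF A X] by simp
  also have "\<dots> = A * X" unfolding X_def by (rule assoc_mult_mat[OF A Gi(1) At])
  finally have "is_pseudoinverse A X"
    using A X XA assoc_mult_mat[OF A X A] by (simp add: is_pseudoinverse_def)
  then show ?thesis
    unfolding pseudoinverse_def by (rule theI) (rule is_pseudoinverse_unique[OF _ \<open>is_pseudoinverse A X\<close>])
qed

text \<open>The difference of the two sides annihilates the columns of \<open>A\<close> and those of
  \<open>V\<close>, which together span the space. Spanning alone would let the range of
  \<open>A\<close> be any complement; \<open>AV\<close> makes it the orthogonal one.\<close>

lemma pseudoinverse_projection:
  fixes A V Q R :: "real mat"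
  assumes A: "A \<in> carrier_mat n c" and ps: "is_pseudoinverse A X"
    and V: "V \<in> carrier_mat n m" and AV: "transpose_mat A * V = 0\<^sub>m c m"
    and Q: "Q \<in> carrier_mat n B" and R: "R \<in> carrier_mat B m"
    and QQ: "transpose_mat Q * Q = 1\<^sub>m B" and VQR: "V = Q * R" and AQ: "transpose_mat Q * A = 0\<^sub>m B c"
    and span: "vec_space.col_space n (mat_of_cols n (cols V @ cols A)) = carrier_vec n"
  shows "A * X = 1\<^sub>m n - Q * transpose_mat Q"
proof -
  interpret vec_space "TYPE(real)" n .
  have X: "X \<in> carrier_mat c n" and X': "A * X * A = A" "X * A * X = X" "transpose_mat (A * X) = A * X"
    using ps A by (auto simp: is_pseudoinverse_def)
  have AX: "A * X \<in> carrier_mat n n" using A X by simp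
  have At: "transpose_mat A \<in> carrier_mat c n" and Xt: "transpose_mat X \<in> carrier_mat n c"
    and Qt: "transpose_mat Q \<in> carrier_mat B n" using A X Q by auto
  have QQt: "Q * transpose_mat Q \<in> carrier_mat n n" using Q by simp
  let ?D = "A * X - (1\<^sub>m n - Q * transpose_mat Q)"
  have D: "?D \<in> carrier_mat n n" by (intro minus_carrier_mat QQt)
  have mult_D: "?D * M = A * X * M - (M - Q * (transpose_mat Q * M))" if M: "M \<in> carrier_mat n l" for M l
    using minus_mult_distrib_mat[OF AX minus_carrier_mat[OF QQt] M, of "1\<^sub>m n"]
      minus_mult_distrib_mat[OF one_carrier_mat QQt M] assoc_mult_mat[OF Q Qt M] left_mult_one_mat[OF M] by simp
  have DA: "?D * A = 0\<^sub>m n c"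
    unfolding mult_D[OF A] AQ X' using A Q by auto
  have "A * X * V = transpose_mat X * (transpose_mat A * V)"
    using transpose_mult[OF A X] X'(3) assoc_mult_mat[OF Xt At V] by simp
  also have "\<dots> = 0\<^sub>m n m" unfolding AV using Xt by simp
  finally have "A * X * V = 0\<^sub>m n m" .
  moreover have "Q * (transpose_mat Q * V) = V"
    unfolding VQR using assoc_mult_mat[OF Qt Q R] QQ R by simp
  ultimately have DV: "?D * V = 0\<^sub>m n m"
    unfolding mult_D[OF V] using V by auto
  let ?M = "mat_of_cols n (cols V @ cols A)"
  have M: "?M \<in> carrier_mat n (m + c)" using V A by (simp add: mat_of_cols_def)
  have DM: "?D * ?M = 0\<^sub>m n (m + c)"
  proof (rule eq_matI)
    fix i j assume "i < dim_row (0\<^sub>m n (m + c) :: real mat)" "j < dim_col (0\<^sub>m n (m + c) :: real mat)"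
    then have i: "i < n" and j: "j < m + c" by auto
    have cl: "col ?M j = (if j < m then col V j else col A (j - m))"
      using j V A by (intro eq_vecI) (auto simp: nth_append mat_of_cols_def)
    have "(?D * ?M) $$ (i, j) = row ?D i \<bullet> col ?M j" using i j D M by (intro index_mult_mat) auto
    also have "\<dots> = (if j < m then (?D * V) $$ (i, j) else (?D * A) $$ (i, j - m))"
      unfolding cl using i j D V A by (auto simp del: index_minus_mat)
    also have "\<dots> = 0" unfolding DA DV using i j by auto
    finally show "(?D * ?M) $$ (i, j) = 0\<^sub>m n (m + c) $$ (i, j)" using i j by simp
  qed (use D M in auto)
  have D0: "?D *\<^sub>v v = 0\<^sub>v n" if v: "v \<in> carrier_vec n" for v
  proof -
    have "v \<in> col_space ?M" using span v by simp
    then obtain z where z: "z \<in> carrier_vec (m + c)" "?M *\<^sub>v z = v"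
      unfolding col_space_eq[OF M] using M by auto
    have "?D *\<^sub>v v = ?D * ?M *\<^sub>v z" unfolding z(2)[symmetric] by (rule assoc_mult_mat_vec[OF D M z(1), symmetric])
    also have "\<dots> = 0\<^sub>v n" unfolding DM using z(1) by (intro eq_vecI) auto
    finally show ?thesis .
  qed
  show ?thesis
  proof (rule eq_matI)
    fix i j assume "i < dim_row (1\<^sub>m n - Q * transpose_mat Q)" "j < dim_col (1\<^sub>m n - Q * transpose_mat Q)"
    then have i: "i < n" and j: "j < n" using Q by auto
    have "?D $$ (i, j) = (?D *\<^sub>v unit_vec n j) $ i" using i j D by (simp del: index_minus_mat add: scalar_prod_right_unit)
    also have "\<dots> = 0" using D0[of "unit_vec n j"] i by simp
    finally show "(A * X) $$ (i, j) = (1\<^sub>m n - Q * transpose_mat Q) $$ (i, j)" using i j QQt AX by (auto simp del: index_mult_mat)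
  qed (use AX Q A X in auto)
qed

section \<open>Ranks of the Vandermonde matrices\<close>

lemma vandermonde_le_carrier: "vandermonde_le mons n x s \<in> carrier_mat n (offset (monomial_count mons) (Suc s))"
  by (simp add: vandermonde_le_def vandermonde_def length_upto_degree del: offset_Suc)

lemma vandermonde_le_index:
  "i < n \<Longrightarrow> j < offset (monomial_count mons) (Suc s) \<Longrightarrow>
    vandermonde_le mons n x s $$ (i, j) = monomial (x i) (upto_degree mons s ! j)"
  by (simp add: vandermonde_le_def vandermonde_def length_upto_degree del: offset_Suc)

lemma vandermonde_le_prefix:
  assumes "s \<le> t" "i < n" "j < offset (monomial_count mons) (Suc s)"
  shows "vandermonde_le mons n x s $$ (i, j) = vandermonde_le mons n x t $$ (i, j)"
proof -
  have "j < offset (monomial_count mons) (Suc t)"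
    using assms(3) offset_mono[of "Suc s" "Suc t" "monomial_count mons"] assms(1) by linarith
  then show ?thesis using assms by (simp only: vandermonde_le_index upto_degree_prefix[OF assms(1,3)])
qed

lemma rank_vandermonde_le_mono:
  "vec_space.rank n (vandermonde_le mons n x s) \<le> vec_space.rank n (vandermonde_le mons n x (Suc s))"
proof -
  interpret vec_space "TYPE(real)" n .
  let ?V = "vandermonde_le mons n x"
  let ?h = "offset (monomial_count mons)"
  show ?thesis
  proof (rule rank_mono_columns[OF vandermonde_le_carrier vandermonde_le_carrier], rule subsetI)
    fix c assume "c \<in> set (cols (?V s))"
    then obtain j where j: "j < ?h (Suc s)" "c = col (?V s) j"
      using vandermonde_le_carrier[of mons n x s] unfolding cols_def by (auto simp del: offset_Suc)
    have j': "j < ?h (Suc (Suc s))" using j(1) by simp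
    have "c = col (?V (Suc s)) j"
      unfolding j(2) using vandermonde_le_carrier[of mons n x s] vandermonde_le_carrier[of mons n x "Suc s"] j(1) j'
        vandermonde_le_prefix[of s "Suc s" _ n j mons x]
      by (intro eq_vecI) (auto simp del: offset_Suc)
    then show "c \<in> set (cols (?V (Suc s)))"
      using vandermonde_le_carrier[of mons n x "Suc s"] j' unfolding cols_def by (auto simp del: offset_Suc)
  qed
qed

text \<open>The increments telescope; the subtraction of natural numbers in them is exact because
  the ranks increase.\<close>

lemma offset_rank_increment:
  "offset (rank_increment mons n x) (Suc i) = vec_space.rank n (vandermonde_le mons n x i)"
proof (induction i)
  case (Suc i)
  have "offset (rank_increment mons n x) (Suc (Suc i))
      = vec_space.rank n (vandermonde_le mons n x i) + rank_increment mons n x (Suc i)"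
    unfolding offset_Suc[of _ "Suc i"] Suc.IH ..
  moreover have "rank_increment mons n x (Suc i)
      = vec_space.rank n (vandermonde_le mons n x (Suc i)) - vec_space.rank n (vandermonde_le mons n x i)"
    by (simp add: rank_increment_def)
  ultimately show ?case using rank_vandermonde_le_mono[of n mons x i] by linarith
qed (simp add: rank_increment_def)

section \<open>Schur complements\<close>

lemma schur_complement_carrier: "schur_complement b H i \<in> carrier_mat (b i) (b i)"
  by (auto simp: schur_complement_def blk_def sub_mat_def)

text \<open>Block elimination: the lower rows express \<open>v\<close> through \<open>y\<close>, and
  substitution into the block rows leaves the Schur complement. \<open>nonsing\<close> ensures that
  the inverse in its definition exists.\<close>

lemma schur_complement_eigenvector:
  assumes sym: "\<And>p q. p < offset b (Suc i) \<Longrightarrow> q < offset b (Suc i) \<Longrightarrow> H $$ (p, q) = H $$ (q, p)"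
    and nonsing: "\<And>\<xi> p. (\<And>p. p < offset b i \<Longrightarrow> (\<Sum>q<offset b i. H $$ (p, q) * \<xi> q) = 0) \<Longrightarrow> p < offset b i \<Longrightarrow> \<xi> p = 0"
    and lower: "\<And>p. p < offset b i \<Longrightarrow>
      (\<Sum>q<offset b i. H $$ (p, q) * v q) + (\<Sum>s<b i. H $$ (p, offset b i + s) * y s) = 0"
    and block: "\<And>t. t < b i \<Longrightarrow> (\<Sum>q<offset b i. H $$ (offset b i + t, q) * v q)
      + (\<Sum>s<b i. H $$ (offset b i + t, offset b i + s) * y s) = \<mu> * y t"
    and t: "t < b i"
  shows "(\<Sum>s<b i. schur_complement b H i $$ (t, s) * y s) = \<mu> * y t"
proof (cases "i = 0")
  case True
  then show ?thesis using block[OF t] t by (simp add: schur_complement_def blk_def sub_mat_def)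
next
  case False
  let ?o = "offset b i"
  define M where "M = sub_mat H 0 ?o 0 ?o"
  define C where "C = sub_mat H ?o (offset b (Suc i)) 0 ?o"
  define N where "N = blk b b H i i"
  have M: "M \<in> carrier_mat ?o ?o" and C: "C \<in> carrier_mat (b i) ?o" and N: "N \<in> carrier_mat (b i) (b i)"
    by (simp_all add: M_def C_def N_def blk_def sub_mat_def)
  have Ct: "transpose_mat C \<in> carrier_mat ?o (b i)" using C by simp
  define vv where "vv = vec ?o v"
  define yy where "yy = vec (b i) y"
  have vv: "vv \<in> carrier_vec ?o" and yy: "yy \<in> carrier_vec (b i)" by (simp_all add: vv_def yy_def)
  have "x = 0\<^sub>v ?o" if x: "x \<in> carrier_vec ?o" and z: "M *\<^sub>v x = 0\<^sub>v ?o" for x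
  proof (rule eq_vecI)
    fix p assume "p < dim_vec (0\<^sub>v ?o :: real vec)"
    then have p: "p < ?o" by simp
    have "(\<Sum>q<?o. H $$ (p, q) * x $ q) = 0" if "p < ?o" for p
      using arg_cong[OF z, of "\<lambda>v. v $ p"] that x by (simp add: M_def sub_mat_def scalar_prod_def atLeast0LessThan)
    from nonsing[of "\<lambda>q. x $ q", OF this p] p show "x $ p = 0\<^sub>v ?o $ p" by simp
  qed (use x in simp)
  then obtain Mi where Mi: "mat_inverse M = Some Mi" "Mi \<in> carrier_mat ?o ?o" "Mi * M = 1\<^sub>m ?o"
    using invertible_if_injective[OF M] by blast
  have S: "schur_complement b H i = N - C * Mi * transpose_mat C"
    using False Mi(1) by (simp add: schur_complement_def M_def C_def N_def del: offset_Suc)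
  have CMiCt: "C * Mi * transpose_mat C \<in> carrier_mat (b i) (b i)" using C Mi by simp
  have low: "M *\<^sub>v vv + transpose_mat C *\<^sub>v yy = 0\<^sub>v ?o"
  proof (rule eq_vecI)
    fix p assume "p < dim_vec (0\<^sub>v ?o :: real vec)"
    then have p: "p < ?o" by simp
    have "(transpose_mat C *\<^sub>v yy) $ p = (\<Sum>s<b i. H $$ (p, ?o + s) * y s)"
      using p C sym by (simp add: C_def sub_mat_def yy_def scalar_prod_def atLeast0LessThan)
    then show "(M *\<^sub>v vv + transpose_mat C *\<^sub>v yy) $ p = 0\<^sub>v ?o $ p"
      using lower[OF p] p M C by (simp add: M_def sub_mat_def vv_def scalar_prod_def atLeast0LessThan)
  qed (use C in simp)
  have Mvv: "M *\<^sub>v vv \<in> carrier_vec ?o" and Cy: "transpose_mat C *\<^sub>v yy \<in> carrier_vec ?o"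
    using M vv Ct yy by (meson mult_mat_vec_carrier)+
  have "vv + Mi *\<^sub>v (transpose_mat C *\<^sub>v yy) = Mi *\<^sub>v (M *\<^sub>v vv) + Mi *\<^sub>v (transpose_mat C *\<^sub>v yy)"
    using assoc_mult_mat_vec[OF Mi(2) M vv] Mi(3) vv by simp
  also have "\<dots> = Mi *\<^sub>v 0\<^sub>v ?o" unfolding low[symmetric] by (rule mult_add_distrib_mat_vec[OF Mi(2) Mvv Cy, symmetric])
  also have "\<dots> = 0\<^sub>v ?o" using Mi(2) by (intro eq_vecI) auto
  finally have sum0: "vv + Mi *\<^sub>v (transpose_mat C *\<^sub>v yy) = 0\<^sub>v ?o" .
  have MiCy: "Mi *\<^sub>v (transpose_mat C *\<^sub>v yy) \<in> carrier_vec ?o" using Mi(2) Cy by (rule mult_mat_vec_carrier)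
  have "Mi *\<^sub>v (transpose_mat C *\<^sub>v yy) = - vv"
  proof (rule eq_vecI)
    fix p assume "p < dim_vec (- vv)"
    then have p: "p < ?o" using vv by simp
    have "(vv + Mi *\<^sub>v (transpose_mat C *\<^sub>v yy)) $ p = 0" using sum0 p by simp
    then show "(Mi *\<^sub>v (transpose_mat C *\<^sub>v yy)) $ p = (- vv) $ p"
      using p vv Mi(2) by (simp del: index_mult_mat_vec)
  qed (use vv Mi(2) in auto)
  then have "C * Mi * transpose_mat C *\<^sub>v yy = C *\<^sub>v (- vv)"
    using assoc_mult_mat_vec[OF mult_carrier_mat[OF C Mi(2)] Ct yy] assoc_mult_mat_vec[OF C Mi(2) Cy] by simp
  then have CMC: "(C * Mi * transpose_mat C *\<^sub>v yy) $ t = - (\<Sum>q<?o. H $$ (?o + t, q) * v q)"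
    using t C by (simp add: C_def sub_mat_def vv_def scalar_prod_def atLeast0LessThan sum_negf)
  have Ny: "(N *\<^sub>v yy) $ t = (\<Sum>s<b i. H $$ (?o + t, ?o + s) * y s)"
    using t by (simp add: N_def blk_def sub_mat_def yy_def scalar_prod_def atLeast0LessThan)
  have "(\<Sum>s<b i. schur_complement b H i $$ (t, s) * y s) = (schur_complement b H i *\<^sub>v yy) $ t"
    using t schur_complement_carrier[of b H i] by (simp add: yy_def scalar_prod_def atLeast0LessThan)
  also have "\<dots> = (N *\<^sub>v yy - C * Mi * transpose_mat C *\<^sub>v yy) $ t"
    unfolding S by (simp only: minus_mult_distrib_mat_vec[OF N CMiCt yy])
  also have "\<dots> = (N *\<^sub>v yy) $ t - (C * Mi * transpose_mat C *\<^sub>v yy) $ t"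
    using t C by (intro index_minus_vec) simp
  also have "\<dots> = \<mu> * y t" unfolding CMC Ny using block[OF t] by simp
  finally show ?thesis .
qed

section \<open>The spectral equivalent in graded coordinates\<close>

lemma sum_offset: "(\<Sum>p<offset b r. f p) = (\<Sum>l<r. \<Sum>s<b l. f (offset b l + s))"
  for f :: "nat \<Rightarrow> real"
proof (induction r)
  case (Suc r)
  have "(\<Sum>p<offset b r + m. f p) = (\<Sum>p<offset b r. f p) + (\<Sum>s<m. f (offset b r + s))" for m
    by (induction m) (simp_all add: add.assoc)
  then show ?case using Suc by simp
qed simp

text \<open>On a block whose order differs from that of \<open>lam\<close> the coordinates at 0
  vanish and both sides are 0. On the remaining block the coordinates form an eigenvector for the
  leading coefficient of \<open>lam\<close>, and its power of \<epsilon> is exactly the order of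
  \<open>lam\<close>.\<close>

lemma (in graded_frame) spectral_equivalent_eigenvector:
  fixes b :: "nat \<Rightarrow> nat" and H :: "real mat" and E :: "real mat"
  assumes B: "B = offset b r" and lev_b: "\<And>p. lev p = block_of b p"
    and H: "\<And>p q. p < B \<Longrightarrow> q < B \<Longrightarrow> H $$ (p, q) = gram p q"
    and w_sym: "\<And>\<alpha> \<beta>. w \<alpha> \<beta> = w \<beta> \<alpha>"
    and E: "\<And>i j. i < n \<Longrightarrow> j < n \<Longrightarrow> E $$ (i, j) =
      (\<Sum>l<r. \<epsilon> ^ (2 * l) * (\<Sum>s<b l. \<Sum>t<b l. Q i (offset b l + s) * schur_complement b H l $$ (s, t) * Q j (offset b l + t)))
      + \<epsilon> ^ (2 * r - 1) * fps_nth \<Psi> (2 * r - 1)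
        * (\<Sum>c<n. \<Sum>d<n. P i c * norm (x c - x d) ^ (2 * r - 1) * P d j)"
    and eig: "\<And>i. i < n \<Longrightarrow> (\<Sum>j<n. K i j * u j) = lam * u i" and i: "i < n"
  shows "(\<Sum>j<n. E $$ (i, j) * fps_nth (u j) 0) = leading_term lam \<epsilon> * fps_nth (u i) 0"
proof -
  define a where "a = subdegree lam"
  define y where "y p = (\<Sum>i<n. Q i p * fps_nth (u i) 0)" for p
  define z where "z i = (\<Sum>j<n. P i j * fps_nth (u j) 0)" for i
  define S where "S l = schur_complement b H l" for l
  define D where "D c d = norm (x c - x d) ^ (2 * r - 1)" for c d
  define lt where "lt = leading_term lam \<epsilon>"
  have gram_sym: "gram p q = gram q p" for p q
    unfolding gram_def by (subst sum.swap) (simp add: w_sym mult_ac)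
  have block: "\<epsilon> ^ (2 * l) * (\<Sum>t<b l. S l $$ (s, t) * y (offset b l + t)) = lt * y (offset b l + s)"
    if l: "l < r" and s: "s < b l" for l s
  proof -
    have less: "offset b l + t < B" "lev (offset b l + t) = l" if "t < b l" for t
      using block_add_less[OF l, of t b] block_of_add[of t b l] that B lev_b by auto
    show ?thesis
    proof (cases "lam = 0 \<or> 2 * l \<noteq> a")
      case True
      then have "y (offset b l + t) = 0" if "t < b l" for t
        using leading_eigenvector(1)[OF eig less(1)[OF that]] less(2)[OF that] unfolding y_def a_def by simp
      then show ?thesis using s by simp
    next
      case False
      then have nz: "lam \<noteq> 0" and a: "a = 2 * l" by auto
      have low: "{q. q < B \<and> lev q < l} = {..<offset b l}"
        using block_of_less_iff[of _ b r l] offset_mono[of l r b] l by (auto simp: B lev_b)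
      have mid: "(\<Sum>q\<in>{q. q < B \<and> lev q = l}. f q) = (\<Sum>t<b l. f (offset b l + t))" for f :: "nat \<Rightarrow> real"
        unfolding B lev_b by (rule sum_block[OF l])
      have lo: "q < B" "lev q < l" if "q < offset b l" for q using low that by auto
      obtain v where v: "\<And>p. p < B \<Longrightarrow> lev p < l \<Longrightarrow> (\<Sum>q<offset b l. gram p q * v q)
           + (\<Sum>t<b l. gram p (offset b l + t) * y (offset b l + t)) = 0"
        "\<And>p. p < B \<Longrightarrow> lev p = l \<Longrightarrow> (\<Sum>q<offset b l. gram p q * v q)
           + (\<Sum>t<b l. gram p (offset b l + t) * y (offset b l + t)) = fps_nth lam a * y p"
        using leading_eigenvector(3)[OF eig l nz, folded a_def, OF _ a, folded y_def] unfolding low mid by blast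
      have oS: "q < B" if "q < offset b (Suc l)" for q
        using that offset_mono[of "Suc l" r b] l B by simp
      have "(\<Sum>t<b l. S l $$ (s, t) * y (offset b l + t)) = fps_nth lam a * y (offset b l + s)"
        unfolding S_def
      proof (rule schur_complement_eigenvector[where v = v])
        show "H $$ (p, q) = H $$ (q, p)" if "p < offset b (Suc l)" "q < offset b (Suc l)" for p q
          using that H oS gram_sym by simp
        show "\<xi> p = 0" if hyp: "\<And>p. p < offset b l \<Longrightarrow> (\<Sum>q<offset b l. H $$ (p, q) * \<xi> q) = 0" and p: "p < offset b l" for \<xi> p
        proof (rule gram_definite[of "{..<offset b l}"])
          show "(\<Sum>q\<in>{..<offset b l}. gram p q * \<xi> q) = 0" if "p \<in> {..<offset b l}" for p
            using hyp[of p] that H lo by simp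
        qed (use p offset_mono[of l r b] l B in auto)
        show "(\<Sum>q<offset b l. H $$ (p, q) * v q) + (\<Sum>s<b l. H $$ (p, offset b l + s) * y (offset b l + s)) = 0"
          if p: "p < offset b l" for p
          using v(1)[OF lo[OF p]] H lo p less by simp
        show "(\<Sum>q<offset b l. H $$ (offset b l + t, q) * v q)
            + (\<Sum>s<b l. H $$ (offset b l + t, offset b l + s) * y (offset b l + s)) = fps_nth lam a * y (offset b l + t)"
          if t: "t < b l" for t
          using v(2)[OF less[OF t]] H lo less[OF t] less by simp
      qed (rule s)
      moreover have "lt = fps_nth lam a * \<epsilon> ^ (2 * l)" by (simp add: lt_def leading_term_def a_def[symmetric] a)
      ultimately show ?thesis by (simp add: mult_ac)
    qed
  qed
  have last: "\<epsilon> ^ (2 * r - 1) * fps_nth \<Psi> (2 * r - 1) * (\<Sum>j<n. (\<Sum>c<n. \<Sum>d<n. P i c * D c d * P d j) * z j) = lt * z i"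
  proof (cases "lam = 0 \<or> 2 * r - 1 \<noteq> a")
    case True
    then have "z j = 0" if "j < n" for j
      using leading_eigenvector(2)[OF eig that] unfolding z_def a_def by simp
    then show ?thesis using i by simp
  next
    case False
    then have nz: "lam \<noteq> 0" and a: "a = 2 * r - 1" by auto
    have Pi: "(\<Sum>c<n. \<Sum>d<n. P i c * D c d * P d j) = (\<Sum>c<n. \<Sum>d<n. P c i * D c d * P d j)" for j
      using P_sym i by (intro sum.cong refl) auto
    have e: "fps_nth \<Psi> (2 * r - 1) * (\<Sum>j<n. (\<Sum>c<n. \<Sum>d<n. P i c * D c d * P d j) * z j) = fps_nth lam a * z i"
      unfolding Pi using leading_eigenvector(4)[OF eig i nz, folded a_def, OF _ a, folded z_def] unfolding D_def by blast
    have "lt = fps_nth lam a * \<epsilon> ^ (2 * r - 1)" by (simp only: lt_def leading_term_def a_def[symmetric] a)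
    then show ?thesis unfolding mult.assoc[of "\<epsilon> ^ (2 * r - 1)"] e by (simp only: mult_ac)
  qed
  \<comment> \<open>The last block is known to act well on \<open>z\<close>, the image of the vector
    under \<open>P\<close>; idempotence allows \<open>z\<close> to be put in its place.\<close>
  have Pz: "(\<Sum>j<n. P d j * z j) = z d" if d: "d < n" for d
  proof -
    have "(\<Sum>j<n. P d j * z j) = (\<Sum>m<n. (\<Sum>j<n. P d j * P j m) * fps_nth (u m) 0)"
      unfolding z_def sum_distrib_left sum_distrib_right by (subst sum.swap) (simp add: mult.assoc)
    then show ?thesis using P_idem d by (simp add: z_def)
  qed
  have PDP: "(\<Sum>j<n. (\<Sum>c<n. \<Sum>d<n. P i c * D c d * P d j) * f j) = (\<Sum>c<n. \<Sum>d<n. P i c * D c d * (\<Sum>j<n. P d j * f j))" for f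
  proof -
    have "(\<Sum>j<n. (\<Sum>c<n. \<Sum>d<n. P i c * D c d * P d j) * f j) = (\<Sum>j<n. \<Sum>c<n. \<Sum>d<n. P i c * D c d * (P d j * f j))"
      by (simp add: sum_distrib_right mult.assoc)
    also have "\<dots> = (\<Sum>c<n. \<Sum>j<n. \<Sum>d<n. P i c * D c d * (P d j * f j))" by (rule sum.swap)
    also have "\<dots> = (\<Sum>c<n. \<Sum>d<n. \<Sum>j<n. P i c * D c d * (P d j * f j))"
      by (intro sum.cong refl sum.swap)
    finally show ?thesis by (simp add: sum_distrib_left)
  qed
  have PDPz: "(\<Sum>j<n. (\<Sum>c<n. \<Sum>d<n. P i c * D c d * P d j) * fps_nth (u j) 0) = (\<Sum>j<n. (\<Sum>c<n. \<Sum>d<n. P i c * D c d * P d j) * z j)"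
    unfolding PDP z_def[symmetric] using Pz by simp
  have QSQ: "(\<Sum>j<n. (\<Sum>l<r. \<epsilon> ^ (2 * l) * (\<Sum>s<b l. \<Sum>t<b l. Q i (offset b l + s) * S l $$ (s, t) * Q j (offset b l + t))) * fps_nth (u j) 0)
      = (\<Sum>l<r. \<Sum>s<b l. Q i (offset b l + s) * (\<epsilon> ^ (2 * l) * (\<Sum>t<b l. S l $$ (s, t) * y (offset b l + t))))"
  proof -
    have "(\<Sum>j<n. (\<Sum>l<r. \<epsilon> ^ (2 * l) * (\<Sum>s<b l. \<Sum>t<b l. Q i (offset b l + s) * S l $$ (s, t) * Q j (offset b l + t))) * fps_nth (u j) 0)
        = (\<Sum>j<n. \<Sum>l<r. \<Sum>s<b l. \<Sum>t<b l. Q i (offset b l + s) * \<epsilon> ^ (2 * l) * S l $$ (s, t) * (Q j (offset b l + t) * fps_nth (u j) 0))"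
      by (simp add: sum_distrib_right sum_distrib_left mult_ac)
    also have "\<dots> = (\<Sum>l<r. \<Sum>j<n. \<Sum>s<b l. \<Sum>t<b l. Q i (offset b l + s) * \<epsilon> ^ (2 * l) * S l $$ (s, t) * (Q j (offset b l + t) * fps_nth (u j) 0))"
      by (rule sum.swap)
    also have "\<dots> = (\<Sum>l<r. \<Sum>s<b l. \<Sum>j<n. \<Sum>t<b l. Q i (offset b l + s) * \<epsilon> ^ (2 * l) * S l $$ (s, t) * (Q j (offset b l + t) * fps_nth (u j) 0))"
      by (rule sum.cong[OF refl], rule sum.swap)
    also have "\<dots> = (\<Sum>l<r. \<Sum>s<b l. \<Sum>t<b l. \<Sum>j<n. Q i (offset b l + s) * \<epsilon> ^ (2 * l) * S l $$ (s, t) * (Q j (offset b l + t) * fps_nth (u j) 0))"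
      by (rule sum.cong[OF refl], rule sum.cong[OF refl], rule sum.swap)
    finally show ?thesis by (simp add: y_def sum_distrib_left mult_ac)
  qed
  have u: "fps_nth (u i) 0 = (\<Sum>l<r. \<Sum>s<b l. Q i (offset b l + s) * y (offset b l + s)) + z i"
  proof -
    have "(\<Sum>p<B. Q i p * y p) + z i = (\<Sum>j<n. ((\<Sum>p<B. Q i p * Q j p) + P i j) * fps_nth (u j) 0)"
      unfolding y_def z_def distrib_right sum.distrib sum_distrib_left sum_distrib_right
      by (subst sum.swap) (simp add: mult.assoc)
    also have "\<dots> = (\<Sum>j<n. if j = i then fps_nth (u j) 0 else 0)"
      using parseval[OF i] by (intro sum.cong refl) auto
    finally show ?thesis using i by (simp add: B sum_offset)
  qed
  have "(\<Sum>j<n. E $$ (i, j) * fps_nth (u j) 0)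
      = (\<Sum>j<n. (\<Sum>l<r. \<epsilon> ^ (2 * l) * (\<Sum>s<b l. \<Sum>t<b l. Q i (offset b l + s) * S l $$ (s, t) * Q j (offset b l + t))) * fps_nth (u j) 0)
        + \<epsilon> ^ (2 * r - 1) * fps_nth \<Psi> (2 * r - 1) * (\<Sum>j<n. (\<Sum>c<n. \<Sum>d<n. P i c * D c d * P d j) * fps_nth (u j) 0)"
    unfolding sum_distrib_left[of "\<epsilon> ^ (2 * r - 1) * fps_nth \<Psi> (2 * r - 1)"] sum.distrib[symmetric]
    using i by (intro sum.cong refl) (simp only: E lessThan_iff S_def D_def distrib_right mult.assoc)
  also have "\<dots> = (\<Sum>l<r. \<Sum>s<b l. Q i (offset b l + s) * (lt * y (offset b l + s))) + lt * z i"
    unfolding QSQ PDPz last using block by simp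
  also have "\<dots> = lt * fps_nth (u i) 0"
    unfolding u by (simp add: distrib_left sum_distrib_left mult_ac)
  finally show ?thesis by (simp only: lt_def)
qed

section \<open>Block QR factorisations\<close>

lemma mult_index:
  assumes "A \<in> carrier_mat n a" "B \<in> carrier_mat a m" "i < n" "j < m"
  shows "(A * B) $$ (i, j) = (\<Sum>s<a. A $$ (i, s) * B $$ (s, j))"
  using assms by (simp add: scalar_prod_def atLeast0LessThan)

lemma mult3_index:
  fixes A :: "'a::semiring_0 mat"
  assumes A: "A \<in> carrier_mat n a" and B: "B \<in> carrier_mat a b" and C: "C \<in> carrier_mat b m" and ij: "i < n" "j < m"
  shows "(A * B * C) $$ (i, j) = (\<Sum>s<a. \<Sum>t<b. A $$ (i, s) * B $$ (s, t) * C $$ (t, j))"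
proof -
  have "(A * B * C) $$ (i, j) = (\<Sum>s<a. A $$ (i, s) * (B * C) $$ (s, j))"
    unfolding assoc_mult_mat[OF A B C] by (rule mult_index[OF A mult_carrier_mat[OF B C] ij])
  also have "\<dots> = (\<Sum>s<a. \<Sum>t<b. A $$ (i, s) * B $$ (s, t) * C $$ (t, j))"
    by (intro sum.cong refl) (simp only: mult_index[OF B C _ ij(2)] sum_distrib_left mult.assoc lessThan_iff)
  finally show ?thesis .
qed

locale block_QR =
  fixes mons :: "nat \<Rightarrow> ('d :: finite) multi_index list" and n :: nat and x :: "nat \<Rightarrow> real ^ 'd"
    and r :: nat and Q R :: "real mat"
  assumes ordering: "monomial_ordering mons" and r_pos: "r \<ge> 1" and QR: "is_block_QR mons n x r Q R"
begin

abbreviation "b \<equiv> rank_increment mons n x"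
abbreviation "h \<equiv> monomial_count mons"
abbreviation "B \<equiv> offset b r"
abbreviation "N \<equiv> offset h r"
abbreviation "Vr \<equiv> vandermonde_le mons n x (r - 1)"

definition mom :: "nat \<Rightarrow> 'd multi_index \<Rightarrow> real" where
  "mom p \<alpha> = (\<Sum>i<n. Q $$ (i, p) * monomial (x i) \<alpha>)"

lemma Suc_r: "Suc (r - 1) = r" using r_pos by simp

lemma Q: "Q \<in> carrier_mat n B" and R: "R \<in> carrier_mat B N" and QQ: "transpose_mat Q * Q = 1\<^sub>m B"
  and VQR: "Vr = Q * R"
  using QR by (simp_all add: is_block_QR_def Let_def)

lemma Vr: "Vr \<in> carrier_mat n N"
  using vandermonde_le_carrier[of mons n x "r - 1"] unfolding Suc_r .

lemma V_index: "i < n \<Longrightarrow> j < N \<Longrightarrow> Vr $$ (i, j) = monomial (x i) (upto_degree mons (r - 1) ! j)"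
  using vandermonde_le_index[of i n j mons "r - 1" x] unfolding Suc_r .

lemma V_QR: "i < n \<Longrightarrow> j < N \<Longrightarrow> Vr $$ (i, j) = (\<Sum>p<B. Q $$ (i, p) * R $$ (p, j))"
  unfolding VQR using Q R by (simp add: scalar_prod_def atLeast0LessThan)

lemma degree_index:
  assumes "m < r" "\<alpha> \<in> multi_indices m"
  obtains j where "j < N" "upto_degree mons (r - 1) ! j = \<alpha>" "block_of h j = m"
proof -
  have "\<alpha> \<in> set (upto_degree mons (r - 1))" using assms by (auto simp: set_upto_degree[OF ordering])
  then obtain j where j: "j < N" "upto_degree mons (r - 1) ! j = \<alpha>"
    using length_upto_degree[of mons "r - 1"] unfolding Suc_r in_set_conv_nth by auto
  have "\<alpha> \<in> multi_indices (block_of h j)"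
    using upto_degree_nth[OF ordering, of j "r - 1"] j unfolding Suc_r by simp
  then show ?thesis using assms(2) j that by (auto simp: multi_indices_def)
qed

text \<open>\<open>R\<close> equals Q^T V, so its entries are moments of the columns of
  \<open>Q\<close>. Through this the vanishing blocks of \<open>R\<close> become vanishing
  moments.\<close>

lemma R_index:
  assumes p: "p < B" and j: "j < N"
  shows "R $$ (p, j) = mom p (upto_degree mons (r - 1) ! j)"
proof -
  have Qt: "transpose_mat Q \<in> carrier_mat B n" using Q by simp
  have "R = transpose_mat Q * Vr" unfolding VQR using assoc_mult_mat[OF Qt Q R] QQ R by simp
  then have "R $$ (p, j) = (\<Sum>i<n. transpose_mat Q $$ (p, i) * Vr $$ (i, j))"
    using mult_index[OF Qt Vr p j] by simp
  also have "\<dots> = (\<Sum>i<n. Q $$ (i, p) * monomial (x i) (upto_degree mons (r - 1) ! j))"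
    using Q p by (intro sum.cong refl) (simp add: V_index[OF _ j, unfolded One_nat_def])
  finally show ?thesis by (simp only: mom_def)
qed

lemma R_lower:
  assumes p: "p < B" and j: "j < N" and less: "block_of h j < block_of b p"
  shows "R $$ (p, j) = 0"
proof -
  obtain i s where i: "i < r" "s < b i" "p = offset b i + s" "block_of b p = i" using block_cases[OF p] .
  obtain l t where l: "l < r" "t < h l" "j = offset h l + t" "block_of h j = l" using block_cases[OF j] .
  have "\<forall>i<r. \<forall>j<i. blk b h R i j = 0\<^sub>m (b i) (h j)"
    using QR by (simp add: is_block_QR_def Let_def)
  then have "blk b h R i l = 0\<^sub>m (b i) (h l)" using i(1,4) l(4) less by simp
  then have "blk b h R i l $$ (s, t) = 0" using i l by simp
  then show ?thesis using blk_index[of s b i t h l R] i l by simp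
qed

lemma mom_low:
  assumes "p < B" "m < block_of b p" "\<alpha> \<in> multi_indices m"
  shows "mom p \<alpha> = 0"
proof -
  have "block_of b p < r" using block_of_less_iff[OF assms(1), of r] assms(1) by simp
  then obtain j where "j < N" "upto_degree mons (r - 1) ! j = \<alpha>" "block_of h j = m"
    using degree_index[of m \<alpha>] assms(2,3) by auto
  then show ?thesis using R_index[OF assms(1), of j] R_lower[OF assms(1), of j] assms(2) by simp
qed

text \<open>By triangularity the Vandermonde matrix up to degree \<open>i\<close> is the product of
  the leading columns of \<open>Q\<close> and the leading part of \<open>R\<close>. Their common
  dimension is its rank, so the rows of that part are independent.\<close>

lemma upper_rows_independent:
  assumes i: "i < r"
    and w: "\<And>j. j < offset h (Suc i) \<Longrightarrow> (\<Sum>q<offset b (Suc i). w q * R $$ (q, j)) = 0"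
    and p: "p < offset b (Suc i)"
  shows "w p = 0"
proof -
  interpret vec_space "TYPE(real)" n .
  let ?o = "offset b (Suc i)" and ?N = "offset h (Suc i)"
  define Qi where "Qi = mat n ?o (\<lambda>(l, q). Q $$ (l, q))"
  define Ri where "Ri = mat ?o ?N (\<lambda>(q, j). R $$ (q, j))"
  have oB: "?o \<le> B" and NN: "?N \<le> N" using i by (intro offset_mono; simp)+
  have Vi: "vandermonde_le mons n x i = Qi * Ri"
  proof (rule eq_matI)
    fix l j assume "l < dim_row (Qi * Ri)" "j < dim_col (Qi * Ri)"
    then have l: "l < n" and j: "j < ?N" by (simp_all add: Qi_def Ri_def del: offset_Suc)
    have j': "j < N" using j NN by linarith
    have "vandermonde_le mons n x i $$ (l, j) = (\<Sum>q<B. Q $$ (l, q) * R $$ (q, j))"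
      using vandermonde_le_prefix[of i "r - 1" l n j mons x] i l j V_QR[OF l j'] by simp
    also have "\<dots> = (\<Sum>q<?o. Q $$ (l, q) * R $$ (q, j))"
    proof (rule sum.mono_neutral_right)
      show "\<forall>q\<in>{..<B} - {..<?o}. Q $$ (l, q) * R $$ (q, j) = 0"
      proof
        fix q assume q: "q \<in> {..<B} - {..<?o}"
        then have "\<not> block_of b q < Suc i" using block_of_less_iff[of q b r "Suc i"] by (simp del: offset_Suc)
        moreover have "block_of h j < Suc i" using block_of_less_iff[OF j', of "Suc i"] j by blast
        ultimately show "Q $$ (l, q) * R $$ (q, j) = 0" using R_lower[of q j] q j' by simp
      qed
    qed (use oB in auto)
    also have "\<dots> = (Qi * Ri) $$ (l, j)"
      using l j by (simp add: Qi_def Ri_def scalar_prod_def atLeast0LessThan del: offset_Suc)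
    finally show "vandermonde_le mons n x i $$ (l, j) = (Qi * Ri) $$ (l, j)" .
  qed (use vandermonde_le_carrier[of mons n x i] in \<open>simp_all add: Qi_def Ri_def del: offset_Suc\<close>)
  show ?thesis
  proof (rule full_rank_factor[of Qi ?o Ri ?N])
    show "rank (Qi * Ri) = ?o" unfolding Vi[symmetric] offset_rank_increment ..
    show "(\<Sum>q<?o. w q * Ri $$ (q, j)) = 0" if "j < ?N" for j
      using w[OF that] that by (simp add: Ri_def del: offset_Suc)
  qed (use p in \<open>simp_all add: Qi_def Ri_def del: offset_Suc\<close>)
qed

text \<open>Extended by 0, a dependence within block row \<open>i\<close> is one among the leading
  rows: in columns of lower degree these entries vanish by triangularity.\<close>

lemma diagonal_block_full_rank:
  assumes i: "i < r"
    and v: "\<And>\<alpha>. \<alpha> \<in> multi_indices i \<Longrightarrow> (\<Sum>q\<in>{q. q < B \<and> block_of b q = i}. v q * mom q \<alpha>) = 0"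
    and p: "p < B" "block_of b p = i"
  shows "v p = 0"
proof -
  let ?w = "\<lambda>q. if block_of b q = i then v q else 0"
  have oB: "offset b (Suc i) \<le> B" and NN: "offset h (Suc i) \<le> N" using i by (intro offset_mono; simp)+
  have lt: "q < offset b (Suc i)" if "q < B" "block_of b q = i" for q
    using block_of_less_iff[OF that(1), of "Suc i"] that(2) by simp
  have "(\<Sum>q<offset b (Suc i). ?w q * R $$ (q, j)) = 0" if j: "j < offset h (Suc i)" for j
  proof -
    have j': "j < N" using j NN by linarith
    have "(\<Sum>q<offset b (Suc i). ?w q * R $$ (q, j))
        = (\<Sum>q\<in>{q. q < B \<and> block_of b q = i}. v q * mom q (upto_degree mons (r - 1) ! j))"
      using oB lt R_index[OF _ j'] by (intro sum.mono_neutral_cong_right) auto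
    also have "\<dots> = 0"
    proof (cases "block_of h j = i")
      case True
      then show ?thesis using v upto_degree_nth[OF ordering, of j "r - 1"] j' unfolding Suc_r by simp
    next
      case False
      have "block_of h j < Suc i" using block_of_less_iff[OF j', of "Suc i"] j by blast
      then have "mom q (upto_degree mons (r - 1) ! j) = 0" if "q < B" "block_of b q = i" for q
        using R_lower[of q j] R_index[of q j] that j' False by simp
      then show ?thesis by (intro sum.neutral) auto
    qed
    finally show ?thesis .
  qed
  from upper_rows_independent[of i ?w, OF i this lt[OF p]] show ?thesis using p by simp
qed

text \<open>The block diagonal factors keep, for each row, only the moments of the degree of its own
  block; this identifies \<open>H\<close> with the matrix \<open>gram\<close> of leading
  coefficients.\<close>

lemma middle_index:
  assumes W: "W \<in> carrier_mat N N"
    and w: "\<And>j l. j < N \<Longrightarrow> l < N \<Longrightarrow> W $$ (j, l) = w (upto_degree mons (r - 1) ! j) (upto_degree mons (r - 1) ! l)"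
    and p: "p < B" and q: "q < B"
  shows "(diag_block_mat (map (\<lambda>i. blk b h R i i) [0..<r]) * W
      * diag_block_mat (map (\<lambda>i. transpose_mat (blk b h R i i)) [0..<r])) $$ (p, q)
    = (\<Sum>\<alpha>\<in>multi_indices (block_of b p). \<Sum>\<beta>\<in>multi_indices (block_of b q). w \<alpha> \<beta> * mom p \<alpha> * mom q \<beta>)"
proof -
  let ?u = "\<lambda>j. upto_degree mons (r - 1) ! j"
  let ?C = "diag_block_mat (map (\<lambda>i. blk b h R i i) [0..<r])"
  let ?D = "diag_block_mat (map (\<lambda>i. transpose_mat (blk b h R i i)) [0..<r])"
  have blkc: "blk b h R i i \<in> carrier_mat (b i) (h i)" "transpose_mat (blk b h R i i) \<in> carrier_mat (h i) (b i)" for i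
    using blk_carrier[of b h R i i] by auto
  have tr: "transpose_mat (blk b h R i i) $$ (t, s) = blk b h R i i $$ (s, t)" if "s < b i" "t < h i" for i s t
    using blkc(1)[of i] that by simp
  have C: "?C \<in> carrier_mat B N" and D: "?D \<in> carrier_mat N B"
    using blkc by (auto intro!: diag_block_mat_carrier)
  have entry: "blk b h R (block_of b p) (block_of b p) $$ (p - offset b (block_of b p), j - offset h (block_of h j)) = mom p (?u j)"
    "p - offset b (block_of b p) < b (block_of b p)" "j - offset h (block_of h j) < h (block_of h j)"
    if p: "p < B" and j: "j < N" and e: "block_of b p = block_of h j" for p j
  proof -
    obtain i s where i: "i < r" "s < b i" "p = offset b i + s" "block_of b p = i" using block_cases[OF p] .
    obtain l t where l: "l < r" "t < h l" "j = offset h l + t" "block_of h j = l" using block_cases[OF j] .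
    show "p - offset b (block_of b p) < b (block_of b p)" "j - offset h (block_of h j) < h (block_of h j)"
      using i l by auto
    show "blk b h R (block_of b p) (block_of b p) $$ (p - offset b (block_of b p), j - offset h (block_of h j)) = mom p (?u j)"
      using blk_index[of s b i t h l R] R_index[OF p j] i l e by simp
  qed
  have Cx: "?C $$ (p, j) = (if block_of h j = block_of b p then mom p (?u j) else 0)" if "j < N" for j
    using diag_block_mat_index[of r "\<lambda>i. blk b h R i i" b h p j] blkc(1) p that entry[OF p that] by auto
  have Dx: "?D $$ (j, q) = (if block_of h j = block_of b q then mom q (?u j) else 0)" if "j < N" for j
    using diag_block_mat_index[of r "\<lambda>i. transpose_mat (blk b h R i i)" h b j q] blkc q that entry[OF q that]
    by (auto simp: tr)
  have "(?C * W * ?D) $$ (p, q) = (\<Sum>j<N. \<Sum>l<N. ?C $$ (p, j) * W $$ (j, l) * ?D $$ (l, q))"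
    by (rule mult3_index[OF C W D p q])
  also have "\<dots> = (\<Sum>j<N. if block_of h j = block_of b p
      then \<Sum>l<N. if block_of h l = block_of b q then w (?u j) (?u l) * mom p (?u j) * mom q (?u l) else 0 else 0)"
    by (intro sum.cong refl) (auto simp: Cx Dx w intro!: sum.cong)
  also have "\<dots> = (\<Sum>\<alpha>\<in>multi_indices (block_of b p).
      \<Sum>l<N. if block_of h l = block_of b q then w \<alpha> (?u l) * mom p \<alpha> * mom q (?u l) else 0)"
    using sum_upto_degree_block[OF ordering, of "block_of b p" "r - 1"
      "\<lambda>\<alpha>. \<Sum>l<N. if block_of h l = block_of b q then w \<alpha> (?u l) * mom p \<alpha> * mom q (?u l) else 0"]
      block_of_less_iff[OF p, of r] p unfolding Suc_r by simp
  also have "\<dots> = (\<Sum>\<alpha>\<in>multi_indices (block_of b p). \<Sum>\<beta>\<in>multi_indices (block_of b q). w \<alpha> \<beta> * mom p \<alpha> * mom q \<beta>)"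
  proof (intro sum.cong refl)
    fix \<alpha>
    have "block_of b q \<le> r - 1" using block_of_less_iff[OF q, of r] q by simp
    from sum_upto_degree_block[OF ordering this, of "\<lambda>\<beta>. w \<alpha> \<beta> * mom p \<alpha> * mom q \<beta>", unfolded Suc_r]
    show "(\<Sum>l<N. if block_of h l = block_of b q then w \<alpha> (?u l) * mom p \<alpha> * mom q (?u l) else 0)
        = (\<Sum>\<beta>\<in>multi_indices (block_of b q). w \<alpha> \<beta> * mom p \<alpha> * mom q \<beta>)" .
  qed
  finally show ?thesis .
qed

end

theorem theorem6p15:
  fixes \<psi> :: "real \<Rightarrow> real" and \<Psi> :: "real fps"
    and k :: "real ^ 'd \<Rightarrow> real ^ 'd \<Rightarrow> real"
    and r n c :: nat
    and x :: "nat \<Rightarrow> real ^ 'd"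
    and mons :: "nat \<Rightarrow> ('d :: finite) multi_index list"
    and Q R A V D W H :: "real mat"
    and K :: "real \<Rightarrow> real mat"
    and b h :: "nat \<Rightarrow> nat"
  defines "V \<equiv> vandermonde_le mons n x (r - 1)"
    and "b \<equiv> rank_increment mons n x"
    and "h \<equiv> monomial_count mons"
    and "c \<equiv> n - vec_space.rank n V"
    and "K \<equiv> \<lambda>\<epsilon>. mat n n (\<lambda>(i, j). \<psi> (\<epsilon> * norm (x i - x j)))"
    and "D \<equiv> mat n n (\<lambda>(i, j). norm (x i - x j) ^ (2 * r - 1))"
    and "W \<equiv> wronskian_le mons k (r - 1)"
    and "H \<equiv> diag_block_mat (map (\<lambda>i. blk b h R i i) [0..<r]) * W
              * diag_block_mat (map (\<lambda>i. transpose_mat (blk b h R i i)) [0..<r])"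
  assumes radial: "\<And>y z. k y z = \<psi> (norm (y - z))"
    and pd: "positive_definite_kernel k"
    and analytic: "\<psi> has_fps_expansion \<Psi>"
    and regularity: "regularity_index \<Psi> r"
    and distinct_points: "inj_on x {..<n}"
    and ordering: "monomial_ordering mons"
    and rank_V: "vec_space.rank n V < n"
    and QR: "is_block_QR mons n x r Q R"
    and A_carrier: "A \<in> carrier_mat n c"
    and A_full_rank: "vec_space.rank n A = c"
    and span: "vec_space.col_space n (mat_of_cols n (cols V @ cols A)) = carrier_vec n"
    and orthogonal: "transpose_mat A * V = 0\<^sub>m c (dim_col V)"
  shows "is_asymptotic_spectral_equivalent n K
    (\<lambda>\<epsilon>. mat_sum n (\<lambda>i. \<epsilon> ^ (2 * i) \<cdot>\<^sub>m
              (col_blk b Q i * schur_complement b H i * transpose_mat (col_blk b Q i))) r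
       + (\<epsilon> ^ (2 * r - 1) * fps_nth \<Psi> (2 * r - 1)) \<cdot>\<^sub>m
           (A * pseudoinverse A * D * A * pseudoinverse A))"
proof -
  have r: "r \<ge> 1" and reg: "fps_nth \<Psi> (2 * r - 1) \<noteq> 0" using regularity by (auto simp: regularity_index_def)
  \<comment> \<open>One array serves two purposes: as Taylor coefficients it enters the definiteness
    arguments, as derivatives it is the Wronskian inside \<open>H\<close>.\<close>
  obtain w :: "'d multi_index \<Rightarrow> 'd multi_index \<Rightarrow> real"
    where w: "\<And>m x y. m \<le> 2 * r - 2 \<Longrightarrow> fps_nth \<Psi> m * norm (x - y) ^ m =
      (\<Sum>u\<le>m. \<Sum>\<alpha>\<in>multi_indices u. \<Sum>\<beta>\<in>multi_indices (m - u). w \<alpha> \<beta> * monomial x \<alpha> * monomial y \<beta>)"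
    and w_deriv: "\<And>a b \<alpha> \<beta>. a < r \<Longrightarrow> b < r \<Longrightarrow> \<alpha> \<in> multi_indices a \<Longrightarrow> \<beta> \<in> multi_indices b \<Longrightarrow>
      multi_deriv \<alpha> (\<lambda>x. multi_deriv \<beta> (\<lambda>y. k x y) 0) 0 / (multi_fact \<alpha> * multi_fact \<beta>) = w \<alpha> \<beta>"
    and w_sym: "\<And>\<alpha> \<beta>. w \<alpha> \<beta> = w \<beta> \<alpha>"
    using radial_kernel_taylor[OF radial analytic regularity] by blast
  interpret qr: block_QR mons n x r Q R using ordering r QR by unfold_locales
  let ?B = "offset b r" and ?N = "offset h r"
  note Qc = qr.Q[folded b_def] and Rc = qr.R[folded b_def h_def] and Vc = qr.Vr[folded V_def h_def]
    and QQ = qr.QQ[folded b_def] and VQR = qr.VQR[folded V_def]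
  interpret vs: vec_space "TYPE(real)" n .
  have ps: "is_pseudoinverse A (pseudoinverse A)"
    using vs.full_column_rank_injective[OF A_carrier A_full_rank]
    by (intro is_pseudoinverse_pseudoinverse[OF A_carrier]) auto
  define X where "X = pseudoinverse A"
  have Xc: "X \<in> carrier_mat c n" and X: "A * X * A = A" "X * A * X = X"
    using ps A_carrier by (auto simp: is_pseudoinverse_def X_def)
  have AV: "transpose_mat A * V = 0\<^sub>m c ?N" using orthogonal Vc by simp
  have At: "transpose_mat A \<in> carrier_mat c n" and Qt: "transpose_mat Q \<in> carrier_mat ?B n"
    using A_carrier Qc by auto
  \<comment> \<open>The columns of \<open>A\<close> are orthogonal to those of \<open>V\<close>,
    that is, of \<open>Q * R\<close>; independence of the rows of \<open>R\<close> transfers this to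
    \<open>Q\<close>.\<close>
  have AQ: "(transpose_mat A * Q) $$ (l, p) = 0" if l: "l < c" and p: "p < ?B" for l p
  proof -
    have sr: "Suc (r - 1) = r" using r by simp
    have "(\<Sum>q<?B. (transpose_mat A * Q) $$ (l, q) * R $$ (q, j)) = 0" if j: "j < ?N" for j
    proof -
      have "(\<Sum>q<?B. (transpose_mat A * Q) $$ (l, q) * R $$ (q, j)) = (transpose_mat A * Q * R) $$ (l, j)"
        using mult_index[OF mult_carrier_mat[OF At Qc] Rc l j] by simp
      also have "transpose_mat A * Q * R = transpose_mat A * V"
        unfolding VQR by (rule assoc_mult_mat[OF At Qc Rc])
      finally show ?thesis using l j by (simp add: AV)
    qed
    from qr.upper_rows_independent[of "r - 1" "\<lambda>q. (transpose_mat A * Q) $$ (l, q)" p, unfolded sr, folded b_def h_def, OF _ this]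
    show ?thesis using r p by simp
  qed
  have QA: "transpose_mat Q * A = 0\<^sub>m ?B c"
  proof (rule eq_matI)
    fix p l assume "p < dim_row (0\<^sub>m ?B c :: real mat)" "l < dim_col (0\<^sub>m ?B c :: real mat)"
    then have pl: "p < ?B" "l < c" by auto
    have "(transpose_mat Q * A) $$ (p, l) = (transpose_mat A * Q) $$ (l, p)"
      using pl Qc A_carrier by (simp add: scalar_prod_def mult.commute)
    then show "(transpose_mat Q * A) $$ (p, l) = 0\<^sub>m ?B c $$ (p, l)" using AQ pl by simp
  qed (use Qc A_carrier in auto)
  have AX: "A * X = 1\<^sub>m n - Q * transpose_mat Q"
    by (rule pseudoinverse_projection[OF A_carrier ps[folded X_def] Vc AV Qc Rc QQ VQR QA span])
  \<comment> \<open>Both descriptions of the projection are used: in terms of \<open>Q\<close> it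
    gives the Parseval identity, symmetry and vanishing moments, and as \<open>A * X\<close> it
    gives idempotence and the last term of the claim.\<close>
  define P where "P i j = (A * X) $$ (i, j)" for i j
  define q where "q i p = Q $$ (i, p)" for i p
  have AXc: "A * X \<in> carrier_mat n n" using A_carrier Xc by simp
  have P: "P i j = (if i = j then 1 else 0) - (\<Sum>p<?B. q i p * q j p)" if "i < n" "j < n" for i j
    using that Qc unfolding P_def AX q_def by (simp add: scalar_prod_def atLeast0LessThan)
  have mom: "(\<Sum>i<n. q i p * monomial (x i) \<alpha>) = qr.mom p \<alpha>" for p \<alpha> by (simp add: q_def qr.mom_def)
  interpret gf: graded_frame \<psi> \<Psi> k r w n ?B x "block_of b" q P
  proof unfold_locales
    show "block_of b p < r" if "p < ?B" for p using block_of_less_iff[OF that, of r] that by simp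
    show "(\<Sum>p<?B. q i p * q j p) + P i j = (if i = j then 1 else 0)" if "i < n" "j < n" for i j
      using P[OF that] by simp
    show "P i j = P j i" if "i < n" "j < n" for i j
      using P that by (simp add: mult.commute)
    show "(\<Sum>l<n. P i l * P l j) = P i j" if ij: "i < n" "j < n" for i j
    proof -
      have "A * X * (A * X) = A * X"
        using assoc_mult_mat[OF AXc A_carrier Xc] X(1) by simp
      from arg_cong[OF this, of "\<lambda>M. M $$ (i, j)"] ij A_carrier Xc show ?thesis
        unfolding P_def by (subst (asm) index_mult_mat) (auto simp: scalar_prod_def atLeast0LessThan)
    qed
    show "(\<Sum>i<n. q i p * monomial (x i) \<alpha>) = 0" if "p < ?B" "m < block_of b p" "\<alpha> \<in> multi_indices m" for p m \<alpha>
      unfolding mom using qr.mom_low[folded b_def] that by blast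
    \<comment> \<open>Q Q^T reproduces the columns of \<open>V\<close>, since the entries of
      \<open>R\<close> are the moments of the columns of \<open>Q\<close>; hence \<open>P\<close>
      annihilates them.\<close>
    show "(\<Sum>i<n. P i j * monomial (x i) \<alpha>) = 0" if j: "j < n" and m: "m < r" "\<alpha> \<in> multi_indices m" for j m \<alpha>
    proof -
      obtain l where l: "l < ?N" "upto_degree mons (r - 1) ! l = \<alpha>" using qr.degree_index[OF m] unfolding h_def by blast
      have "(\<Sum>i<n. P i j * monomial (x i) \<alpha>)
          = (\<Sum>i<n. (if i = j then monomial (x i) \<alpha> else 0) - (\<Sum>p<?B. q j p * (q i p * monomial (x i) \<alpha>)))"
      proof (intro sum.cong refl)
        fix i assume "i \<in> {..<n}"
        moreover have "(\<Sum>p<?B. q i p * q j p) * monomial (x i) \<alpha> = (\<Sum>p<?B. q j p * (q i p * monomial (x i) \<alpha>))"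
          unfolding sum_distrib_right by (intro sum.cong refl) (simp only: mult_ac)
        ultimately show "P i j * monomial (x i) \<alpha> = (if i = j then monomial (x i) \<alpha> else 0)
            - (\<Sum>p<?B. q j p * (q i p * monomial (x i) \<alpha>))"
          using P[of i j] j by (auto simp: left_diff_distrib)
      qed
      also have "\<dots> = monomial (x j) \<alpha> - (\<Sum>p<?B. q j p * (\<Sum>i<n. q i p * monomial (x i) \<alpha>))"
        unfolding sum_subtractf sum_distrib_left using j by (subst sum.swap) simp
      also have "(\<Sum>p<?B. q j p * (\<Sum>i<n. q i p * monomial (x i) \<alpha>)) = (\<Sum>p<?B. Q $$ (j, p) * R $$ (p, l))"
        unfolding mom using qr.R_index[folded b_def h_def] l by (simp add: q_def)
      also have "\<dots> = monomial (x j) \<alpha>"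
        using qr.V_QR[OF j, folded b_def h_def, OF l(1)] qr.V_index[OF j, folded h_def, OF l(1)] l(2) by simp
      finally show ?thesis by simp
    qed
    show "v p = 0" if "i < r"
      and "\<And>\<alpha>. \<alpha> \<in> multi_indices i \<Longrightarrow> (\<Sum>p\<in>{p. p < ?B \<and> block_of b p = i}. v p * (\<Sum>j<n. q j p * monomial (x j) \<alpha>)) = 0"
      and "p < ?B" "block_of b p = i" for i v p
      using qr.diagonal_block_full_rank[folded b_def, OF that(1) _ that(3,4)] that(2) unfolding mom by blast
  qed (use r reg w radial pd analytic distinct_points in auto)
  have Wc: "W \<in> carrier_mat ?N ?N"
    unfolding W_def wronskian_le_def wronskian_def length_upto_degree h_def qr.Suc_r by simp
  have W: "W $$ (j, l) = w (upto_degree mons (r - 1) ! j) (upto_degree mons (r - 1) ! l)" if jl: "j < ?N" "l < ?N" for j l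
  proof -
    have "block_of h j < r" "block_of h l < r"
      using block_of_less_iff[of j h r r] block_of_less_iff[of l h r r] jl by auto
    moreover have "upto_degree mons (r - 1) ! j \<in> multi_indices (block_of h j)" "upto_degree mons (r - 1) ! l \<in> multi_indices (block_of h l)"
      using upto_degree_nth[OF ordering, of _ "r - 1", unfolded qr.Suc_r, folded h_def] jl by auto
    moreover have "W $$ (j, l) = multi_deriv (upto_degree mons (r - 1) ! j) (\<lambda>x. multi_deriv (upto_degree mons (r - 1) ! l) (\<lambda>y. k x y) 0) 0
       / (multi_fact (upto_degree mons (r - 1) ! j) * multi_fact (upto_degree mons (r - 1) ! l))"
      using jl unfolding W_def wronskian_le_def wronskian_def length_upto_degree qr.Suc_r h_def by simp
    ultimately show ?thesis using w_deriv by metis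
  qed
  have H: "H $$ (p, p') = gf.gram p p'" if "p < ?B" "p' < ?B" for p p'
    using qr.middle_index[folded b_def h_def, OF Wc W that] that
    by (simp add: H_def gf.gram_def gf.moment_def gf.frame_def mom)
  have Dc: "D \<in> carrier_mat n n" by (simp add: D_def)
  interpret am: analytic_matrix n K gf.K
  proof
    show "K \<epsilon> \<in> carrier_mat n n" for \<epsilon> by (simp add: K_def)
    show "(\<lambda>\<epsilon>. K \<epsilon> $$ (i, j)) has_fps_expansion gf.K i j" if "i < n" "j < n" for i j
      using has_fps_expansion_scale[OF analytic, of "norm (x i - x j)"] that
      by (simp add: K_def gf.K_def mult.commute)
  qed
  define E where "E = (\<lambda>\<epsilon>. mat_sum n (\<lambda>i. \<epsilon> ^ (2 * i) \<cdot>\<^sub>m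
              (col_blk b Q i * schur_complement b H i * transpose_mat (col_blk b Q i))) r
       + (\<epsilon> ^ (2 * r - 1) * fps_nth \<Psi> (2 * r - 1)) \<cdot>\<^sub>m
           (A * X * D * A * X))"
  have AXDAX: "A * X * D * A * X = A * X * D * (A * X)"
    using assoc_mult_mat[OF mult_carrier_mat[OF AXc Dc] A_carrier Xc] .
  have Ec: "E \<epsilon> \<in> carrier_mat n n" for \<epsilon>
    unfolding E_def AXDAX by (intro add_carrier_mat smult_carrier_mat mult_carrier_mat[OF mult_carrier_mat[OF AXc Dc] AXc])
  have E: "E \<epsilon> $$ (i, j) =
      (\<Sum>l<r. \<epsilon> ^ (2 * l) * (\<Sum>s<b l. \<Sum>t<b l. q i (offset b l + s) * schur_complement b H l $$ (s, t) * q j (offset b l + t)))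
      + \<epsilon> ^ (2 * r - 1) * fps_nth \<Psi> (2 * r - 1)
        * (\<Sum>c<n. \<Sum>d<n. P i c * norm (x c - x d) ^ (2 * r - 1) * P d j)"
    if i: "i < n" and j: "j < n" for \<epsilon> i j
  proof -
    have cb: "col_blk b Q l \<in> carrier_mat n (b l)" "transpose_mat (col_blk b Q l) \<in> carrier_mat (b l) n" for l
      using Qc by (simp_all add: col_blk_def sub_mat_def)
    have e: "col_blk b Q l $$ (i, s) = q i (offset b l + s)" if "s < b l" "i < n" for i l s
      using that Qc by (simp add: col_blk_def sub_mat_def q_def)
    have "(col_blk b Q l * schur_complement b H l * transpose_mat (col_blk b Q l)) $$ (i, j)
        = (\<Sum>s<b l. \<Sum>t<b l. q i (offset b l + s) * schur_complement b H l $$ (s, t) * q j (offset b l + t))" for l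
      unfolding mult3_index[OF cb(1)[of l] schur_complement_carrier[of b H l] cb(2)[of l] i j]
      using i j e cb(1)[of l] by (intro sum.cong refl) simp
    moreover have "(A * X * D * A * X) $$ (i, j) = (\<Sum>c<n. \<Sum>d<n. P i c * norm (x c - x d) ^ (2 * r - 1) * P d j)"
      unfolding AXDAX mult3_index[OF AXc Dc AXc i j] P_def[symmetric] by (simp add: D_def)
    moreover have "(\<epsilon> ^ (2 * l) \<cdot>\<^sub>m (col_blk b Q l * schur_complement b H l * transpose_mat (col_blk b Q l))) $$ (i, j)
        = \<epsilon> ^ (2 * l) * (col_blk b Q l * schur_complement b H l * transpose_mat (col_blk b Q l)) $$ (i, j)" for l
      using i j cb[of l] by (intro index_smult_mat) auto
    moreover have "E \<epsilon> $$ (i, j) = (\<Sum>l<r. (\<epsilon> ^ (2 * l) \<cdot>\<^sub>m (col_blk b Q l * schur_complement b H l * transpose_mat (col_blk b Q l))) $$ (i, j))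
        + \<epsilon> ^ (2 * r - 1) * fps_nth \<Psi> (2 * r - 1) * (A * X * D * A * X) $$ (i, j)"
      using i j A_carrier Xc by (simp add: E_def mat_sum_def del: index_mult_mat(1))
    ultimately show ?thesis by simp
  qed
  have "is_asymptotic_spectral_equivalent n K E"
  proof (rule am.spectral_equivalentI)
    show "gf.K i j = gf.K j i" for i j by (simp add: gf.K_def norm_minus_commute)
    show "(\<Sum>j<n. E \<epsilon> $$ (i, j) * fps_nth (u j) 0) = leading_term lam \<epsilon> * fps_nth (u i) 0"
      if "\<And>i. i < n \<Longrightarrow> (\<Sum>j<n. gf.K i j * u j) = lam * u i" "i < n" for u lam \<epsilon> i
      by (rule gf.spectral_equivalent_eigenvector[OF refl refl H w_sym E that])
  qed (rule Ec)
  then show ?thesis by (simp only: E_def X_def)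
qed

end
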